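(* Let $(A,\mathcal{L})$ be a polarized abelian variety of dimension $g$ over $\mathbb{C}$, and let $1\le n\le g$. The map $X\mapsto \alpha_X$ is a bijection between the following two sets: (1) the set of abelian subvarieties $X\subseteq A$ of dimension $n$; (2) the set of classes $\alpha\in \mathrm{NS}_{\mathbb{Q}}(A)$ such that, for all $1\le r\le g$, $$(\alpha^r\cdot\mathcal{L}^{g-r})=\begin{cases}\chi(\mathcal{L})\, n!\,\prod_{i=n+1}^{g}(i-r) & \text{if } 1\le r\le n,\\ 0 & \text{if } r\ge n+1.\end{cases}$$
   Context: All abelian varieties are over $\mathbb{C}$. A polarization on $A$ is given by an ample line bundle $\mathcal{L}$; its type is $(d_1,\dots,d_g)$ with $d_i\mid d_{i+1}$, where $\ker\phi_{\mathcal{L}}\simeq(\mathbb{Z}/d_1\oplus\cdots\oplus\mathbb{Z}/d_g)^2$ and $\phi_{\mathcal{L}}:A\to\widehat A=\mathrm{Pic}^0(A)$, $a\mapsto t_a^*\mathcal{L}\otimes\mathcal{L}^{-1}$. The Euler characteristic is $\chi(\mathcal{L})=d_1\cdots d_g$. Put $\mathrm{NS}_{\mathbb{Q}}(A)=(\mathrm{Pic}(A)/\mathrm{Pic}^0(A))\otimes\mathbb{Q}$ and $\mathrm{End}_{\mathbb{Q}}(A)=\mathrm{End}(A)\otimes\mathbb{Q}$. For $\alpha\in \mathrm{NS}_{\mathbb{Q}}(A)$, $\phi_\alpha\in\mathrm{Hom}(A,\widehat A)\otimes\mathbb{Q}$ is the $\mathbb{Q}$-linear extension of $\mathcal{M}\mapsto\phi_{\mathcal{M}}$.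 Intersection numbers $(\alpha_1\cdots\alpha_g)\in\mathbb{Q}$ are the $\mathbb{Q}$-multilinear extension of intersection numbers of line bundles. The Rosati involution on $\mathrm{End}_{\mathbb{Q}}(A)$ is $f\mapsto f'=\phi_{\mathcal{L}}^{-1}\widehat f\phi_{\mathcal{L}}$, and $\mathrm{End}^s_{\mathbb{Q}}(A)$ denotes the elements fixed by it. The map $\varphi:\mathrm{NS}_{\mathbb{Q}}(A)\to\mathrm{End}^s_{\mathbb{Q}}(A)$, $\alpha\mapsto\phi_{\mathcal{L}}^{-1}\phi_\alpha$, is an isomorphism of $\mathbb{Q}$-vector spaces. For an abelian subvariety $\iota_X:X\hookrightarrow A$ of dimension $n\ge1$, $\mathcal{L}|_X$ is a polarization of some type $(e_1,\dots,e_n)$; the exponent of $X$ is $e_X:=e_n$, $\psi_X:=e_X\phi_{\mathcal{L}|_X}^{-1}:\widehat X\to X$, the norm endomorphism is $N_X:=\iota_X\psi_X\widehat\iota_X\phi_{\mathcal{L}}\in\mathrm{End}(A)$, the symmetric idempotent is $\varepsilon_X:=\frac1{e_X}N_X\in\mathrm{End}^s_{\mathbb{Q}}(A)$, and $\alpha_X:=\varphi^{-1}(\varepsilon_X)\in\mathrm{NS}_{\mathbb{Q}}(A)$. *)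

theory Defs
  imports "HOL-Analysis.Analysis" "HOL-Algebra.Product_Groups"
begin

text \<open>
  A complex abelian variety is a complex torus \<open>V / \<Lambda>\<close> carrying an ample line bundle. All tori below
  are given by a pair \<open>V \<Lambda>\<close>, where \<open>V\<close> is a complex linear subspace of some \<open>\<complex>\<^sup>g\<close> and \<open>\<Lambda>\<close> is a
  lattice in \<open>V\<close>. Allowing proper subspaces makes a subtorus \<open>W / (\<Lambda> \<inter> W)\<close> an object of the same
  kind, to which the same definitions (line bundles, dual, type) apply.
\<close>

type_synonym 'g point = "(complex ^ 'g) set"
type_synonym 'g factor = "complex ^ 'g \<Rightarrow> complex ^ 'g \<Rightarrow> complex"
type_synonym 'g line_bundle = "'g factor set"
type_synonym 'g ns_class = "'g line_bundle set"


section \<open>Extension of scalars from the integers to the rationals\<close>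

text \<open>
  For a commutative group \<open>G\<close> (written multiplicatively), \<open>G \<otimes> \<rat>\<close> is the localization of the
  \<open>\<int>\<close>-module \<open>G\<close> at the positive integers; the pair \<open>(x, m)\<close> stands for \<open>x \<otimes> 1/m\<close>.
\<close>

definition rat_rel :: "('a, 'b) monoid_scheme \<Rightarrow> (('a \<times> nat) \<times> ('a \<times> nat)) set" where
  "rat_rel G = {((x, m), (y, n)). x \<in> carrier G \<and> y \<in> carrier G \<and> 0 < m \<and> 0 < n \<and>
     (\<exists>k>0. x [^]\<^bsub>G\<^esub> (k * n :: nat) = y [^]\<^bsub>G\<^esub> (k * m :: nat))}"

definition tensor_rat :: "('a, 'b) monoid_scheme \<Rightarrow> ('a \<times> nat) set set" where
  "tensor_rat G = (carrier G \<times> {0<..}) // rat_rel G"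

definition rat_frac :: "('a, 'b) monoid_scheme \<Rightarrow> 'a \<Rightarrow> nat \<Rightarrow> ('a \<times> nat) set" where
  "rat_frac G x m = rat_rel G `` {(x, m)}"

text \<open>The \<open>\<rat>\<close>-linear extension of a group homomorphism \<open>h\<close> with values in \<open>H\<close>.\<close>

definition map_rat :: "('b, 'c) monoid_scheme \<Rightarrow> ('a \<Rightarrow> 'b) \<Rightarrow> ('a \<times> nat) set \<Rightarrow> ('b \<times> nat) set" where
  "map_rat H h c = (\<Union>(x, m)\<in>c. rat_frac H (h x) m)"


section \<open>Complex tori\<close>

definition is_lattice :: "(complex ^ 'g) set \<Rightarrow> (complex ^ 'g) set \<Rightarrow> bool" where
  "is_lattice V \<Lambda> \<longleftrightarrow> vec.subspace V \<and> \<Lambda> \<subseteq> V \<and> 0 \<in> \<Lambda> \<and> (\<forall>x\<in>\<Lambda>. \<forall>y\<in>\<Lambda>. x - y \<in> \<Lambda>) \<and>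
     uniform_discrete \<Lambda> \<and> span \<Lambda> = V"
  \<comment> \<open>\<^const>\<open>span\<close> is the real span, while \<open>vec.subspace\<close> and \<open>vec.dim\<close> refer to complex scalars\<close>

definition vec_group :: "(complex ^ 'g) set \<Rightarrow> (complex ^ 'g) monoid" where
  "vec_group V = \<lparr>carrier = V, mult = (+), one = 0\<rparr>"

definition torus :: "(complex ^ 'g) set \<Rightarrow> (complex ^ 'g) set \<Rightarrow> 'g point monoid" where
  "torus V \<Lambda> = vec_group V Mod \<Lambda>"

definition proj :: "(complex ^ 'g) set \<Rightarrow> (complex ^ 'g) set \<Rightarrow> complex ^ 'g \<Rightarrow> 'g point" where
  "proj V \<Lambda> v = \<Lambda> #>\<^bsub>vec_group V\<^esub> v"

definition holo :: "(complex ^ 'g) set \<Rightarrow> (complex ^ 'g \<Rightarrow> complex) \<Rightarrow> bool" where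
  "holo V f \<longleftrightarrow> (\<forall>w\<in>V. \<exists>D. (f has_derivative D) (at w within V) \<and>
     (\<forall>c. \<forall>v\<in>V. D (c *s v) = c * D v))"


section \<open>Line bundles\<close>

text \<open>
  The pullback of a line bundle to the vector space \<open>V\<close> is trivial, so
  \<open>Pic (V / \<Lambda>) = H\<^sup>1(\<Lambda>, \<O>\<^sup>*(V))\<close>: a line bundle is a factor of automorphy \<open>f\<close>, i.e. the quotient of
  \<open>V \<times> \<complex>\<close> by \<open>\<lambda> \<cdot> (w, z) = (w + \<lambda>, f \<lambda> w * z)\<close>, and two factors define isomorphic bundles iff they
  differ by a coboundary. Factors take the value 1 outside \<open>\<Lambda> \<times> V\<close>, so that they are
  determined by their values on \<open>\<Lambda> \<times> V\<close>.
\<close>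

definition factors :: "(complex ^ 'g) set \<Rightarrow> (complex ^ 'g) set \<Rightarrow> 'g factor monoid" where
  "factors V \<Lambda> = \<lparr>
     carrier = {f. (\<forall>l\<in>\<Lambda>. holo V (f l)) \<and> (\<forall>l w. f l w \<noteq> 0) \<and>
                   (\<forall>l\<in>\<Lambda>. \<forall>m\<in>\<Lambda>. \<forall>w\<in>V. f (l + m) w = f l (w + m) * f m w) \<and>
                   (\<forall>l w. l \<notin> \<Lambda> \<or> w \<notin> V \<longrightarrow> f l w = 1)},
     mult = (\<lambda>f g l w. f l w * g l w),
     one = (\<lambda>l w. 1)\<rparr>"

definition coboundary :: "(complex ^ 'g) set \<Rightarrow> (complex ^ 'g) set \<Rightarrow>
    (complex ^ 'g \<Rightarrow> complex) \<Rightarrow> 'g factor" where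
  "coboundary V \<Lambda> h = (\<lambda>l w. if l \<in> \<Lambda> \<and> w \<in> V then h (w + l) / h w else 1)"

definition coboundaries :: "(complex ^ 'g) set \<Rightarrow> (complex ^ 'g) set \<Rightarrow> 'g factor set" where
  "coboundaries V \<Lambda> = coboundary V \<Lambda> ` {h. holo V h \<and> (\<forall>w\<in>V. h w \<noteq> 0)}"

definition Pic :: "(complex ^ 'g) set \<Rightarrow> (complex ^ 'g) set \<Rightarrow> 'g line_bundle monoid" where
  "Pic V \<Lambda> = factors V \<Lambda> Mod coboundaries V \<Lambda>"

definition bundle_of :: "(complex ^ 'g) set \<Rightarrow> (complex ^ 'g) set \<Rightarrow> 'g factor \<Rightarrow> 'g line_bundle" where
  "bundle_of V \<Lambda> f = coboundaries V \<Lambda> #>\<^bsub>factors V \<Lambda>\<^esub> f"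

text \<open>The pullback \<open>t\<^sub>a\<^sup>* L\<close>; the union runs over all representatives of \<open>L\<close> and \<open>a\<close>.\<close>

definition translate :: "(complex ^ 'g) set \<Rightarrow> (complex ^ 'g) set \<Rightarrow>
    'g point \<Rightarrow> 'g line_bundle \<Rightarrow> 'g line_bundle" where
  "translate V \<Lambda> a L = (\<Union>f\<in>L. \<Union>v\<in>a. bundle_of V \<Lambda> (\<lambda>l w. f l (w + v)))"

text \<open>The restriction of a line bundle to the subtorus \<open>W / (\<Lambda> \<inter> W)\<close>.\<close>

definition restr_bundle :: "(complex ^ 'g) set \<Rightarrow> (complex ^ 'g) set \<Rightarrow>
    'g line_bundle \<Rightarrow> 'g line_bundle" where
  "restr_bundle W \<Lambda> L =
     (\<Union>f\<in>L. bundle_of W (\<Lambda> \<inter> W) (\<lambda>l w. if l \<in> \<Lambda> \<inter> W \<and> w \<in> W then f l w else 1))"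

text \<open>
  Sections of the \<open>k\<close>-th power of the bundle given by \<open>f\<close>, as functions on \<open>V\<close>.
\<close>

definition sections :: "(complex ^ 'g) set \<Rightarrow> (complex ^ 'g) set \<Rightarrow> 'g factor \<Rightarrow> nat \<Rightarrow>
    (complex ^ 'g \<Rightarrow> complex) set" where
  "sections V \<Lambda> f k = {\<theta>. holo V \<theta> \<and> (\<forall>l\<in>\<Lambda>. \<forall>w\<in>V. \<theta> (w + l) = f l w ^ k * \<theta> w)}"

text \<open>
  \<open>L\<close> is ample iff sections \<open>\<theta>\<^sub>0, \<dots>, \<theta>\<^sub>N\<close> of some positive power define an embedding
  \<open>[\<theta>\<^sub>0 : \<dots> : \<theta>\<^sub>N]\<close> of \<open>V / \<Lambda>\<close> into projective space: they have no common zero, they separate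
  points, and the induced map is an immersion. A tangent vector \<open>v\<close> at \<open>w\<close> is killed by the
  differential iff the derivative of \<open>(\<theta>\<^sub>0, \<dots>, \<theta>\<^sub>N)\<close> along \<open>v\<close> is proportional to the value at \<open>w\<close>.
\<close>

definition ample :: "(complex ^ 'g) set \<Rightarrow> (complex ^ 'g) set \<Rightarrow> 'g line_bundle \<Rightarrow> bool" where
  "ample V \<Lambda> L \<longleftrightarrow> (\<exists>f\<in>L. \<exists>k>0. \<exists>N::nat. \<exists>\<theta>.
     (\<forall>j\<le>N. \<theta> j \<in> sections V \<Lambda> f k) \<and>
     (\<forall>w\<in>V. \<exists>j\<le>N. \<theta> j w \<noteq> 0) \<and>
     (\<forall>w\<in>V. \<forall>w'\<in>V. (\<exists>c. \<forall>j\<le>N. \<theta> j w' = c * \<theta> j w) \<longrightarrow> w' - w \<in> \<Lambda>) \<and>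
     (\<forall>w\<in>V. \<forall>v\<in>V. (\<exists>c. \<forall>j\<le>N. deriv (\<lambda>t. \<theta> j (w + t *s v)) 0 = c * \<theta> j w) \<longrightarrow> v = 0))"


section \<open>First Chern class, Neron-Severi group and intersection numbers\<close>

text \<open>
  The first Chern class lives in \<open>H\<^sup>2(V / \<Lambda>, \<int>) = Alt\<^sup>2(\<Lambda>, \<int>)\<close>. With \<open>f \<lambda> = exp (2\<pi>i g\<^sub>\<lambda>)\<close>, the
  connecting homomorphism of the exponential sequence sends \<open>f\<close> to the 2-cocycle
  \<open>(\<lambda>, \<mu>) \<mapsto> g\<^sub>\<mu>(w + \<lambda>) - g\<^bsub>\<lambda>+\<mu>\<^esub>(w) + g\<^sub>\<lambda>(w)\<close>, up to sign; antisymmetrizing gives the form below (which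
  does not depend on \<open>w\<close>, here 0). The sign is such that \<open>\<O>(p)\<close> on an elliptic curve has
  degree 1 with respect to the complex orientation: for \<open>\<Lambda> = \<int> + \<tau>\<int>\<close>, \<open>Im \<tau> > 0\<close>, and the factor
  \<open>g\<^sub>1 = 0\<close>, \<open>g\<^sub>\<tau>(w) = - w - \<tau>/2\<close> of the Riemann theta function, the value at \<open>(1, \<tau>)\<close> is 1.
\<close>

definition chern_factor :: "(complex ^ 'g) set \<Rightarrow> (complex ^ 'g) set \<Rightarrow> 'g factor \<Rightarrow>
    complex ^ 'g \<Rightarrow> complex ^ 'g \<Rightarrow> int" where
  "chern_factor V \<Lambda> f l m = (THE k. \<exists>g.
     (\<forall>x\<in>\<Lambda>. holo V (g x) \<and> (\<forall>w\<in>V. f x w = exp (2 * of_real pi * \<i> * g x w))) \<and>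
     of_int k = g l m + g m 0 - g m l - g l 0)"

definition chern :: "(complex ^ 'g) set \<Rightarrow> (complex ^ 'g) set \<Rightarrow> 'g line_bundle \<Rightarrow>
    complex ^ 'g \<Rightarrow> complex ^ 'g \<Rightarrow> int" where
  "chern V \<Lambda> L = chern_factor V \<Lambda> (SOME f. f \<in> L)"

definition Pic0_set :: "(complex ^ 'g) set \<Rightarrow> (complex ^ 'g) set \<Rightarrow> 'g line_bundle set" where
  "Pic0_set V \<Lambda> = {L \<in> carrier (Pic V \<Lambda>). \<forall>l\<in>\<Lambda>. \<forall>m\<in>\<Lambda>. chern V \<Lambda> L l m = 0}"

definition dual :: "(complex ^ 'g) set \<Rightarrow> (complex ^ 'g) set \<Rightarrow> 'g line_bundle monoid" where
  "dual V \<Lambda> = (Pic V \<Lambda>)\<lparr>carrier := Pic0_set V \<Lambda>\<rparr>"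

definition NS :: "(complex ^ 'g) set \<Rightarrow> (complex ^ 'g) set \<Rightarrow> 'g ns_class monoid" where
  "NS V \<Lambda> = Pic V \<Lambda> Mod Pic0_set V \<Lambda>"

definition ns_of :: "(complex ^ 'g) set \<Rightarrow> (complex ^ 'g) set \<Rightarrow> 'g line_bundle \<Rightarrow> 'g ns_class" where
  "ns_of V \<Lambda> L = Pic0_set V \<Lambda> #>\<^bsub>Pic V \<Lambda>\<^esub> L"

abbreviation NS_rat :: "(complex ^ 'g) set \<Rightarrow> (complex ^ 'g) set \<Rightarrow> ('g ns_class \<times> nat) set set" where
  "NS_rat V \<Lambda> \<equiv> tensor_rat (NS V \<Lambda>)"

text \<open>
  The value of \<open>\<omega>\<^sub>0 \<and> \<dots> \<and> \<omega>\<^bsub>n-1\<^esub>\<close> at \<open>(b\<^sub>0, \<dots>, b\<^bsub>2n-1\<^esub>)\<close>, for alternating 2-forms \<open>\<omega>\<^sub>i\<close>.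
\<close>

definition wedge_eval :: "nat \<Rightarrow> (nat \<Rightarrow> 'v \<Rightarrow> 'v \<Rightarrow> 'b::field_char_0) \<Rightarrow> (nat \<Rightarrow> 'v) \<Rightarrow> 'b" where
  "wedge_eval n \<omega> b =
     (\<Sum>p | p permutes {..<2 * n}. of_int (sign p) *
        (\<Prod>i<n. \<omega> i (b (p (2 * i))) (b (p (2 * i + 1))))) / 2 ^ n"

text \<open>
  The complex orientation of an \<open>n\<close>-dimensional complex vector space is the one given by \<open>\<omega>\<^sup>n\<close>, for
  \<open>\<omega>\<close> the standard Kaehler form, normalized by \<open>\<omega>(v, i v) > 0\<close>.
\<close>

definition kaehler :: "complex ^ 'g \<Rightarrow> complex ^ 'g \<Rightarrow> real" where
  "kaehler u v = Im (\<Sum>k\<in>UNIV. cnj (u $ k) * v $ k)"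

definition oriented_basis :: "(complex ^ 'g) set \<Rightarrow> nat \<Rightarrow> (nat \<Rightarrow> complex ^ 'g) \<Rightarrow> bool" where
  "oriented_basis \<Lambda> n b \<longleftrightarrow>
     inj_on b {..<2 * n} \<and> independent (b ` {..<2 * n}) \<and>
     \<Lambda> = range (\<lambda>c :: nat \<Rightarrow> int. \<Sum>i<2 * n. of_int (c i) *\<^sub>R b i) \<and>
     wedge_eval n (\<lambda>_. kaehler) b > 0"

text \<open>
  The intersection number \<open>(L\<^sub>0 \<cdots> L\<^bsub>n-1\<^esub>)\<close> is the value of \<open>c\<^sub>1(L\<^sub>0) \<union> \<dots> \<union> c\<^sub>1(L\<^bsub>n-1\<^esub>)\<close> on the fundamental
  class; any positively oriented basis of \<open>\<Lambda> = H\<^sub>1(V / \<Lambda>, \<int>)\<close> gives the same value.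
\<close>

definition intersection :: "(complex ^ 'g) set \<Rightarrow> (complex ^ 'g) set \<Rightarrow> (nat \<Rightarrow> 'g line_bundle) \<Rightarrow> rat" where
  "intersection V \<Lambda> L =
     wedge_eval (vec.dim V) (\<lambda>i l m. of_int (chern V \<Lambda> (L i) l m))
       (SOME b. oriented_basis \<Lambda> (vec.dim V) b)"

text \<open>The \<open>\<rat>\<close>-multilinear extension, computed on arbitrary representatives \<open>\<alpha> i = [M\<^sub>i] \<otimes> 1/m\<^sub>i\<close>.\<close>

definition intersection_rat :: "(complex ^ 'g) set \<Rightarrow> (complex ^ 'g) set \<Rightarrow>
    (nat \<Rightarrow> ('g ns_class \<times> nat) set) \<Rightarrow> rat" where
  "intersection_rat V \<Lambda> \<alpha> =
     (let q = (\<lambda>i. SOME p. p \<in> \<alpha> i) in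
      intersection V \<Lambda> (\<lambda>i. SOME M. M \<in> fst (q i)) / (\<Prod>i<vec.dim V. of_nat (snd (q i))))"


section \<open>Homomorphisms, polarizations and their type\<close>

definition Hom :: "('a, 'm) monoid_scheme \<Rightarrow> ('b, 'n) monoid_scheme \<Rightarrow> ('a \<Rightarrow> 'b) monoid" where
  "Hom G H = \<lparr>
     carrier = hom G H \<inter> extensional (carrier G),
     mult = (\<lambda>f h. \<lambda>x\<in>carrier G. f x \<otimes>\<^bsub>H\<^esub> h x),
     one = (\<lambda>x\<in>carrier G. \<one>\<^bsub>H\<^esub>)\<rparr>"

text \<open>
  The additive group of \<open>End (V / \<Lambda>)\<close>. Since \<open>V\<close> is the universal cover, a map of the torus is
  holomorphic iff it lifts to a holomorphic map \<open>V \<rightarrow> V\<close>.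
\<close>

definition End :: "(complex ^ 'g) set \<Rightarrow> (complex ^ 'g) set \<Rightarrow> ('g point \<Rightarrow> 'g point) monoid" where
  "End V \<Lambda> = (Hom (torus V \<Lambda>) (torus V \<Lambda>))\<lparr>carrier :=
     {f \<in> carrier (Hom (torus V \<Lambda>) (torus V \<Lambda>)). \<exists>F. F ` V \<subseteq> V \<and>
        (\<forall>j. holo V (\<lambda>w. F w $ j)) \<and> (\<forall>w\<in>V. f (proj V \<Lambda> w) = proj V \<Lambda> (F w))}\<rparr>"

text \<open>\<open>\<phi>\<^sub>M : A \<rightarrow> Pic\<^sup>0(A)\<close>, \<open>a \<mapsto> t\<^sub>a\<^sup>* M \<otimes> M\<^sup>-\<^sup>1\<close>\<close>

definition phi :: "(complex ^ 'g) set \<Rightarrow> (complex ^ 'g) set \<Rightarrow> 'g line_bundle \<Rightarrow>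
    'g point \<Rightarrow> 'g line_bundle" where
  "phi V \<Lambda> M =
     (\<lambda>a\<in>carrier (torus V \<Lambda>). translate V \<Lambda> a M \<otimes>\<^bsub>Pic V \<Lambda>\<^esub> inv\<^bsub>Pic V \<Lambda>\<^esub> M)"

definition has_type :: "(complex ^ 'g) set \<Rightarrow> (complex ^ 'g) set \<Rightarrow> 'g line_bundle \<Rightarrow> nat list \<Rightarrow> bool" where
  "has_type V \<Lambda> L ds \<longleftrightarrow>
     length ds = vec.dim V \<and> (\<forall>d\<in>set ds. 0 < d) \<and>
     (\<forall>i. Suc i < length ds \<longrightarrow> ds ! i dvd ds ! Suc i) \<and>
     (let D = product_group {..<length ds} (\<lambda>i. integer_mod_group (ds ! i)) in
      (torus V \<Lambda>)\<lparr>carrier := kernel (torus V \<Lambda>) (dual V \<Lambda>) (phi V \<Lambda> L)\<rparr> \<cong> D \<times>\<times> D)"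

text \<open>The type of a polarization exists and is unique, so the choice is harmless.\<close>

definition pol_type :: "(complex ^ 'g) set \<Rightarrow> (complex ^ 'g) set \<Rightarrow> 'g line_bundle \<Rightarrow> nat list" where
  "pol_type V \<Lambda> L = (SOME ds. has_type V \<Lambda> L ds)"

definition euler_char :: "(complex ^ 'g) set \<Rightarrow> (complex ^ 'g) set \<Rightarrow> 'g line_bundle \<Rightarrow> nat" where
  "euler_char V \<Lambda> L = prod_list (pol_type V \<Lambda> L)"

text \<open>
  \<open>\<phi>\<^sub>\<alpha> \<in> Hom(A, Pic\<^sup>0(A)) \<otimes> \<rat>\<close>, and \<open>\<phi>\<^sub>L\<^sup>-\<^sup>1 \<phi>\<^sub>\<alpha> \<in> End(A) \<otimes> \<rat>\<close> as the solution \<open>\<epsilon>\<close> of \<open>\<phi>\<^sub>L \<epsilon> = \<phi>\<^sub>\<alpha>\<close>.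
  Holomorphy is imposed on \<open>\<epsilon>\<close>; then all homomorphisms to \<open>Pic\<^sup>0(A)\<close> that occur are automatically
  holomorphic, so the equation may be read in the group of all homomorphisms.
\<close>

definition phi_rat :: "(complex ^ 'g) set \<Rightarrow> (complex ^ 'g) set \<Rightarrow> ('g ns_class \<times> nat) set \<Rightarrow>
    (('g point \<Rightarrow> 'g line_bundle) \<times> nat) set" where
  "phi_rat V \<Lambda> = map_rat (Hom (torus V \<Lambda>) (dual V \<Lambda>)) (\<lambda>c. phi V \<Lambda> (SOME M. M \<in> c))"

definition phi_comp_rat :: "(complex ^ 'g) set \<Rightarrow> (complex ^ 'g) set \<Rightarrow> 'g line_bundle \<Rightarrow>
    (('g point \<Rightarrow> 'g point) \<times> nat) set \<Rightarrow> (('g point \<Rightarrow> 'g line_bundle) \<times> nat) set" where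
  "phi_comp_rat V \<Lambda> L = map_rat (Hom (torus V \<Lambda>) (dual V \<Lambda>))
     (\<lambda>f. compose (carrier (torus V \<Lambda>)) (phi V \<Lambda> L) f)"

definition ns_to_end :: "(complex ^ 'g) set \<Rightarrow> (complex ^ 'g) set \<Rightarrow> 'g line_bundle \<Rightarrow>
    ('g ns_class \<times> nat) set \<Rightarrow> (('g point \<Rightarrow> 'g point) \<times> nat) set" where
  "ns_to_end V \<Lambda> L \<alpha> =
     (THE \<epsilon>. \<epsilon> \<in> tensor_rat (End V \<Lambda>) \<and> phi_comp_rat V \<Lambda> L \<epsilon> = phi_rat V \<Lambda> \<alpha>)"


section \<open>Abelian subvarieties and their norm endomorphisms\<close>

text \<open>Abelian subvarieties of dimension \<open>n\<close> are the \<open>n\<close>-dimensional complex subtori, as sets of points.\<close>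

definition abelian_subvarieties :: "(complex ^ 'g) set \<Rightarrow> (complex ^ 'g) set \<Rightarrow> nat \<Rightarrow> 'g point set set" where
  "abelian_subvarieties V \<Lambda> n =
     {proj V \<Lambda> ` W | W. W \<subseteq> V \<and> vec.dim W = n \<and> is_lattice W (\<Lambda> \<inter> W)}"

text \<open>The Lie algebra of \<open>X\<close>; it recovers \<open>W\<close> from \<open>X = proj V \<Lambda> ` W\<close>.\<close>

definition tangent_space :: "(complex ^ 'g) set \<Rightarrow> (complex ^ 'g) set \<Rightarrow> 'g point set \<Rightarrow> (complex ^ 'g) set" where
  "tangent_space V \<Lambda> X = {v \<in> V. \<forall>t::real. proj V \<Lambda> (t *\<^sub>R v) \<in> X}"

text \<open>In the following definitions the subvariety is the subtorus \<open>W / (\<Lambda> \<inter> W)\<close>.\<close>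

definition subvar_incl :: "(complex ^ 'g) set \<Rightarrow> (complex ^ 'g) set \<Rightarrow> 'g point \<Rightarrow> 'g point" where
  "subvar_incl V \<Lambda> x = (\<Union>w\<in>x. proj V \<Lambda> w)"

definition subvar_exponent :: "(complex ^ 'g) set \<Rightarrow> (complex ^ 'g) set \<Rightarrow> 'g line_bundle \<Rightarrow> nat" where
  "subvar_exponent W \<Lambda> L = last (pol_type W (\<Lambda> \<inter> W) (restr_bundle W \<Lambda> L))"

text \<open>
  \<open>\<psi> = e \<phi>\<^sup>-\<^sup>1\<close> for \<open>\<phi> = \<phi>\<^bsub>L|X\<^esub>\<close>: it maps \<open>P\<close> to \<open>e\<close> times any preimage of \<open>P\<close> under the isogeny \<open>\<phi>\<close>,
  which is well defined because \<open>e\<close> annihilates the kernel of \<open>\<phi>\<close>.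
\<close>

definition subvar_psi :: "(complex ^ 'g) set \<Rightarrow> (complex ^ 'g) set \<Rightarrow> 'g line_bundle \<Rightarrow>
    'g line_bundle \<Rightarrow> 'g point" where
  "subvar_psi W \<Lambda> L P =
     inv_into (carrier (torus W (\<Lambda> \<inter> W))) (phi W (\<Lambda> \<inter> W) (restr_bundle W \<Lambda> L)) P
       [^]\<^bsub>torus W (\<Lambda> \<inter> W)\<^esub> subvar_exponent W \<Lambda> L"

definition norm_endo :: "(complex ^ 'g) set \<Rightarrow> (complex ^ 'g) set \<Rightarrow> 'g line_bundle \<Rightarrow>
    (complex ^ 'g) set \<Rightarrow> 'g point \<Rightarrow> 'g point" where
  "norm_endo V \<Lambda> L W = (\<lambda>a\<in>carrier (torus V \<Lambda>).
     subvar_incl V \<Lambda> (subvar_psi W \<Lambda> L (restr_bundle W \<Lambda> (phi V \<Lambda> L a))))"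

definition sym_idem :: "(complex ^ 'g) set \<Rightarrow> (complex ^ 'g) set \<Rightarrow> 'g line_bundle \<Rightarrow>
    'g point set \<Rightarrow> (('g point \<Rightarrow> 'g point) \<times> nat) set" where
  "sym_idem V \<Lambda> L X = (let W = tangent_space V \<Lambda> X in
     rat_frac (End V \<Lambda>) (norm_endo V \<Lambda> L W) (subvar_exponent W \<Lambda> L))"

definition subvar_class :: "(complex ^ 'g) set \<Rightarrow> (complex ^ 'g) set \<Rightarrow> 'g line_bundle \<Rightarrow>
    'g point set \<Rightarrow> ('g ns_class \<times> nat) set" where
  "subvar_class V \<Lambda> L X = inv_into (NS_rat V \<Lambda>) (ns_to_end V \<Lambda> L) (sym_idem V \<Lambda> L X)"

end

theory Submission
  imports Defs "HOL-Complex_Analysis.Complex_Analysis"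
begin

text \<open>
  By the Appell-Humbert normal form of a factor of automorphy, the class of a line bundle in
  \<open>NS \<otimes> \<rat>\<close> is a rational (1,1)-form, and \<open>\<phi>\<^sub>M\<close> sends \<open>v\<close> to the flat bundle with character
  \<open>l \<mapsto> exp (2\<pi>i c\<^sub>1(M)(l, v))\<close>. The form \<open>E\<close> of the ample bundle \<open>L\<close> is positive, so \<open>\<alpha> \<mapsto> \<phi>\<^sub>L\<^sup>-\<^sup>1\<phi>\<^sub>\<alpha>\<close>
  is the passage from a form \<open>F\<close> to the operator \<open>A\<close> with \<open>E(x, A y) = F(x, y)\<close>, and \<open>\<epsilon>\<^sub>X\<close> is the
  \<open>E\<close>-orthogonal projection onto the tangent space of \<open>X\<close>. In a basis that diagonalises \<open>F\<close> with
  respect to \<open>E\<close>, with eigenvalues \<open>c\<^sub>j\<close>, the numbers \<open>(\<alpha>\<^sup>r L\<^bsup>g-r\<^esup>)\<close> are the elementary symmetric functions of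
  the \<open>c\<^sub>j\<close> up to explicit factors, and the prescribed values say that \<open>\<Prod>\<^sub>j (t + c\<^sub>j) = (t + 1)\<^sup>n t\<^bsup>g-n\<^esup>\<close>,
  i.e. that \<open>A\<close> is a projection of rank \<open>n\<close>; being rational, its image is spanned by
  lattice vectors.
\<close>

text \<open>Bundles are given as arbitrary holomorphic cocycles, so the analytic burden lies in the
  normal form. A logarithm of a factor satisfies the cocycle identity up to integers only; these do
  not depend on the point, and the difference equations are solved up to constants. A complex basis
  inside the lattice is treated by Guichard's method, one vector at a time. What is left is periodic
  in these directions and is solved by a Fourier series for all other lattice vectors at once. Small
  denominators do not occur: the lattice spans the space over the reals, so for each nonzero
  frequency some member of a fixed finite set of lattice vectors has a divisor bounded below.
  Subtori inherit the normal form by restriction, with the same form \<open>E\<close>; this is why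
  \<open>has_form\<close> and \<open>positive_form\<close> refer to a general \<open>V\<close>.
  Classes and endomorphisms with rational coefficients are handled through additive embeddings into
  real vectors, namely values of forms and of linear lifts. Rationality then appears as lattice
  conditions, in \<open>form_surj\<close>, \<open>ex_rat_end\<close> and
  \<open>condition_imp_subvar\<close>.\<close>

lemma vec_scale_of_real: "complex_of_real r *s (v :: complex ^ 'g) = r *\<^sub>R v"
  by (simp add: vec_eq_iff complex_eq_iff)

lemma bounded_linear_vec_scale_left: "bounded_linear (\<lambda>z. z *s (v :: complex ^ 'g))"
  by (rule linear_conv_bounded_linear[THEN iffD1], rule linearI)
     (auto simp: vec_eq_iff algebra_simps)

lemma continuous_on_vec_scale [continuous_intros]:
  assumes "continuous_on S f" "continuous_on S g"
  shows "continuous_on S (\<lambda>x. f x *s (g x :: complex ^ 'g))"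
  unfolding vector_scalar_mult_def
  by (intro continuous_intros assms)

lemma norm_vec_scale: "norm (z *s (v :: complex ^ 'g)) = norm z * norm v"
  by (simp add: norm_vec_def L2_set_def norm_mult power_mult_distrib flip: sum_distrib_left)
     (simp add: real_sqrt_mult)

lemma exp_2pi_eq_1_iff: "exp (2 * of_real pi * \<i> * z) = 1 \<longleftrightarrow> z \<in> \<int>"
proof -
  have "exp (2 * of_real pi * \<i> * z) = 1 \<longleftrightarrow> (\<exists>n::int. 2 * of_real pi * \<i> * z = of_int (2 * n) * of_real pi * \<i>)"
    by (subst exp_eq_1) (auto simp: complex_eq_iff algebra_simps)
  also have "\<dots> \<longleftrightarrow> (\<exists>n::int. z = of_int n)"
    by (auto simp: field_simps)
  finally show ?thesis by (auto simp: Ints_def)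
qed

section \<open>Several complex variables, leading to the Appell-Humbert normal form\<close>

section \<open>Holomorphic functions of several variables\<close>

lemma holoE:
  assumes "holo V f" "w \<in> V"
  obtains D where "(f has_derivative D) (at w within V)" "\<And>c v. v \<in> V \<Longrightarrow> D (c *s v) = c * D v"
  using assms unfolding holo_def by blast

lemma holo_const [intro]: "holo V (\<lambda>w. c)"
  unfolding holo_def by (auto intro!: exI[of _ "\<lambda>_. 0"])

lemma holo_add [intro]:
  assumes "holo V f" "holo V g" shows "holo V (\<lambda>w. f w + g w)"
  unfolding holo_def
proof
  fix w assume w: "w \<in> V"
  from holoE[OF assms(1) w] obtain D where D: "(f has_derivative D) (at w within V)"
      "\<And>c v. v \<in> V \<Longrightarrow> D (c *s v) = c * D v" by blast
  from holoE[OF assms(2) w] obtain D' where D': "(g has_derivative D') (at w within V)"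
      "\<And>c v. v \<in> V \<Longrightarrow> D' (c *s v) = c * D' v" by blast
  show "\<exists>D. ((\<lambda>w. f w + g w) has_derivative D) (at w within V) \<and> (\<forall>c. \<forall>v\<in>V. D (c *s v) = c * D v)"
    using has_derivative_add[OF D(1) D'(1)] D(2) D'(2)
    by (intro exI[of _ "\<lambda>v. D v + D' v"]) (simp add: algebra_simps)
qed

lemma holo_mult [intro]:
  assumes "holo V f" "holo V g" shows "holo V (\<lambda>w. f w * g w)"
  unfolding holo_def
proof
  fix w assume w: "w \<in> V"
  from holoE[OF assms(1) w] obtain D where D: "(f has_derivative D) (at w within V)"
      "\<And>c v. v \<in> V \<Longrightarrow> D (c *s v) = c * D v" by blast
  from holoE[OF assms(2) w] obtain D' where D': "(g has_derivative D') (at w within V)"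
      "\<And>c v. v \<in> V \<Longrightarrow> D' (c *s v) = c * D' v" by blast
  show "\<exists>D. ((\<lambda>w. f w * g w) has_derivative D) (at w within V) \<and> (\<forall>c. \<forall>v\<in>V. D (c *s v) = c * D v)"
    using has_derivative_mult[OF D(1) D'(1)] D(2) D'(2)
    by (intro exI[of _ "\<lambda>v. f w * D' v + D v * g w"]) (simp add: algebra_simps)
qed

lemma holo_compose_field:
  assumes f: "holo V f" and g: "\<And>w. w \<in> V \<Longrightarrow> (g has_field_derivative g' w) (at (f w))"
  shows "holo V (\<lambda>w. g (f w))"
  unfolding holo_def
proof
  fix w assume w: "w \<in> V"
  from holoE[OF f w] obtain D where D: "(f has_derivative D) (at w within V)"
      "\<And>c v. v \<in> V \<Longrightarrow> D (c *s v) = c * D v" by blast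
  have "((\<lambda>w. g (f w)) has_derivative (\<lambda>v. g' w * D v)) (at w within V)"
    using has_derivative_compose[OF D(1), of g "\<lambda>x. g' w * x"] g[OF w]
    by (simp add: has_field_derivative_def)
  thus "\<exists>D. ((\<lambda>w. g (f w)) has_derivative D) (at w within V) \<and> (\<forall>c. \<forall>v\<in>V. D (c *s v) = c * D v)"
    using D(2) by (intro exI[of _ "\<lambda>v. g' w * D v"]) auto
qed

lemma holo_exp [intro]: "holo V f \<Longrightarrow> holo V (\<lambda>w. exp (f w))"
  by (erule holo_compose_field) (rule DERIV_exp)

lemma holo_inverse:
  assumes "holo V f" "\<And>w. w \<in> V \<Longrightarrow> f w \<noteq> 0" shows "holo V (\<lambda>w. inverse (f w))"
  using assms(1) by (rule holo_compose_field) (use assms(2) in \<open>rule DERIV_inverse\<close>)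

lemma holo_divide:
  assumes "holo V f" "holo V g" "\<And>w. w \<in> V \<Longrightarrow> g w \<noteq> 0" shows "holo V (\<lambda>w. f w / g w)"
  unfolding divide_inverse by (intro holo_mult assms holo_inverse)

lemma holo_minus: "holo V f \<Longrightarrow> holo V (\<lambda>w. - f w)"
  using holo_mult[OF holo_const[of V "-1"], of f] by simp

lemma holo_diff:
  assumes "holo V f" "holo V g" shows "holo V (\<lambda>w. f w - g w)"
  using holo_add[OF assms(1) holo_minus[OF assms(2)]] by simp

lemma holo_power: "holo V f \<Longrightarrow> holo V (\<lambda>w. f w ^ n)"
  by (induction n) auto

lemma holo_sum: "(\<And>i. i \<in> I \<Longrightarrow> holo V (f i)) \<Longrightarrow> holo V (\<lambda>w. \<Sum>i\<in>I. f i w)"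
  by (induction I rule: infinite_finite_induct) auto

lemma holo_cong: "(\<And>w. w \<in> V \<Longrightarrow> f w = g w) \<Longrightarrow> holo V f \<longleftrightarrow> holo V g"
  unfolding holo_def by (metis has_derivative_transform)

lemma holo_subset: "holo V f \<Longrightarrow> W \<subseteq> V \<Longrightarrow> holo W f"
  unfolding holo_def by (meson has_derivative_subset subset_iff)

lemma holo_linear:
  assumes "linear f" "\<And>c v. f (c *s v) = c * f v" shows "holo V f"
  unfolding holo_def using assms linear_conv_bounded_linear bounded_linear_imp_has_derivative by metis

lemma holo_component: "holo V (\<lambda>w. w $ j)"
  by (rule holo_linear) (auto intro!: linearI)

lemma holo_translate:
  assumes "holo V f" "\<And>w. w \<in> V \<Longrightarrow> w + v \<in> V"
  shows "holo V (\<lambda>w. f (w + v))"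
  unfolding holo_def
proof
  fix w assume w: "w \<in> V"
  from holoE[OF assms(1) assms(2)[OF w]] obtain D where D: "(f has_derivative D) (at (w + v) within V)"
      "\<And>c v. v \<in> V \<Longrightarrow> D (c *s v) = c * D v" by blast
  have "((\<lambda>w. f (w + v)) has_derivative D) (at w within V)"
  proof -
    have "((\<lambda>w. w + v) has_derivative (\<lambda>x. x)) (at w within V)"
      by (auto intro!: derivative_eq_intros)
    moreover have "(f has_derivative D) (at (w + v) within (\<lambda>w. w + v) ` V)"
      by (rule has_derivative_subset[OF D(1)]) (use assms(2) in auto)
    ultimately show ?thesis by (rule has_derivative_in_compose)
  qed
  thus "\<exists>D. ((\<lambda>w. f (w + v)) has_derivative D) (at w within V) \<and> (\<forall>c. \<forall>v\<in>V. D (c *s v) = c * D v)"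
    using D(2) by blast
qed

lemma holo_continuous_on: "holo V f \<Longrightarrow> continuous_on V f"
  unfolding holo_def continuous_on_eq_continuous_within using has_derivative_continuous by blast

text \<open>Cauchy's formula, power series and Liouville's theorem reach functions of several
  variables through complex lines.\<close>

lemma holo_line:
  assumes "holo V f" "vec.subspace V" "w \<in> V" "v \<in> V"
  shows "(\<lambda>z. f (w + z *s v)) holomorphic_on UNIV"
proof -
  have inV: "w + z *s v \<in> V" for z
    using assms vec.subspace_add vec.subspace_scale by blast
  have "\<exists>c. ((\<lambda>z. f (w + z *s v)) has_field_derivative c) (at z)" for z
  proof -
    from holoE[OF assms(1) inV[of z]] obtain D where D: "(f has_derivative D) (at (w + z *s v) within V)"
        "\<And>c v. v \<in> V \<Longrightarrow> D (c *s v) = c * D v" by blast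
    have "((\<lambda>z. w + z *s v) has_derivative (\<lambda>c. c *s v)) (at z)"
      by (auto intro!: derivative_eq_intros bounded_linear_imp_has_derivative bounded_linear_vec_scale_left)
    hence "((\<lambda>z. f (w + z *s v)) has_derivative (\<lambda>c. D (c *s v))) (at z)"
      using has_derivative_in_compose[of "\<lambda>z. w + z *s v" "\<lambda>c. c *s v" z UNIV f D]
        has_derivative_subset[OF D(1)] inV by (metis image_subsetI)
    moreover have "(\<lambda>c. D (c *s v)) = (*) (D v)"
      using D(2)[OF assms(4)] by (simp add: fun_eq_iff)
    ultimately show ?thesis
      unfolding has_field_derivative_def by metis
  qed
  thus ?thesis by (auto simp: holomorphic_on_def field_differentiable_def)
qed

text \<open>Cauchy's formula, as an integral over \<open>[0,1]\<close> so that dependence on parameters is easy to control.\<close>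

lemma deriv_eq_integral:
  assumes "f holomorphic_on UNIV"
  shows "deriv f z = integral (cbox 0 1) (\<lambda>s. f (z + exp (2 * of_real pi * \<i> * of_real s)) / exp (2 * of_real pi * \<i> * of_real s))"
proof -
  have "deriv f z = 1 / (2 * of_real pi * \<i>) * contour_integral (circlepath z 1) (\<lambda>u. f u / (u - z)\<^sup>2)"
    by (rule Cauchy_derivative_integral_circlepath(2)[of z 1 f z, THEN DERIV_imp_deriv])
       (use assms in \<open>auto intro: holomorphic_on_imp_continuous_on holomorphic_on_subset\<close>)
  also have "contour_integral (circlepath z 1) (\<lambda>u. f u / (u - z)\<^sup>2) =
      integral {0..1} (\<lambda>s. f (circlepath z 1 s) / (circlepath z 1 s - z)\<^sup>2 * vector_derivative (circlepath z 1) (at s))"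
    by (rule contour_integral_integral)
  also have "\<dots> = integral {0..1} (\<lambda>s. (2 * of_real pi * \<i>) * (f (z + exp (2 * of_real pi * \<i> * of_real s)) / exp (2 * of_real pi * \<i> * of_real s)))"
    by (intro integral_cong, subst vector_derivative_circlepath)
       (simp add: circlepath power2_eq_square field_simps)
  also have "\<dots> = (2 * of_real pi * \<i>) * integral {0..1} (\<lambda>s. f (z + exp (2 * of_real pi * \<i> * of_real s)) / exp (2 * of_real pi * \<i> * of_real s))"
    by (rule integral_mult_right)
  finally show ?thesis by simp
qed

text \<open>Cauchy's formula writes the derivative as an integral of \<open>F\<close> over a compact
  circle, and such an integral inherits joint continuity from \<open>F\<close>.\<close>

lemma continuous_on_deriv_param:
  fixes F :: "'p::topological_space \<Rightarrow> complex \<Rightarrow> complex"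
  assumes cont: "continuous_on (U \<times> UNIV) (\<lambda>(p, z). F p z)" and hol: "\<And>p. p \<in> U \<Longrightarrow> F p holomorphic_on UNIV"
  shows "continuous_on (U \<times> UNIV) (\<lambda>(p, z). deriv (F p) z)"
proof -
  have "continuous_on (U \<times> UNIV) (\<lambda>q. integral (cbox 0 1) (\<lambda>s. F (fst q) (snd q + exp (2 * of_real pi * \<i> * of_real s)) / exp (2 * of_real pi * \<i> * of_real s)))"
    apply (rule integral_continuous_on_param)
    unfolding split_beta
    apply (intro continuous_intros)
     apply (rule continuous_on_compose2[OF cont, of _ "\<lambda>x. (fst (fst x), snd (fst x) + exp (2 * of_real pi * \<i> * of_real (snd x)))", simplified split_beta fst_conv snd_conv])
      apply (intro continuous_intros)
    by auto
  thus ?thesis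
    by (rule continuous_on_eq) (use hol deriv_eq_integral in auto)
qed

text \<open>Cauchy's formula makes the partial derivatives continuous in all variables together.
  Then the usual argument for continuously differentiable functions applies: change one coordinate
  at a time and bound each increment by the mean value inequality. Limits and integrals of
  holomorphic functions are handled through this criterion.\<close>

lemma Osgood:
  fixes F :: "complex ^ 'g \<Rightarrow> complex"
  assumes cont: "continuous_on UNIV F"
    and hol: "\<And>w j. (\<lambda>z. F (w + z *s axis j 1)) holomorphic_on UNIV"
  shows "holo UNIV F"
proof -
  define p where "p j w = deriv (\<lambda>z. F (w + z *s axis j 1)) 0" for j w
  have cp: "continuous_on UNIV (p j)" for j
  proof -
    have "continuous_on (UNIV \<times> UNIV) (\<lambda>(w, z). F (w + z *s axis j 1))"
      unfolding split_beta
      by (rule continuous_on_compose2[OF cont]) (auto intro!: continuous_intros)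
    from continuous_on_deriv_param[OF this]
    have *: "continuous_on (UNIV \<times> UNIV) (\<lambda>(w, z). deriv (\<lambda>z. F (w + z *s axis j 1)) z)"
      using hol by auto
    show ?thesis unfolding p_def
      by (rule continuous_on_compose2[OF *, of UNIV "\<lambda>w. (w, 0)", simplified]) (auto intro!: continuous_intros)
  qed
  have dp: "((\<lambda>z. F (w + z *s axis j 1)) has_field_derivative p j (w + z *s axis j 1)) (at z)" for w j z
  proof -
    have "((\<lambda>u. F ((w + z *s axis j 1) + u *s axis j 1)) has_field_derivative p j (w + z *s axis j 1)) (at 0)"
      unfolding p_def using holomorphic_derivI[OF hol open_UNIV UNIV_I] by blast
    hence "((\<lambda>u. F (w + (z + u) *s axis j 1)) has_field_derivative p j (w + z *s axis j 1)) (at 0)"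
      by (simp add: vec.scale_left_distrib add.assoc)
    thus ?thesis using DERIV_shift[of "\<lambda>u. F (w + u *s axis j 1)" _ 0 z] by (simp add: add.commute)
  qed
  have "(F has_derivative (\<lambda>v. \<Sum>j\<in>UNIV. v $ j * p j w)) (at w)" for w
    unfolding has_derivative_at_alt
  proof (intro conjI allI impI)
    show "bounded_linear (\<lambda>v. \<Sum>j\<in>UNIV. v $ j * p j w)"
      by (intro bounded_linear_sum bounded_linear_mult_const) (simp add: bounded_linear_vec_nth)
    fix e :: real assume e: "e > 0"
    define e' where "e' = e / CARD('g)"
    have e': "e' > 0" using e by (simp add: e'_def)
    have "\<exists>d>0. \<forall>u. norm (u - w) < d \<longrightarrow> norm (p j u - p j w) < e'" for j
      using cp[of j] e' unfolding continuous_on_iff by (auto simp: dist_norm)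
    then obtain d where d: "\<And>j. d j > 0" "\<And>j u. norm (u - w) < d j \<Longrightarrow> norm (p j u - p j w) < e'"
      by metis
    define \<delta> where "\<delta> = Min (range d)"
    have \<delta>: "\<delta> > 0" "\<And>j. \<delta> \<le> d j" unfolding \<delta>_def using d(1) by (auto simp: Min_gr_iff)
    show "\<exists>d>0. \<forall>y. norm (y - w) < d \<longrightarrow> norm (F y - F w - (\<Sum>j\<in>UNIV. (y - w) $ j * p j w)) \<le> e * norm (y - w)"
    proof (intro exI[of _ \<delta>] conjI \<delta> allI impI)
      fix y assume y: "norm (y - w) < \<delta>"
      define v where "v = y - w"
      \<comment> \<open>The increment \<open>v\<close> truncated to the coordinates in
        \<open>J\<close>; the induction over \<open>J\<close> moves from \<open>w\<close> to
        \<open>w + v\<close> along coordinate directions.\<close>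
      define vJ where "vJ J = (\<Sum>j\<in>J. v $ j *s axis j (1::complex))" for J
      have vJ_nth: "vJ J $ i = (if i \<in> J then v $ i else 0)" if "finite J" for J i
        using that unfolding vJ_def by (simp add: axis_def if_distrib[of "\<lambda>x. _ * x"] sum.delta' cong: if_cong)
      have "norm (F (w + vJ J) - F w - (\<Sum>j\<in>J. v $ j * p j w)) \<le> (\<Sum>j\<in>J. e' * norm (v $ j))" if "finite J" for J
        using that
      proof (induction J)
        case empty thus ?case by (simp add: vJ_def)
      next
        case (insert k J)
        define \<phi> where "\<phi> z = F ((w + vJ J) + z *s axis k 1) - z * p k w" for z
        have ins: "vJ (insert k J) = vJ J + v $ k *s axis k 1"
          using insert by (simp add: vJ_def add.commute)
        have "norm (\<phi> (v $ k) - \<phi> 0) \<le> e' * norm (v $ k - 0)"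
        proof (rule field_differentiable_bound[where S = "cball 0 (norm (v $ k))"])
          fix z :: complex assume z: "z \<in> cball 0 (norm (v $ k))"
          show "(\<phi> has_field_derivative p k (w + vJ J + z *s axis k 1) - p k w) (at z within cball 0 (norm (v $ k)))"
            unfolding \<phi>_def
            by (rule has_field_derivative_at_within) (auto intro!: derivative_eq_intros dp)
          \<comment> \<open>As \<open>k\<close> is not in \<open>J\<close> and \<open>z\<close> is
            no longer than \<open>v $ k\<close>, every component is dominated by that of
            \<open>v\<close>; the path stays in the ball on which \<open>p k\<close> varies by less
            than \<open>e'\<close>.\<close>
          have "norm (vJ J + z *s axis k 1) \<le> norm v"
            by (rule norm_le_componentwise_cart)
               (use z insert in \<open>auto simp: vJ_nth axis_def\<close>)
          hence "norm ((w + vJ J + z *s axis k 1) - w) < d k"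
            using y \<delta>(2)[of k] by (simp add: v_def add.assoc)
          from d(2)[OF this] show "norm (p k (w + vJ J + z *s axis k 1) - p k w) \<le> e'" by simp
        qed auto
        moreover have eq: "F (w + vJ (insert k J)) - F w - (\<Sum>j\<in>insert k J. v $ j * p j w)
            = (F (w + vJ J) - F w - (\<Sum>j\<in>J. v $ j * p j w)) + (\<phi> (v $ k) - \<phi> 0)"
          using insert by (simp add: \<phi>_def ins add.assoc)
        moreover have "(\<Sum>j\<in>insert k J. e' * norm (v $ j)) = e' * norm (v $ k) + (\<Sum>j\<in>J. e' * norm (v $ j))"
          using insert by simp
        ultimately show ?case
          using insert.IH norm_triangle_ineq[of "F (w + vJ J) - F w - (\<Sum>j\<in>J. v $ j * p j w)" "\<phi> (v $ k) - \<phi> 0"]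
          unfolding eq by simp
      qed
      from this[of UNIV] have "norm (F (w + vJ UNIV) - F w - (\<Sum>j\<in>UNIV. v $ j * p j w)) \<le> (\<Sum>j\<in>UNIV. e' * norm (v $ j))"
        by simp
      also have "\<dots> \<le> (\<Sum>j\<in>(UNIV :: 'g set). e' * norm v)"
        by (intro sum_mono mult_left_mono) (use e' in \<open>auto simp: Finite_Cartesian_Product.norm_nth_le\<close>)
      also have "\<dots> = e * norm v" by (simp add: e'_def)
      also have "vJ UNIV = v" by (simp add: vec_eq_iff vJ_nth)
      finally show "norm (F y - F w - (\<Sum>j\<in>UNIV. (y - w) $ j * p j w)) \<le> e * norm (y - w)"
        by (simp add: v_def)
    qed
  qed
  thus ?thesis
    unfolding holo_def by (auto intro!: exI simp: sum_distrib_left mult.assoc)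
qed

text \<open>By \<open>Osgood\<close> it suffices that the limit is continuous and that the
  one-variable Weierstrass theorem holds on coordinate lines. The filter is arbitrary because
  Fourier series are summed along finite sets of frequencies.\<close>

lemma holo_uniform_limit:
  fixes f :: "'i \<Rightarrow> complex ^ 'g \<Rightarrow> complex"
  assumes ev: "eventually (\<lambda>n. holo UNIV (f n)) F" and F: "F \<noteq> bot"
    and lim: "\<And>R. uniform_limit (cball 0 R) f h F"
  shows "holo UNIV h"
proof (rule Osgood)
  have "continuous_on (cball 0 R) h" for R
    by (rule uniform_limit_theorem[OF _ lim F])
       (rule eventually_mono[OF ev], auto intro: holo_continuous_on holo_subset continuous_on_subset)
  hence "isCont h w" for w
    by (metis continuous_on_interior interior_cball in_interior_closure_convex_segment less_add_one mem_ball_0)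
  thus "continuous_on UNIV h" by (simp add: continuous_at_imp_continuous_on)
  fix w j
  have "(\<lambda>z. h (w + z *s axis j 1)) holomorphic_on ball 0 R" for R
  proof -
    have A: "uniform_limit (cball 0 R) (\<lambda>n z. f n (w + z *s axis j 1)) (\<lambda>z. h (w + z *s axis j 1)) F"
    proof (rule uniform_limit_compose'[OF lim])
      show "(\<lambda>z::complex. w + z *s axis j 1) \<in> cball 0 R \<rightarrow> cball 0 (norm w + R)"
        by (auto simp: norm_vec_scale intro!: order_trans[OF norm_triangle_ineq] add_mono)
    qed
    have B: "eventually (\<lambda>n. continuous_on (cball 0 R) (\<lambda>z. f n (w + z *s axis j 1)) \<and> (\<lambda>z. f n (w + z *s axis j 1)) holomorphic_on ball 0 R) F"
      by (rule eventually_mono[OF ev])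
         (auto dest!: holo_line[of _ _ w "axis j 1"] intro: holomorphic_on_subset holomorphic_on_imp_continuous_on continuous_on_subset)
    show ?thesis by (rule holomorphic_uniform_limit[OF B A F])
  qed
  hence "(\<lambda>z. h (w + z *s axis j 1)) holomorphic_on (\<Union>R. ball 0 R)"
    by (intro holomorphic_on_UN_open) auto
  moreover have "(\<Union>R. ball (0::complex) R) = UNIV"
    by (auto intro: less_add_one exI[of _ "_ + 1"] simp: ball_def)
  ultimately show "(\<lambda>z. h (w + z *s axis j 1)) holomorphic_on UNIV" by simp
qed

text \<open>Continuity under the integral sign and the Leibniz rule on each coordinate line,
  combined by \<open>Osgood\<close>.\<close>

lemma holo_integral:
  fixes G :: "complex ^ 'g \<Rightarrow> real \<Rightarrow> complex"
  assumes cont: "continuous_on (UNIV \<times> cbox a b) (\<lambda>(w, t). G w t)"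
    and hol: "\<And>t. t \<in> cbox a b \<Longrightarrow> holo UNIV (\<lambda>w. G w t)"
  shows "holo UNIV (\<lambda>w. integral (cbox a b) (G w))"
proof (rule Osgood)
  show "continuous_on UNIV (\<lambda>w. integral (cbox a b) (G w))"
    by (rule integral_continuous_on_param[OF cont])
  fix w j
  define g where "g z t = G (w + z *s axis j 1) t" for z t
  have hg: "(\<lambda>z. g z t) holomorphic_on UNIV" if "t \<in> cbox a b" for t
    unfolding g_def using holo_line[OF hol[OF that]] by simp
  have cg: "continuous_on (cbox a b \<times> UNIV) (\<lambda>(t, z). g z t)"
    unfolding split_beta g_def
    by (rule continuous_on_compose2[OF cont, of _ "\<lambda>x. (w + snd x *s axis j 1, fst x)", simplified split_beta fst_conv snd_conv])
       (auto intro!: continuous_intros)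
  have "continuous_on (cbox a b \<times> UNIV) (\<lambda>(t, z). deriv (\<lambda>z. g z t) z)"
    by (rule continuous_on_deriv_param[OF cg hg])
  hence c': "continuous_on (UNIV \<times> cbox a b) (\<lambda>(z, t). deriv (\<lambda>z. g z t) z)"
    unfolding split_beta
    using continuous_on_compose2[of "cbox a b \<times> UNIV" "\<lambda>q. deriv (\<lambda>z. g z (fst q)) (snd q)" "UNIV \<times> cbox a b" "\<lambda>x. (snd x, fst x)"]
      continuous_on_swap_args
    by (simp add: split_beta continuous_on_snd continuous_on_fst continuous_on_Pair image_subset_iff)
  have "(\<lambda>z. integral (cbox a b) (g z)) holomorphic_on UNIV"
  proof (rule leibniz_rule_holomorphic[OF _ _ c'])
    fix z t assume "t \<in> cbox a b"
    thus "((\<lambda>z. g z t) has_field_derivative deriv (\<lambda>z. g z t) z) (at z within UNIV)"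
      by (auto intro: holomorphic_derivI[OF hg])
  next
    fix z
    have "continuous_on (cbox a b) (g z)"
      by (rule continuous_on_compose2[OF cg, of _ "\<lambda>t. (t, z)", simplified]) (auto intro!: continuous_intros)
    thus "g z integrable_on cbox a b" by (rule integrable_continuous)
  qed auto
  thus "(\<lambda>z. integral (cbox a b) (G (w + z *s axis j 1))) holomorphic_on UNIV"
    by (simp add: g_def[abs_def])
qed

lemma holo_compose_affine:
  fixes f :: "complex ^ 'g \<Rightarrow> complex" and T :: "complex ^ 'h \<Rightarrow> complex ^ 'g"
  assumes f: "holo UNIV f" and T: "linear T" "\<And>c v. T (c *s v) = c *s T v"
  shows "holo UNIV (\<lambda>w. f (T w + b))"
  unfolding holo_def
proof
  fix w
  from holoE[OF f] obtain D where D: "(f has_derivative D) (at (T w + b))" "\<And>c v. D (c *s v) = c * D v"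
    by (metis UNIV_I)
  have "((\<lambda>w. T w + b) has_derivative T) (at w)"
    using T(1) by (auto intro!: derivative_eq_intros linear_imp_has_derivative)
  from has_derivative_compose[OF this, of f D] D(1)
  have "((\<lambda>w. f (T w + b)) has_derivative (\<lambda>v. D (T v))) (at w)" by simp
  thus "\<exists>D. ((\<lambda>w. f (T w + b)) has_derivative D) (at w within UNIV) \<and> (\<forall>c. \<forall>v\<in>UNIV. D (c *s v) = c * D v)"
    using D(2) T(2) by (intro exI[of _ "\<lambda>v. D (T v)"]) auto
qed

lemma linear_vec_scale: "linear (\<lambda>v::complex ^ 'g. c *s v)"
  by (rule linearI) (auto simp: vec_eq_iff algebra_simps)

text \<open>Contractibility gives a continuous logarithm. Near a point it stays within distance pi
  of its value there, so it is a constant plus the principal branch of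
  \<open>Ln (f u / f w)\<close>, which is differentiable at \<open>w\<close>.\<close>

lemma holo_log:
  fixes f :: "complex ^ 'g \<Rightarrow> complex"
  assumes f: "holo UNIV f" and nz: "\<And>w. f w \<noteq> 0"
  obtains g where "holo UNIV g" "\<And>w. f w = exp (g w)"
proof -
  have "contractible (UNIV :: (complex ^ 'g) set)" by (simp add: convex_imp_contractible)
  from continuous_logarithm_on_contractible[OF holo_continuous_on[OF f] this] nz
  obtain g where g: "continuous_on UNIV g" "\<And>w. f w = exp (g w)" by auto
  have "holo UNIV g"
    unfolding holo_def
  proof
    fix w
    have "isCont g w" using g(1) by (simp add: continuous_on_eq_continuous_at)
    hence "\<forall>\<^sub>F u in nhds w. dist (g u) (g w) < pi"
      using tendstoD[of g "g w" "nhds w" pi] by (simp add: isCont_def tendsto_at_iff_tendsto_nhds)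
    hence ev: "\<forall>\<^sub>F u in nhds w. g w + Ln (f u / f w) = g u"
    proof eventually_elim
      case (elim u)
      have "\<bar>Im (g u - g w)\<bar> < pi"
        using abs_Im_le_cmod[of "g u - g w"] elim by (simp add: dist_norm)
      hence "Ln (exp (g u - g w)) = g u - g w" by (intro Ln_exp) auto
      thus ?case by (simp add: g(2) exp_diff)
    qed
    have "holo UNIV (\<lambda>u. f u / f w)"
      by (rule holo_divide) (use f nz in auto)
    from holoE[OF this UNIV_I[of w]] obtain D where D: "((\<lambda>u. f u / f w) has_derivative D) (at w)" "\<And>c v. D (c *s v) = c * D v"
      by auto
    have "(Ln has_field_derivative inverse 1) (at 1)"
      by (rule has_field_derivative_Ln) simp
    hence "(Ln has_derivative (\<lambda>x. x)) (at (f w / f w))"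
      using nz by (simp add: has_field_derivative_def mult_1_left[abs_def])
    from has_derivative_compose[OF D(1) this]
    have "((\<lambda>u. g w + Ln (f u / f w)) has_derivative D) (at w)"
      by (auto intro!: derivative_eq_intros)
    hence "(g has_derivative D) (at w)"
      by (rule has_derivative_transform_eventually)
         (use ev eventually_nhds_x_imp_x[OF ev] in \<open>auto simp: eventually_at_filter elim: eventually_mono\<close>)
    thus "\<exists>D. (g has_derivative D) (at w within UNIV) \<and> (\<forall>c. \<forall>v\<in>UNIV. D (c *s v) = c * D v)"
      using D(2) by auto
  qed
  thus thesis using that g(2) by blast
qed

section \<open>Solving difference equations in entire functions\<close>

text \<open>The zeros of exp t - 1 are the even multiples of pi on the imaginary axis; the circle
  passes midway between two of them, and its radius grows linearly in \<open>n\<close>.\<close>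

definition guichard_radius :: "nat \<Rightarrow> real" where
  "guichard_radius n = (2 * real n + 1) * pi"

text \<open>If the real part of \<open>t\<close> has modulus at least 1, then the modulus of exp t
  is far from 1. Otherwise the modulus of the imaginary part lies within 1 of an odd multiple of pi,
  where exp t has real part at most 0.\<close>

lemma exp_minus_1_bound:
  fixes t :: complex
  assumes "norm t = guichard_radius n" shows "norm (exp t - 1) \<ge> 1 / 2"
proof -
  define R where "R = guichard_radius n"
  have R: "R \<ge> pi" "R = pi + of_int (int n) * (2 * pi)"
    by (auto simp: R_def guichard_radius_def algebra_simps)
  have e: "exp 1 \<ge> (2::real)" using exp_ge_add_one_self[of "1::real"] by simp
  consider "Re t \<ge> 1" | "Re t \<le> -1" | "\<bar>Re t\<bar> < 1" by linarith
  thus ?thesis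
  proof cases
    case 1
    have "exp (Re t) \<ge> exp 1" using 1 by simp
    moreover have "exp (Re t) - 1 \<le> norm (exp t - 1)"
      using norm_triangle_ineq2[of "exp t" 1] by simp
    ultimately show ?thesis using e by linarith
  next
    case 2
    have "exp (Re t) \<le> exp (-1)" using 2 by simp
    also have "\<dots> \<le> 1 / (2::real)" using e by (simp add: exp_minus field_simps)
    finally have "exp (Re t) \<le> 1 / 2" .
    moreover have "1 - exp (Re t) \<le> norm (exp t - 1)"
      using norm_triangle_ineq2[of 1 "exp t"] by (simp add: norm_minus_commute)
    ultimately show ?thesis by linarith
  next
    case 3
    define y where "y = \<bar>Im t\<bar>"
    have yR: "y\<^sup>2 = R\<^sup>2 - (Re t)\<^sup>2" using assms cmod_power2[of t] by (simp add: R_def y_def)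
    have Re2: "(Re t)\<^sup>2 \<le> 1" using 3 by (simp add: abs_square_le_1)
    have y0: "y \<ge> 0" "y \<le> R" using abs_Im_le_cmod[of t] assms by (auto simp: y_def R_def)
    have "(R - y) * (R + y) = (Re t)\<^sup>2" using yR by (simp add: power2_eq_square algebra_simps)
    moreover have "(R - y) * pi \<le> (R - y) * (R + y)"
      using y0 R by (intro mult_left_mono) auto
    ultimately have "(R - y) * pi \<le> 1" using Re2 by linarith
    moreover have "(R - y) * 1 \<le> (R - y) * pi" using y0 pi_ge_two by (intro mult_left_mono) auto
    ultimately have "(R - y) * 1 \<le> 1" by (rule order_trans[rotated])
    hence "R - y \<le> 1" by simp
    hence "0 \<le> cos (R - y)" using y0 pi_ge_two by (intro cos_ge_zero) auto
    moreover have "cos (R - y) = - cos y"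
    proof -
      have "cos (R - y) = cos ((pi - y) + of_int (int n) * (2 * pi))" by (simp add: R(2) algebra_simps)
      also have "\<dots> = cos (pi - y)"
        unfolding cos_add mult.commute[of "of_int _" "2 * pi"] cos_int_2pin sin_int_2pin by simp
      finally show ?thesis by simp
    qed
    ultimately have "cos (Im t) \<le> 0" by (simp add: y_def)
    hence "Re (exp t) \<le> 0" by (simp add: Re_exp mult_nonneg_nonpos)
    hence "1 \<le> \<bar>Re (exp t - 1)\<bar>" by simp
    thus ?thesis using abs_Re_le_cmod[of "exp t - 1"] by linarith
  qed
qed

text \<open>
  Entire solutions of \<open>\<beta>(z + 1) - \<beta>(z) = z\<^sup>n\<close>. The integral over the circle of radius \<open>(2n+1)\<pi>\<close> is the
  Bernoulli polynomial corrected by \<open>2n\<close> periodic terms; this keeps the growth in \<open>n\<close> geometric, so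
  that entire power series may be solved term by term.
\<close>

definition guichard_beta :: "nat \<Rightarrow> complex \<Rightarrow> complex" where
  "guichard_beta n z = fact n * integral (cbox 0 1)
     (\<lambda>s. exp (z * circlepath 0 (guichard_radius n) s) /
        ((exp (circlepath 0 (guichard_radius n) s) - 1) * circlepath 0 (guichard_radius n) s ^ n))"

context
  fixes n :: nat and t :: "real \<Rightarrow> complex"
  defines "t \<equiv> circlepath 0 (guichard_radius n)"
begin

lemma guichard_radius_pos: "guichard_radius n > 0"
  by (simp add: guichard_radius_def)

lemma norm_circle: "norm (t s) = guichard_radius n"
  using guichard_radius_pos by (simp add: t_def circlepath norm_mult)

lemma circle_nz: "t s \<noteq> 0" "exp (t s) \<noteq> 1"
  using norm_circle[of s] guichard_radius_pos exp_minus_1_bound[OF norm_circle[of s]] by auto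

lemma continuous_circle [continuous_intros]: "continuous_on S g \<Longrightarrow> continuous_on S (\<lambda>x. t (g x))"
  unfolding t_def circlepath by (intro continuous_intros)

lemma guichard_integrable:
  "(\<lambda>s. exp (z * t s) / ((exp (t s) - 1) * t s ^ n)) integrable_on cbox 0 1"
  by (intro integrable_continuous continuous_intros) (simp add: circle_nz)

lemma guichard_beta_holomorphic: "guichard_beta n holomorphic_on UNIV"
proof -
  have "(\<lambda>z. integral (cbox 0 1) (\<lambda>s. exp (z * t s) / ((exp (t s) - 1) * t s ^ n))) holomorphic_on UNIV"
  proof (rule leibniz_rule_holomorphic)
    show "((\<lambda>z. exp (z * t s) / ((exp (t s) - 1) * t s ^ n)) has_field_derivative
       t s * exp (z * t s) / ((exp (t s) - 1) * t s ^ n)) (at z within UNIV)" for z s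
      by (rule derivative_eq_intros refl)+ (use circle_nz[of s] in auto)
    show "continuous_on (UNIV \<times> cbox 0 1) (\<lambda>(z, s). t s * exp (z * t s) / ((exp (t s) - 1) * t s ^ n))"
      unfolding split_beta by (intro continuous_intros) (simp add: circle_nz)
  qed (use guichard_integrable in auto)
  thus ?thesis unfolding guichard_beta_def[abs_def] t_def
    by (intro holomorphic_intros)
qed

text \<open>On the circle \<open>t s ^ n\<close> has modulus \<open>guichard_radius n ^ n\<close>,
  which absorbs \<open>fact n\<close>; what is left grows only geometrically in \<open>n\<close> for
  bounded \<open>z\<close>.\<close>

lemma guichard_beta_bound: "norm (guichard_beta n z) \<le> 2 * exp (norm z * guichard_radius n)"
proof -
  have f: "fact n \<le> guichard_radius n ^ n"
  proof -
    have "fact n \<le> real (n ^ n)" using fact_le_power[of n, where 'a = real] by simp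
    also have "\<dots> \<le> guichard_radius n ^ n"
    proof -
      have "real n * 1 \<le> (2 * real n + 1) * pi" by (intro mult_mono) (use pi_ge_two in auto)
      thus ?thesis by (auto intro!: power_mono simp: guichard_radius_def)
    qed
    finally show ?thesis .
  qed
  have "norm (integral (cbox 0 1) (\<lambda>s. exp (z * t s) / ((exp (t s) - 1) * t s ^ n)))
      \<le> 2 * exp (norm z * guichard_radius n) / guichard_radius n ^ n * measure lborel (cbox 0 (1::real))"
  proof (rule integrable_bound)
    show "0 \<le> 2 * exp (norm z * guichard_radius n) / guichard_radius n ^ n"
      using guichard_radius_pos by simp
    fix s
    have "Re (z * t s) \<le> norm z * guichard_radius n"
      using complex_Re_le_cmod[of "z * t s"] by (simp add: norm_mult norm_circle)
    hence "norm (exp (z * t s)) \<le> exp (norm z * guichard_radius n)" by simp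
    hence "norm (exp (z * t s)) / norm (exp (t s) - 1) \<le> exp (norm z * guichard_radius n) / (1 / 2)"
      by (intro frac_le) (use exp_minus_1_bound[OF norm_circle[of s]] in auto)
    hence "norm (exp (z * t s)) / norm (exp (t s) - 1) / guichard_radius n ^ n
        \<le> exp (norm z * guichard_radius n) / (1 / 2) / guichard_radius n ^ n"
      by (rule divide_right_mono) (use guichard_radius_pos in auto)
    thus "norm (exp (z * t s) / ((exp (t s) - 1) * t s ^ n)) \<le> 2 * exp (norm z * guichard_radius n) / guichard_radius n ^ n"
      by (simp add: norm_divide norm_mult norm_power norm_circle mult.commute)
  qed (rule guichard_integrable)
  hence "norm (guichard_beta n z) \<le> fact n * (2 * exp (norm z * guichard_radius n) / guichard_radius n ^ n)"
    unfolding guichard_beta_def t_def[symmetric] norm_mult by (intro mult_mono) auto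
  also have "\<dots> = (fact n / guichard_radius n ^ n) * (2 * exp (norm z * guichard_radius n))" by simp
  also have "\<dots> \<le> 1 * (2 * exp (norm z * guichard_radius n))"
    by (intro mult_right_mono) (use f guichard_radius_pos in auto)
  finally show ?thesis by simp
qed

text \<open>Taking the difference cancels the factor exp t - 1, and Cauchy's formula evaluates the
  rest as the n-th derivative of exp (z u) at u = 0.\<close>

lemma guichard_beta_diff: "guichard_beta n (z + 1) - guichard_beta n z = z ^ n"
proof -
  have "guichard_beta n (z + 1) - guichard_beta n z
      = fact n * integral (cbox 0 1) (\<lambda>s. exp ((z + 1) * t s) / ((exp (t s) - 1) * t s ^ n) - exp (z * t s) / ((exp (t s) - 1) * t s ^ n))"
    unfolding guichard_beta_def t_def[symmetric]
    by (simp add: integral_diff guichard_integrable right_diff_distrib del: box_real)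
  also have "(\<lambda>s. exp ((z + 1) * t s) / ((exp (t s) - 1) * t s ^ n) - exp (z * t s) / ((exp (t s) - 1) * t s ^ n))
      = (\<lambda>s. exp (z * t s) / t s ^ n)"
  proof
    fix s
    have "exp ((z + 1) * t s) - exp (z * t s) = exp (z * t s) * (exp (t s) - 1)"
      by (simp add: distrib_right right_diff_distrib exp_add)
    thus "exp ((z + 1) * t s) / ((exp (t s) - 1) * t s ^ n) - exp (z * t s) / ((exp (t s) - 1) * t s ^ n) = exp (z * t s) / t s ^ n"
      using circle_nz[of s] by (simp flip: diff_divide_distrib)
  qed
  finally have 1: "guichard_beta n (z + 1) - guichard_beta n z = fact n * integral (cbox 0 1) (\<lambda>s. exp (z * t s) / t s ^ n)" .
  have "contour_integral t (\<lambda>u. exp (z * u) / (u - 0) ^ (Suc n)) = (2 * pi * \<i>) * (deriv ^^ n) (\<lambda>u. exp (z * u)) 0 / fact n"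
    unfolding t_def
    by (rule Cauchy_contour_integral_circlepath) (use guichard_radius_pos in \<open>auto intro!: continuous_intros holomorphic_intros\<close>)
  also have "(deriv ^^ n) (\<lambda>u. exp (z * u)) = (\<lambda>u. z ^ n * exp (z * u))" for n
  proof (induction n)
    case (Suc n)
    have "((\<lambda>u. z ^ n * exp (z * u)) has_field_derivative z ^ Suc n * exp (z * u)) (at u)" for u
      by (auto intro!: derivative_eq_intros)
    thus ?case by (auto simp: Suc.IH intro!: DERIV_imp_deriv)
  qed simp
  finally have 2: "contour_integral t (\<lambda>u. exp (z * u) / u ^ (Suc n)) = (2 * pi * \<i>) * z ^ n / fact n" by simp
  have "contour_integral t (\<lambda>u. exp (z * u) / u ^ (Suc n)) = integral {0..1} (\<lambda>s. exp (z * t s) / t s ^ Suc n * vector_derivative t (at s))"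
    by (rule contour_integral_integral)
  also have "\<dots> = integral {0..1} (\<lambda>s. (2 * pi * \<i>) * (exp (z * t s) / t s ^ n))"
  proof (intro integral_cong)
    fix s :: real
    have "vector_derivative t (at s) = 2 * pi * \<i> * t s"
      unfolding t_def by (subst vector_derivative_circlepath) (simp add: circlepath)
    thus "exp (z * t s) / t s ^ Suc n * vector_derivative t (at s) = (2 * pi * \<i>) * (exp (z * t s) / t s ^ n)"
      using circle_nz(1)[of s] by simp
  qed
  also have "\<dots> = (2 * pi * \<i>) * integral {0..1} (\<lambda>s. exp (z * t s) / t s ^ n)"
    by (rule integral_mult_right)
  finally have "(2 * pi * \<i>) * integral {0..1} (\<lambda>s. exp (z * t s) / t s ^ n) = (2 * pi * \<i>) * (z ^ n / fact n)"
    using 2 by simp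
  hence "integral {0..1} (\<lambda>s. exp (z * t s) / t s ^ n) = z ^ n / fact n"
    unfolding mult_cancel_left by simp
  thus ?thesis using 1 by simp
qed

end

text \<open>Expand \<open>G\<close> in powers of the j-th coordinate and replace each power by
  \<open>guichard_beta\<close>. The last clause, on periods whose j-th coordinate is 0, allows the
  coordinates to be treated one after another without destroying what has been achieved.\<close>

lemma guichard:
  fixes G :: "complex ^ 'g \<Rightarrow> complex"
  assumes G: "holo UNIV G"
  obtains h where "holo UNIV h" "\<And>w. h (w + axis j 1) - h w = G w"
    "\<And>v. v $ j = 0 \<Longrightarrow> (\<And>w. G (w + v) = G w) \<Longrightarrow> (\<And>w. h (w + v) = h w)"
proof -
  \<comment> \<open>\<open>w\<close> with its j-th coordinate replaced by \<open>u\<close>. The old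
    j-th coordinate is forgotten, so the Taylor coefficients \<open>a n\<close> below do not change
    under a shift by \<open>axis j 1\<close>.\<close>
  define rep where "rep w u = w + (u - w $ j) *s axis j (1::complex)" for w :: "complex ^ 'g" and u
  have rep_line: "rep w u = (w + (- (w $ j)) *s axis j 1) + u *s axis j 1" for w u
    by (simp add: rep_def vec.scale_left_diff_distrib)
  have rep_self: "rep w (w $ j) = w" for w by (simp add: rep_def)
  have rep_shift: "rep (w + axis j 1) u = rep w u" for w u
    by (simp add: rep_def vec_eq_iff axis_def)
  have hol_rep: "(\<lambda>u. G (rep w u)) holomorphic_on UNIV" for w
    unfolding rep_line by (rule holo_line) (use G in auto)
  have norm_rep: "norm (rep w u) \<le> 2 * norm w + norm u" for w u
  proof -
    have "norm (rep w u) \<le> norm w + norm ((u - w $ j) *s axis j (1::complex))"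
      unfolding rep_def by (rule norm_triangle_ineq)
    also have "\<dots> \<le> norm w + (norm u + norm (w $ j))"
      unfolding norm_vec_scale using norm_triangle_ineq4[of u "w $ j"] by (simp add: norm_axis_1)
    also have "\<dots> \<le> 2 * norm w + norm u" using Finite_Cartesian_Product.norm_nth_le[of w j] by simp
    finally show ?thesis .
  qed
  define a where "a n w = (deriv ^^ n) (\<lambda>u. G (rep w u)) 0 / fact n" for n w
  \<comment> \<open>The integral form gives holomorphic dependence on \<open>w\<close>, by
    \<open>holo_integral\<close>.\<close>
  have a_integral: "a n w = integral (cbox 0 1) (\<lambda>s. G (rep w (circlepath 0 1 s)) / circlepath 0 1 s ^ n)" for n w
  proof -
    have "contour_integral (circlepath 0 1) (\<lambda>u. G (rep w u) / (u - 0) ^ (Suc n)) = (2 * pi * \<i>) * (deriv ^^ n) (\<lambda>u. G (rep w u)) 0 / fact n"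
      by (rule Cauchy_contour_integral_circlepath)
         (use hol_rep in \<open>auto intro!: holomorphic_on_imp_continuous_on intro: holomorphic_on_subset\<close>)
    also have "contour_integral (circlepath 0 1) (\<lambda>u. G (rep w u) / (u - 0) ^ (Suc n)) =
        integral {0..1} (\<lambda>s. G (rep w (circlepath 0 1 s)) / (circlepath 0 1 s - 0) ^ Suc n * vector_derivative (circlepath 0 1) (at s))"
      by (rule contour_integral_integral)
    also have "\<dots> = integral {0..1} (\<lambda>s. (2 * pi * \<i>) * (G (rep w (circlepath 0 1 s)) / circlepath 0 1 s ^ n))"
      by (intro integral_cong, subst vector_derivative_circlepath) (simp add: circlepath)
    also have "\<dots> = (2 * pi * \<i>) * integral {0..1} (\<lambda>s. G (rep w (circlepath 0 1 s)) / circlepath 0 1 s ^ n)"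
      by (rule integral_mult_right)
    finally have "(2 * pi * \<i>) * integral {0..1} (\<lambda>s. G (rep w (circlepath 0 1 s)) / circlepath 0 1 s ^ n) = (2 * pi * \<i>) * a n w"
      by (simp add: a_def)
    thus ?thesis by simp
  qed
  have holo_a: "holo UNIV (a n)" for n
  proof -
    have "holo UNIV (\<lambda>w. integral (cbox 0 1) (\<lambda>s. G (rep w (circlepath 0 1 s)) / circlepath 0 1 s ^ n))"
    proof (rule holo_integral)
      show "continuous_on (UNIV \<times> cbox 0 1) (\<lambda>(w, s). G (rep w (circlepath 0 1 s)) / circlepath 0 1 s ^ n)"
        unfolding split_beta circlepath rep_def
        by (intro continuous_intros continuous_on_compose2[OF holo_continuous_on[OF G]]) auto
      fix s :: real
      have "holo UNIV (\<lambda>w. G ((w + (- (w $ j)) *s axis j 1) + circlepath 0 1 s *s axis j 1))"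
        by (rule holo_compose_affine[OF G, of "\<lambda>w. w + (- (w $ j)) *s axis j 1"])
           (auto intro!: linearI simp: vec_eq_iff algebra_simps)
      thus "holo UNIV (\<lambda>w. G (rep w (circlepath 0 1 s)) / circlepath 0 1 s ^ n)"
        unfolding rep_line by (intro holo_divide) (auto simp: circlepath)
    qed
    thus ?thesis using a_integral by presburger
  qed
  define T where "T n w = a n w * guichard_beta n (w $ j)" for n w
  have holo_T: "holo UNIV (T n)" for n
  proof -
    have "holo UNIV (\<lambda>w::complex ^ 'g. guichard_beta n (w $ j))"
      by (rule holo_compose_field[OF holo_component]) (auto intro: holomorphic_derivI[OF guichard_beta_holomorphic])
    thus ?thesis unfolding T_def by (intro holo_mult holo_a)
  qed
  have bound: "\<exists>C. \<forall>n. \<forall>w\<in>cball 0 R. norm (T n w) \<le> C * (1/2) ^ n" if "R \<ge> 0" for R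
  proof -
    \<comment> \<open>Cauchy's inequality on the circle of radius \<open>r\<close> puts
      \<open>r ^ n\<close> into the denominator, while \<open>guichard_beta\<close> contributes the
      n-th power of exp (2 pi R); taking \<open>r\<close> twice as large as the latter leaves the
      ratio 1/2.\<close>
    define r where "r = 2 * exp (2 * pi * R)"
    have r: "r > 0" by (simp add: r_def)
    have "compact (G ` cball 0 (2 * R + r))"
      by (rule compact_continuous_image) (auto intro: continuous_on_subset[OF holo_continuous_on[OF G]])
    then obtain M where M: "\<And>w. norm w \<le> 2 * R + r \<Longrightarrow> norm (G w) \<le> M" "M > 0"
      by (metis bounded_pos compact_imp_bounded imageI mem_cball_0)
    have "norm (T n w) \<le> (2 * M * exp (pi * R)) * (1/2) ^ n" if w: "norm w \<le> R" for n w
    proof -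
      have "norm ((deriv ^^ n) (\<lambda>u. G (rep w u)) 0) \<le> fact n * M / r ^ n"
      proof (rule Cauchy_inequality)
        fix u :: complex assume "norm (0 - u) = r"
        thus "norm (G (rep w u)) \<le> M" using norm_rep[of w u] w by (intro M(1)) auto
      qed (use hol_rep r in \<open>auto intro: holomorphic_on_imp_continuous_on holomorphic_on_subset continuous_on_subset\<close>)
      hence an: "norm (a n w) \<le> M / r ^ n" by (simp add: a_def norm_divide field_simps)
      have "norm (w $ j) \<le> R" using Finite_Cartesian_Product.norm_nth_le[of w j] w by linarith
      hence "norm (w $ j) * guichard_radius n \<le> R * guichard_radius n"
        by (intro mult_right_mono) (auto simp: guichard_radius_def)
      hence "exp (norm (w $ j) * guichard_radius n) \<le> exp (R * guichard_radius n)" by simp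
      with guichard_beta_bound[of n "w $ j"]
      have "norm (guichard_beta n (w $ j)) \<le> 2 * exp (R * guichard_radius n)" by linarith
      hence "norm (T n w) \<le> (M / r ^ n) * (2 * exp (R * guichard_radius n))"
        unfolding T_def norm_mult using an M(2) r by (intro mult_mono) auto
      also have "exp (R * guichard_radius n) = exp (pi * R) * exp (2 * pi * R) ^ n"
        by (simp add: guichard_radius_def algebra_simps exp_add flip: exp_of_nat_mult)
      also have "M / r ^ n * (2 * (exp (pi * R) * exp (2 * pi * R) ^ n)) = (2 * M * exp (pi * R)) * (exp (2 * pi * R) / r) ^ n"
        by (simp add: power_divide)
      also have "exp (2 * pi * R) / r = 1 / 2" by (simp add: r_def)
      finally show ?thesis .
    qed
    thus ?thesis by (intro exI[of _ "2 * M * exp (pi * R)"]) auto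
  qed
  define h where "h w = (\<Sum>n. T n w)" for w
  have holo_h: "holo UNIV h"
  proof (rule holo_uniform_limit[of "\<lambda>N w. \<Sum>n<N. T n w" sequentially])
    show "\<forall>\<^sub>F N in sequentially. holo UNIV (\<lambda>w. \<Sum>n<N. T n w)"
      by (intro always_eventually allI holo_sum holo_T)
    fix R :: real
    obtain C where C: "\<And>n w. w \<in> cball 0 \<bar>R\<bar> \<Longrightarrow> norm (T n w) \<le> C * (1/2) ^ n"
      using bound[of "\<bar>R\<bar>"] by (meson abs_ge_zero)
    have "uniform_limit (cball 0 \<bar>R\<bar>) (\<lambda>N w. \<Sum>n<N. T n w) h sequentially"
      unfolding h_def by (rule Weierstrass_m_test[OF C]) (auto intro!: summable_mult summable_geometric)
    thus "uniform_limit (cball 0 R) (\<lambda>N w. \<Sum>n<N. T n w) h sequentially"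
      by (rule uniform_limit_on_subset) auto
  qed simp
  have summ: "summable (\<lambda>n. T n w)" for w
  proof -
    obtain C where C: "\<And>n. norm (T n w) \<le> C * (1/2) ^ n"
      using bound[of "norm w"] by (meson mem_cball_0 norm_ge_zero order_refl)
    show ?thesis by (rule summable_comparison_test'[OF summable_mult[OF summable_geometric] C]) auto
  qed
  have a_shift: "a n (w + axis j 1) = a n w" for n w by (simp add: a_def rep_shift)
  show thesis
  proof (rule that[OF holo_h])
    fix w
    have "(\<lambda>n. T n (w + axis j 1) - T n w) sums (h (w + axis j 1) - h w)"
      unfolding h_def by (intro sums_diff summable_sums summ)
    moreover have "T n (w + axis j 1) - T n w = a n w * (w $ j) ^ n" for n
      using guichard_beta_diff[of n "w $ j"] by (simp add: T_def a_shift flip: right_diff_distrib)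
    moreover have "(\<lambda>n. (deriv ^^ n) (\<lambda>u. G (rep w u)) 0 / fact n * (w $ j - 0) ^ n) sums G (rep w (w $ j))"
      by (rule holomorphic_power_series[of _ _ "norm (w $ j) + 1"]) (use hol_rep in \<open>auto intro: holomorphic_on_subset\<close>)
    ultimately show "h (w + axis j 1) - h w = G w"
      using sums_unique2 by (fastforce simp: rep_self a_def)
  next
    fix v w assume v: "v $ j = 0" "\<And>w. G (w + v) = G w"
    have "rep (w + v) u = rep w u + v" for w u using v(1) by (simp add: rep_def)
    hence "a n (w + v) = a n w" for n w by (simp add: a_def v(2))
    thus "h (w + v) = h w" by (simp add: h_def T_def v(1))
  qed
qed

definition ce :: "complex \<Rightarrow> complex" where "ce z = exp (2 * of_real pi * \<i> * z)"

lemma ce_add: "ce (x + y) = ce x * ce y"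
  by (simp add: ce_def distrib_left exp_add)

lemma ce_diff: "ce (x - y) = ce x / ce y"
  by (simp add: ce_def right_diff_distrib exp_diff)

lemma ce_0 [simp]: "ce 0 = 1" by (simp add: ce_def)

lemma ce_nz [simp]: "ce z \<noteq> 0" by (simp add: ce_def)

lemma ce_eq_1_iff: "ce z = 1 \<longleftrightarrow> z \<in> \<int>" unfolding ce_def by (rule exp_2pi_eq_1_iff)

lemma ce_Ints [simp]: "z \<in> \<int> \<Longrightarrow> ce z = 1" by (simp add: ce_eq_1_iff)

lemma ce_eq_iff: "ce x = ce y \<longleftrightarrow> x - y \<in> \<int>"
  using ce_eq_1_iff[of "x - y"] by (simp add: ce_diff)

lemma norm_ce: "norm (ce z) = exp (- (2 * pi * Im z))"
  by (simp add: ce_def)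

lemma continuous_on_ce [continuous_intros]: "continuous_on S f \<Longrightarrow> continuous_on S (\<lambda>x. ce (f x))"
  unfolding ce_def by (intro continuous_intros)

lemma has_field_derivative_ce: "(ce has_field_derivative 2 * of_real pi * \<i> * ce z) (at z)"
  unfolding ce_def by (auto intro!: derivative_eq_intros)

lemma holomorphic_on_ce [holomorphic_intros]: "f holomorphic_on S \<Longrightarrow> (\<lambda>x. ce (f x)) holomorphic_on S"
  unfolding ce_def by (intro holomorphic_intros)

lemma holo_ce [intro]: "holo V f \<Longrightarrow> holo V (\<lambda>w. ce (f w))"
  unfolding ce_def by (intro holo_exp holo_mult holo_const)

section \<open>Fourier expansion of periodic entire functions\<close>

lemma entire_primitive:
  assumes "f holomorphic_on UNIV"
  obtains \<Phi> where "\<And>z. (\<Phi> has_field_derivative f z) (at z)"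
  using holomorphic_convex_primitive'[of UNIV f] assms by auto

lemma integral_line:
  fixes f \<Phi> :: "complex \<Rightarrow> complex"
  assumes "\<And>z. (\<Phi> has_field_derivative f z) (at z)" and "a \<le> b"
  shows "((\<lambda>t. f (s + of_real t)) has_integral \<Phi> (s + of_real b) - \<Phi> (s + of_real a)) {a..b}"
proof (rule fundamental_theorem_of_calculus[OF assms(2), of "\<lambda>t. \<Phi> (s + of_real t)"])
  fix t
  have "((\<lambda>z. \<Phi> (s + z)) has_field_derivative f (s + of_real t) * (0 + 1)) (at (of_real t))"
    by (rule DERIV_chain2[of \<Phi>]) (auto intro!: assms(1) derivative_eq_intros)
  thus "((\<lambda>t. \<Phi> (s + of_real t)) has_vector_derivative f (s + of_real t)) (at t within {a..b})"
    using has_vector_derivative_real_field by fastforce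
qed

lemma periodic_primitive:
  assumes f: "f holomorphic_on UNIV" "\<And>z. f (z + 1) = f z"
  obtains \<Phi> K where "\<And>z. (\<Phi> has_field_derivative f z) (at z)" "\<And>z. \<Phi> (z + 1) - \<Phi> z = K"
proof -
  obtain \<Phi> where \<Phi>: "\<And>z. (\<Phi> has_field_derivative f z) (at z)"
    using entire_primitive[OF f(1)] by blast
  have "((\<lambda>z. \<Phi> (z + 1) - \<Phi> z) has_field_derivative 0) (at z)" for z
    using DERIV_diff[OF DERIV_shift[THEN iffD1, OF \<Phi>[of "z + 1"]] \<Phi>[of z]] f(2) by simp
  then obtain K where "\<And>z. \<Phi> (z + 1) - \<Phi> z = K"
    using has_field_derivative_zero_constant[of UNIV "\<lambda>z. \<Phi> (z + 1) - \<Phi> z"] by auto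
  thus thesis using that \<Phi> by blast
qed

text \<open>All these integrals are increments of one primitive over an interval of length 1, and
  this increment does not depend on the starting point.\<close>

lemma periodic_integral_shift:
  assumes f: "f holomorphic_on UNIV" "\<And>z. f (z + 1) = f z"
  shows "integral {0..1} (\<lambda>t. f (s + of_real t)) = integral {0..1} (\<lambda>t. f (of_real t))"
    "integral {-1/2..1/2} (\<lambda>t. f (of_real t)) = integral {0..1} (\<lambda>t. f (of_real t))"
proof -
  obtain \<Phi> K where \<Phi>: "\<And>z. (\<Phi> has_field_derivative f z) (at z)" "\<And>z. \<Phi> (z + 1) - \<Phi> z = K"
    using periodic_primitive[OF f] by blast
  have "integral {0..1} (\<lambda>t. f (s + of_real t)) = K" for s
    using integral_unique[OF integral_line[OF \<Phi>(1), of 0 1 s]] \<Phi>(2)[of s] by simp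
  from this[of s] this[of 0] show "integral {0..1} (\<lambda>t. f (s + of_real t)) = integral {0..1} (\<lambda>t. f (of_real t))"
    by simp
  have "integral {-1/2..1/2} (\<lambda>t. f (of_real t)) = K"
    using integral_unique[OF integral_line[OF \<Phi>(1), of "-1/2" "1/2" 0]] \<Phi>(2)[of "-1/2"] by simp
  with \<open>\<And>s. integral {0..1} (\<lambda>t. f (s + of_real t)) = K\<close>[of 0]
  show "integral {-1/2..1/2} (\<lambda>t. f (of_real t)) = integral {0..1} (\<lambda>t. f (of_real t))" by simp
qed

lemma int_multiples_bounded_imp_0:
  fixes c :: complex
  assumes "\<And>n::nat. norm (of_nat n * c) \<le> M" shows "c = 0"
proof (rule ccontr)
  assume "c \<noteq> 0"
  then obtain n :: nat where "M < of_nat n * norm c" using reals_Archimedean3[of "norm c"] by auto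
  with assms[of n] show False by (simp add: norm_mult)
qed

text \<open>
  Chernoff's proof: \<open>f - f 0\<close> is divisible by \<open>ce - 1\<close>, so the Fourier coefficients of the quotient
  \<open>q\<close> telescope; they tend to 0 by partial integration.
\<close>

lemma fourier_unique:
  assumes f: "f holomorphic_on UNIV" "\<And>z. f (z + 1) = f z"
    and coeff: "\<And>n::int. integral {0..1} (\<lambda>t. f (of_real t) * ce (- (of_int n * of_real t))) = 0"
  shows "f 0 = 0"
proof -
  \<comment> \<open>\<open>A\<close> and \<open>B\<close> are difference quotients with the
    singularity at 0 removed; \<open>B\<close> has no zero in the unit disc, where alone
    \<open>q\<close> is used.\<close>
  define A where "A = (\<lambda>z. if z = 0 then deriv f 0 else (f z - f 0) / (z - 0))"
  define B where "B = (\<lambda>z. if z = 0 then deriv ce 0 else (ce z - ce 0) / (z - 0))"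
  have hA: "A holomorphic_on UNIV" unfolding A_def by (rule pole_lemma_open) (use f in auto)
  have hB: "B holomorphic_on UNIV" unfolding B_def by (rule pole_lemma_open) (auto intro: holomorphic_intros)
  have Bnz: "B z \<noteq> 0" if "norm z < 1" for z
  proof (cases "z = 0")
    case True
    thus ?thesis using DERIV_imp_deriv[OF has_field_derivative_ce[of 0]] by (simp add: B_def)
  next
    case False
    have "z \<notin> \<int>" using that False by (auto simp: Ints_def)
    thus ?thesis using False by (simp add: B_def ce_eq_1_iff)
  qed
  define q where "q z = A z / B z" for z
  have hq: "q holomorphic_on ball 0 1" unfolding q_def
    by (intro holomorphic_on_divide) (use hA hB Bnz in \<open>auto intro: holomorphic_on_subset\<close>)
  have fq: "f z - f 0 = q z * (ce z - 1)" if "norm z < 1" for z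
  proof (cases "z = 0")
    case False
    have "A z * z = f z - f 0" "B z * z = ce z - 1" using False by (auto simp: A_def B_def)
    thus ?thesis using Bnz[OF that] by (metis q_def mult.assoc nonzero_eq_divide_eq)
  qed simp
  define c where "c n = integral {-1/2..1/2} (\<lambda>t. q (of_real t) * ce (- (of_int n * of_real t)))" for n :: int
  let ?I = "{-1/2..1/2} :: real set"
  have inb: "complex_of_real t \<in> ball 0 1" if "t \<in> ?I" for t using that by auto
  have contq: "continuous_on ?I (\<lambda>t. q (of_real t))"
    by (rule continuous_on_compose2[OF holomorphic_on_imp_continuous_on[OF hq]])
       (use inb in \<open>auto intro!: continuous_intros\<close>)
  have int_q: "(\<lambda>t. q (of_real t) * ce (- (of_int n * of_real t))) integrable_on ?I" for n :: int
    by (intro integrable_continuous_real continuous_intros contq)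
  \<comment> \<open>The interval is centred at 0 to stay inside the unit disc. Equal values of
    \<open>q\<close> at its ends make the boundary terms of the partial integration vanish.\<close>
  have qhalf: "q (1/2) = q (-1/2)"
  proof -
    have 1: "ce (1/2) = ce (-1/2)" by (simp add: ce_eq_iff)
    have "(f (1/2) - f 0) = q (1/2) * (ce (1/2) - 1)" by (rule fq) auto
    moreover have "(f (-1/2) - f 0) = q (-1/2) * (ce (-1/2) - 1)" by (rule fq) auto
    moreover have "f (1/2) = f (-1/2)" using f(2)[of "-1/2"] by simp
    moreover have "ce (1/2) \<noteq> 1"
    proof
      assume "ce (1/2) = 1"
      then obtain m :: int where "(1/2 :: complex) = of_int m" by (auto simp: ce_eq_1_iff Ints_def)
      hence "of_int (2 * m) = (1::complex)" by (simp flip: \<open>1 / 2 = of_int m\<close>)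
      hence "2 * m = 1" by (simp only: of_int_eq_1_iff)
      thus False by presburger
    qed
    ultimately show ?thesis using 1 by auto
  qed
  have "compact ((\<lambda>t. deriv q (of_real t)) ` ?I)"
    by (intro compact_continuous_image continuous_on_compose2[OF holomorphic_on_imp_continuous_on[OF holomorphic_deriv[OF hq]]])
       (use inb in \<open>auto intro!: continuous_intros\<close>)
  from compact_imp_bounded[OF this] obtain M
    where "\<forall>x\<in>(\<lambda>t. deriv q (complex_of_real t)) ` ?I. norm x \<le> M"
    unfolding bounded_iff by blast
  hence M: "\<And>t. t \<in> ?I \<Longrightarrow> norm (deriv q (of_real t)) \<le> M" by blast
  have decay: "norm (of_int n * c n) \<le> M / (2 * pi)" for n :: int
  proof -
    let ?g = "\<lambda>z. q z * ce (- (of_int n * z))"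
    let ?g' = "\<lambda>z. deriv q z * ce (- (of_int n * z)) - 2 * of_real pi * \<i> * of_int n * (q z * ce (- (of_int n * z)))"
    have "((\<lambda>t. ?g' (of_real t)) has_integral (?g (of_real (1/2)) - ?g (of_real (-1/2)))) ?I"
    proof (rule fundamental_theorem_of_calculus)
      fix t assume t: "t \<in> ?I"
      have "(q has_field_derivative deriv q (of_real t)) (at (of_real t))"
        using hq inb[OF t] by (intro holomorphic_derivI[of q "ball 0 1"]) auto
      hence "(?g has_field_derivative ?g' (of_real t)) (at (of_real t))"
        unfolding ce_def by (auto intro!: derivative_eq_intros)
      thus "((\<lambda>t. ?g (of_real t)) has_vector_derivative ?g' (of_real t)) (at t within ?I)"
        using has_vector_derivative_real_field has_vector_derivative_at_within by blast
    qed simp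
    moreover have "?g (of_real (1/2)) - ?g (of_real (-1/2)) = 0"
    proof -
      have "ce (- (of_int n * (1/2))) = ce (- (of_int n * (-1/2)))"
        unfolding ce_eq_iff by simp
      thus ?thesis using qhalf by simp
    qed
    ultimately have I0: "integral ?I (\<lambda>t. ?g' (of_real t)) = 0" by (simp add: integral_unique)
    have int_dq: "(\<lambda>t. deriv q (of_real t) * ce (- (of_int n * of_real t))) integrable_on ?I"
      by (intro integrable_continuous_real continuous_intros
          continuous_on_compose2[OF holomorphic_on_imp_continuous_on[OF holomorphic_deriv[OF hq]]])
         (use inb in auto)
    have "integral ?I (\<lambda>t. ?g' (of_real t)) = integral ?I (\<lambda>t. deriv q (of_real t) * ce (- (of_int n * of_real t)))
        - 2 * of_real pi * \<i> * of_int n * c n"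
      unfolding c_def by (subst integral_diff[OF int_dq integrable_on_mult_right[OF int_q]]) simp
    with I0 have eq: "2 * of_real pi * \<i> * (of_int n * c n) = integral ?I (\<lambda>t. deriv q (of_real t) * ce (- (of_int n * of_real t)))"
      by simp
    have "norm (integral ?I (\<lambda>t. deriv q (of_real t) * ce (- (of_int n * of_real t)))) \<le> M * (1/2 - (-1/2))"
    proof (rule integral_bound)
      show "continuous_on ?I (\<lambda>t. deriv q (of_real t) * ce (- (of_int n * of_real t)))"
        by (intro continuous_intros
          continuous_on_compose2[OF holomorphic_on_imp_continuous_on[OF holomorphic_deriv[OF hq]]])
         (use inb in auto)
      fix t assume "t \<in> ?I"
      from M[OF this] show "norm (deriv q (of_real t) * ce (- (of_int n * of_real t))) \<le> M"
        by (simp add: norm_mult norm_ce)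
    qed simp
    hence "norm (2 * of_real pi * \<i> * (of_int n * c n)) \<le> M" unfolding eq by simp
    hence "2 * pi * norm (of_int n * c n) \<le> M" by (simp add: norm_mult mult.assoc)
    thus ?thesis by (simp add: field_simps)
  qed
  \<comment> \<open>Multiplication by \<open>ce z - 1\<close> turns the coefficients of
    \<open>q\<close> into differences of neighbours; the constant \<open>f 0\<close> is seen by the
    frequency 0 only.\<close>
  have step: "c (n - 1) - c n = (if n = 0 then - f 0 else 0)" for n :: int
  proof -
    have "((\<lambda>t. ce (- (of_int n * of_real t))) has_integral (if n = 0 then 1 else 0)) {0..1}"
    proof (cases "n = 0")
      case False
      have "((\<lambda>z. ce (- (of_int n * z)) / (- 2 * of_real pi * \<i> * of_int n)) has_field_derivative ce (- (of_int n * z))) (at z)" for z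
        unfolding ce_def using False by (auto intro!: derivative_eq_intros)
      from integral_line[OF this, of 0 1 0] show ?thesis using False by simp
    qed (use has_integral_const_real[of "1::complex" 0 1] in simp)
    hence e0: "integral {0..1} (\<lambda>t. ce (- (of_int n * of_real t))) = (if n = 0 then 1 else 0)"
      by (rule integral_unique)
    define F where "F z = (f z - f 0) * ce (- (of_int n * z))" for z
    have F: "F holomorphic_on UNIV" unfolding F_def by (intro holomorphic_intros f)
    have Fp: "F (z + 1) = F z" for z
    proof -
      have "ce (- (of_int n * (z + 1))) = ce (- (of_int n * z))" unfolding ce_eq_iff by (simp add: algebra_simps)
      thus ?thesis by (simp add: F_def f(2))
    qed
    have "integral ?I (\<lambda>t. F (of_real t)) = integral {0..1} (\<lambda>t. F (of_real t))"
      by (rule periodic_integral_shift(2)) (use F Fp in auto)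
    also have "\<dots> = integral {0..1} (\<lambda>t. f (of_real t) * ce (- (of_int n * of_real t))) - integral {0..1} (\<lambda>t. f 0 * ce (- (of_int n * of_real t)))"
      unfolding F_def left_diff_distrib
      by (rule integral_diff)
         (auto intro!: integrable_continuous_real continuous_intros continuous_on_compose2[OF holomorphic_on_imp_continuous_on[OF f(1)]])
    also have "integral {0..1} (\<lambda>t. f 0 * ce (- (of_int n * of_real t))) = f 0 * (if n = 0 then 1 else 0)"
      by (simp only: integral_mult_right e0)
    finally have 1: "integral ?I (\<lambda>t. F (of_real t)) = (if n = 0 then - f 0 else 0)" using coeff by simp
    have "integral ?I (\<lambda>t. F (of_real t)) = integral ?I (\<lambda>t. q (of_real t) * ce (- (of_int (n - 1) * of_real t)) - q (of_real t) * ce (- (of_int n * of_real t)))"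
    proof (rule integral_cong)
      fix t assume "t \<in> ?I"
      hence eq: "f (of_real t) - f 0 = q (of_real t) * (ce (of_real t) - 1)" by (intro fq) auto
      have "ce (- (of_int (n - 1) * of_real t)) = ce (of_real t) * ce (- (of_int n * of_real t))"
        by (simp add: algebra_simps flip: ce_add)
      thus "F (of_real t) = q (of_real t) * ce (- (of_int (n - 1) * of_real t)) - q (of_real t) * ce (- (of_int n * of_real t))"
        unfolding F_def eq by (simp add: algebra_simps)
    qed
    also have "\<dots> = c (n - 1) - c n" unfolding c_def by (rule integral_diff[OF int_q int_q])
    finally show ?thesis using 1 by simp
  qed
  \<comment> \<open>The sequence is constant on either side of the gap between -1 and 0. Decay
    forces both constants to be 0, and then so is the jump \<open>- f 0\<close>.\<close>
  have pos: "c (int n) = c 0" for n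
    by (induction n) (use step[of "1 + int n" for n] in \<open>auto simp: algebra_simps\<close>)
  have neg: "c (- 1 - int n) = c (- 1)" for n
  proof (induction n)
    case (Suc n)
    thus ?case using step[of "- 1 - int n"] by (simp add: algebra_simps)
  qed simp
  have "c 0 = 0"
    by (rule int_multiples_bounded_imp_0[of _ "M / (2 * pi)"]) (use decay[of "int n" for n] pos in simp)
  moreover have "c (- 1) = 0"
  proof (rule int_multiples_bounded_imp_0[of _ "M / (2 * pi) + norm (c (- 1))"])
    fix n
    have "norm (of_nat n * c (- 1)) = norm (of_int (- 1 - int n) * c (- 1 - int n) + c (- 1))"
      unfolding neg by (simp add: algebra_simps norm_minus_commute)
    also have "\<dots> \<le> norm (of_int (- 1 - int n) * c (- 1 - int n)) + norm (c (- 1))"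
      by (rule norm_triangle_ineq)
    also have "\<dots> \<le> M / (2 * pi) + norm (c (- 1))" using decay[of "- 1 - int n"] by (intro add_right_mono)
    finally show "norm (of_nat n * c (- 1)) \<le> M / (2 * pi) + norm (c (- 1))" .
  qed
  ultimately show ?thesis using step[of 0] by simp
qed

abbreviation ax :: "'g \<Rightarrow> complex ^ 'g" where "ax j \<equiv> axis j 1"

text \<open>
  The component of \<open>F\<close> with frequency \<open>n\<close> in the direction of the \<open>j\<close>-th coordinate. Iterating over
  all coordinates gives the terms of the Fourier series of \<open>F\<close>, as functions rather than as numbers;
  so all translation properties are immediate.
\<close>

definition four1 :: "'g \<Rightarrow> int \<Rightarrow> (complex ^ 'g \<Rightarrow> complex) \<Rightarrow> complex ^ 'g \<Rightarrow> complex" where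
  "four1 j n F w = integral {0..1} (\<lambda>t. F (w + of_real t *s ax j) * ce (- (of_int n * of_real t)))"

fun four :: "'g list \<Rightarrow> ('g \<Rightarrow> int) \<Rightarrow> (complex ^ 'g \<Rightarrow> complex) \<Rightarrow> complex ^ 'g \<Rightarrow> complex" where
  "four [] k F = F"
| "four (j # js) k F = four1 j (k j) (four js k F)"

lemma four1_integrable:
  assumes "holo UNIV F"
  shows "(\<lambda>t. F (w + of_real t *s ax j) * ce (- (of_int n * of_real t))) integrable_on {a..b}"
  by (intro integrable_continuous_real continuous_intros continuous_on_compose2[OF holo_continuous_on[OF assms]]) auto

lemma holo_shift: "holo UNIV F \<Longrightarrow> holo UNIV (\<lambda>w. F (w + v))"
  by (rule holo_translate) auto

lemma holo_four1: assumes "holo UNIV F" shows "holo UNIV (four1 j n F)"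
proof -
  have "holo UNIV (\<lambda>w. integral (cbox 0 1) (\<lambda>t. F (w + of_real t *s ax j) * ce (- (of_int n * of_real t))))"
  proof (rule holo_integral)
    show "continuous_on (UNIV \<times> cbox 0 1) (\<lambda>(w, t). F (w + of_real t *s ax j) * ce (- (of_int n * of_real t)))"
      unfolding split_beta
    proof (rule continuous_on_mult)
      show "continuous_on (UNIV \<times> cbox 0 1) (\<lambda>x. F (fst x + of_real (snd x) *s ax j))"
        by (rule continuous_on_compose2[OF holo_continuous_on[OF assms]])
           (rule continuous_intros | simp)+
      show "continuous_on (UNIV \<times> cbox 0 1) (\<lambda>x. ce (- (of_int n * of_real (snd x))))"
        by (rule continuous_intros | simp)+
    qed
    show "holo UNIV (\<lambda>w. F (w + of_real t *s ax j) * ce (- (of_int n * of_real t)))" for t :: real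
      by (rule holo_mult[OF holo_shift[OF assms] holo_const])
  qed
  thus ?thesis by (simp add: four1_def[abs_def])
qed

lemma four1_diff:
  assumes "holo UNIV F" "holo UNIV G"
  shows "four1 j n (\<lambda>w. F w - G w) = (\<lambda>w. four1 j n F w - four1 j n G w)"
  unfolding four1_def left_diff_distrib
  by (intro ext integral_diff four1_integrable assms)

lemma four1_cmult: "four1 j n (\<lambda>w. c * F w) = (\<lambda>w. c * four1 j n F w)"
  unfolding four1_def mult.assoc integral_mult_right ..

lemma four1_shift: "four1 j n (\<lambda>w. F (w + v)) w = four1 j n F (w + v)"
  by (simp add: four1_def add_ac)

text \<open>The integrand is entire and 1-periodic, so its integral over a unit segment is the same
  on every horizontal line. Hence complex shifts \<open>s\<close> are allowed, not just real ones;
  the decay of the coefficients rests on this.\<close>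

lemma four1_line:
  assumes F: "holo UNIV F" "\<And>w. F (w + ax j) = F w"
  shows "four1 j n F (w + s *s ax j) = ce (of_int n * s) * four1 j n F w"
proof -
  define f where "f z = F (w + z *s ax j) * ce (- (of_int n * z))" for z
  have f: "f holomorphic_on UNIV" unfolding f_def
    by (intro holomorphic_intros holo_line[OF F(1)]) auto
  have fp: "f (z + 1) = f z" for z
  proof -
    have "F (w + (z + 1) *s ax j) = F (w + z *s ax j)"
      using F(2)[of "w + z *s ax j"] by (simp add: vec.scale_left_distrib add_ac)
    moreover have "ce (- (of_int n * (z + 1))) = ce (- (of_int n * z))"
      unfolding ce_eq_iff by (simp add: algebra_simps)
    ultimately show ?thesis by (simp add: f_def)
  qed
  have "four1 j n F (w + s *s ax j) = integral {0..1} (\<lambda>t. ce (of_int n * s) * f (s + of_real t))"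
    unfolding four1_def
  proof (rule integral_cong)
    fix t :: real
    have "ce (of_int n * s) * ce (- (of_int n * (s + of_real t))) = ce (- (of_int n * of_real t))"
      by (simp add: algebra_simps flip: ce_add)
    thus "F (w + s *s ax j + of_real t *s ax j) * ce (- (of_int n * of_real t)) = ce (of_int n * s) * f (s + of_real t)"
      by (simp add: f_def vec.scale_left_distrib add.assoc mult.left_commute)
  qed
  also have "\<dots> = ce (of_int n * s) * integral {0..1} (\<lambda>t. f (s + of_real t))"
    by (rule integral_mult_right)
  also have "integral {0..1} (\<lambda>t. f (s + of_real t)) = integral {0..1} (\<lambda>t. f (of_real t))"
    by (rule periodic_integral_shift(1)[OF f fp])
  finally show ?thesis by (simp add: f_def four1_def)
qed

lemma four1_eigen:
  assumes "\<And>w. F (w + v) = c * F w"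
  shows "four1 j n F (w + v) = c * four1 j n F w"
proof -
  have "F (w + v + of_real t *s ax j) = c * F (w + of_real t *s ax j)" for t
    using assms[of "w + of_real t *s ax j"] by (simp add: add_ac)
  hence "four1 j n F (w + v) = integral {0..1} (\<lambda>t. c * (F (w + of_real t *s ax j) * ce (- (of_int n * of_real t))))"
    by (simp add: four1_def mult.assoc)
  thus ?thesis by (simp only: integral_mult_right four1_def)
qed

lemma four1_bound:
  assumes "holo UNIV F" "\<And>u. norm u \<le> norm w + 1 \<Longrightarrow> norm (F u) \<le> M"
  shows "norm (four1 j n F w) \<le> M"
proof -
  have "norm (four1 j n F w) \<le> M * (1 - 0)"
    unfolding four1_def
  proof (rule integral_bound)
    show "continuous_on {0..1} (\<lambda>t. F (w + of_real t *s ax j) * ce (- (of_int n * of_real t)))"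
      by (intro continuous_intros continuous_on_compose2[OF holo_continuous_on[OF assms(1)]]) auto
    fix t :: real assume "t \<in> {0..1}"
    hence "norm (w + of_real t *s ax j) \<le> norm w + 1"
      by (intro order_trans[OF norm_triangle_ineq] add_left_mono) (simp add: norm_vec_scale norm_axis_1)
    thus "norm (F (w + of_real t *s ax j) * ce (- (of_int n * of_real t))) \<le> M"
      using assms(2) by (simp add: norm_mult norm_ce)
  qed simp
  thus ?thesis by simp
qed

lemma holo_four: "holo UNIV F \<Longrightarrow> holo UNIV (four js k F)"
  by (induction js) (auto intro: holo_four1)

lemma four_diff:
  assumes "holo UNIV F" "holo UNIV G"
  shows "four js k (\<lambda>w. F w - G w) = (\<lambda>w. four js k F w - four js k G w)"
  by (induction js) (simp_all add: four1_diff holo_four assms)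

lemma four_cmult: "four js k (\<lambda>w. c * F w) = (\<lambda>w. c * four js k F w)"
  by (induction js) (simp_all add: four1_cmult)

lemma four_shift: "four js k (\<lambda>w. F (w + v)) = (\<lambda>w. four js k F (w + v))"
proof (induction js)
  case (Cons j js)
  show ?case unfolding four.simps Cons.IH by (simp add: four1_shift fun_eq_iff)
qed simp

lemma four_eigen:
  assumes "\<And>w. F (w + v) = c * F w"
  shows "four js k F (w + v) = c * four js k F w"
proof (induction js arbitrary: w)
  case (Cons j js)
  show ?case unfolding four.simps by (rule four1_eigen) (rule Cons.IH)
qed (simp add: assms)

text \<open>Each integration over a unit segment moves the argument by at most 1, hence the
  enlargement by \<open>length js\<close>.\<close>

lemma four_bound:
  assumes "holo UNIV F" "\<And>u. norm u \<le> norm w + length js \<Longrightarrow> norm (F u) \<le> M"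
  shows "norm (four js k F w) \<le> M"
  using assms(2)
proof (induction js arbitrary: w)
  case (Cons j js)
  show ?case unfolding four.simps
    by (rule four1_bound[OF holo_four[OF assms(1)]]) (rule Cons.IH, rule Cons.prems, auto)
qed auto

lemma four_line:
  assumes "holo UNIV F" "\<And>i w. F (w + ax i) = F w" "i \<in> set js" "distinct js"
  shows "four js k F (w + s *s ax i) = ce (of_int (k i) * s) * four js k F w"
  using assms(3,4)
proof (induction js arbitrary: w)
  case (Cons j js)
  show ?case
  proof (cases "i = j")
    case True
    have "four js k F (w + ax j) = four js k F w" for w
      using four_eigen[of F "ax j" 1] assms(2) by simp
    thus ?thesis using True four1_line[OF holo_four[OF assms(1)]] by simp
  next
    case False
    thus ?thesis using Cons four1_eigen[of "four js k F" "s *s ax i"] by auto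
  qed
qed auto

lemma four_cong: "(\<And>j. j \<in> set js \<Longrightarrow> k j = k' j) \<Longrightarrow> four js k F = four js k' F"
  by (induction js) auto

lemma four_unique:
  assumes "holo UNIV F" "\<And>i w. F (w + ax i) = F w" "distinct js" "\<And>k w. four js k F w = 0"
  shows "F w = 0"
  using assms(3,4)
proof (induction js arbitrary: w)
  case (Cons j js)
  have "four js k F w = 0" for k w
  proof -
    define f where "f z = four js k F (w + z *s ax j)" for z
    have "f holomorphic_on UNIV" unfolding f_def by (rule holo_line) (use holo_four assms(1) in auto)
    moreover have "f (z + 1) = f z" for z
      using four_eigen[of F "ax j" 1 js k "w + z *s ax j"] assms(2)
      by (simp add: f_def vec.scale_left_distrib add.assoc)
    moreover have "integral {0..1} (\<lambda>t. f (of_real t) * ce (- (of_int n * of_real t))) = 0" for n :: int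
    proof -
      \<comment> \<open>Changing the frequency at \<open>j\<close> leaves the inner coefficient
        untouched, so all one-variable coefficients in direction \<open>j\<close> vanish and
        \<open>fourier_unique\<close> applies.\<close>
      have "four js (k(j := n)) F = four js k F"
        using Cons.prems(1) by (auto intro!: four_cong)
      thus ?thesis using Cons.prems(2)[of "k(j := n)" w]
        unfolding four.simps four1_def f_def by (simp only: fun_upd_same)
    qed
    ultimately have "f 0 = 0" by (rule fourier_unique)
    thus ?thesis by (simp add: f_def)
  qed
  thus ?case using Cons by auto
qed auto

section \<open>Fourier coefficients in all variables\<close>

definition pairing :: "('g \<Rightarrow> int) \<Rightarrow> complex ^ 'g \<Rightarrow> complex" where
  "pairing k w = (\<Sum>j\<in>UNIV. of_int (k j) * w $ j)"

lemma pairing_add: "pairing k (v + w) = pairing k v + pairing k w"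
  by (simp add: pairing_def algebra_simps sum.distrib)

lemma pairing_scale: "pairing k (c *s w) = c * pairing k w"
  by (simp add: pairing_def sum_distrib_left mult_ac)

lemma pairing_axis: "pairing k (ax j) = of_int (k j)"
  by (simp add: pairing_def axis_def if_distrib[of "\<lambda>x. _ * x"] cong: if_cong)

lemma pairing_0 [simp]: "pairing (\<lambda>_. 0) w = 0" "pairing k 0 = 0"
  by (simp_all add: pairing_def)

lemma linear_pairing: "linear (pairing k)"
proof (rule linearI)
  show "pairing k (r *\<^sub>R v) = r *\<^sub>R pairing k v" for r v
    using pairing_scale[of k "of_real r" v] by (simp only: vec_scale_of_real scaleR_conv_of_real)
qed (rule pairing_add)

lemma holo_pairing: "holo UNIV (pairing k)"
  by (rule holo_linear) (auto simp: linear_pairing pairing_scale)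

definition coords :: "'g::finite list" where
  "coords = (SOME js. distinct js \<and> set js = UNIV)"

lemma coords:
  shows "distinct (coords :: 'g::finite list)" "set (coords :: 'g list) = UNIV" "length (coords :: 'g::finite list) = CARD('g)"
proof -
  have "\<exists>js :: 'g list. distinct js \<and> set js = UNIV"
    using finite_distinct_list[of "UNIV :: 'g set"] by auto
  thus *: "distinct (coords :: 'g list)" "set (coords :: 'g list) = UNIV"
    unfolding coords_def by (metis (mono_tags, lifting) someI_ex)+
  thus "length (coords :: 'g list) = CARD('g)" by (metis distinct_card)
qed

definition fcoeff :: "('g \<Rightarrow> int) \<Rightarrow> (complex ^ 'g \<Rightarrow> complex) \<Rightarrow> complex" where
  "fcoeff k F = four coords k F 0"

text \<open>\<open>four_line\<close>, applied in every coordinate, determines a Fourier term by its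
  value at 0, even at complex arguments.\<close>

lemma four_eq_fcoeff:
  fixes F :: "complex ^ 'g \<Rightarrow> complex"
  assumes F: "holo UNIV F" "\<And>i w. F (w + ax i) = F w"
  shows "four coords k F w = fcoeff k F * ce (pairing k w)"
proof -
  have "four coords k F (\<Sum>i\<in>J. w $ i *s ax i) = fcoeff k F * ce (\<Sum>i\<in>J. of_int (k i) * w $ i)" if "finite J" for J
    using that
  proof (induction J)
    case (insert i J)
    have "four coords k F ((\<Sum>i\<in>J. w $ i *s ax i) + w $ i *s ax i) = ce (of_int (k i) * w $ i) * four coords k F (\<Sum>i\<in>J. w $ i *s ax i)"
      by (rule four_line[OF F]) (auto simp: coords)
    thus ?case using insert by (simp add: add.commute[of "w $ i *s ax i"] ce_add)
  qed (simp add: fcoeff_def)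
  from this[of UNIV] show ?thesis
    by (simp add: pairing_def basis_expansion)
qed

lemma fcoeff_bound:
  fixes F :: "complex ^ 'g \<Rightarrow> complex"
  assumes F: "holo UNIV F" "\<And>i w. F (w + ax i) = F w" and R: "R \<ge> 0"
  obtains M where "M \<ge> 0" "\<And>k. norm (fcoeff k F) \<le> M * exp (- (2 * pi * R * (\<Sum>j\<in>UNIV. \<bar>of_int (k j)\<bar>)))"
proof -
  define r where "r = R * CARD('g) + CARD('g)"
  have "compact (F ` cball 0 r)"
    by (rule compact_continuous_image) (auto intro: continuous_on_subset[OF holo_continuous_on[OF F(1)]])
  from compact_imp_bounded[OF this] obtain M where M: "M > 0" "\<And>w. norm w \<le> r \<Longrightarrow> norm (F w) \<le> M"
    unfolding bounded_pos by auto
  show thesis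
  proof (rule that[of M])
    fix k :: "'g \<Rightarrow> int"
    \<comment> \<open>The imaginary parts are chosen against the signs of the frequencies. The
      character at \<open>w\<close> then has modulus exp (2 pi R |k|), with |k| the sum of the
      absolute values, while \<open>F\<close> stays bounded.\<close>
    define w :: "complex ^ 'g" where "w = (\<chi> j. - \<i> * of_real R * of_int (sgn (k j)))"
    have "norm w \<le> (\<Sum>j\<in>UNIV. norm (w $ j))" by (simp add: norm_vec_def L2_set_le_sum)
    also have "\<dots> \<le> (\<Sum>j\<in>(UNIV::'g set). R)"
    proof (rule sum_mono)
      fix j
      have "norm (of_int (sgn (k j)) :: complex) \<le> 1" by (simp add: sgn_if)
      thus "norm (w $ j) \<le> R" using R by (simp add: w_def norm_mult mult_left_le)
    qed
    finally have w: "norm w \<le> R * CARD('g)" by (simp add: mult.commute)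
    have "norm (four coords k F w) \<le> M"
      by (rule four_bound[OF F(1)], rule M(2)) (use w in \<open>auto simp: coords(3) r_def\<close>)
    hence "norm (fcoeff k F) * norm (ce (pairing k w)) \<le> M"
      by (simp add: four_eq_fcoeff[OF F] norm_mult)
    moreover have "pairing k w = - \<i> * of_real (R * (\<Sum>j\<in>UNIV. \<bar>of_int (k j)\<bar>))"
      unfolding pairing_def w_def of_real_mult of_real_sum sum_distrib_left
      by (intro sum.cong) (auto simp: sgn_if abs_if)
    ultimately have "norm (fcoeff k F) * exp (2 * pi * R * (\<Sum>j\<in>UNIV. \<bar>of_int (k j)\<bar>)) \<le> M"
      by (simp add: norm_ce mult.assoc del: of_real_mult of_real_sum)
    thus "norm (fcoeff k F) \<le> M * exp (- (2 * pi * R * (\<Sum>j\<in>UNIV. \<bar>of_int (k j)\<bar>)))"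
      by (simp add: exp_minus field_simps)
  qed (use M in auto)
qed

lemma four1_ce_pairing:
  "four1 j n (\<lambda>w. ce (pairing k w)) = (\<lambda>w. (if n = k j then 1 else 0) * ce (pairing k w))"
proof
  fix w
  have *: "((\<lambda>t. ce (of_int m * of_real t)) has_integral (if m = 0 then 1 else 0)) {0..1}" for m :: int
  proof (cases "m = 0")
    case False
    have "((\<lambda>z. ce (of_int m * z) / (2 * of_real pi * \<i> * of_int m)) has_field_derivative ce (of_int m * z)) (at z)" for z
      unfolding ce_def using False by (auto intro!: derivative_eq_intros)
    from integral_line[OF this, of 0 1 0] show ?thesis using False by simp
  qed (use has_integral_const_real[of "1::complex" 0 1] in simp)
  have "four1 j n (\<lambda>w. ce (pairing k w)) w = integral {0..1} (\<lambda>t. ce (pairing k w) * ce (of_int (k j - n) * of_real t))"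
    unfolding four1_def
    by (intro integral_cong) (simp add: pairing_add pairing_scale pairing_axis algebra_simps flip: ce_add)
  also have "\<dots> = ce (pairing k w) * (if k j - n = 0 then 1 else 0)"
    unfolding integral_mult_right integral_unique[OF *] ..
  finally show "four1 j n (\<lambda>w. ce (pairing k w)) w = (if n = k j then 1 else 0) * ce (pairing k w)"
    by simp
qed

lemma four_ce_pairing:
  "four js m (\<lambda>w. ce (pairing k w)) = (\<lambda>w. (if \<forall>j\<in>set js. m j = k j then 1 else 0) * ce (pairing k w))"
proof (induction js)
  case (Cons j js)
  show ?case unfolding four.simps Cons.IH four1_cmult four1_ce_pairing by auto
qed simp

lemma fcoeff_ce_pairing: "fcoeff m (\<lambda>w. ce (pairing k w)) = (if m = k then 1 else 0)"
  unfolding fcoeff_def four_ce_pairing by (auto simp: coords fun_eq_iff)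

lemma fcoeff_diff:
  "holo UNIV F \<Longrightarrow> holo UNIV G \<Longrightarrow> fcoeff k (\<lambda>w. F w - G w) = fcoeff k F - fcoeff k G"
  by (simp add: fcoeff_def four_diff)

lemma fcoeff_cmult: "fcoeff k (\<lambda>w. c * F w) = c * fcoeff k F"
  by (simp add: fcoeff_def four_cmult)

lemma fcoeff_const: "fcoeff k (\<lambda>w. c) = (if k = (\<lambda>_. 0) then c else 0)"
  using fcoeff_cmult[of k c "\<lambda>w. ce (pairing (\<lambda>_. 0) w)"] fcoeff_ce_pairing[of k "\<lambda>_. 0"]
  by (cases "k = (\<lambda>_. 0)") simp_all

lemma fcoeff_shift:
  assumes F: "holo UNIV F" "\<And>i w. F (w + ax i) = F w"
  shows "fcoeff k (\<lambda>w. F (w + v)) = ce (pairing k v) * fcoeff k F"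
  using four_eq_fcoeff[OF F, of k v] unfolding fcoeff_def four_shift by (simp add: mult.commute)

lemma fcoeff_unique:
  assumes F: "holo UNIV F" "\<And>i w. F (w + ax i) = F w" and "\<And>k. fcoeff k F = 0"
  shows "F w = 0"
  by (rule four_unique[OF F coords(1)]) (simp add: four_eq_fcoeff[OF F] assms(3))

lemma fcoeff_limit:
  fixes f :: "'i \<Rightarrow> complex ^ 'g \<Rightarrow> complex"
  assumes f: "\<And>n. holo UNIV (f n)" and h: "holo UNIV h"
    and lim: "\<And>R. uniform_limit (cball 0 R) f h F"
  shows "((\<lambda>n. fcoeff k (f n)) \<longlongrightarrow> fcoeff k h) F"
proof (rule tendstoI)
  fix e :: real assume e: "e > 0"
  have "\<forall>\<^sub>F n in F. \<forall>x\<in>cball 0 (real CARD('g)). dist (f n x) (h x) < e / 2"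
    using lim[of "CARD('g)"] e unfolding uniform_limit_iff by (meson half_gt_zero)
  thus "\<forall>\<^sub>F n in F. dist (fcoeff k (f n)) (fcoeff k h) < e"
  proof eventually_elim
    case (elim n)
    have "norm (four coords k (\<lambda>w. f n w - h w) 0) \<le> e / 2"
      by (rule four_bound[OF holo_diff[OF f h]])
         (use elim in \<open>auto simp: coords(3) dist_norm intro: less_imp_le\<close>)
    thus ?case using e f h by (simp add: dist_norm fcoeff_def four_diff)
  qed
qed

text \<open>Two logarithms of one function differ by integers at every point; connectedness makes
  such a difference constant.\<close>

lemma int_valued_constant:
  fixes F :: "'a::topological_space \<Rightarrow> complex"
  assumes "connected S" "continuous_on S F" "\<And>w. w \<in> S \<Longrightarrow> F w \<in> \<int>" "v \<in> S" "w \<in> S"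
  shows "F v = F w"
proof -
  have "F constant_on S"
  proof (rule continuous_discrete_range_constant[OF assms(1,2)])
    fix x assume x: "x \<in> S"
    show "\<exists>e>0. \<forall>y. y \<in> S \<and> F y \<noteq> F x \<longrightarrow> e \<le> norm (F y - F x)"
    proof (intro exI[of _ 1] conjI allI impI)
      fix y assume y: "y \<in> S \<and> F y \<noteq> F x"
      then obtain n :: int where "F y - F x = of_int n"
        using assms(3) x by (meson Ints_cases Ints_diff)
      moreover have "1 \<le> real_of_int \<bar>n\<bar>" using y calculation by (cases "n = 0") auto
      ultimately show "1 \<le> norm (F y - F x)" by (simp add: norm_of_int)
    qed simp
  qed
  thus ?thesis using assms(4,5) by (auto simp: constant_on_def)
qed

section \<open>The Appell-Humbert normal form\<close>

definition affine_fun :: "(complex ^ 'g \<Rightarrow> complex) \<Rightarrow> bool" where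
  "affine_fun u \<longleftrightarrow> (\<exists>b c. \<forall>w. u w = (\<Sum>j\<in>UNIV. b j * w $ j) + c)"

lemma affine_fun_shift: "affine_fun u \<Longrightarrow> \<exists>c. \<forall>w. u (w + v) - u w = c"
  unfolding affine_fun_def by (auto simp: algebra_simps sum.distrib)

lemma holo_lincomb: "holo UNIV (\<lambda>w. \<Sum>j\<in>J. b j * w $ j)"
  by (intro holo_sum holo_mult holo_const holo_component)

text \<open>Normalizing along the coordinate vectors, one after the other.\<close>

lemma AH_coordinates:
  fixes g :: "complex ^ 'g \<Rightarrow> complex ^ 'g \<Rightarrow> complex"
  assumes hol: "\<And>l. l \<in> \<Lambda> \<Longrightarrow> holo UNIV (g l)"
    and comm: "\<And>l m. l \<in> \<Lambda> \<Longrightarrow> m \<in> \<Lambda> \<Longrightarrow> \<exists>\<kappa>. \<forall>w. g l (w + m) - g l w - (g m (w + l) - g m w) = \<kappa>"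
    and ax: "\<And>j. ax j \<in> \<Lambda>" and "finite J"
  shows "\<exists>H. holo UNIV H \<and> (\<forall>i\<in>J. affine_fun (\<lambda>w. g (ax i) w - (H (w + ax i) - H w)))"
  using \<open>finite J\<close>
proof (induction J)
  case empty
  thus ?case by (auto intro!: exI[of _ "\<lambda>_. 0"])
next
  case (insert j J)
  then obtain H where H: "holo UNIV H" "\<And>i. i \<in> J \<Longrightarrow> affine_fun (\<lambda>w. g (ax i) w - (H (w + ax i) - H w))"
    by blast
  define u where "u i w = g (ax i) w - (H (w + ax i) - H w)" for i w
  have holu: "holo UNIV (u i)" for i
    unfolding u_def by (rule holo_diff[OF hol[OF ax] holo_diff[OF holo_shift[OF H(1)] H(1)]])
  \<comment> \<open>Up to a constant the commutation relation exchanges the roles of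
    \<open>i\<close> and \<open>j\<close>, and the already normalised \<open>u i\<close> is
    affine.\<close>
  have "\<exists>a. \<forall>w. u j (w + ax i) - u j w = a" if i: "i \<in> J" for i
  proof -
    obtain \<kappa> where \<kappa>: "\<And>w. g (ax j) (w + ax i) - g (ax j) w - (g (ax i) (w + ax j) - g (ax i) w) = \<kappa>"
      using comm[OF ax ax] by blast
    obtain c where c: "\<And>w. u i (w + ax j) - u i w = c"
      using affine_fun_shift[OF H(2)[OF i]] unfolding u_def by blast
    have "u j (w + ax i) - u j w = c + \<kappa>" for w
      unfolding c[of w, symmetric] \<kappa>[of w, symmetric] u_def by (simp add: algebra_simps)
    thus ?thesis by blast
  qed
  then obtain a where a: "\<And>i w. i \<in> J \<Longrightarrow> u j (w + ax i) - u j w = a i" by metis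
  \<comment> \<open>Removing a linear function makes \<open>u j\<close> periodic in the directions
    of \<open>J\<close>. The solution \<open>h\<close> inherits these periods, so the earlier
    normalisations survive.\<close>
  define P where "P w = u j w - (\<Sum>i\<in>J. a i * w $ i)" for w
  have holP: "holo UNIV P" unfolding P_def by (intro holo_diff holu holo_lincomb)
  obtain h where h: "holo UNIV h" "\<And>w. h (w + ax j) - h w = P w"
      "\<And>v w. v $ j = 0 \<Longrightarrow> (\<And>w. P (w + v) = P w) \<Longrightarrow> h (w + v) = h w"
    using guichard[OF holP] by blast
  have hper: "h (w + ax i) = h w" if i: "i \<in> J" for i w
  proof (rule h(3))
    show "ax i $ j = (0::complex)" using i insert by (auto simp: axis_def)
    have "(\<Sum>k\<in>J. a k * ax i $ k) = a i"
      using i insert(1) by (simp add: axis_def if_distrib[of "\<lambda>x. _ * x"] cong: if_cong)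
    thus "P (w + ax i) = P w" for w
      using a[OF i, of w] by (simp add: P_def algebra_simps sum.distrib)
  qed
  have "affine_fun (\<lambda>w. g (ax i) w - ((H (w + ax i) + h (w + ax i)) - (H w + h w)))" if "i \<in> insert j J" for i
  proof (cases "i = j")
    case True
    have "g (ax i) w - ((H (w + ax i) + h (w + ax i)) - (H w + h w)) = (\<Sum>k\<in>UNIV. (if k \<in> J then a k else 0) * w $ k) + 0" for w
    proof -
      have "g (ax i) w - ((H (w + ax i) + h (w + ax i)) - (H w + h w)) = u j w - P w"
        using h(2)[of w] True by (simp add: u_def algebra_simps)
      also have "\<dots> = (\<Sum>k\<in>UNIV. (if k \<in> J then a k else 0) * w $ k)"
        by (simp add: P_def if_distrib[of "\<lambda>x. x * _"] sum.If_cases)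
      finally show ?thesis by simp
    qed
    thus ?thesis unfolding affine_fun_def
      by (intro exI[of _ "\<lambda>k. if k \<in> J then a k else 0"] exI[of _ 0]) blast
  next
    case False
    thus ?thesis using H(2)[of i] hper[of i] that by simp
  qed
  thus ?case using H(1) h(1) by (intro exI[of _ "\<lambda>w. H w + h w"]) auto
qed

text \<open>A finite set of frequencies lies in a box, over which the sum factors into
  one-dimensional sums; each of these is at most two geometric series, one for either sign.\<close>

lemma summable_on_exp_multi:
  assumes "c > 0"
  shows "(\<lambda>k :: 'g::finite \<Rightarrow> int. exp (- (c * (\<Sum>j\<in>UNIV. \<bar>real_of_int (k j)\<bar>)))) summable_on UNIV"
proof (rule nonneg_bdd_above_summable_on)
  define K where "K = 2 * (1 / (1 - exp (- c)))"
  have one: "(\<Sum>m\<in>{-int N..int N}. exp (- (c * \<bar>real_of_int m\<bar>))) \<le> K" for N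
  proof -
    have "(\<Sum>m\<in>{-int N..int N}. exp (- (c * \<bar>real_of_int m\<bar>))) \<le> (\<Sum>m\<in>int ` {..N} \<union> (\<lambda>n. - int n) ` {..N}. exp (- (c * \<bar>real_of_int m\<bar>)))"
    proof (rule sum_mono2)
      show "{-int N..int N} \<subseteq> int ` {..N} \<union> (\<lambda>n. - int n) ` {..N}"
      proof
        fix m assume m: "m \<in> {-int N..int N}"
        show "m \<in> int ` {..N} \<union> (\<lambda>n. - int n) ` {..N}"
        proof (cases "m \<ge> 0")
          case True
          hence "m = int (nat m)" "nat m \<in> {..N}" using m by auto
          thus ?thesis by blast
        next
          case False
          hence "m = - int (nat (- m))" "nat (- m) \<in> {..N}" using m by auto
          thus ?thesis by blast
        qed
      qed
    qed auto
    also have "\<dots> \<le> (\<Sum>m\<in>int ` {..N}. exp (- (c * \<bar>real_of_int m\<bar>))) + (\<Sum>m\<in>(\<lambda>n. - int n) ` {..N}. exp (- (c * \<bar>real_of_int m\<bar>)))"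
      by (simp add: sum_Un sum_nonneg)
    also have "\<dots> = 2 * (\<Sum>n\<le>N. exp (- c) ^ n)"
      by (simp add: sum.reindex inj_on_def flip: exp_of_nat_mult) (simp add: mult.commute)
    also have "\<dots> \<le> K" unfolding K_def
      by (intro mult_left_mono, subst suminf_geometric[symmetric]) (use assms in \<open>auto intro!: sum_le_suminf\<close>)
    finally show ?thesis .
  qed
  show "bdd_above (sum (\<lambda>k :: 'g \<Rightarrow> int. exp (- (c * (\<Sum>j\<in>UNIV. \<bar>real_of_int (k j)\<bar>)))) ` {F. F \<subseteq> UNIV \<and> finite F})"
  proof (rule bdd_aboveI2)
    fix X assume X: "X \<in> {F :: ('g \<Rightarrow> int) set. F \<subseteq> UNIV \<and> finite F}"
    define N where "N = (\<Sum>k\<in>X. \<Sum>j\<in>UNIV. nat \<bar>k j\<bar>)"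
    have "X \<subseteq> PiE UNIV (\<lambda>_. {-int N..int N})"
    proof
      fix k assume k: "k \<in> X"
      have "nat \<bar>k j\<bar> \<le> N" for j
      proof -
        have "nat \<bar>k j\<bar> \<le> (\<Sum>j\<in>UNIV. nat \<bar>k j\<bar>)" by (intro member_le_sum) auto
        also have "\<dots> \<le> N" unfolding N_def using k X by (intro member_le_sum[of k X "\<lambda>k. \<Sum>j\<in>UNIV. nat \<bar>k j\<bar>"]) auto
        finally show ?thesis .
      qed
      hence "\<bar>k j\<bar> \<le> int N" for j by (metis abs_ge_zero int_nat_eq nat_int_comparison(3))
      thus "k \<in> PiE UNIV (\<lambda>_. {-int N..int N})" by (auto simp: abs_le_iff) (smt (verit))
    qed
    hence "(\<Sum>k\<in>X. exp (- (c * (\<Sum>j\<in>UNIV. \<bar>real_of_int (k j)\<bar>)))) \<le> (\<Sum>k\<in>PiE UNIV (\<lambda>_::'g. {-int N..int N}). exp (- (c * (\<Sum>j\<in>UNIV. \<bar>real_of_int (k j)\<bar>))))"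
      by (intro sum_mono2) (auto intro: finite_PiE)
    also have "\<dots> = (\<Sum>k\<in>PiE UNIV (\<lambda>_::'g. {-int N..int N}). \<Prod>j\<in>UNIV. exp (- (c * \<bar>real_of_int (k j)\<bar>)))"
      by (simp add: sum_distrib_left exp_sum flip: sum_negf)
    also have "\<dots> = (\<Prod>j\<in>(UNIV::'g set). \<Sum>m\<in>{-int N..int N}. exp (- (c * \<bar>real_of_int m\<bar>)))"
      by (rule prod_sum_PiE[symmetric]) auto
    also have "\<dots> \<le> (\<Prod>j\<in>(UNIV::'g set). K)" by (intro prod_mono conjI one sum_nonneg) auto
    finally show "(\<Sum>k\<in>X. exp (- (c * (\<Sum>j\<in>UNIV. \<bar>real_of_int (k j)\<bar>)))) \<le> (\<Prod>j\<in>(UNIV::'g set). K)" .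
  qed
qed auto

text \<open>If all these characters were close to 1, all imaginary parts of
  \<open>pairing k l\<close> would be small. But \<open>\<i> *s ax j\<close> is a real combination
  of lattice vectors, and its pairing with \<open>k\<close> has imaginary part \<open>k j\<close>, a
  nonzero integer for some \<open>j\<close>.\<close>

lemma small_denominators:
  fixes \<Lambda> :: "(complex ^ 'g) set"
  assumes "span \<Lambda> = UNIV"
  obtains S \<delta> where "finite S" "S \<subseteq> \<Lambda>" "\<delta> > 0"
    "\<And>k. k \<noteq> (\<lambda>_. 0) \<Longrightarrow> \<exists>l\<in>S. norm (ce (pairing k l) - 1) \<ge> \<delta>"
proof -
  obtain S where S: "S \<subseteq> \<Lambda>" "independent S" "\<Lambda> \<subseteq> span S"
    using maximal_independent_subset[of \<Lambda>] by blast
  have "span S = UNIV" using span_minimal[OF S(3) subspace_span] assms by auto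
  note S = S(1,2) this
  hence fin: "finite S" using independent_imp_finite by blast
  have "\<exists>u. (\<Sum>l\<in>S. u l *\<^sub>R l) = \<i> *s ax j" for j :: 'g
    using S(3) span_finite[OF fin] by (metis (no_types, lifting) UNIV_I imageE)
  then obtain u where u: "\<And>j. (\<Sum>l\<in>S. u j l *\<^sub>R l) = \<i> *s (ax j :: complex ^ 'g)" by metis
  \<comment> \<open>Dominates the sum of the absolute coordinates of \<open>\<i> *s ax j\<close> for
    every \<open>j\<close>; the summand 1 makes it positive and the final inequality strict.\<close>
  define C where "C = (\<Sum>j\<in>UNIV. \<Sum>l\<in>S. \<bar>u j l\<bar>) + 1"
  have C: "C > 0" unfolding C_def by (intro add_nonneg_pos sum_nonneg) auto
  define \<delta> where "\<delta> = 1 - exp (- (2 * pi / C))"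
  have "\<exists>l\<in>S. norm (ce (pairing k l) - 1) \<ge> \<delta>" if k: "k \<noteq> (\<lambda>_. 0)" for k
  proof (rule ccontr)
    assume neg: "\<not> (\<exists>l\<in>S. norm (ce (pairing k l) - 1) \<ge> \<delta>)"
    have small: "\<bar>Im (pairing k l)\<bar> \<le> 1 / C" if l: "l \<in> S" for l
    proof (rule ccontr)
      assume big: "\<not> \<bar>Im (pairing k l)\<bar> \<le> 1 / C"
      define y where "y = 2 * pi * Im (pairing k l)"
      have y: "\<bar>y\<bar> \<ge> 2 * pi / C"
        using big mult_left_mono[of "1 / C" "\<bar>Im (pairing k l)\<bar>" "2 * pi"] by (simp add: y_def abs_mult)
      have n: "norm (ce (pairing k l)) = exp (- y)" by (simp add: norm_ce y_def)
      have "\<delta> \<le> norm (ce (pairing k l) - 1)"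
      proof (cases "y \<ge> 0")
        case True
        hence "exp (- y) \<le> exp (- (2 * pi / C))" using y by simp
        hence "\<delta> \<le> 1 - norm (ce (pairing k l))" unfolding n \<delta>_def by simp
        thus ?thesis using norm_triangle_ineq2[of 1 "ce (pairing k l)"] by (simp add: norm_minus_commute)
      next
        case False
        hence "exp (- y) \<ge> exp (2 * pi / C)" using y by simp
        moreover have "exp (2 * pi / C) + exp (- (2 * pi / C)) \<ge> 2"
          using exp_ge_add_one_self[of "2 * pi / C"] exp_ge_add_one_self[of "- (2 * pi / C)"] by linarith
        ultimately have "\<delta> \<le> norm (ce (pairing k l)) - 1" unfolding n \<delta>_def by linarith
        thus ?thesis using norm_triangle_ineq2[of "ce (pairing k l)" 1] by simp
      qed
      thus False using neg l by blast
    qed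
    obtain j where j: "k j \<noteq> 0" using k by auto
    have "pairing k (\<i> *s ax j) = \<i> * of_int (k j)" by (simp add: pairing_scale pairing_axis)
    moreover have "pairing k (\<Sum>l\<in>S. u j l *\<^sub>R l) = (\<Sum>l\<in>S. u j l *\<^sub>R pairing k l)"
      by (simp add: linear_sum[OF linear_pairing] linear_cmul[OF linear_pairing])
    ultimately have "of_int (k j) = (\<Sum>l\<in>S. u j l * Im (pairing k l))"
      unfolding u[of j] by (metis (no_types, lifting) Im_i_times Im_sum Re_complex_of_real complex_Re_of_int scaleR_complex.sel(2) sum.cong)
    hence "\<bar>of_int (k j)\<bar> \<le> (\<Sum>l\<in>S. \<bar>u j l * Im (pairing k l)\<bar>)" by simp
    also have "\<dots> \<le> (\<Sum>l\<in>S. \<bar>u j l\<bar> * (1 / C))"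
      unfolding abs_mult by (intro sum_mono mult_left_mono small) auto
    also have "\<dots> = (\<Sum>l\<in>S. \<bar>u j l\<bar>) / C" by (simp add: sum_divide_distrib)
    also have "\<dots> < 1"
    proof -
      have "(\<Sum>l\<in>S. \<bar>u j l\<bar>) \<le> (\<Sum>j\<in>UNIV. \<Sum>l\<in>S. \<bar>u j l\<bar>)"
        by (rule member_le_sum[of j UNIV "\<lambda>j. \<Sum>l\<in>S. \<bar>u j l\<bar>"]) (auto intro: sum_nonneg)
      thus ?thesis using C by (simp add: C_def)
    qed
    finally have "\<bar>k j\<bar> < 1" by linarith
    thus False using j by simp
  qed
  moreover have "\<delta> > 0" using C by (simp add: \<delta>_def)
  ultimately show thesis using that fin S(1) by blast
qed

text \<open>After \<open>AH_coordinates\<close> every \<open>u l\<close> is a linear function plus a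
  function \<open>G l\<close> with the coordinate vectors as periods. It remains to solve
  \<open>h (w + l) - h w = G l w\<close> up to constants, for all \<open>l\<close> at once; on
  Fourier coefficients this is division by \<open>ce (pairing k l) - 1\<close>.\<close>

lemma AH_core:
  fixes g :: "complex ^ 'g \<Rightarrow> complex ^ 'g \<Rightarrow> complex"
  assumes hol: "\<And>l. l \<in> \<Lambda> \<Longrightarrow> holo UNIV (g l)"
    and comm: "\<And>l m. l \<in> \<Lambda> \<Longrightarrow> m \<in> \<Lambda> \<Longrightarrow> \<exists>\<kappa>. \<forall>w. g l (w + m) - g l w - (g m (w + l) - g m w) = \<kappa>"
    and ax: "\<And>j. ax j \<in> \<Lambda>" and span: "span \<Lambda> = UNIV"
  obtains h where "holo UNIV h" "\<And>l. l \<in> \<Lambda> \<Longrightarrow> affine_fun (\<lambda>w. g l w - (h (w + l) - h w))"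
proof -
  obtain H where H: "holo UNIV H" "\<And>i. affine_fun (\<lambda>w. g (ax i) w - (H (w + ax i) - H w))"
    using AH_coordinates[of \<Lambda> g UNIV] hol comm ax by auto
  define u where "u l w = g l w - (H (w + l) - H w)" for l w
  have holu: "holo UNIV (u l)" if "l \<in> \<Lambda>" for l
    unfolding u_def by (rule holo_diff[OF hol[OF that] holo_diff[OF holo_shift[OF H(1)] H(1)]])
  have commu: "\<exists>\<kappa>. \<forall>w. u l (w + m) - u l w - (u m (w + l) - u m w) = \<kappa>" if lm: "l \<in> \<Lambda>" "m \<in> \<Lambda>" for l m
  proof -
    obtain \<kappa> where \<kappa>: "\<And>w. g l (w + m) - g l w - (g m (w + l) - g m w) = \<kappa>" using comm[OF lm] by blast
    have "u l (w + m) - u l w - (u m (w + l) - u m w) = \<kappa>" for w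
      unfolding \<kappa>[of w, symmetric] u_def by (simp add: algebra_simps)
    thus ?thesis by blast
  qed
  have "\<exists>a. \<forall>w. u l (w + ax j) - u l w = a" if l: "l \<in> \<Lambda>" for l j
  proof -
    obtain \<kappa> where \<kappa>: "\<And>w. u l (w + ax j) - u l w - (u (ax j) (w + l) - u (ax j) w) = \<kappa>"
      using commu[OF l ax] by blast
    obtain c where c: "\<And>w. u (ax j) (w + l) - u (ax j) w = c"
      using affine_fun_shift[OF H(2)] unfolding u_def by blast
    have "u l (w + ax j) - u l w = c + \<kappa>" for w
      unfolding c[of w, symmetric] \<kappa>[of w, symmetric] by simp
    thus ?thesis by blast
  qed
  then obtain a where a: "\<And>l j w. l \<in> \<Lambda> \<Longrightarrow> u l (w + ax j) - u l w = a l j" by metis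
  define G where "G l w = u l w - (\<Sum>j\<in>UNIV. a l j * w $ j)" for l w
  have holG: "holo UNIV (G l)" if "l \<in> \<Lambda>" for l
    unfolding G_def by (intro holo_diff holu holo_lincomb that)
  have perG: "G l (w + ax i) = G l w" if l: "l \<in> \<Lambda>" for l i w
  proof -
    have "(\<Sum>k\<in>UNIV. a l k * ax i $ k) = a l i"
      by (simp add: axis_def if_distrib[of "\<lambda>x. _ * x"] cong: if_cong)
    thus ?thesis using a[OF l, of w i] by (simp add: G_def algebra_simps sum.distrib)
  qed
  \<comment> \<open>Commutation, read on Fourier coefficients: at frequency \<open>k\<close> all
    quotients agree, so any lattice vector with a nonzero divisor may be used.\<close>
  have rel: "fcoeff k (G l) * (ce (pairing k m) - 1) = fcoeff k (G m) * (ce (pairing k l) - 1)"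
    if lm: "l \<in> \<Lambda>" "m \<in> \<Lambda>" and k: "k \<noteq> (\<lambda>_. 0)" for k l m
  proof -
    obtain \<kappa> where \<kappa>: "\<And>w. u l (w + m) - u l w - (u m (w + l) - u m w) = \<kappa>" using commu[OF lm] by blast
    define \<kappa>' where "\<kappa>' = \<kappa> - (\<Sum>j\<in>UNIV. a l j * m $ j) + (\<Sum>j\<in>UNIV. a m j * l $ j)"
    have "(G l (w + m) - G l w) - (G m (w + l) - G m w) = \<kappa>'" for w
      unfolding \<kappa>'_def \<kappa>[of w, symmetric] G_def by (simp add: algebra_simps sum.distrib)
    hence "fcoeff k (\<lambda>w. (G l (w + m) - G l w) - (G m (w + l) - G m w)) = fcoeff k (\<lambda>w. \<kappa>')" by simp
    also have "\<dots> = 0" using k by (simp add: fcoeff_const)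
    finally have "fcoeff k (\<lambda>w. G l (w + m) - G l w) = fcoeff k (\<lambda>w. G m (w + l) - G m w)"
      by (subst (asm) fcoeff_diff) (use lm in \<open>auto intro!: holo_diff holo_shift[OF holG] holG\<close>)
    moreover have "fcoeff k (\<lambda>w. G l (w + m) - G l w) = fcoeff k (G l) * (ce (pairing k m) - 1)" if lm: "l \<in> \<Lambda>" "m \<in> \<Lambda>" for l m
      by (subst fcoeff_diff) (use lm in \<open>auto intro!: holo_shift[OF holG] holG simp: fcoeff_shift[OF holG perG] algebra_simps\<close>)
    ultimately show ?thesis using lm by simp
  qed
  obtain S \<delta> where S: "finite S" "S \<subseteq> \<Lambda>" "\<delta> > 0"
    "\<And>k. k \<noteq> (\<lambda>_. 0) \<Longrightarrow> \<exists>l\<in>S. norm (ce (pairing k l) - 1) \<ge> \<delta>"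
    using small_denominators[OF span] by blast
  then obtain s where s: "\<And>k. k \<noteq> (\<lambda>_. 0) \<Longrightarrow> s k \<in> S" "\<And>k. k \<noteq> (\<lambda>_. 0) \<Longrightarrow> norm (ce (pairing k (s k)) - 1) \<ge> \<delta>"
    by metis
  \<comment> \<open>The divisor is taken at a vector \<open>s k\<close> from a finite set, where it
    is bounded below; so the decay of the coefficients of the functions \<open>G l\<close> carries
    over to \<open>hk\<close>.\<close>
  define hk where "hk k = (if k = (\<lambda>_. 0) then 0 else fcoeff k (G (s k)) / (ce (pairing k (s k)) - 1))" for k
  have hk_rel: "hk k * (ce (pairing k l) - 1) = fcoeff k (G l)" if "k \<noteq> (\<lambda>_. 0)" "l \<in> \<Lambda>" for k l
  proof -
    have "ce (pairing k (s k)) - 1 \<noteq> 0" using s(2)[OF that(1)] S(3) by auto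
    moreover have "fcoeff k (G l) * (ce (pairing k (s k)) - 1) = fcoeff k (G (s k)) * (ce (pairing k l) - 1)"
      by (rule rel) (use that s(1) S(2) in auto)
    ultimately show ?thesis using that by (simp add: hk_def field_simps)
  qed
  have hk_bound: "\<exists>M\<ge>0. \<forall>k :: 'g \<Rightarrow> int. norm (hk k) \<le> M * exp (- (2 * pi * R * (\<Sum>j\<in>UNIV. \<bar>of_int (k j)\<bar>)))" if "R \<ge> 0" for R
  proof -
    have "\<exists>M\<ge>0. \<forall>k :: 'g \<Rightarrow> int. norm (fcoeff k (G l)) \<le> M * exp (- (2 * pi * R * (\<Sum>j\<in>UNIV. \<bar>of_int (k j)\<bar>)))" if "l \<in> S" for l
      by (rule fcoeff_bound[of "G l" R]) (use holG perG \<open>R \<ge> 0\<close> that S(2) in auto)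
    then obtain M where M: "\<And>l. l \<in> S \<Longrightarrow> M l \<ge> 0"
        "\<And>l k. l \<in> S \<Longrightarrow> norm (fcoeff k (G l)) \<le> M l * exp (- (2 * pi * R * (\<Sum>j\<in>UNIV. \<bar>of_int (k j)\<bar>)))"
      by metis
    show ?thesis
    proof (intro exI[of _ "(\<Sum>l\<in>S. M l) / \<delta>"] conjI allI)
      show "0 \<le> (\<Sum>l\<in>S. M l) / \<delta>" using S(3) M(1) by (simp add: sum_nonneg)
      fix k :: "'g \<Rightarrow> int"
      let ?e = "exp (- (2 * pi * R * (\<Sum>j\<in>UNIV. \<bar>of_int (k j)\<bar>)))"
      show "norm (hk k) \<le> (\<Sum>l\<in>S. M l) / \<delta> * ?e"
      proof (cases "k = (\<lambda>_. 0)")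
        case False
        have "norm (fcoeff k (G (s k))) \<le> M (s k) * ?e" using M(2) s(1)[OF False] by blast
        also have "\<dots> \<le> (\<Sum>l\<in>S. M l) * ?e"
          by (intro mult_right_mono member_le_sum) (use S(1) s(1)[OF False] M(1) in auto)
        finally have "norm (hk k) \<le> ((\<Sum>l\<in>S. M l) * ?e) / \<delta>"
          using s(2)[OF False] S(3) False unfolding hk_def by (simp add: norm_divide) (intro frac_le, auto simp: sum_nonneg M(1))
        thus ?thesis by simp
      qed (use S(3) M(1) in \<open>simp add: hk_def sum_nonneg\<close>)
    qed
  qed
  define h where "h w = (\<Sum>\<^sub>\<infinity>k\<in>UNIV. hk k * ce (pairing k w))" for w
  have lim: "uniform_limit (cball 0 R) (\<lambda>X w. \<Sum>k\<in>X. hk k * ce (pairing k w)) h (finite_subsets_at_top UNIV)" for R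
  proof -
    obtain M where M: "M \<ge> 0" "\<And>k. norm (hk k) \<le> M * exp (- (2 * pi * (\<bar>R\<bar> + 1) * (\<Sum>j\<in>UNIV. \<bar>of_int (k j)\<bar>)))"
      using hk_bound[of "\<bar>R\<bar> + 1"] by auto
    show ?thesis unfolding h_def
    proof (rule Weierstrass_m_test_general)
      show "(\<lambda>k :: 'g \<Rightarrow> int. M * exp (- (2 * pi * (\<Sum>j\<in>UNIV. \<bar>of_int (k j)\<bar>)))) summable_on UNIV"
        by (intro summable_on_cmult_right summable_on_exp_multi) simp
      fix k :: "'g \<Rightarrow> int" and w :: "complex ^ 'g" assume w: "w \<in> cball 0 R"
      let ?n = "\<Sum>j\<in>UNIV. \<bar>of_int (k j)\<bar> :: real"
      have "- Im (pairing k w) \<le> norm (pairing k w)" using abs_Im_le_cmod[of "pairing k w"] by linarith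
      also have "\<dots> \<le> (\<Sum>j\<in>UNIV. norm (of_int (k j) * w $ j))" unfolding pairing_def by (rule norm_sum)
      also have "\<dots> \<le> (\<Sum>j\<in>UNIV. \<bar>of_int (k j)\<bar> * \<bar>R\<bar>)"
      proof (intro sum_mono)
        fix j
        have "norm (w $ j) \<le> \<bar>R\<bar>" using Finite_Cartesian_Product.norm_nth_le[of w j] w by simp
        thus "norm (of_int (k j) * w $ j) \<le> \<bar>of_int (k j)\<bar> * \<bar>R\<bar>" by (simp add: norm_mult mult_left_mono)
      qed
      finally have "- Im (pairing k w) \<le> ?n * \<bar>R\<bar>" by (simp add: sum_distrib_right)
      hence "- (2 * pi * Im (pairing k w)) \<le> 2 * pi * (?n * \<bar>R\<bar>)"
        using mult_left_mono[of "- Im (pairing k w)" "?n * \<bar>R\<bar>" "2 * pi"] by simp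
      hence "norm (ce (pairing k w)) \<le> exp (2 * pi * (?n * \<bar>R\<bar>))" by (simp add: norm_ce)
      hence "norm (hk k * ce (pairing k w)) \<le> (M * exp (- (2 * pi * (\<bar>R\<bar> + 1) * ?n))) * exp (2 * pi * (?n * \<bar>R\<bar>))"
        unfolding norm_mult by (intro mult_mono M) (use M(1) in auto)
      also have "\<dots> = M * exp (- (2 * pi * ?n))" by (simp add: mult.assoc algebra_simps flip: exp_add)
      finally show "norm (hk k * ce (pairing k w)) \<le> M * exp (- (2 * pi * ?n))" .
    qed
  qed
  have holsum: "holo UNIV (\<lambda>w. \<Sum>k\<in>X. hk k * ce (pairing k w))" for X
    by (intro holo_sum holo_mult holo_const holo_ce holo_pairing)
  have holh: "holo UNIV h"
    by (rule holo_uniform_limit[OF _ _ lim]) (auto intro!: always_eventually holsum)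
  have perh: "h (w + ax i) = h w" for i w
    by (simp add: h_def pairing_add pairing_axis ce_add)
  have fch: "fcoeff m h = hk m" for m
  proof -
    have fsum: "fcoeff m (\<lambda>w. \<Sum>k\<in>X. hk k * ce (pairing k w)) = (if m \<in> X then hk m else 0)" if "finite X" for X
      using that
    proof (induction X)
      case (insert k X)
      have "fcoeff m (\<lambda>w. \<Sum>k\<in>insert k X. hk k * ce (pairing k w))
          = fcoeff m (\<lambda>w. (\<Sum>k\<in>X. hk k * ce (pairing k w)) - (- hk k) * ce (pairing k w))"
        using insert by (simp add: add.commute)
      also have "\<dots> = fcoeff m (\<lambda>w. \<Sum>k\<in>X. hk k * ce (pairing k w)) - (- hk k) * fcoeff m (\<lambda>w. ce (pairing k w))"
        by (subst fcoeff_diff) (auto intro!: holsum holo_mult holo_ce holo_pairing simp only: fcoeff_cmult)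
      finally show ?case using insert by (auto simp: fcoeff_ce_pairing)
    qed (simp add: fcoeff_const)
    have "((\<lambda>X. fcoeff m (\<lambda>w. \<Sum>k\<in>X. hk k * ce (pairing k w))) \<longlongrightarrow> fcoeff m h) (finite_subsets_at_top UNIV)"
      by (rule fcoeff_limit[OF holsum holh lim])
    moreover have "\<forall>\<^sub>F X in finite_subsets_at_top UNIV. fcoeff m (\<lambda>w. \<Sum>k\<in>X. hk k * ce (pairing k w)) = hk m"
      unfolding eventually_finite_subsets_at_top
      by (intro exI[of _ "{m}"]) (auto simp: fsum)
    hence "((\<lambda>X. fcoeff m (\<lambda>w. \<Sum>k\<in>X. hk k * ce (pairing k w))) \<longlongrightarrow> hk m) (finite_subsets_at_top UNIV)"
      by (rule tendsto_eventually)
    ultimately show ?thesis by (rule tendsto_unique[OF finite_subsets_at_top_neq_bot])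
  qed
  \<comment> \<open>At nonzero frequencies the coefficients agree by the construction of
    \<open>hk\<close>; the coefficient at frequency 0 is the constant that remains.\<close>
  have main: "G l w - (h (w + l) - h w) - fcoeff (\<lambda>_. 0) (G l) = 0" if l: "l \<in> \<Lambda>" for l w
  proof (rule fcoeff_unique[of "\<lambda>w. G l w - (h (w + l) - h w) - fcoeff (\<lambda>_. 0) (G l)"])
    have h1: "holo UNIV (\<lambda>w. h (w + l) - h w)" by (rule holo_diff[OF holo_shift[OF holh] holh])
    have h2: "holo UNIV (\<lambda>w. G l w - (h (w + l) - h w))" by (rule holo_diff[OF holG[OF l] h1])
    show "holo UNIV (\<lambda>w. G l w - (h (w + l) - h w) - fcoeff (\<lambda>_. 0) (G l))"
      by (rule holo_diff[OF h2 holo_const])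
    show "G l (w + ax i) - (h (w + ax i + l) - h (w + ax i)) - fcoeff (\<lambda>_. 0) (G l) = G l w - (h (w + l) - h w) - fcoeff (\<lambda>_. 0) (G l)" for i w
      using perh[of "w + l" i] by (simp add: perG[OF l] perh add_ac)
    fix k
    have "fcoeff k (\<lambda>w. G l w - (h (w + l) - h w) - fcoeff (\<lambda>_. 0) (G l))
        = fcoeff k (G l) - (ce (pairing k l) * hk k - hk k) - (if k = (\<lambda>_. 0) then fcoeff (\<lambda>_. 0) (G l) else 0)"
      unfolding fcoeff_diff[OF h2 holo_const] fcoeff_diff[OF holG[OF l] h1] fcoeff_diff[OF holo_shift[OF holh] holh]
        fcoeff_shift[OF holh perh] fch fcoeff_const ..
    also have "\<dots> = 0"
      using hk_rel[OF _ l, of k] by (cases "k = (\<lambda>_. 0)") (auto simp: algebra_simps)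
    finally show "fcoeff k (\<lambda>w. G l w - (h (w + l) - h w) - fcoeff (\<lambda>_. 0) (G l)) = 0" .
  qed
  show thesis
  proof (rule that[of "\<lambda>w. H w + h w"])
    show "holo UNIV (\<lambda>w. H w + h w)" by (intro holo_add H(1) holh)
    fix l assume l: "l \<in> \<Lambda>"
    have "g l w - (H (w + l) + h (w + l) - (H w + h w)) = (\<Sum>j\<in>UNIV. a l j * w $ j) + fcoeff (\<lambda>_. 0) (G l)" for w
      using main[OF l, of w] by (simp add: G_def u_def algebra_simps)
    thus "affine_fun (\<lambda>w. g l w - (H (w + l) + h (w + l) - (H w + h w)))"
      unfolding affine_fun_def by blast
  qed
qed

section \<open>Lattices\<close>

lemma is_latticeD:
  assumes "is_lattice V \<Lambda>"
  shows "vec.subspace V" "\<Lambda> \<subseteq> V" "0 \<in> \<Lambda>" "\<And>x y. x \<in> \<Lambda> \<Longrightarrow> y \<in> \<Lambda> \<Longrightarrow> x - y \<in> \<Lambda>"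
    "uniform_discrete \<Lambda>" "span \<Lambda> = V" "\<And>x. x \<in> \<Lambda> \<Longrightarrow> - x \<in> \<Lambda>"
    "\<And>x y. x \<in> \<Lambda> \<Longrightarrow> y \<in> \<Lambda> \<Longrightarrow> x + y \<in> \<Lambda>"
proof -
  show *: "vec.subspace V" "\<Lambda> \<subseteq> V" "0 \<in> \<Lambda>" "\<And>x y. x \<in> \<Lambda> \<Longrightarrow> y \<in> \<Lambda> \<Longrightarrow> x - y \<in> \<Lambda>"
    "uniform_discrete \<Lambda>" "span \<Lambda> = V"
    using assms by (auto simp: is_lattice_def)
  show m: "- x \<in> \<Lambda>" if "x \<in> \<Lambda>" for x using *(3) *(4)[OF *(3) that] by simp
  show "x + y \<in> \<Lambda>" if "x \<in> \<Lambda>" "y \<in> \<Lambda>" for x y using *(4)[OF that(1) m[OF that(2)]] by simp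
qed

lemma vec_subspace_imp_subspace: "vec.subspace V \<Longrightarrow> subspace (V :: (complex ^ 'g) set)"
  by (auto simp: subspace_def vec.subspace_def simp flip: vec_scale_of_real)

lemma lattice_sum: "is_lattice V \<Lambda> \<Longrightarrow> (\<And>i. i \<in> I \<Longrightarrow> f i \<in> \<Lambda>) \<Longrightarrow> (\<Sum>i\<in>I. f i) \<in> \<Lambda>"
  by (induction I rule: infinite_finite_induct) (auto simp: is_latticeD)

lemma lattice_int_scale:
  assumes "is_lattice V \<Lambda>" "x \<in> \<Lambda>" shows "of_int n *\<^sub>R x \<in> \<Lambda>"
proof -
  have nat: "of_nat n *\<^sub>R x \<in> \<Lambda>" for n
    by (induction n) (use assms in \<open>auto simp: is_latticeD scaleR_left_distrib\<close>)
  show ?thesis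
    using nat[of "nat n"] is_latticeD(7)[OF assms(1) nat[of "nat (- n)"]] by (cases "n \<ge> 0") auto
qed

lemma lattice_finite: "is_lattice V \<Lambda> \<Longrightarrow> bounded A \<Longrightarrow> finite (\<Lambda> \<inter> A)"
  by (meson Int_lower1 bounded_Int is_latticeD(5) uniform_discrete_finite_iff uniform_discrete_subset)

text \<open>\<open>S\<close> is merely a real basis made of lattice vectors; rounding down the
  coordinates leaves a bounded remainder.\<close>

lemma lattice_reduce:
  assumes "is_lattice V \<Lambda>"
  obtains S r where "finite S" "S \<subseteq> \<Lambda>" "independent S" "span S = V"
    "\<And>w. w \<in> V \<Longrightarrow> \<exists>n. norm (w - (\<Sum>s\<in>S. of_int (n s) *\<^sub>R s)) \<le> r"
proof -
  note L = is_latticeD[OF assms]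
  obtain S where S: "S \<subseteq> \<Lambda>" "independent S" "\<Lambda> \<subseteq> span S"
    using maximal_independent_subset[of \<Lambda>] by blast
  have spanS: "span S = V"
    using span_minimal[OF S(3) subspace_span] span_mono[OF S(1)] L(6) by auto
  have fin: "finite S" using independent_imp_finite S(2) by blast
  show thesis
  proof (rule that[OF fin S(1,2) spanS])
    fix w assume "w \<in> V"
    then obtain u where u: "w = (\<Sum>s\<in>S. u s *\<^sub>R s)" using spanS span_finite[OF fin] by auto
    have "w - (\<Sum>s\<in>S. of_int \<lfloor>u s\<rfloor> *\<^sub>R s) = (\<Sum>s\<in>S. frac (u s) *\<^sub>R s)"
      by (simp add: u frac_def scaleR_left_diff_distrib sum_subtractf)
    also have "norm \<dots> \<le> (\<Sum>s\<in>S. norm s)"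
      by (rule sum_norm_le) (auto simp: frac_lt_1 less_imp_le mult_left_le_one_le)
    finally show "\<exists>n. norm (w - (\<Sum>s\<in>S. of_int (n s) *\<^sub>R s)) \<le> (\<Sum>s\<in>S. norm s)"
      by (rule exI[of _ "\<lambda>s. \<lfloor>u s\<rfloor>"])
  qed
qed

text \<open>The remainders of the multiples of \<open>l\<close> modulo integral combinations of
  \<open>S\<close> are bounded lattice points, hence finite in number. Two of them coincide, so a
  positive multiple of \<open>l\<close> is an integral combination of \<open>S\<close>, where both
  maps agree.\<close>

lemma lattice_additive_extends:
  fixes \<phi> :: "complex ^ 'g \<Rightarrow> 'b::real_vector"
  assumes "is_lattice V \<Lambda>" and add: "\<And>x y. x \<in> \<Lambda> \<Longrightarrow> y \<in> \<Lambda> \<Longrightarrow> \<phi> (x + y) = \<phi> x + \<phi> y"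
  obtains \<phi>' where "linear \<phi>'" "\<And>l. l \<in> \<Lambda> \<Longrightarrow> \<phi>' l = \<phi> l"
proof -
  note L = is_latticeD[OF assms(1)]
  obtain S r where S: "finite S" "S \<subseteq> \<Lambda>" "independent S" "span S = V"
      "\<And>w. w \<in> V \<Longrightarrow> \<exists>n. norm (w - (\<Sum>s\<in>S. of_int (n s) *\<^sub>R s)) \<le> r"
    using lattice_reduce[OF assms(1)] by blast
  obtain \<phi>' where \<phi>': "linear \<phi>'" "\<And>s. s \<in> S \<Longrightarrow> \<phi>' s = \<phi> s"
    using linear_independent_extend[OF S(3)] by metis
  have add0: "\<phi> 0 = 0" using add[OF L(3) L(3)] by simp
  have addm: "\<phi> (- x) = - \<phi> x" if "x \<in> \<Lambda>" for x
    using add[OF that L(7)[OF that]] add0 by (simp add: eq_neg_iff_add_eq_0 add.commute)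
  have addn: "\<phi> (of_nat n *\<^sub>R x) = of_nat n *\<^sub>R \<phi> x" if "x \<in> \<Lambda>" for n x
  proof (induction n)
    case (Suc n)
    have "of_int (int n) *\<^sub>R x \<in> \<Lambda>" using lattice_int_scale[OF assms(1) that] .
    thus ?case using add[OF that, of "of_nat n *\<^sub>R x"] Suc by (simp add: scaleR_left_distrib)
  qed (simp add: add0)
  have addz: "\<phi> (of_int n *\<^sub>R x) = of_int n *\<^sub>R \<phi> x" if "x \<in> \<Lambda>" for n x
  proof (cases "n \<ge> 0")
    case True
    thus ?thesis using addn[OF that, of "nat n"] by simp
  next
    case False
    have "of_nat (nat (- n)) *\<^sub>R x \<in> \<Lambda>" using lattice_int_scale[OF assms(1) that, of "- n"] False by simp
    hence "\<phi> (- (of_nat (nat (- n)) *\<^sub>R x)) = - (of_nat (nat (- n)) *\<^sub>R \<phi> x)"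
      by (simp only: addm addn[OF that])
    thus ?thesis using False by simp
  qed
  have adds: "\<phi> (\<Sum>s\<in>T. of_int (n s) *\<^sub>R s) = (\<Sum>s\<in>T. of_int (n s) *\<^sub>R \<phi> s)" if "T \<subseteq> S" "finite T" for n T
    using that(2,1)
  proof (induction T)
    case (insert t T)
    have "(\<Sum>s\<in>T. of_int (n s) *\<^sub>R s) \<in> \<Lambda>"
      by (rule lattice_sum[OF assms(1)]) (use insert S(2) lattice_int_scale[OF assms(1)] in auto)
    moreover have "of_int (n t) *\<^sub>R t \<in> \<Lambda>" using insert S(2) lattice_int_scale[OF assms(1)] by auto
    ultimately show ?case using insert S(2) by (auto simp: add addz)
  qed (simp add: add0)
  have "\<phi>' l = \<phi> l" if l: "l \<in> \<Lambda>" for l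
  proof -
    have "\<forall>k::nat. \<exists>n. norm (of_nat k *\<^sub>R l - (\<Sum>s\<in>S. of_int (n s) *\<^sub>R s)) \<le> r"
      using S(5) lattice_int_scale[OF assms(1) l, of "int k" for k] L(2) by auto
    then obtain n where n: "\<And>k::nat. norm (of_nat k *\<^sub>R l - (\<Sum>s\<in>S. of_int (n k s) *\<^sub>R s)) \<le> r" by metis
    define p where "p k = of_nat k *\<^sub>R l - (\<Sum>s\<in>S. of_int (n k s) *\<^sub>R s)" for k
    have "p k \<in> \<Lambda>" for k unfolding p_def
      using lattice_int_scale[OF assms(1) l, of "int k"]
      by (intro L(4) lattice_sum[OF assms(1)] lattice_int_scale[OF assms(1)]) (use S(2) in auto)
    hence "range p \<subseteq> \<Lambda> \<inter> cball 0 r" using n by (auto simp: p_def)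
    hence "finite (range p)" using lattice_finite[OF assms(1) bounded_cball] finite_subset by blast
    hence "\<not> inj p" using finite_imageD infinite_UNIV_nat by blast
    then obtain j k where jk: "p j = p k" "j < k" unfolding inj_def by (metis linorder_neqE_nat)
    have eq: "of_nat (k - j) *\<^sub>R l = (\<Sum>s\<in>S. of_int (n k s - n j s) *\<^sub>R s)"
      using jk by (simp add: p_def of_nat_diff scaleR_left_diff_distrib sum_subtractf algebra_simps)
    have "of_nat (k - j) *\<^sub>R \<phi> l = \<phi> (of_nat (k - j) *\<^sub>R l)" using addn[OF l] by simp
    also have "\<dots> = (\<Sum>s\<in>S. of_int (n k s - n j s) *\<^sub>R \<phi> s)" unfolding eq by (rule adds) (use S(1) in auto)
    also have "\<dots> = \<phi>' (of_nat (k - j) *\<^sub>R l)"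
      unfolding eq using \<phi>' by (simp add: linear_sum linear_cmul del: of_int_diff)
    also have "\<dots> = of_nat (k - j) *\<^sub>R \<phi>' l" by (rule linear_cmul[OF \<phi>'(1)])
    finally show ?thesis using jk(2) by simp
  qed
  thus thesis using that \<phi>'(1) by blast
qed

text \<open>Lattice translations bring every point into a compact part of \<open>V\<close>.\<close>

lemma lattice_periodic_bounded:
  fixes F :: "complex ^ 'g \<Rightarrow> 'b::real_normed_vector"
  assumes "is_lattice V \<Lambda>" and cont: "continuous_on V F"
    and per: "\<And>w l. w \<in> V \<Longrightarrow> l \<in> \<Lambda> \<Longrightarrow> F (w + l) = F w"
  shows "bounded (F ` V)"
proof -
  note L = is_latticeD[OF assms(1)]
  obtain S r where S: "S \<subseteq> \<Lambda>" "\<And>w. w \<in> V \<Longrightarrow> \<exists>n. norm (w - (\<Sum>s\<in>S. of_int (n s) *\<^sub>R s)) \<le> r"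
    by (rule lattice_reduce[OF assms(1)]) (rule that)
  have sub: "subspace V" using L(1) by (rule vec_subspace_imp_subspace)
  have "F ` V \<subseteq> F ` (cball 0 r \<inter> V)"
  proof
    fix y assume "y \<in> F ` V"
    then obtain w where w: "w \<in> V" "y = F w" by auto
    obtain n where n: "norm (w - (\<Sum>s\<in>S. of_int (n s) *\<^sub>R s)) \<le> r" using S(2)[OF w(1)] by blast
    define l where "l = (\<Sum>s\<in>S. of_int (n s) *\<^sub>R s)"
    have l: "l \<in> \<Lambda>" unfolding l_def
      by (rule lattice_sum[OF assms(1)]) (use S(1) lattice_int_scale[OF assms(1)] in auto)
    have V: "w - l \<in> V" using subspace_diff[OF sub w(1)] l L(2) by auto
    hence "F (w - l) = y" using per[OF V l] w(2) by simp
    thus "y \<in> F ` (cball 0 r \<inter> V)" using V n by (auto simp: l_def intro!: image_eqI[of _ _ "w - l"])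
  qed
  moreover have "compact (F ` (cball 0 r \<inter> V))"
    by (intro compact_continuous_image continuous_on_subset[OF cont] compact_Int_closed closed_subspace sub) auto
  ultimately show ?thesis using bounded_subset compact_imp_bounded by blast
qed

section \<open>Complex linear algebra over the reals\<close>

definition clin :: "(complex ^ 'g \<Rightarrow> complex) \<Rightarrow> bool" where
  "clin T \<longleftrightarrow> linear T \<and> (\<forall>c v. T (c *s v) = c * T v)"

lemma clin_expand:
  assumes "clin T" shows "T w = (\<Sum>j\<in>UNIV. T (ax j) * w $ j)"
proof -
  have "T w = T (\<Sum>j\<in>UNIV. w $ j *s ax j)" by (simp add: basis_expansion)
  also have "\<dots> = (\<Sum>j\<in>UNIV. T (ax j) * w $ j)"
    using assms unfolding clin_def by (simp add: linear_sum mult.commute)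
  finally show ?thesis .
qed

lemma clin_sum: "clin (\<lambda>w. \<Sum>j\<in>UNIV. b j * w $ j)"
  unfolding clin_def
  by (auto intro!: linearI simp: algebra_simps sum.distrib sum_distrib_left scaleR_sum_right)

lemma clin_diff: "clin T \<Longrightarrow> clin U \<Longrightarrow> clin (\<lambda>w. T w - U w)"
  unfolding clin_def by (simp add: linear_compose_sub right_diff_distrib)

lemma holo_clin: "clin T \<Longrightarrow> holo V T"
  unfolding clin_def by (auto intro: holo_linear)

lemma affine_fun_iff: "affine_fun u \<longleftrightarrow> (\<exists>T c. clin T \<and> (\<forall>w. u w = T w + c))"
proof
  assume "affine_fun u"
  then obtain b c where "\<And>w. u w = (\<Sum>j\<in>UNIV. b j * w $ j) + c" by (auto simp: affine_fun_def)
  thus "\<exists>T c. clin T \<and> (\<forall>w. u w = T w + c)"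
    using clin_sum[of b] by blast
next
  assume "\<exists>T c. clin T \<and> (\<forall>w. u w = T w + c)"
  then obtain T c where T: "clin T" "\<And>w. u w = T w + c" by blast
  have "u w = (\<Sum>j\<in>UNIV. T (ax j) * w $ j) + c" for w
    using T(2)[of w] clin_expand[OF T(1), of w] by simp
  thus "affine_fun u" unfolding affine_fun_def
    by (intro exI[of _ "\<lambda>j. T (ax j)"] exI[of _ c]) blast
qed

lemma span_le_vec_span: "span S \<subseteq> vec.span (S :: (complex ^ 'g) set)"
  by (rule span_minimal) (auto simp: vec.span_superset vec_subspace_imp_subspace)

lemma vec_linear_imp_linear: "Vector_Spaces.linear (*s) (*s) (T :: complex ^ 'g \<Rightarrow> complex ^ 'h) \<Longrightarrow> linear T"
  by (rule linearI) (auto simp: vec.linear_add vec.linear_scale simp flip: vec_scale_of_real)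

text \<open>\<open>AH_core\<close> expects the coordinate vectors in the lattice. A spanning lattice
  contains a complex basis, and \<open>G\<close>, with inverse \<open>T\<close>, carries that basis
  to the standard one.\<close>

lemma AH_additive:
  fixes g :: "complex ^ 'g \<Rightarrow> complex ^ 'g \<Rightarrow> complex"
  assumes hol: "\<And>l. l \<in> \<Lambda> \<Longrightarrow> holo UNIV (g l)"
    and comm: "\<And>l m. l \<in> \<Lambda> \<Longrightarrow> m \<in> \<Lambda> \<Longrightarrow> \<exists>\<kappa>. \<forall>w. g l (w + m) - g l w - (g m (w + l) - g m w) = \<kappa>"
    and span: "span \<Lambda> = UNIV"
  obtains h where "holo UNIV h" "\<And>l. l \<in> \<Lambda> \<Longrightarrow> \<exists>T c. clin T \<and> (\<forall>w. g l w - (h (w + l) - h w) = T w + c)"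
proof -
  obtain B where B: "B \<subseteq> \<Lambda>" "vec.independent B" "\<Lambda> \<subseteq> vec.span B"
    using vec.maximal_independent_subset[of \<Lambda>] by blast
  have spanB: "vec.span B = UNIV"
    using vec.span_minimal[OF B(3) vec.subspace_span] span_le_vec_span[of \<Lambda>] span by auto
  have "card B = CARD('g)" using vec.dim_eq_card_independent[OF B(2)] vec.dim_span[of B] spanB
    by (simp add: card_cart_basis)
  then obtain \<beta> where \<beta>: "bij_betw \<beta> (UNIV :: 'g set) B"
    using finite_same_card_bij[of "UNIV :: 'g set" B] vec.finiteI_independent[OF B(2)] by auto
  obtain G where G: "Vector_Spaces.linear (*s) (*s) G" "\<And>b. b \<in> B \<Longrightarrow> G b = ax (inv_into UNIV \<beta> b)"
    using vec.linear_independent_extend[OF B(2), of "\<lambda>b. ax (inv_into UNIV \<beta> b)"] by blast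
  have G\<beta>: "G (\<beta> j) = ax j" for j
  proof -
    have "\<beta> j \<in> B" "inv_into UNIV \<beta> (\<beta> j) = j" using \<beta> by (auto simp: bij_betw_def)
    thus ?thesis using G(2) by simp
  qed
  define T where "T w = (\<Sum>j\<in>UNIV. w $ j *s \<beta> j)" for w :: "complex ^ 'g"
  have T: "Vector_Spaces.linear (*s) (*s) T"
    unfolding T_def by unfold_locales (auto simp: vec.scale_left_distrib sum.distrib vec.scale_sum_right mult.assoc)
  have Tax: "T (ax j) = \<beta> j" for j
  proof -
    have "T (ax j) = (\<Sum>i\<in>UNIV. if i = j then \<beta> j else 0)"
      unfolding T_def by (rule sum.cong) (auto simp: axis_def)
    thus ?thesis by simp
  qed
  have GT: "G (T w) = w" for w
    unfolding T_def using G\<beta> by (simp add: vec.linear_sum[OF G(1)] vec.linear_scale[OF G(1)] basis_expansion)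
  have TG: "T (G w) = w" for w
  proof (rule vec.linear_eq_on[of "T \<circ> G" "\<lambda>x. x" w B, simplified])
    show "Vector_Spaces.linear (*s) (*s) (T \<circ> G)" using G(1) T by (rule Vector_Spaces.linear_compose)
    show "Vector_Spaces.linear (*s) (*s) (\<lambda>x. x)" by (rule vec.linear_ident)
    show "w \<in> vec.span B" by (simp add: spanB)
    fix b assume "b \<in> B"
    then obtain j where "b = \<beta> j" using \<beta> by (auto simp: bij_betw_def)
    thus "T (G b) = b" by (simp add: G\<beta> Tax)
  qed
  note linT = vec_linear_imp_linear[OF T] vec.linear_scale[OF T]
  note linG = vec_linear_imp_linear[OF G(1)] vec.linear_scale[OF G(1)]
  obtain h where h: "holo UNIV h" "\<And>l. l \<in> G ` \<Lambda> \<Longrightarrow> affine_fun (\<lambda>w. g (T l) (T w) - (h (w + l) - h w))"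
  proof (rule AH_core[of "G ` \<Lambda>" "\<lambda>l w. g (T l) (T w)"])
    show "holo UNIV (\<lambda>w. g (T l) (T w))" if "l \<in> G ` \<Lambda>" for l
      using holo_compose_affine[OF hol linT, of "T l" 0] that by (auto simp: TG)
    show "\<exists>\<kappa>. \<forall>w. g (T l) (T (w + m)) - g (T l) (T w) - (g (T m) (T (w + l)) - g (T m) (T w)) = \<kappa>"
      if lm: "l \<in> G ` \<Lambda>" "m \<in> G ` \<Lambda>" for l m
    proof -
      obtain \<kappa> where "\<forall>w. g (T l) (w + T m) - g (T l) w - (g (T m) (w + T l) - g (T m) w) = \<kappa>"
        using comm[of "T l" "T m"] lm by (auto simp: TG)
      thus ?thesis by (auto simp: vec.linear_add[OF T])
    qed
    show "ax j \<in> G ` \<Lambda>" for j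
      using G\<beta>[of j] \<beta> B(1) by (metis UNIV_I bij_betwE imageI subsetD)
    have "span (G ` \<Lambda>) = G ` UNIV" using linear_span_image[OF linG(1)] span by metis
    also have "\<dots> = UNIV" using GT by (metis surjI)
    finally show "span (G ` \<Lambda>) = UNIV" .
  qed blast
  show thesis
  proof (rule that)
    show "holo UNIV (\<lambda>w. h (G w))" using holo_compose_affine[OF h(1) linG, of 0] by simp
    fix l assume "l \<in> \<Lambda>"
    then obtain U c where U: "clin U" "\<And>w. g l (T w) - (h (w + G l) - h w) = U w + c"
      using h(2)[of "G l"] by (auto simp: affine_fun_iff TG)
    have "clin (\<lambda>w. U (G w))" using U(1) linG unfolding clin_def
      by (auto intro: linear_compose[unfolded o_def])
    moreover have "g l w - (h (G (w + l)) - h (G w)) = U (G w) + c" for w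
      using U(2)[of "G w"] by (simp add: TG vec.linear_add[OF G(1)])
    ultimately show "\<exists>T c. clin T \<and> (\<forall>w. g l w - (h (G (w + l)) - h (G w)) = T w + c)" by blast
  qed
qed

lemma factorsD:
  assumes "f \<in> carrier (factors V \<Lambda>)"
  shows "\<And>l. l \<in> \<Lambda> \<Longrightarrow> holo V (f l)" "\<And>l w. f l w \<noteq> 0"
    "\<And>l m w. l \<in> \<Lambda> \<Longrightarrow> m \<in> \<Lambda> \<Longrightarrow> w \<in> V \<Longrightarrow> f (l + m) w = f l (w + m) * f m w"
    "\<And>l w. l \<notin> \<Lambda> \<or> w \<notin> V \<Longrightarrow> f l w = 1"
  using assms unfolding factors_def by auto

text \<open>\<open>E = B - B\<^sup>T\<close> represents the first Chern class.\<close>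

definition exponent_form :: "(complex ^ 'g \<Rightarrow> complex ^ 'g \<Rightarrow> complex) \<Rightarrow> (complex ^ 'g \<Rightarrow> complex ^ 'g \<Rightarrow> real) \<Rightarrow> bool" where
  "exponent_form B E \<longleftrightarrow> (\<forall>x. clin (B x)) \<and> (\<forall>y. linear (\<lambda>x. B x y)) \<and> (\<forall>x y. of_real (E x y) = B x y - B y x)"

text \<open>The Appell-Humbert form without conditions on the constants \<open>c l\<close>; what
  later arguments use about them is read off from the cocycle identity of \<open>f\<close>. A
  general \<open>V\<close> lets the notion pass to subtori.\<close>

definition has_form :: "(complex ^ 'g) set \<Rightarrow> (complex ^ 'g) set \<Rightarrow> 'g factor \<Rightarrow>
    (complex ^ 'g \<Rightarrow> complex ^ 'g \<Rightarrow> real) \<Rightarrow> bool" where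
  "has_form V \<Lambda> f E \<longleftrightarrow> (\<exists>h B c. holo V h \<and> (\<forall>w\<in>V. h w \<noteq> 0) \<and> exponent_form B E \<and>
     (\<forall>l\<in>\<Lambda>. \<forall>w\<in>V. f l w = h (w + l) / h w * ce (B l w + c l)))"

lemma bilinear_eq_0_on_lattice:
  fixes D :: "complex ^ 'g \<Rightarrow> complex ^ 'g \<Rightarrow> 'b::real_vector"
  assumes "span \<Lambda> = UNIV" "\<And>y. linear (\<lambda>x. D x y)" "\<And>x. linear (D x)"
    "\<And>l m. l \<in> \<Lambda> \<Longrightarrow> m \<in> \<Lambda> \<Longrightarrow> D l m = 0"
  shows "D x y = 0"
proof -
  have sp: "x \<in> span \<Lambda>" for x using assms(1) by (metis UNIV_I)
  have D0: "D l y = 0" if "l \<in> \<Lambda>" for l y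
    by (rule linear_eq_0_on_span[OF assms(3) assms(4)[OF that] sp])
  show ?thesis
    by (rule linear_eq_0_on_span[OF assms(2) D0 sp])
qed

lemma clin_constant_imp_0:
  assumes "clin T" "\<And>w. T w + c \<in> \<int>" shows "T w = 0"
proof -
  have "T w + c = T 0 + c"
    by (rule int_valued_constant[of UNIV "\<lambda>w. T w + c"])
       (use assms(2) holo_continuous_on[OF holo_add[OF holo_clin[OF assms(1)] holo_const]] in auto)
  thus ?thesis using assms(1) by (simp add: clin_def linear_0)
qed

text \<open>\<open>AH_additive\<close> applies to the logarithms \<open>g l\<close> because their
  commutation defects are integers, hence constant. The resulting linear parts \<open>T l\<close>
  are additive in \<open>l\<close>, since their defect is affine and integer valued; so they extend
  to a form \<open>B\<close> that is real linear in the first argument.\<close>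

theorem appell_humbert:
  assumes L: "is_lattice UNIV \<Lambda>" and f: "f \<in> carrier (factors UNIV \<Lambda>)"
  obtains E where "has_form UNIV \<Lambda> f E"
proof -
  note LD = is_latticeD[OF L]
  note F = factorsD[OF f]
  have "\<exists>g. holo UNIV g \<and> (\<forall>w. f l w = ce (g w))" if l: "l \<in> \<Lambda>" for l
  proof -
    obtain g where g: "holo UNIV g" "\<And>w. f l w = exp (g w)" using holo_log[OF F(1)[OF l] F(2)] by blast
    have "holo UNIV (\<lambda>w. g w / (2 * of_real pi * \<i>))" by (intro holo_divide g holo_const) simp
    moreover have "f l w = ce (g w / (2 * of_real pi * \<i>))" for w by (simp add: g(2) ce_def)
    ultimately show ?thesis by blast
  qed
  then obtain g where g: "\<And>l. l \<in> \<Lambda> \<Longrightarrow> holo UNIV (g l)" "\<And>l w. l \<in> \<Lambda> \<Longrightarrow> f l w = ce (g l w)" by metis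
  obtain h where h: "holo UNIV h" "\<And>l. l \<in> \<Lambda> \<Longrightarrow> \<exists>T c. clin T \<and> (\<forall>w. g l w - (h (w + l) - h w) = T w + c)"
  proof (rule AH_additive[OF g(1) _ LD(6)])
    fix l m assume lm: "l \<in> \<Lambda>" "m \<in> \<Lambda>"
    define D where "D w = g l (w + m) - g l w - (g m (w + l) - g m w)" for w
    have "D w \<in> \<int>" for w
    proof -
      have "ce (g l (w + m) + g m w) = ce (g m (w + l) + g l w)"
        using F(3)[OF lm, of w] F(3)[OF lm(2,1), of w] lm by (simp add: ce_add g(2) ac_simps)
      thus ?thesis unfolding ce_eq_iff D_def by (simp add: algebra_simps)
    qed
    moreover have "holo UNIV D" unfolding D_def using lm
      by (intro holo_diff holo_shift g)
    ultimately have "D w = D 0" for w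
      using int_valued_constant[of UNIV D w 0] holo_continuous_on by auto
    thus "\<exists>\<kappa>. \<forall>w. g l (w + m) - g l w - (g m (w + l) - g m w) = \<kappa>" unfolding D_def by blast
  qed (assumption, rule that)
  then obtain T c where T: "\<And>l. l \<in> \<Lambda> \<Longrightarrow> clin (T l)" "\<And>l w. l \<in> \<Lambda> \<Longrightarrow> g l w - (h (w + l) - h w) = T l w + c l"
    by metis
  have fT: "f l w = ce (h (w + l) - h w) * ce (T l w + c l)" if "l \<in> \<Lambda>" for l w
    using g(2)[OF that, of w] by (simp flip: T(2)[OF that] ce_add)
  have coc: "T (l + m) w - T l w - T m w + (c (l + m) - c l - c m - T l m) \<in> \<int>"
    if lm: "l \<in> \<Lambda>" "m \<in> \<Lambda>" for l m w
  proof -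
    have "ce (h (w + (l + m)) - h w) * ce (T (l + m) w + c (l + m))
        = ce (h (w + m + l) - h (w + m)) * ce (T l (w + m) + c l) * (ce (h (w + m) - h w) * ce (T m w + c m))"
      using F(3)[OF lm, of w] fT lm LD(8)[OF lm] by simp
    hence "ce (h (w + (l + m)) - h w) * ce (T (l + m) w + c (l + m))
        = ce (h (w + (l + m)) - h w) * (ce (T l (w + m) + c l) * ce (T m w + c m))"
      by (simp add: ce_diff add_ac)
    hence "ce (T (l + m) w + c (l + m)) = ce (T l (w + m) + c l + (T m w + c m))" by (simp add: ce_add)
    hence "(T (l + m) w + c (l + m)) - (T l (w + m) + c l + (T m w + c m)) \<in> \<int>" by (simp only: ce_eq_iff)
    moreover have "T l (w + m) = T l w + T l m" using T(1)[OF lm(1)] by (simp add: clin_def linear_add)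
    ultimately show ?thesis by (simp add: algebra_simps)
  qed
  have Tadd: "T (l + m) w = T l w + T m w" if lm: "l \<in> \<Lambda>" "m \<in> \<Lambda>" for l m w
  proof -
    have "clin (\<lambda>w. T (l + m) w - T l w - T m w)"
      by (intro clin_diff T(1) lm LD(8)[OF lm])
    from clin_constant_imp_0[OF this coc[OF lm], of w] show ?thesis by (simp add: algebra_simps)
  qed
  obtain \<phi> :: "complex ^ 'a \<Rightarrow> complex ^ 'a" where \<phi>: "linear \<phi>" "\<And>l. l \<in> \<Lambda> \<Longrightarrow> \<phi> l = (\<chi> j. T l (ax j))"
    using lattice_additive_extends[OF L, of "\<lambda>l. \<chi> j. T l (ax j)"] Tadd by (auto simp: vec_eq_iff)
  define B where "B x w = (\<Sum>j\<in>UNIV. \<phi> x $ j * w $ j)" for x w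
  have B1: "clin (B x)" for x unfolding B_def by (rule clin_sum)
  have B2: "linear (\<lambda>x. B x y)" for y
    unfolding B_def by (rule linearI) (auto simp: linear_add[OF \<phi>(1)] linear_cmul[OF \<phi>(1)] algebra_simps sum.distrib scaleR_sum_right)
  have BT: "B l w = T l w" if "l \<in> \<Lambda>" for l w
    using clin_expand[OF T(1)[OF that], of w] by (simp add: B_def \<phi>(2)[OF that])
  \<comment> \<open>Comparing the cocycle defects of the pairs \<open>l\<close>, \<open>m\<close>
    and \<open>m\<close>, \<open>l\<close> eliminates the constants \<open>c\<close>.\<close>
  have Bint: "B l m - B m l \<in> \<int>" if lm: "l \<in> \<Lambda>" "m \<in> \<Lambda>" for l m
  proof -
    have "c (l + m) - c l - c m - T l m \<in> \<int>" using coc[OF lm, of 0] Tadd[OF lm, of 0] by simp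
    moreover have "c (m + l) - c m - c l - T m l \<in> \<int>" using coc[OF lm(2,1), of 0] Tadd[OF lm(2,1), of 0] by simp
    ultimately have "(c (m + l) - c m - c l - T m l) - (c (l + m) - c l - c m - T l m) \<in> \<int>" by (rule Ints_diff[rotated])
    thus ?thesis by (simp add: BT lm add.commute algebra_simps)
  qed
  define E where "E x y = Re (B x y - B y x)" for x y
  have lin2: "linear (B x)" for x using B1 by (simp add: clin_def)
  \<comment> \<open>Integral on the lattice, hence real there, hence real everywhere because the
    lattice spans over the reals.\<close>
  have "Im (B x y - B y x) = 0" for x y
  proof (rule bilinear_eq_0_on_lattice[OF LD(6), of "\<lambda>x y. Im (B x y - B y x)"])
    show "linear (\<lambda>x. Im (B x y - B y x))" for y
      using linear_compose[OF linear_compose_sub[OF B2 lin2] bounded_linear.linear[OF bounded_linear_Im]] by (simp add: o_def)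
    show "linear (\<lambda>y. Im (B x y - B y x))" for x
      using linear_compose[OF linear_compose_sub[OF lin2 B2] bounded_linear.linear[OF bounded_linear_Im]] by (simp add: o_def)
    show "Im (B l m - B m l) = 0" if "l \<in> \<Lambda>" "m \<in> \<Lambda>" for l m using Bint[OF that] by (elim Ints_cases) (simp only: complex_Im_of_int)
  qed
  hence "of_real (E x y) = B x y - B y x" for x y by (simp add: E_def complex_eq_iff)
  hence "exponent_form B E" using B1 B2 by (simp add: exponent_form_def)
  moreover have "f l w = ce (h (w + l)) / ce (h w) * ce (B l w + c l)" if "l \<in> \<Lambda>" for l w
    using fT[OF that, of w] by (simp add: BT[OF that] ce_diff)
  moreover have "holo UNIV (\<lambda>w. ce (h w))" by (rule holo_ce[OF h(1)])
  ultimately have "has_form UNIV \<Lambda> f E" unfolding has_form_def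
    by (intro exI[of _ "\<lambda>w. ce (h w)"] exI[of _ B] exI[of _ c]) auto
  thus thesis by (rule that)
qed

section \<open>Groups of points and of line bundles, and their extension to the rationals\<close>

section \<open>Quotients of abelian groups\<close>

context comm_group
begin

lemma rcos_mult:
  assumes "subgroup H G" "x \<in> carrier G" "y \<in> carrier G"
  shows "(H #> x) \<otimes>\<^bsub>G Mod H\<^esub> (H #> y) = H #> (x \<otimes> y)"
  using normal.rcos_sum[OF subgroup_imp_normal[OF assms(1)]] assms by simp

lemma mem_rcos_iff:
  assumes "subgroup H G" "x \<in> carrier G"
  shows "y \<in> H #> x \<longleftrightarrow> y \<in> carrier G \<and> y \<otimes> inv x \<in> H"
proof
  assume "y \<in> H #> x"
  then obtain h where h: "h \<in> H" "y = h \<otimes> x" by (auto simp: r_coset_def)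
  hence "h \<in> carrier G" using subgroup.mem_carrier[OF assms(1)] by blast
  thus "y \<in> carrier G \<and> y \<otimes> inv x \<in> H" using h assms(2) by (simp add: m_assoc)
next
  assume y: "y \<in> carrier G \<and> y \<otimes> inv x \<in> H"
  hence "y = (y \<otimes> inv x) \<otimes> x" using assms(2) by (simp add: m_assoc)
  thus "y \<in> H #> x" using y by (auto simp: r_coset_def)
qed

lemma rcos_eq_iff:
  assumes "subgroup H G" "x \<in> carrier G" "y \<in> carrier G"
  shows "H #> x = H #> y \<longleftrightarrow> x \<otimes> inv y \<in> H"
proof
  assume "H #> x = H #> y"
  hence "x \<in> H #> y" using rcos_self[OF assms(2,1)] by simp
  thus "x \<otimes> inv y \<in> H" using mem_rcos_iff assms by blast
next
  assume "x \<otimes> inv y \<in> H"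
  hence "x \<in> H #> y" using mem_rcos_iff assms by blast
  thus "H #> x = H #> y" using repr_independence assms by metis
qed

lemma rcos_pow:
  assumes "subgroup H G" "x \<in> carrier G"
  shows "(H #> x) [^]\<^bsub>G Mod H\<^esub> (n::nat) = H #> (x [^] n)"
proof (induction n)
  case 0
  thus ?case using assms by (simp add: coset_join2 subgroup.one_closed subgroup.subset)
next
  case (Suc n)
  thus ?case using rcos_mult[OF assms(1)] assms(2) by simp
qed

end

section \<open>Rational extension of groups\<close>

lemma (in monoid) equiv_rat_rel: "equiv (carrier G \<times> {0<..}) (rat_rel G)"
proof (rule equivI)
  show "rat_rel G \<subseteq> (carrier G \<times> {0<..}) \<times> (carrier G \<times> {0<..})" by (auto simp: rat_rel_def)
  show "refl_on (carrier G \<times> {0<..}) (rat_rel G)"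
    by (rule refl_onI) (auto simp: rat_rel_def)
  show "sym (rat_rel G)" by (rule symI) (force simp: rat_rel_def)
  show "trans (rat_rel G)"
  proof (rule transI)
    fix a b c assume "(a, b) \<in> rat_rel G" "(b, c) \<in> rat_rel G"
    moreover obtain x m y n z p where "a = (x, m)" "b = (y, n)" "c = (z, p)" by (metis surj_pair)
    ultimately obtain j k where *: "x \<in> carrier G" "y \<in> carrier G" "z \<in> carrier G" "0 < m" "0 < n" "0 < p"
        "0 < k" "0 < j" "x [^] (k * n) = y [^] (k * m)" "y [^] (j * p) = z [^] (j * n)"
        "a = (x, m)" "c = (z, p)"
      by (auto simp: rat_rel_def)
    have "x [^] ((k * j * n) * p) = (x [^] (k * n)) [^] (j * p)"
      unfolding nat_pow_pow[OF *(1)] by (simp only: mult_ac)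
    also have "\<dots> = (y [^] (j * p)) [^] (k * m)"
      unfolding *(9) nat_pow_pow[OF *(2)] by (simp only: mult_ac)
    also have "\<dots> = z [^] ((k * j * n) * m)"
      unfolding *(10) nat_pow_pow[OF *(3)] by (simp only: mult_ac)
    finally show "(a, c) \<in> rat_rel G" using * unfolding rat_rel_def by (auto intro!: exI[of _ "k * j * n"])
  qed
qed

lemma rat_relI:
  assumes "x \<in> carrier G" "y \<in> carrier G" "0 < m" "0 < n" "x [^]\<^bsub>G\<^esub> (n :: nat) = y [^]\<^bsub>G\<^esub> (m :: nat)"
  shows "((x, m), (y, n)) \<in> rat_rel G"
  using assms by (auto simp: rat_rel_def intro!: exI[of _ 1])

context monoid
begin

lemma rat_frac_in: "x \<in> carrier G \<Longrightarrow> 0 < m \<Longrightarrow> rat_frac G x m \<in> tensor_rat G"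
  by (auto simp: rat_frac_def tensor_rat_def intro: quotientI)

lemma rat_frac_self: "x \<in> carrier G \<Longrightarrow> 0 < m \<Longrightarrow> (x, m) \<in> rat_frac G x m"
  using equiv_class_self[OF equiv_rat_rel, of "(x, m)"] by (simp add: rat_frac_def)

lemma rat_frac_eq_iff:
  assumes "x \<in> carrier G" "0 < m" "y \<in> carrier G" "0 < n"
  shows "rat_frac G x m = rat_frac G y n \<longleftrightarrow> ((x, m), (y, n)) \<in> rat_rel G"
  unfolding rat_frac_def by (rule eq_equiv_class_iff[OF equiv_rat_rel]) (use assms in auto)

lemma tensor_ratD:
  assumes "c \<in> tensor_rat G" "(x, m) \<in> c"
  shows "x \<in> carrier G" "0 < m" "c = rat_frac G x m"
proof -
  obtain p where p: "p \<in> carrier G \<times> {0<..}" "c = rat_rel G `` {p}"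
    using assms(1) by (auto simp: tensor_rat_def elim: quotientE)
  hence r: "(p, (x, m)) \<in> rat_rel G" using assms(2) by auto
  thus "x \<in> carrier G" "0 < m" by (auto simp: rat_rel_def)
  show "c = rat_frac G x m" unfolding rat_frac_def p(2) using equiv_class_eq[OF equiv_rat_rel r] .
qed

lemma tensor_ratE:
  assumes "c \<in> tensor_rat G"
  obtains x m where "x \<in> carrier G" "0 < m" "c = rat_frac G x m" "(x, m) \<in> c"
proof -
  obtain p where p: "p \<in> carrier G \<times> {0<..}" "c = rat_rel G `` {p}"
    using assms by (auto simp: tensor_rat_def elim: quotientE)
  thus thesis using that[of "fst p" "snd p"] rat_frac_self[of "fst p" "snd p"]
    by (auto simp: rat_frac_def)
qed

lemma map_rat_eq:
  assumes "(x, m) \<in> c" "\<And>y n. (y, n) \<in> c \<Longrightarrow> ((h y, n), (h x, m)) \<in> rat_rel G"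
  shows "map_rat G h c = rat_frac G (h x) m"
proof -
  have eq: "rat_frac G (h y) n = rat_frac G (h x) m" if "(y, n) \<in> c" for y n
    unfolding rat_frac_def by (rule equiv_class_eq[OF equiv_rat_rel assms(2)[OF that]])
  show ?thesis unfolding map_rat_def
  proof (rule SUP_eq_const)
    show "c \<noteq> {}" using assms(1) by blast
    fix p assume "p \<in> c"
    thus "(case p of (x, m) \<Rightarrow> rat_frac G (h x) m) = rat_frac G (h x) m"
      using eq[of "fst p" "snd p"] by (simp add: case_prod_beta)
  qed
qed

end

text \<open>An additive injection into families of real vectors rules out torsion, so fractions are
  compared by comparing real vectors. It is used for Neron-Severi classes, with the values of forms,
  and for endomorphisms, with the values of lifts.\<close>

locale vector_embedding = monoid G for G (structure) +
  fixes \<rho> :: "'a \<Rightarrow> 'i \<Rightarrow> 'v::real_vector"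
  assumes hom: "x \<in> carrier G \<Longrightarrow> y \<in> carrier G \<Longrightarrow> \<rho> (x \<otimes> y) i = \<rho> x i + \<rho> y i"
    and inj: "x \<in> carrier G \<Longrightarrow> y \<in> carrier G \<Longrightarrow> \<rho> x = \<rho> y \<Longrightarrow> x = y"
begin

lemma pow: "x \<in> carrier G \<Longrightarrow> \<rho> (x [^] (n::nat)) i = real n *\<^sub>R \<rho> x i"
proof (induction n)
  case 0
  have "\<rho> \<one> i = \<rho> \<one> i + \<rho> \<one> i" using hom[of \<one> \<one> i] by simp
  thus ?case by simp
qed (simp add: hom scaleR_left_distrib add.commute)

lemma rat_rel_iff:
  assumes "x \<in> carrier G" "y \<in> carrier G" "0 < m" "0 < n"
  shows "((x, m), (y, n)) \<in> rat_rel G \<longleftrightarrow> (\<forall>i. \<rho> x i /\<^sub>R real m = \<rho> y i /\<^sub>R real n)"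
proof
  assume "((x, m), (y, n)) \<in> rat_rel G"
  then obtain k where k: "k > 0" "x [^] (k * n) = y [^] (k * m)" by (auto simp: rat_rel_def)
  show "\<forall>i. \<rho> x i /\<^sub>R real m = \<rho> y i /\<^sub>R real n"
  proof
    fix i
    have "real (k * n) *\<^sub>R \<rho> x i = real (k * m) *\<^sub>R \<rho> y i" using pow[OF assms(1), of "k * n" i] pow[OF assms(2), of "k * m" i] k(2) by simp
    hence "(1 / (real k * real m * real n)) *\<^sub>R (real (k * n) *\<^sub>R \<rho> x i) = (1 / (real k * real m * real n)) *\<^sub>R (real (k * m) *\<^sub>R \<rho> y i)" by simp
    thus "\<rho> x i /\<^sub>R real m = \<rho> y i /\<^sub>R real n" using k(1) assms by (simp add: field_simps)
  qed
next
  assume *: "\<forall>i. \<rho> x i /\<^sub>R real m = \<rho> y i /\<^sub>R real n"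
  have "\<rho> (x [^] n) = \<rho> (y [^] m)"
  proof
    fix i
    have "real n *\<^sub>R \<rho> x i = (real n * real m) *\<^sub>R (\<rho> x i /\<^sub>R real m)" using assms by simp
    also have "\<dots> = real m *\<^sub>R \<rho> y i" unfolding spec[OF *] using assms by simp
    finally show "\<rho> (x [^] n) i = \<rho> (y [^] m) i" using pow assms by simp
  qed
  hence "x [^] n = y [^] m" using inj assms by simp
  thus "((x, m), (y, n)) \<in> rat_rel G" by (rule rat_relI[OF assms])
qed

definition ext :: "('a \<times> nat) set \<Rightarrow> 'i \<Rightarrow> 'v" where
  "ext c i = (let (x, m) = SOME p. p \<in> c in \<rho> x i /\<^sub>R real m)"

lemma ext_eq:
  assumes "c \<in> tensor_rat G" "(x, m) \<in> c" shows "ext c i = \<rho> x i /\<^sub>R real m"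
proof -
  obtain y n where yn: "(SOME p. p \<in> c) = (y, n)" by (metis surj_pair)
  have "(y, n) \<in> c" using someI[of "\<lambda>p. p \<in> c"] assms(2) yn by metis
  note yc = tensor_ratD[OF assms(1) this] and xc = tensor_ratD[OF assms]
  have "ext c i = \<rho> y i /\<^sub>R real n" by (simp add: ext_def yn)
  moreover have "rat_frac G y n = rat_frac G x m" using yc(3) xc(3) by simp
  ultimately show ?thesis
    using rat_rel_iff[of y x n m] rat_frac_eq_iff[of y n x m] yc(1,2) xc(1,2) by simp
qed

lemma ext_frac: "x \<in> carrier G \<Longrightarrow> 0 < m \<Longrightarrow> ext (rat_frac G x m) i = \<rho> x i /\<^sub>R real m"
  by (rule ext_eq) (auto intro: rat_frac_in rat_frac_self)

lemma ext_inj: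
  assumes "c \<in> tensor_rat G" "d \<in> tensor_rat G" "ext c = ext d" shows "c = d"
proof -
  obtain x m where x: "x \<in> carrier G" "0 < m" "c = rat_frac G x m" using tensor_ratE[OF assms(1)] by metis
  obtain y n where y: "y \<in> carrier G" "0 < n" "d = rat_frac G y n" using tensor_ratE[OF assms(2)] by metis
  have "\<rho> x i /\<^sub>R real m = \<rho> y i /\<^sub>R real n" for i
    using ext_frac[OF x(1,2), of i] ext_frac[OF y(1,2), of i] assms(3) x(3) y(3) by simp
  thus ?thesis
    unfolding x(3) y(3) using rat_frac_eq_iff[OF x(1,2) y(1,2)] rat_rel_iff[OF x(1) y(1) x(2) y(2)] by blast
qed

end

section \<open>Complex tori\<close>

lemma vec_group_simps [simp]:
  "carrier (vec_group V) = V" "x \<otimes>\<^bsub>vec_group V\<^esub> y = x + y" "\<one>\<^bsub>vec_group V\<^esub> = 0"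
  by (simp_all add: vec_group_def)

lemma comm_group_vec_group: "vec.subspace V \<Longrightarrow> comm_group (vec_group V)"
  by (rule comm_groupI)
     (auto simp: vec.subspace_add vec.subspace_0 add_ac intro!: bexI[of _ "- _"] vec.subspace_neg)

lemma inv_vec_group: "vec.subspace V \<Longrightarrow> x \<in> V \<Longrightarrow> inv\<^bsub>vec_group V\<^esub> x = - x"
  using comm_group.axioms(2)[OF comm_group_vec_group]
  by (intro group.inv_equality) (auto simp: vec.subspace_neg)

lemma lattice_subgroup:
  assumes "is_lattice V \<Lambda>" shows "subgroup \<Lambda> (vec_group V)"
  using is_latticeD[OF assms] by unfold_locales (auto simp: inv_vec_group subset_iff)

lemma comm_group_torus: "is_lattice V \<Lambda> \<Longrightarrow> comm_group (torus V \<Lambda>)"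
  unfolding torus_def
  by (intro comm_group.abelian_FactGroup lattice_subgroup comm_group_vec_group is_latticeD(1))

context
  fixes V \<Lambda> :: "(complex ^ 'g) set"
  assumes L: "is_lattice V \<Lambda>"
begin

interpretation vg: comm_group "vec_group V"
  by (rule comm_group_vec_group[OF is_latticeD(1)[OF L]])

lemma carrier_torus: "carrier (torus V \<Lambda>) = proj V \<Lambda> ` V"
  by (auto simp: torus_def carrier_FactGroup proj_def)

lemma one_torus: "\<one>\<^bsub>torus V \<Lambda>\<^esub> = \<Lambda>" by (simp add: torus_def)

lemma proj_add: "v \<in> V \<Longrightarrow> w \<in> V \<Longrightarrow> proj V \<Lambda> v \<otimes>\<^bsub>torus V \<Lambda>\<^esub> proj V \<Lambda> w = proj V \<Lambda> (v + w)"
  using vg.rcos_mult[OF lattice_subgroup[OF L]] by (simp add: torus_def proj_def del: mult_FactGroup)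

lemma proj_eq_iff: "v \<in> V \<Longrightarrow> w \<in> V \<Longrightarrow> proj V \<Lambda> v = proj V \<Lambda> w \<longleftrightarrow> v - w \<in> \<Lambda>"
  using vg.rcos_eq_iff[OF lattice_subgroup[OF L]] by (simp add: proj_def inv_vec_group is_latticeD(1)[OF L])

lemma mem_proj_iff: "v \<in> V \<Longrightarrow> w \<in> proj V \<Lambda> v \<longleftrightarrow> w \<in> V \<and> w - v \<in> \<Lambda>"
  using vg.mem_rcos_iff[OF lattice_subgroup[OF L]] by (simp add: proj_def inv_vec_group is_latticeD(1)[OF L])

lemma proj_eq_one_iff: "v \<in> V \<Longrightarrow> proj V \<Lambda> v = \<Lambda> \<longleftrightarrow> v \<in> \<Lambda>"
proof -
  assume v: "v \<in> V"
  have "proj V \<Lambda> 0 = \<Lambda>"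
    using proj_eq_iff[of 0 0] by (simp add: proj_def r_coset_def)
  thus ?thesis using proj_eq_iff[OF v vec.subspace_0[OF is_latticeD(1)[OF L]]] by simp
qed

lemma proj_pow: "v \<in> V \<Longrightarrow> proj V \<Lambda> v [^]\<^bsub>torus V \<Lambda>\<^esub> (n::nat) = proj V \<Lambda> (real n *\<^sub>R v)"
proof (induction n)
  case 0
  thus ?case using proj_eq_one_iff[of 0] is_latticeD(3)[OF L] vec.subspace_0[OF is_latticeD(1)[OF L]]
    by (simp add: one_torus)
next
  case (Suc n)
  have "real n *\<^sub>R v \<in> V" using Suc.prems vec_subspace_imp_subspace[OF is_latticeD(1)[OF L]] subspace_scale by blast
  thus ?case using Suc proj_add[of "real n *\<^sub>R v" v]
    by (simp add: scaleR_left_distrib add.commute)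
qed

end

section \<open>Line bundles as cocycle classes\<close>

lemma factors_simps [simp]:
  "f \<otimes>\<^bsub>factors V \<Lambda>\<^esub> g = (\<lambda>l w. f l w * g l w)" "\<one>\<^bsub>factors V \<Lambda>\<^esub> = (\<lambda>l w. 1)"
  by (simp_all add: factors_def)

lemma factorsI:
  assumes "\<And>l. l \<in> \<Lambda> \<Longrightarrow> holo V (f l)" "\<And>l w. f l w \<noteq> 0"
    "\<And>l m w. l \<in> \<Lambda> \<Longrightarrow> m \<in> \<Lambda> \<Longrightarrow> w \<in> V \<Longrightarrow> f (l + m) w = f l (w + m) * f m w"
    "\<And>l w. l \<notin> \<Lambda> \<or> w \<notin> V \<Longrightarrow> f l w = 1"
  shows "f \<in> carrier (factors V \<Lambda>)"
  using assms unfolding factors_def by auto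

lemma comm_group_factors: "comm_group (factors V \<Lambda>)"
proof (rule comm_groupI)
  fix f g assume f: "f \<in> carrier (factors V \<Lambda>)" and g: "g \<in> carrier (factors V \<Lambda>)"
  show "f \<otimes>\<^bsub>factors V \<Lambda>\<^esub> g \<in> carrier (factors V \<Lambda>)"
    using factorsD[OF f] factorsD[OF g] by (intro factorsI) (auto intro!: holo_mult)
next
  show "\<one>\<^bsub>factors V \<Lambda>\<^esub> \<in> carrier (factors V \<Lambda>)" by (rule factorsI) auto
next
  fix f assume f: "f \<in> carrier (factors V \<Lambda>)"
  have "(\<lambda>l w. inverse (f l w)) \<in> carrier (factors V \<Lambda>)"
    using factorsD[OF f] by (intro factorsI holo_inverse) auto
  thus "\<exists>g\<in>carrier (factors V \<Lambda>). g \<otimes>\<^bsub>factors V \<Lambda>\<^esub> f = \<one>\<^bsub>factors V \<Lambda>\<^esub>"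
    by (rule bexI[rotated]) (use factorsD(2)[OF f] in simp)
qed (auto simp: mult_ac)

lemma inv_factors:
  assumes "f \<in> carrier (factors V \<Lambda>)" shows "inv\<^bsub>factors V \<Lambda>\<^esub> f = (\<lambda>l w. inverse (f l w))"
proof (rule group.inv_equality[OF comm_group.axioms(2)[OF comm_group_factors]])
  show "(\<lambda>l w. inverse (f l w)) \<in> carrier (factors V \<Lambda>)"
    using factorsD[OF assms] by (intro factorsI holo_inverse) auto
qed (use assms factorsD(2)[OF assms] in auto)

lemma coboundaryI:
  assumes "f \<in> carrier (factors V \<Lambda>)" "holo V h" "\<And>w. w \<in> V \<Longrightarrow> h w \<noteq> 0"
    "\<And>l w. l \<in> \<Lambda> \<Longrightarrow> w \<in> V \<Longrightarrow> f l w = h (w + l) / h w"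
  shows "f \<in> coboundaries V \<Lambda>"
proof -
  have "f = coboundary V \<Lambda> h"
    using assms(4) factorsD(4)[OF assms(1)] unfolding coboundary_def by (intro ext) auto
  thus ?thesis using assms(2,3) unfolding coboundaries_def by blast
qed

lemma coboundaryE:
  assumes "f \<in> coboundaries V \<Lambda>"
  obtains h where "holo V h" "\<And>w. w \<in> V \<Longrightarrow> h w \<noteq> 0"
    "\<And>l w. l \<in> \<Lambda> \<Longrightarrow> w \<in> V \<Longrightarrow> f l w = h (w + l) / h w"
  using assms unfolding coboundaries_def coboundary_def by fastforce

context
  fixes V \<Lambda> :: "(complex ^ 'g) set"
  assumes L: "is_lattice V \<Lambda>"
begin

lemma lattice_shift: "w \<in> V \<Longrightarrow> l \<in> \<Lambda> \<Longrightarrow> w + l \<in> V"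
  using is_latticeD(1,2)[OF L] vec.subspace_add by blast

lemma coboundary_in_factors:
  assumes "holo V h" "\<And>w. w \<in> V \<Longrightarrow> h w \<noteq> 0"
  shows "coboundary V \<Lambda> h \<in> carrier (factors V \<Lambda>)"
proof (rule factorsI)
  fix l assume l: "l \<in> \<Lambda>"
  have "holo V (\<lambda>w. h (w + l) / h w)"
    by (intro holo_divide holo_translate assms) (use lattice_shift l in auto)
  thus "holo V (coboundary V \<Lambda> h l)"
    using holo_cong[of V "coboundary V \<Lambda> h l"] l unfolding coboundary_def by simp
next
  show "coboundary V \<Lambda> h l w \<noteq> 0" for l w
    using assms(2) lattice_shift by (simp add: coboundary_def)
  fix l m w assume lm: "l \<in> \<Lambda>" "m \<in> \<Lambda>" and w: "w \<in> V"
  have "h (w + m) \<noteq> 0" using assms(2) lattice_shift[OF w lm(2)] by blast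
  thus "coboundary V \<Lambda> h (l + m) w = coboundary V \<Lambda> h l (w + m) * coboundary V \<Lambda> h m w"
    using lm w lattice_shift[OF w lm(2)] is_latticeD(8)[OF L lm] by (simp add: coboundary_def add_ac)
qed (auto simp: coboundary_def)

lemma coboundaries_subgroup: "subgroup (coboundaries V \<Lambda>) (factors V \<Lambda>)"
proof
  show sub: "coboundaries V \<Lambda> \<subseteq> carrier (factors V \<Lambda>)"
    using coboundary_in_factors unfolding coboundaries_def by auto
  show "\<one>\<^bsub>factors V \<Lambda>\<^esub> \<in> coboundaries V \<Lambda>"
    by (rule coboundaryI[of _ _ _ "\<lambda>_. 1"])
       (use monoid.one_closed[of "factors V \<Lambda>"] comm_group_factors in \<open>auto simp: comm_group_def group_def\<close>)
  fix f assume f: "f \<in> coboundaries V \<Lambda>"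
  obtain h where h: "holo V h" "\<And>w. w \<in> V \<Longrightarrow> h w \<noteq> 0" "\<And>l w. l \<in> \<Lambda> \<Longrightarrow> w \<in> V \<Longrightarrow> f l w = h (w + l) / h w"
    using coboundaryE[OF f] by blast
  have fc: "f \<in> carrier (factors V \<Lambda>)" using f sub by auto
  show "inv\<^bsub>factors V \<Lambda>\<^esub> f \<in> coboundaries V \<Lambda>"
  proof (rule coboundaryI[of _ _ _ "\<lambda>w. inverse (h w)"])
    show "inv\<^bsub>factors V \<Lambda>\<^esub> f \<in> carrier (factors V \<Lambda>)"
      by (rule group.inv_closed[OF comm_group.axioms(2)[OF comm_group_factors] fc])
    show "holo V (\<lambda>w. inverse (h w))" by (rule holo_inverse[OF h(1,2)])
  qed (use h(2,3) in \<open>simp_all add: inv_factors[OF fc] divide_inverse mult.commute\<close>)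
  fix g assume g: "g \<in> coboundaries V \<Lambda>"
  obtain k where k: "holo V k" "\<And>w. w \<in> V \<Longrightarrow> k w \<noteq> 0" "\<And>l w. l \<in> \<Lambda> \<Longrightarrow> w \<in> V \<Longrightarrow> g l w = k (w + l) / k w"
    using coboundaryE[OF g] by blast
  have gc: "g \<in> carrier (factors V \<Lambda>)" using g sub by auto
  have "f \<otimes>\<^bsub>factors V \<Lambda>\<^esub> g \<in> carrier (factors V \<Lambda>)"
    using fc gc monoid.m_closed[of "factors V \<Lambda>"] comm_group_factors by (auto simp: comm_group_def group_def)
  thus "f \<otimes>\<^bsub>factors V \<Lambda>\<^esub> g \<in> coboundaries V \<Lambda>"
    by (rule coboundaryI[of _ _ _ "\<lambda>w. h w * k w"]) (use h k in auto)
qed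

interpretation fg: comm_group "factors V \<Lambda>" by (rule comm_group_factors)

lemma comm_group_Pic: "comm_group (Pic V \<Lambda>)"
  unfolding Pic_def by (rule fg.abelian_FactGroup[OF coboundaries_subgroup])

lemma carrier_Pic: "carrier (Pic V \<Lambda>) = bundle_of V \<Lambda> ` carrier (factors V \<Lambda>)"
  by (auto simp: Pic_def carrier_FactGroup bundle_of_def)

lemma bundle_mult:
  assumes "f \<in> carrier (factors V \<Lambda>)" "g \<in> carrier (factors V \<Lambda>)"
  shows "bundle_of V \<Lambda> f \<otimes>\<^bsub>Pic V \<Lambda>\<^esub> bundle_of V \<Lambda> g = bundle_of V \<Lambda> (\<lambda>l w. f l w * g l w)"
  using fg.rcos_mult[OF coboundaries_subgroup assms] by (simp add: Pic_def bundle_of_def)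

lemma bundle_eq_iff:
  assumes "f \<in> carrier (factors V \<Lambda>)" "g \<in> carrier (factors V \<Lambda>)"
  shows "bundle_of V \<Lambda> f = bundle_of V \<Lambda> g \<longleftrightarrow> (\<lambda>l w. f l w / g l w) \<in> coboundaries V \<Lambda>"
  using fg.rcos_eq_iff[OF coboundaries_subgroup assms] assms by (simp add: bundle_of_def inv_factors divide_inverse)

lemma bundle_eqI:
  assumes "f \<in> carrier (factors V \<Lambda>)" "g \<in> carrier (factors V \<Lambda>)" "holo V h" "\<And>w. w \<in> V \<Longrightarrow> h w \<noteq> 0"
    "\<And>l w. l \<in> \<Lambda> \<Longrightarrow> w \<in> V \<Longrightarrow> f l w = h (w + l) / h w * g l w"
  shows "bundle_of V \<Lambda> f = bundle_of V \<Lambda> g"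
proof -
  have "(\<lambda>l w. f l w / g l w) \<in> carrier (factors V \<Lambda>)"
    using fg.m_closed[OF assms(1) fg.inv_closed[OF assms(2)]] assms(2) by (simp add: inv_factors divide_inverse)
  hence "(\<lambda>l w. f l w / g l w) \<in> coboundaries V \<Lambda>"
    by (rule coboundaryI[of _ _ _ h]) (use assms factorsD(2)[OF assms(2)] in auto)
  thus ?thesis using bundle_eq_iff[OF assms(1,2)] by simp
qed

lemma mem_bundleD:
  assumes "M \<in> carrier (Pic V \<Lambda>)" "f \<in> M"
  shows "f \<in> carrier (factors V \<Lambda>)" "M = bundle_of V \<Lambda> f"
proof -
  obtain g where g: "g \<in> carrier (factors V \<Lambda>)" "M = bundle_of V \<Lambda> g" using assms(1) carrier_Pic by auto
  thus "f \<in> carrier (factors V \<Lambda>)"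
    using assms(2) fg.mem_rcos_iff[OF coboundaries_subgroup g(1)] unfolding bundle_of_def by blast
  show "M = bundle_of V \<Lambda> f"
    using fg.repr_independence[OF _ g(1) coboundaries_subgroup, of f] assms(2) g(2) unfolding bundle_of_def by simp
qed

lemma mem_bundle_of: "f \<in> carrier (factors V \<Lambda>) \<Longrightarrow> f \<in> bundle_of V \<Lambda> f"
  unfolding bundle_of_def by (rule fg.rcos_self[OF _ coboundaries_subgroup])

lemma one_Pic: "\<one>\<^bsub>Pic V \<Lambda>\<^esub> = bundle_of V \<Lambda> (\<lambda>l w. 1)"
proof -
  have "coboundaries V \<Lambda> #>\<^bsub>factors V \<Lambda>\<^esub> \<one>\<^bsub>factors V \<Lambda>\<^esub> = coboundaries V \<Lambda>"
    by (rule fg.coset_mult_one[OF subgroup.subset[OF coboundaries_subgroup]])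
  thus ?thesis by (simp add: Pic_def bundle_of_def)
qed

end

section \<open>First Chern forms, characters, and the positivity of ample bundles\<close>

section \<open>The first Chern class as a real form\<close>

text \<open>Real alternating forms of type (1,1). For such \<open>E\<close> the expression
  \<open>E x (\<i> *s y)\<close> is symmetric; it is the real part of the hermitian form attached to
  \<open>E\<close>.\<close>

definition form11 :: "(complex ^ 'g \<Rightarrow> complex ^ 'g \<Rightarrow> real) \<Rightarrow> bool" where
  "form11 E \<longleftrightarrow> (\<forall>x. linear (E x)) \<and> (\<forall>y. linear (\<lambda>x. E x y)) \<and> (\<forall>x y. E x y = - E y x) \<and>
     (\<forall>x y. E (\<i> *s x) (\<i> *s y) = E x y)"

lemma form11D:
  assumes "form11 E"
  shows "linear (E x)" "linear (\<lambda>x. E x y)" "E x y = - E y x" "E (\<i> *s x) (\<i> *s y) = E x y"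
    "E x (y + z) = E x y + E x z" "E (x + y) z = E x z + E y z"
    "E x (r *\<^sub>R y) = r * E x y" "E (r *\<^sub>R x) y = r * E x y"
    "E x (y - z) = E x y - E x z" "E (x - y) z = E x z - E y z" "E x 0 = 0" "E 0 y = 0" "E x x = 0"
proof -
  show *: "linear (E x)" "linear (\<lambda>x. E x y)" "E x y = - E y x" "E (\<i> *s x) (\<i> *s y) = E x y" for x y
    using assms unfolding form11_def by blast+
  show "E x (y + z) = E x y + E x z" "E (x + y) z = E x z + E y z"
    "E x (r *\<^sub>R y) = r * E x y" "E (r *\<^sub>R x) y = r * E x y"
    "E x (y - z) = E x y - E x z" "E (x - y) z = E x z - E y z" "E x 0 = 0" "E 0 y = 0"
    using linear_add[OF *(1)] linear_add[OF *(2)] linear_cmul[OF *(1)] linear_cmul[OF *(2)]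
      linear_diff[OF *(1)] linear_diff[OF *(2)] linear_0[OF *(1)] linear_0[OF *(2)] by auto
  show "E x x = 0" using *(3)[of x x] by simp
qed

text \<open>Reality of \<open>E = B - B\<^sup>T\<close> forces type (1,1), because \<open>E(ix,iy) - E(x,y)\<close> is imaginary.\<close>

lemma exponent_form_form11:
  assumes "exponent_form B E" shows "form11 E"
proof -
  have B: "clin (B x)" "linear (\<lambda>x. B x y)" "complex_of_real (E x y) = B x y - B y x" for x y
    using assms by (auto simp: exponent_form_def)
  have E: "E x y = Re (B x y - B y x)" for x y using B(3)[of x y] by (metis Re_complex_of_real)
  have lB: "linear (B x)" for x using B(1) by (simp add: clin_def)
  note lRe = bounded_linear.linear[OF bounded_linear_Re]
  have "linear (E x)" for x
    unfolding E using linear_compose[OF linear_compose_sub[OF lB B(2)] lRe] by (simp add: o_def)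
  moreover have "linear (\<lambda>x. E x y)" for y
    unfolding E using linear_compose[OF linear_compose_sub[OF B(2) lB] lRe] by (simp add: o_def)
  moreover have "E x y = - E y x" for x y by (simp add: E)
  moreover have "E (\<i> *s x) (\<i> *s y) = E x y" for x y
  proof -
    have i: "B u (\<i> *s v) = \<i> * B u v" for u v using B(1) by (simp add: clin_def)
    have 1: "B (\<i> *s x) y = E (\<i> *s x) y + \<i> * B y x" "B (\<i> *s y) x = E (\<i> *s y) x + \<i> * B x y"
      using B(3)[of "\<i> *s x" y] B(3)[of "\<i> *s y" x] by (simp_all add: i algebra_simps)
    have "complex_of_real (E (\<i> *s x) (\<i> *s y)) = \<i> * B (\<i> *s x) y - \<i> * B (\<i> *s y) x"
      using B(3)[of "\<i> *s x" "\<i> *s y"] by (simp add: i)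
    also have "\<dots> = \<i> * (complex_of_real (E (\<i> *s x) y) + \<i> * B y x) - \<i> * (complex_of_real (E (\<i> *s y) x) + \<i> * B x y)"
      by (simp only: 1)
    also have "\<dots> = (B x y - B y x) + \<i> * complex_of_real (E (\<i> *s x) y - E (\<i> *s y) x)"
      by (simp add: algebra_simps)
    also have "\<dots> = complex_of_real (E x y) + \<i> * complex_of_real (E (\<i> *s x) y - E (\<i> *s y) x)"
      by (simp only: B(3)[of x y])
    finally have "Re (complex_of_real (E (\<i> *s x) (\<i> *s y))) = Re (complex_of_real (E x y) + \<i> * complex_of_real (E (\<i> *s x) y - E (\<i> *s y) x))"
      by simp
    thus ?thesis by simp
  qed
  ultimately show ?thesis unfolding form11_def by blast
qed

lemma has_formE:
  assumes "has_form V \<Lambda> f E"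
  obtains h B c where "holo V h" "\<And>w. w \<in> V \<Longrightarrow> h w \<noteq> 0" "exponent_form B E"
    "\<And>l w. l \<in> \<Lambda> \<Longrightarrow> w \<in> V \<Longrightarrow> f l w = h (w + l) / h w * ce (B l w + c l)"
  using assms unfolding has_form_def by metis

lemma has_form_form11: "has_form V \<Lambda> f E \<Longrightarrow> form11 E"
  by (elim has_formE) (rule exponent_form_form11)

lemma exponent_formD:
  assumes "exponent_form B E"
  shows "clin (B x)" "linear (\<lambda>x. B x y)" "of_real (E x y) = B x y - B y x"
    "B x (v + w) = B x v + B x w" "B (v + w) y = B v y + B w y" "B x (c *s v) = c * B x v" "B x 0 = 0"
    "B x (v - w) = B x v - B x w" "B (r *\<^sub>R x) y = r *\<^sub>R B x y"
proof -
  show *: "clin (B x)" "linear (\<lambda>x. B x y)" "of_real (E x y) = B x y - B y x" for x y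
    using assms by (auto simp: exponent_form_def)
  have l: "linear (B x)" for x using *(1) by (simp add: clin_def)
  show "B x (v + w) = B x v + B x w" "B (v + w) y = B v y + B w y" "B x (c *s v) = c * B x v" "B x 0 = 0"
    "B x (v - w) = B x v - B x w" "B (r *\<^sub>R x) y = r *\<^sub>R B x y"
    using *(1)[of x] linear_add[OF l] linear_add[OF *(2)] linear_0[OF l] linear_diff[OF l] linear_cmul[OF *(2)]
    by (auto simp: clin_def)
qed

lemma has_form_mult:
  assumes f: "has_form V \<Lambda> f E" and g: "has_form V \<Lambda> g F"
  shows "has_form V \<Lambda> (\<lambda>l w. f l w * g l w) (\<lambda>x y. E x y + F x y)"
proof -
  obtain h B c where h: "holo V h" "\<And>w. w \<in> V \<Longrightarrow> h w \<noteq> 0" "exponent_form B E"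
    "\<And>l w. l \<in> \<Lambda> \<Longrightarrow> w \<in> V \<Longrightarrow> f l w = h (w + l) / h w * ce (B l w + c l)" using has_formE[OF f] by blast
  obtain h' B' c' where h': "holo V h'" "\<And>w. w \<in> V \<Longrightarrow> h' w \<noteq> 0" "exponent_form B' F"
    "\<And>l w. l \<in> \<Lambda> \<Longrightarrow> w \<in> V \<Longrightarrow> g l w = h' (w + l) / h' w * ce (B' l w + c' l)" using has_formE[OF g] by blast
  have "exponent_form (\<lambda>x y. B x y + B' x y) (\<lambda>x y. E x y + F x y)"
    unfolding exponent_form_def
    using exponent_formD(1-3)[OF h(3)] exponent_formD(1-3)[OF h'(3)]
    by (auto intro!: linear_compose_add simp: clin_def distrib_left)
  moreover have "f l w * g l w = (h (w + l) * h' (w + l)) / (h w * h' w) * ce ((B l w + B' l w) + (c l + c' l))"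
    if "l \<in> \<Lambda>" "w \<in> V" for l w
    using h(4)[OF that] h'(4)[OF that] by (simp add: ce_add)
  ultimately show ?thesis
    unfolding has_form_def
    by (intro exI[of _ "\<lambda>w. h w * h' w"] exI[of _ "\<lambda>x y. B x y + B' x y"] exI[of _ "\<lambda>l. c l + c' l"])
       (use h(1,2) h'(1,2) in auto)
qed

lemma has_form_coboundary:
  assumes f: "has_form V \<Lambda> f E" and k: "holo V k" "\<And>w. w \<in> V \<Longrightarrow> k w \<noteq> 0"
    and g: "\<And>l w. l \<in> \<Lambda> \<Longrightarrow> w \<in> V \<Longrightarrow> g l w = k (w + l) / k w * f l w"
  shows "has_form V \<Lambda> g E"
proof -
  obtain h B c where h: "holo V h" "\<And>w. w \<in> V \<Longrightarrow> h w \<noteq> 0" "exponent_form B E"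
    "\<And>l w. l \<in> \<Lambda> \<Longrightarrow> w \<in> V \<Longrightarrow> f l w = h (w + l) / h w * ce (B l w + c l)" using has_formE[OF f] by blast
  show ?thesis
    unfolding has_form_def
    by (intro exI[of _ "\<lambda>w. k w * h w"] exI[of _ B] exI[of _ c]) (use h k g in auto)
qed

lemma has_form_bundle:
  assumes L: "is_lattice V \<Lambda>" and f: "f \<in> carrier (factors V \<Lambda>)" "has_form V \<Lambda> f E" and g: "g \<in> bundle_of V \<Lambda> f"
  shows "has_form V \<Lambda> g E"
proof -
  obtain u where u: "u \<in> coboundaries V \<Lambda>" "g = (\<lambda>l w. u l w * f l w)"
    using g by (auto simp: bundle_of_def r_coset_def)
  obtain k where "holo V k" "\<And>w. w \<in> V \<Longrightarrow> k w \<noteq> 0" "\<And>l w. l \<in> \<Lambda> \<Longrightarrow> w \<in> V \<Longrightarrow> u l w = k (w + l) / k w"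
    using coboundaryE[OF u(1)] by blast
  thus ?thesis using has_form_coboundary[OF f(2), of k g] u(2) by simp
qed

text \<open>Subtori inherit the ambient normal form with the same \<open>h\<close>, \<open>B\<close>
  and \<open>c\<close>, so integrality and positivity of \<open>E\<close> serve for the restricted
  bundle as well.\<close>

lemma has_form_restrict:
  assumes "has_form UNIV \<Lambda> f E"
  shows "has_form W (\<Lambda> \<inter> W) (\<lambda>l w. if l \<in> \<Lambda> \<inter> W \<and> w \<in> W then f l w else 1) E"
proof -
  obtain h B c where h: "holo UNIV h" "\<And>w. h w \<noteq> 0" "exponent_form B E"
    "\<And>l w. l \<in> \<Lambda> \<Longrightarrow> f l w = h (w + l) / h w * ce (B l w + c l)" using has_formE[OF assms] by (metis UNIV_I)
  show ?thesis
    unfolding has_form_def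
    by (intro exI[of _ h] exI[of _ B] exI[of _ c]) (use h holo_subset[OF h(1), of W] in auto)
qed

text \<open>Expanding \<open>f (l + m) 0\<close> in the two possible orders gives
  \<open>ce (B l m) = ce (B m l)\<close>.\<close>

lemma has_form_int:
  assumes L: "is_lattice V \<Lambda>" and f: "f \<in> carrier (factors V \<Lambda>)" "has_form V \<Lambda> f E"
    and lm: "l \<in> \<Lambda>" "m \<in> \<Lambda>"
  shows "E l m \<in> \<int>"
proof -
  obtain h B c where h: "holo V h" "\<And>w. w \<in> V \<Longrightarrow> h w \<noteq> 0" "exponent_form B E"
    "\<And>l w. l \<in> \<Lambda> \<Longrightarrow> w \<in> V \<Longrightarrow> f l w = h (w + l) / h w * ce (B l w + c l)" using has_formE[OF f(2)] by blast
  note B = exponent_formD[OF h(3)]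
  have V: "0 \<in> V" "l \<in> V" "m \<in> V"
    using is_latticeD(1,2)[OF L] lm vec.subspace_0 by auto
  have hnz: "h 0 \<noteq> 0" "h l \<noteq> 0" "h m \<noteq> 0" using h(2) V by auto
  have "f l m * f m 0 = f m l * f l 0"
    using factorsD(3)[OF f(1) lm V(1)] factorsD(3)[OF f(1) lm(2,1) V(1)] by (simp add: add.commute)
  hence "(h (m + l) / h 0) * ce (B l m + c l + c m) = (h (m + l) / h 0) * ce (B m l + c m + c l)"
    using h(4) lm V hnz by (simp add: B ce_add add.commute mult_ac)
  moreover have "h (m + l) \<noteq> 0" using h(2) lattice_shift[OF L V(3) lm(1)] by blast
  ultimately have "ce (B l m + c l + c m) = ce (B m l + c m + c l)" using hnz by simp
  hence "B l m - B m l \<in> \<int>" unfolding ce_eq_iff by (simp add: algebra_simps)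
  hence "complex_of_real (E l m) \<in> \<int>" by (simp add: B(3))
  thus ?thesis by (metis Ints_cases Ints_of_int Re_complex_of_real complex_Re_of_int)
qed

text \<open>A logarithm of \<open>h\<close> and the normal form give explicit logarithms of the
  factor, whose antisymmetrised value is \<open>E l m\<close>. Any other choice differs by one
  integer for each lattice vector, and these integers cancel.\<close>

lemma chern_factor_eq:
  fixes \<Lambda> :: "(complex ^ 'g) set"
  assumes L: "is_lattice UNIV \<Lambda>" and f: "f \<in> carrier (factors UNIV \<Lambda>)" "has_form UNIV \<Lambda> f E"
    and lm: "l \<in> \<Lambda>" "m \<in> \<Lambda>"
  shows "real_of_int (chern_factor UNIV \<Lambda> f l m) = E l m"
proof -
  obtain h B c where h: "holo UNIV h" "\<And>w. h w \<noteq> 0" "exponent_form B E"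
    "\<And>l w. l \<in> \<Lambda> \<Longrightarrow> f l w = h (w + l) / h w * ce (B l w + c l)" using has_formE[OF f(2)] by (metis UNIV_I)
  note B = exponent_formD[OF h(3)]
  obtain k0 where k0: "holo UNIV k0" "\<And>w. h w = exp (k0 w)" using holo_log[OF h(1,2)] by blast
  define k where "k w = k0 w / (2 * of_real pi * \<i>)" for w
  have k: "holo UNIV k" "\<And>w. h w = ce (k w)"
    unfolding k_def using k0 by (auto intro!: holo_divide simp: ce_def)
  define g where "g x w = k (w + x) - k w + (B x w + c x)" for x w
  have hg: "holo UNIV (g x)" for x
    unfolding g_def by (rule holo_add[OF holo_diff[OF holo_shift[OF k(1)] k(1)] holo_add[OF holo_clin[OF B(1)] holo_const]])
  have fg: "f x w = ce (g x w)" if "x \<in> \<Lambda>" for x w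
    by (simp add: g_def ce_add ce_diff h(4)[OF that] k(2))
  obtain e where e: "E l m = of_int e" using has_form_int[OF L f lm] by (elim Ints_cases)
  have ge: "of_int e = g l m + g m 0 - g m l - g l 0"
  proof -
    have "complex_of_real (E l m) = g l m + g m 0 - g m l - g l 0"
      unfolding B(3) by (simp add: g_def B add.commute)
    thus ?thesis by (simp add: e)
  qed
  have "chern_factor UNIV \<Lambda> f l m = e"
    unfolding chern_factor_def
  proof (rule the_equality)
    show "\<exists>g. (\<forall>x\<in>\<Lambda>. holo UNIV (g x) \<and> (\<forall>w\<in>UNIV. f x w = exp (2 * of_real pi * \<i> * g x w))) \<and>
        of_int e = g l m + g m 0 - g m l - g l 0"
      by (rule exI[of _ g]) (use hg fg ge in \<open>simp add: ce_def\<close>)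
    fix j assume "\<exists>g. (\<forall>x\<in>\<Lambda>. holo UNIV (g x) \<and> (\<forall>w\<in>UNIV. f x w = exp (2 * of_real pi * \<i> * g x w))) \<and>
        of_int j = g l m + g m 0 - g m l - g l 0"
    then obtain g' where g': "\<And>x. x \<in> \<Lambda> \<Longrightarrow> holo UNIV (g' x)" "\<And>x w. x \<in> \<Lambda> \<Longrightarrow> f x w = ce (g' x w)"
        "of_int j = g' l m + g' m 0 - g' m l - g' l 0"
      unfolding ce_def by blast
    have const: "g' x v - g x v = g' x w - g x w" if x: "x \<in> \<Lambda>" for x v w
    proof (rule int_valued_constant[of UNIV "\<lambda>w. g' x w - g x w"])
      show "continuous_on UNIV (\<lambda>w. g' x w - g x w)"
        by (rule holo_continuous_on[OF holo_diff[OF g'(1)[OF x] hg]])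
      show "g' x w - g x w \<in> \<int>" for w
        unfolding ce_eq_iff[symmetric] using g'(2)[OF x, of w] fg[OF x, of w] by simp
    qed auto
    have "of_int j - of_int e = (0::complex)"
      unfolding ge g'(3) using const[OF lm(1), of m 0] const[OF lm(2), of 0 l] by (simp add: algebra_simps)
    thus "j = e" by simp
  qed
  thus ?thesis by (simp add: e)
qed

lemma form_eq_on_lattice:
  assumes "span \<Lambda> = UNIV" "form11 E" "form11 F" "\<And>l m. l \<in> \<Lambda> \<Longrightarrow> m \<in> \<Lambda> \<Longrightarrow> E l m = F l m"
  shows "E = F"
proof (intro ext)
  fix x y
  have "E x y - F x y = 0"
    by (rule bilinear_eq_0_on_lattice[OF assms(1), of "\<lambda>x y. E x y - F x y"])
       (use assms in \<open>auto intro: linear_compose_sub form11D\<close>)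
  thus "E x y = F x y" by simp
qed

lemma has_form_unique:
  assumes L: "is_lattice UNIV \<Lambda>" and f: "f \<in> carrier (factors UNIV \<Lambda>)" "has_form UNIV \<Lambda> f E" "has_form UNIV \<Lambda> f F"
  shows "E = F"
  by (rule form_eq_on_lattice[OF is_latticeD(6)[OF L]])
     (use f has_form_form11 chern_factor_eq[OF L f(1)] in metis)+

text \<open>The first Chern class, extended from the lattice to a real form.\<close>

definition c1 :: "(complex ^ 'g) set \<Rightarrow> 'g line_bundle \<Rightarrow> (complex ^ 'g \<Rightarrow> complex ^ 'g \<Rightarrow> real)" where
  "c1 \<Lambda> M = (SOME E. \<exists>f\<in>M. has_form UNIV \<Lambda> f E)"

context
  fixes \<Lambda> :: "(complex ^ 'g) set"
  assumes L: "is_lattice UNIV \<Lambda>"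
begin

lemma has_form_c1:
  assumes "M \<in> carrier (Pic UNIV \<Lambda>)" "f \<in> M" shows "has_form UNIV \<Lambda> f (c1 \<Lambda> M)"
proof -
  note f = mem_bundleD[OF L assms]
  obtain E where "has_form UNIV \<Lambda> f E" using appell_humbert[OF L f(1)] by blast
  hence "\<exists>f\<in>M. has_form UNIV \<Lambda> f (c1 \<Lambda> M)"
    unfolding c1_def using assms(2) by (intro someI_ex[where P = "\<lambda>E. \<exists>f\<in>M. has_form UNIV \<Lambda> f E"]) blast
  then obtain g where g: "g \<in> M" "has_form UNIV \<Lambda> g (c1 \<Lambda> M)" by blast
  note g' = mem_bundleD[OF L assms(1) g(1)]
  show ?thesis using has_form_bundle[OF L g'(1) g(2)] g'(2) assms(2) by blast
qed

lemma c1_bundle_of: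
  assumes "f \<in> carrier (factors UNIV \<Lambda>)" "has_form UNIV \<Lambda> f E" shows "c1 \<Lambda> (bundle_of UNIV \<Lambda> f) = E"
  using has_form_unique[OF L assms(1) has_form_c1[OF _ mem_bundle_of[OF L assms(1)]] assms(2)] carrier_Pic[OF L] assms(1)
  by blast

lemma mem_Pic_nonempty: "M \<in> carrier (Pic UNIV \<Lambda>) \<Longrightarrow> \<exists>f. f \<in> M"
  using carrier_Pic[OF L] mem_bundle_of[OF L] by auto

lemma form11_c1: "M \<in> carrier (Pic UNIV \<Lambda>) \<Longrightarrow> form11 (c1 \<Lambda> M)"
  using has_form_c1 has_form_form11 mem_Pic_nonempty by blast

lemma c1_int: "M \<in> carrier (Pic UNIV \<Lambda>) \<Longrightarrow> l \<in> \<Lambda> \<Longrightarrow> m \<in> \<Lambda> \<Longrightarrow> c1 \<Lambda> M l m \<in> \<int>"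
  using mem_Pic_nonempty has_form_c1 has_form_int[OF L] mem_bundleD(1)[OF L] by metis

lemma chern_eq_c1:
  assumes "M \<in> carrier (Pic UNIV \<Lambda>)" "l \<in> \<Lambda>" "m \<in> \<Lambda>"
  shows "real_of_int (chern UNIV \<Lambda> M l m) = c1 \<Lambda> M l m"
proof -
  have s: "(SOME f. f \<in> M) \<in> M" using mem_Pic_nonempty[OF assms(1)] by (simp add: some_in_eq ex_in_conv)
  show ?thesis unfolding chern_def
    by (rule chern_factor_eq[OF L mem_bundleD(1)[OF L assms(1) s] has_form_c1[OF assms(1) s] assms(2,3)])
qed

lemma c1_mult:
  assumes "M \<in> carrier (Pic UNIV \<Lambda>)" "N \<in> carrier (Pic UNIV \<Lambda>)"
  shows "c1 \<Lambda> (M \<otimes>\<^bsub>Pic UNIV \<Lambda>\<^esub> N) = (\<lambda>x y. c1 \<Lambda> M x y + c1 \<Lambda> N x y)"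
proof -
  obtain f g where fg: "f \<in> M" "g \<in> N" using mem_Pic_nonempty assms by blast
  note f = mem_bundleD[OF L assms(1) fg(1)] and g = mem_bundleD[OF L assms(2) fg(2)]
  have "c1 \<Lambda> (bundle_of UNIV \<Lambda> (\<lambda>l w. f l w * g l w)) = (\<lambda>x y. c1 \<Lambda> M x y + c1 \<Lambda> N x y)"
  proof (rule c1_bundle_of)
    show "(\<lambda>l w. f l w * g l w) \<in> carrier (factors UNIV \<Lambda>)"
      using monoid.m_closed[of "factors UNIV \<Lambda>" f g] f(1) g(1) comm_group_factors[of UNIV \<Lambda>]
      by (auto simp: comm_group_def group_def)
  qed (intro has_form_mult has_form_c1 assms fg)
  thus ?thesis using bundle_mult[OF L f(1) g(1)] f(2) g(2) by simp
qed

lemma Pic0_iff: "M \<in> Pic0_set UNIV \<Lambda> \<longleftrightarrow> M \<in> carrier (Pic UNIV \<Lambda>) \<and> c1 \<Lambda> M = (\<lambda>x y. 0)"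
proof (cases "M \<in> carrier (Pic UNIV \<Lambda>)")
  case True
  have "(\<forall>l\<in>\<Lambda>. \<forall>m\<in>\<Lambda>. chern UNIV \<Lambda> M l m = 0) \<longleftrightarrow> (\<forall>l\<in>\<Lambda>. \<forall>m\<in>\<Lambda>. c1 \<Lambda> M l m = 0)"
    using chern_eq_c1[OF True] by (metis of_int_eq_0_iff)
  moreover have "form11 (\<lambda>x y. 0)" by (auto simp: form11_def intro: linear_zero)
  ultimately show ?thesis
    using True form_eq_on_lattice[OF is_latticeD(6)[OF L] form11_c1[OF True], of "\<lambda>x y. 0"]
    by (auto simp: Pic0_set_def)
qed (auto simp: Pic0_set_def)

text \<open>Evenness makes the trivial semicharacter admissible.\<close>

lemma ex_bundle_c1:
  assumes E: "form11 E" and even: "\<And>l m. l \<in> \<Lambda> \<Longrightarrow> m \<in> \<Lambda> \<Longrightarrow> E l m / 2 \<in> \<int>"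
  obtains M where "M \<in> carrier (Pic UNIV \<Lambda>)" "c1 \<Lambda> M = E"
proof -
  note D = form11D[OF E]
  \<comment> \<open>This is H / (2i) for the hermitian form H(x, y) = E(x, iy) + i E(x, y), complex
    linear in \<open>y\<close>.\<close>
  define B where "B x y = (of_real (E x y) - \<i> * of_real (E x (\<i> *s y))) / 2" for x y :: "complex ^ 'g"
  have ii: "\<i> *s (\<i> *s y) = - y" for y :: "complex ^ 'g" by (simp add: vec_eq_iff)
  have li: "linear (\<lambda>y. E x (\<i> *s y))" for x
    using linear_compose[OF linear_vec_scale[of \<i>] D(1)[of x]] by (simp add: o_def)
  have linB: "linear (B x)" for x unfolding B_def
    by (rule linearI) (simp_all add: D(5,7) linear_add[OF li] linear_cmul[OF li] complex_eq_iff add_divide_distrib diff_divide_distrib algebra_simps)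
  have iB: "B x (\<i> *s y) = \<i> * B x y" for x y
    unfolding B_def ii using linear_neg[OF D(1)[of x], of y] by (simp add: algebra_simps)
  have scB: "B x (c *s y) = c * B x y" for x y c
  proof -
    have "c *s y = Re c *\<^sub>R y + Im c *\<^sub>R (\<i> *s y)"
      by (simp add: vec_eq_iff complex_eq_iff)
    hence "B x (c *s y) = Re c *\<^sub>R B x y + Im c *\<^sub>R (\<i> * B x y)"
      by (simp only: linear_add[OF linB] linear_cmul[OF linB] iB)
    also have "\<dots> = c * B x y" by (simp add: complex_eq_iff)
    finally show ?thesis .
  qed
  have lin1: "linear (\<lambda>x. B x y)" for y unfolding B_def
    by (rule linearI) (simp_all add: D(6,8) complex_eq_iff add_divide_distrib diff_divide_distrib algebra_simps)
  have EB: "of_real (E x y) = B x y - B y x" for x y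
  proof -
    have "E y (\<i> *s x) = E (\<i> *s y) (\<i> *s (\<i> *s x))" by (rule D(4)[symmetric])
    also have "\<dots> = E x (\<i> *s y)" unfolding ii using linear_neg[OF D(1)] D(3)[of x] by simp
    finally have "E y (\<i> *s x) = E x (\<i> *s y)" .
    moreover have "E y x = - E x y" by (rule D(3))
    ultimately show ?thesis by (simp add: B_def field_simps)
  qed
  have BE: "exponent_form B E" using linB scB lin1 EB by (simp add: exponent_form_def clin_def)
  note BD = exponent_formD[OF BE]
  define f where "f l w = (if l \<in> \<Lambda> then ce (B l w + B l l / 2) else 1)" for l w
  have f: "f \<in> carrier (factors UNIV \<Lambda>)"
  proof (rule factorsI)
    show "holo UNIV (f l)" if "l \<in> \<Lambda>" for l
      unfolding f_def using that by (simp add: holo_ce[OF holo_add[OF holo_clin[OF BD(1)] holo_const]])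
    fix l m w assume lm: "l \<in> \<Lambda>" "m \<in> \<Lambda>"
    have "complex_of_real (E m l / 2) \<in> \<int>" using even[OF lm(2,1)] by (metis Ints_cases Ints_of_int of_real_of_int_eq)
    moreover have "(B (l + m) w + B (l + m) (l + m) / 2) - (B l (w + m) + B l l / 2 + (B m w + B m m / 2)) = of_real (E m l / 2)"
      using EB[of m l] by (simp add: BD field_simps)
    ultimately have "ce (B (l + m) w + B (l + m) (l + m) / 2) = ce (B l (w + m) + B l l / 2 + (B m w + B m m / 2))"
      unfolding ce_eq_iff by (simp only:)
    thus "f (l + m) w = f l (w + m) * f m w" using lm is_latticeD(8)[OF L lm] by (simp add: f_def ce_add)
  qed (auto simp: f_def)
  moreover have "has_form UNIV \<Lambda> f E"
    unfolding has_form_def using BE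
    by (intro exI[of _ "\<lambda>_. 1"] exI[of _ B] exI[of _ "\<lambda>l. B l l / 2"]) (auto simp: f_def)
  ultimately show thesis using that[of "bundle_of UNIV \<Lambda> f"] c1_bundle_of carrier_Pic[OF L] by blast
qed

end

section \<open>Characters and the map \<open>\<phi>\<close>\<close>

definition chr :: "(complex ^ 'g) set \<Rightarrow> (complex ^ 'g) set \<Rightarrow> (complex ^ 'g \<Rightarrow> real) \<Rightarrow> 'g factor" where
  "chr V \<Lambda> \<phi> = (\<lambda>l w. if l \<in> \<Lambda> \<and> w \<in> V then ce (of_real (\<phi> l)) else 1)"

text \<open>The flat bundle with character \<open>ce (\<phi> l)\<close>. As \<open>\<phi>\<close> is
  real the character is unitary, which is what lets the class determine \<open>\<phi>\<close> on the
  lattice modulo integers.\<close>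

definition flat :: "(complex ^ 'g) set \<Rightarrow> (complex ^ 'g) set \<Rightarrow> (complex ^ 'g \<Rightarrow> real) \<Rightarrow> 'g line_bundle" where
  "flat V \<Lambda> \<phi> = bundle_of V \<Lambda> (chr V \<Lambda> \<phi>)"

context
  fixes V \<Lambda> :: "(complex ^ 'g) set"
  assumes L: "is_lattice V \<Lambda>"
begin

lemma chr_in_factors:
  assumes "linear \<phi>" shows "chr V \<Lambda> \<phi> \<in> carrier (factors V \<Lambda>)"
proof (rule factorsI)
  show "holo V (chr V \<Lambda> \<phi> l)" if "l \<in> \<Lambda>" for l
    using holo_cong[of V "chr V \<Lambda> \<phi> l" "\<lambda>w. ce (of_real (\<phi> l))"] that by (simp add: chr_def holo_const)
  fix l m w assume "l \<in> \<Lambda>" "m \<in> \<Lambda>" "w \<in> V"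
  thus "chr V \<Lambda> \<phi> (l + m) w = chr V \<Lambda> \<phi> l (w + m) * chr V \<Lambda> \<phi> m w"
    using lattice_shift[OF L] is_latticeD(8)[OF L] by (simp add: chr_def linear_add[OF assms] ce_add)
qed (auto simp: chr_def)

lemma flat_in_Pic: "linear \<phi> \<Longrightarrow> flat V \<Lambda> \<phi> \<in> carrier (Pic V \<Lambda>)"
  using carrier_Pic[OF L] chr_in_factors by (auto simp: flat_def)

lemma flat_mult:
  assumes "linear \<phi>" "linear \<psi>"
  shows "flat V \<Lambda> \<phi> \<otimes>\<^bsub>Pic V \<Lambda>\<^esub> flat V \<Lambda> \<psi> = flat V \<Lambda> (\<lambda>l. \<phi> l + \<psi> l)"
  unfolding flat_def bundle_mult[OF L chr_in_factors[OF assms(1)] chr_in_factors[OF assms(2)]]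
  by (rule arg_cong[of _ _ "bundle_of V \<Lambda>"]) (auto simp: chr_def ce_add fun_eq_iff)

lemma flat_0: "flat V \<Lambda> (\<lambda>l. 0) = \<one>\<^bsub>Pic V \<Lambda>\<^esub>"
proof -
  have "chr V \<Lambda> (\<lambda>l. 0) = (\<lambda>l w. 1)" by (auto simp: chr_def fun_eq_iff)
  thus ?thesis by (simp add: flat_def one_Pic[OF L])
qed

text \<open>A coboundary with unitary constant values is trivial, by Liouville's theorem along complex lines.\<close>

lemma flat_eq_iff:
  assumes "linear \<phi>" "linear \<psi>"
  shows "flat V \<Lambda> \<phi> = flat V \<Lambda> \<psi> \<longleftrightarrow> (\<forall>l\<in>\<Lambda>. \<phi> l - \<psi> l \<in> \<int>)"
proof
  assume "flat V \<Lambda> \<phi> = flat V \<Lambda> \<psi>"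
  hence "(\<lambda>l w. chr V \<Lambda> \<phi> l w / chr V \<Lambda> \<psi> l w) \<in> coboundaries V \<Lambda>"
    using bundle_eq_iff[OF L chr_in_factors[OF assms(1)] chr_in_factors[OF assms(2)]] by (simp add: flat_def)
  then obtain h where h: "holo V h" "\<And>w. w \<in> V \<Longrightarrow> h w \<noteq> 0"
      "\<And>l w. l \<in> \<Lambda> \<Longrightarrow> w \<in> V \<Longrightarrow> chr V \<Lambda> \<phi> l w / chr V \<Lambda> \<psi> l w = h (w + l) / h w"
    using coboundaryE by blast
  have hl: "h (w + l) = ce (of_real (\<phi> l - \<psi> l)) * h w" if "l \<in> \<Lambda>" "w \<in> V" for l w
    using h(3)[OF that] h(2)[OF that(2)] that by (simp add: chr_def ce_diff field_simps)
  have "bounded ((\<lambda>w. norm (h w)) ` V)"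
  proof (rule lattice_periodic_bounded[OF L])
    show "continuous_on V (\<lambda>w. norm (h w))" by (intro continuous_intros holo_continuous_on h(1))
    show "norm (h (w + l)) = norm (h w)" if "w \<in> V" "l \<in> \<Lambda>" for w l
      using hl[OF that(2,1)] by (simp add: norm_mult norm_ce)
  qed
  then obtain M where M: "\<And>w. w \<in> V \<Longrightarrow> norm (h w) \<le> M" unfolding bounded_iff by auto
  have V: "vec.subspace V" "0 \<in> V" using is_latticeD(1)[OF L] vec.subspace_0 by auto
  have const: "h v = h 0" if v: "v \<in> V" for v
  proof -
    have "(\<lambda>z. h (0 + z *s v)) holomorphic_on UNIV" by (rule holo_line[OF h(1) V v])
    moreover have "bounded (range (\<lambda>z. h (0 + z *s v)))"
      unfolding bounded_iff using M vec.subspace_scale[OF V(1) v] by auto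
    ultimately have "(\<lambda>z. h (0 + z *s v)) constant_on UNIV" by (rule Liouville_theorem)
    then obtain c where c: "\<And>z. h (0 + z *s v) = c" by (auto simp: constant_on_def)
    show ?thesis using c[of 0] c[of 1] by simp
  qed
  show "\<forall>l\<in>\<Lambda>. \<phi> l - \<psi> l \<in> \<int>"
  proof
    fix l assume l: "l \<in> \<Lambda>"
    hence "h l = h 0" using const is_latticeD(2)[OF L] by auto
    hence "ce (of_real (\<phi> l - \<psi> l)) = 1" using hl[OF l V(2)] h(2)[OF V(2)] by simp
    hence "complex_of_real (\<phi> l - \<psi> l) \<in> \<int>" by (simp only: ce_eq_1_iff)
    thus "\<phi> l - \<psi> l \<in> \<int>" by (metis Ints_cases Ints_of_int Re_complex_of_real complex_Re_of_int)
  qed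
next
  assume *: "\<forall>l\<in>\<Lambda>. \<phi> l - \<psi> l \<in> \<int>"
  have "chr V \<Lambda> \<phi> = chr V \<Lambda> \<psi>"
  proof (intro ext)
    fix l w
    have "complex_of_real (\<phi> l) - of_real (\<psi> l) \<in> \<int>" if "l \<in> \<Lambda>"
      using * that by (metis Ints_cases Ints_of_int of_real_diff of_real_of_int_eq)
    thus "chr V \<Lambda> \<phi> l w = chr V \<Lambda> \<psi> l w" by (simp add: chr_def ce_eq_iff)
  qed
  thus "flat V \<Lambda> \<phi> = flat V \<Lambda> \<psi>" by (simp add: flat_def)
qed

lemma flat_pow:
  assumes "linear \<phi>" shows "flat V \<Lambda> \<phi> [^]\<^bsub>Pic V \<Lambda>\<^esub> (n::nat) = flat V \<Lambda> (\<lambda>l. real n * \<phi> l)"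
proof (induction n)
  case 0
  thus ?case by (simp add: flat_0)
next
  case (Suc n)
  have "linear (\<lambda>l. real n * \<phi> l)" using linear_compose_scale_right[OF assms, of "real n"] by simp
  thus ?case using Suc flat_mult[OF _ assms] by (simp add: algebra_simps)
qed

lemma translate_factor:
  assumes f: "f \<in> carrier (factors V \<Lambda>)" and v: "v \<in> V"
  shows "(\<lambda>l w. f l (w + v)) \<in> carrier (factors V \<Lambda>)"
proof (rule factorsI)
  note V = is_latticeD(1)[OF L]
  show "holo V (\<lambda>w. f l (w + v))" if "l \<in> \<Lambda>" for l
    by (rule holo_translate[OF factorsD(1)[OF f that]]) (rule vec.subspace_add[OF V _ v])
  show "f (l + m) (w + v) = f l (w + m + v) * f m (w + v)" if "l \<in> \<Lambda>" "m \<in> \<Lambda>" "w \<in> V" for l m w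
    using factorsD(3)[OF f that(1,2) vec.subspace_add[OF V that(3) v]] by (simp add: add_ac)
  show "f l (w + v) = 1" if "l \<notin> \<Lambda> \<or> w \<notin> V" for l w
  proof -
    have "w = (w + v) - v" by simp
    hence "w + v \<in> V \<Longrightarrow> w \<in> V" using vec.subspace_diff[OF V _ v] by metis
    thus ?thesis using factorsD(4)[OF f] that by blast
  qed
qed (rule factorsD(2)[OF f])

text \<open>Translation by \<open>v\<close> multiplies the factor by \<open>ce (B l v)\<close>, up
  to a coboundary coming from \<open>h\<close>. Since \<open>B l v = E l v + B v l\<close>, and
  \<open>ce (B v l)\<close> is the coboundary of the function \<open>ce (B v w)\<close> of
  \<open>w\<close>, the unitary character \<open>ce (E l v)\<close> remains.\<close>

lemma translate_eq:
  assumes M: "M \<in> carrier (Pic V \<Lambda>)" and f: "f \<in> M" "has_form V \<Lambda> f E" and v: "v \<in> V"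
  shows "translate V \<Lambda> (proj V \<Lambda> v) M = M \<otimes>\<^bsub>Pic V \<Lambda>\<^esub> flat V \<Lambda> (\<lambda>l. E l v)"
proof -
  note fM = mem_bundleD[OF L M f(1)]
  note V = is_latticeD(1)[OF L]
  obtain h B c where h: "holo V h" "\<And>w. w \<in> V \<Longrightarrow> h w \<noteq> 0" "exponent_form B E"
    "\<And>l w. l \<in> \<Lambda> \<Longrightarrow> w \<in> V \<Longrightarrow> f l w = h (w + l) / h w * ce (B l w + c l)" using has_formE[OF f(2)] by blast
  note B = exponent_formD[OF h(3)]
  note E = form11D[OF has_form_form11[OF f(2)]]
  have lin: "linear (\<lambda>l. E l v)" by (rule E(2))
  define g where "g = (\<lambda>l w. f l w * chr V \<Lambda> (\<lambda>l. E l v) l w)"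
  have g: "g \<in> carrier (factors V \<Lambda>)" unfolding g_def
    using monoid.m_closed[of "factors V \<Lambda>", OF _ fM(1) chr_in_factors[OF lin]] comm_group_factors[of V \<Lambda>]
    by (simp add: comm_group_def group_def)
  have MM: "M \<otimes>\<^bsub>Pic V \<Lambda>\<^esub> flat V \<Lambda> (\<lambda>l. E l v) = bundle_of V \<Lambda> g"
    unfolding flat_def g_def using bundle_mult[OF L fM(1) chr_in_factors[OF lin]] fM(2) by simp
  have eq: "bundle_of V \<Lambda> (\<lambda>l w. f' l (w + v')) = bundle_of V \<Lambda> g"
    if f': "f' \<in> M" and v': "v' \<in> proj V \<Lambda> v" for f' v'
  proof -
    have v'V: "v' \<in> V" and l0: "v' - v \<in> \<Lambda>" using mem_proj_iff[OF L v] v' by auto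
    note f'c = mem_bundleD(1)[OF L M f']
    have "f' \<in> bundle_of V \<Lambda> f" using fM(2) f' by simp
    then obtain u where u: "u \<in> coboundaries V \<Lambda>" "f' = (\<lambda>l w. u l w * f l w)"
      by (auto simp: bundle_of_def r_coset_def)
    obtain k where k: "holo V k" "\<And>w. w \<in> V \<Longrightarrow> k w \<noteq> 0" "\<And>l w. l \<in> \<Lambda> \<Longrightarrow> w \<in> V \<Longrightarrow> u l w = k (w + l) / k w"
      using coboundaryE[OF u(1)] by blast
    have shift: "w + v' \<in> V" if "w \<in> V" for w using vec.subspace_add[OF V that v'V] .
    \<comment> \<open>Accounts for the other representative (\<open>k\<close>), the translated
      trivialisation (\<open>h\<close>) and the coboundary of \<open>ce (B v' w)\<close>. Replacing
      \<open>v'\<close> by \<open>v\<close> costs \<open>E l (v' - v)\<close>, an integer.\<close>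
    define H where "H w = k (w + v') * h (w + v') / h w * ce (B v' w)" for w
    show ?thesis
    proof (rule bundle_eqI[OF L translate_factor[OF f'c v'V] g, of H])
      have "holo V (\<lambda>w. k (w + v') * h (w + v') / h w)"
        by (rule holo_divide[OF holo_mult[OF holo_translate[OF k(1) shift] holo_translate[OF h(1) shift]] h(1,2)])
      thus "holo V H" unfolding H_def by (rule holo_mult[OF _ holo_ce[OF holo_clin[OF B(1)]]])
      show "H w \<noteq> 0" if "w \<in> V" for w unfolding H_def using h(2) k(2) shift that by simp
      fix l w assume l: "l \<in> \<Lambda>" and w: "w \<in> V"
      have nz: "h w \<noteq> 0" "h (w + l) \<noteq> 0" "k (w + v') \<noteq> 0" "h (w + v') \<noteq> 0"
        using h(2) k(2) w shift[OF w] lattice_shift[OF L w l] by auto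
      have Eint: "complex_of_real (E l (v' - v)) \<in> \<int>"
        using has_form_int[OF L fM(1) f(2) l l0] by (metis Ints_cases Ints_of_int of_real_of_int_eq)
      have "B l (w + v') + c l - (B v' l + (B l w + c l + of_real (E l v))) = of_real (E l (v' - v))"
        using B(3)[of l v'] by (simp add: B E(9) algebra_simps)
      hence "ce (B l (w + v') + c l) = ce (B v' l + (B l w + c l + of_real (E l v)))"
        unfolding ce_eq_iff using Eint by (simp only:)
      hence ce1: "ce (B l (w + v') + c l) = ce (B v' l) * (ce (B l w + c l) * ce (of_real (E l v)))"
        by (simp only: ce_add)
      have "f' l (w + v') = (k (w + v' + l) / k (w + v')) * (h (w + v' + l) / h (w + v')) * ce (B l (w + v') + c l)"
        using u(2) k(3)[OF l shift[OF w]] h(4)[OF l shift[OF w]] by simp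
      also have "\<dots> = (k (w + l + v') / k (w + v')) * (h (w + l + v') / h (w + v')) * (ce (B v' l) * (ce (B l w + c l) * ce (of_real (E l v))))"
        unfolding ce1 by (simp add: add_ac)
      also have "\<dots> = H (w + l) / H w * g l w"
        using nz l w h(4)[OF l w] by (simp add: H_def g_def chr_def B ce_add field_simps)
      finally show "f' l (w + v') = H (w + l) / H w * g l w" .
    qed
  qed
  have "v \<in> proj V \<Lambda> v" using mem_proj_iff[OF L v] v is_latticeD(3)[OF L] by simp
  hence "translate V \<Lambda> (proj V \<Lambda> v) M = bundle_of V \<Lambda> g"
    unfolding translate_def using f(1) eq by blast
  thus ?thesis using MM by simp
qed

lemma phi_eq:
  assumes M: "M \<in> carrier (Pic V \<Lambda>)" and f: "f \<in> M" "has_form V \<Lambda> f E" and v: "v \<in> V"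
  shows "phi V \<Lambda> M (proj V \<Lambda> v) = flat V \<Lambda> (\<lambda>l. E l v)"
proof -
  interpret P: comm_group "Pic V \<Lambda>" by (rule comm_group_Pic[OF L])
  have lin: "linear (\<lambda>l. E l v)" by (rule form11D(2)[OF has_form_form11[OF f(2)]])
  have "proj V \<Lambda> v \<in> carrier (torus V \<Lambda>)" using carrier_torus[OF L] v by auto
  hence "phi V \<Lambda> M (proj V \<Lambda> v) = (M \<otimes>\<^bsub>Pic V \<Lambda>\<^esub> flat V \<Lambda> (\<lambda>l. E l v)) \<otimes>\<^bsub>Pic V \<Lambda>\<^esub> inv\<^bsub>Pic V \<Lambda>\<^esub> M"
    unfolding phi_def using translate_eq[OF assms] by simp
  also have "\<dots> = flat V \<Lambda> (\<lambda>l. E l v)"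
    using M flat_in_Pic[OF lin] by (simp add: P.m_comm[of M] P.m_assoc)
  finally show ?thesis .
qed

lemma phi_eq_one_iff:
  assumes M: "M \<in> carrier (Pic V \<Lambda>)" and f: "f \<in> M" "has_form V \<Lambda> f E" and v: "v \<in> V"
  shows "phi V \<Lambda> M (proj V \<Lambda> v) = \<one>\<^bsub>Pic V \<Lambda>\<^esub> \<longleftrightarrow> (\<forall>l\<in>\<Lambda>. E l v \<in> \<int>)"
  unfolding phi_eq[OF assms] flat_0[symmetric]
  by (subst flat_eq_iff) (auto intro: linear_zero form11D(2)[OF has_form_form11[OF f(2)]])

end

section \<open>Restriction to subtori\<close>

context
  fixes \<Lambda> W :: "(complex ^ 'g) set"
  assumes L: "is_lattice UNIV \<Lambda>" and LW: "is_lattice W (\<Lambda> \<inter> W)"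
begin

definition res :: "'g factor \<Rightarrow> 'g factor" where
  "res f = (\<lambda>l w. if l \<in> \<Lambda> \<inter> W \<and> w \<in> W then f l w else 1)"

lemma res_in_factors:
  assumes f: "f \<in> carrier (factors UNIV \<Lambda>)" shows "res f \<in> carrier (factors W (\<Lambda> \<inter> W))"
proof (rule factorsI)
  show "holo W (res f l)" if "l \<in> \<Lambda> \<inter> W" for l
    using holo_cong[of W "res f l" "f l"] that holo_subset[OF factorsD(1)[OF f], of l W] by (simp add: res_def)
  show "res f l w \<noteq> 0" for l w using factorsD(2)[OF f] by (simp add: res_def)
  show "res f (l + m) w = res f l (w + m) * res f m w" if "l \<in> \<Lambda> \<inter> W" "m \<in> \<Lambda> \<inter> W" "w \<in> W" for l m w
    using that factorsD(3)[OF f, of l m w] is_latticeD(8)[OF LW that(1,2)] lattice_shift[OF LW that(3,2)] by (simp add: res_def)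
qed (auto simp: res_def)

lemma restr_bundle_eq:
  assumes M: "M \<in> carrier (Pic UNIV \<Lambda>)" and f: "f \<in> M"
  shows "restr_bundle W \<Lambda> M = bundle_of W (\<Lambda> \<inter> W) (res f)"
proof -
  note fM = mem_bundleD[OF L M f]
  have "bundle_of W (\<Lambda> \<inter> W) (res f') = bundle_of W (\<Lambda> \<inter> W) (res f)" if f': "f' \<in> M" for f'
  proof -
    note f'c = mem_bundleD(1)[OF L M f']
    have "f' \<in> bundle_of UNIV \<Lambda> f" using fM(2) f' by simp
    then obtain u where u: "u \<in> coboundaries UNIV \<Lambda>" "f' = (\<lambda>l w. u l w * f l w)"
      by (auto simp: bundle_of_def r_coset_def)
    obtain k where k: "holo UNIV k" "\<And>w. k w \<noteq> 0" "\<And>l w. l \<in> \<Lambda> \<Longrightarrow> u l w = k (w + l) / k w"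
      using coboundaryE[OF u(1)] by (metis UNIV_I)
    show ?thesis
      by (rule bundle_eqI[OF LW res_in_factors[OF f'c] res_in_factors[OF fM(1)], of k])
         (use k u(2) holo_subset[OF k(1), of W] in \<open>auto simp: res_def\<close>)
  qed
  thus ?thesis unfolding restr_bundle_def res_def[symmetric] using f by blast
qed

lemma restr_flat:
  assumes "linear \<phi>" shows "restr_bundle W \<Lambda> (flat UNIV \<Lambda> \<phi>) = flat W (\<Lambda> \<inter> W) \<phi>"
proof -
  have "restr_bundle W \<Lambda> (flat UNIV \<Lambda> \<phi>) = bundle_of W (\<Lambda> \<inter> W) (res (chr UNIV \<Lambda> \<phi>))"
    by (rule restr_bundle_eq[OF flat_in_Pic[OF L assms]])
       (use mem_bundle_of[OF L chr_in_factors[OF L assms]] in \<open>simp add: flat_def\<close>)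
  also have "res (chr UNIV \<Lambda> \<phi>) = chr W (\<Lambda> \<inter> W) \<phi>" by (auto simp: res_def chr_def fun_eq_iff)
  finally show ?thesis by (simp add: flat_def)
qed

lemma restr_bundle_form:
  assumes M: "M \<in> carrier (Pic UNIV \<Lambda>)"
  obtains f where "f \<in> carrier (factors W (\<Lambda> \<inter> W))" "restr_bundle W \<Lambda> M = bundle_of W (\<Lambda> \<inter> W) f"
    "has_form W (\<Lambda> \<inter> W) f (c1 \<Lambda> M)" "f \<in> restr_bundle W \<Lambda> M" "restr_bundle W \<Lambda> M \<in> carrier (Pic W (\<Lambda> \<inter> W))"
proof -
  obtain f where f: "f \<in> M" using mem_Pic_nonempty[OF L M] by blast
  note fc = res_in_factors[OF mem_bundleD(1)[OF L M f]]
  show thesis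
    by (rule that[of "res f", OF fc restr_bundle_eq[OF M f]])
       (use has_form_restrict[OF has_form_c1[OF L M f], of W] mem_bundle_of[OF LW fc] restr_bundle_eq[OF M f] fc carrier_Pic[OF LW]
         in \<open>auto simp: res_def\<close>)
qed

end

section \<open>Positivity of ample classes\<close>

text \<open>
  If \<open>E v (iv) \<le> 0\<close>, Liouville's theorem along the line \<open>\<complex>v\<close> shows that all sections of all powers are
  multiples of a single function there, so they cannot separate points.
\<close>

lemma ample_pos:
  fixes \<Lambda> :: "(complex ^ 'g) set"
  assumes La: "is_lattice UNIV \<Lambda>" and L: "L \<in> carrier (Pic UNIV \<Lambda>)" and ample: "ample UNIV \<Lambda> L" and v: "v \<noteq> 0"
  shows "c1 \<Lambda> L v (\<i> *s v) > 0"
proof (rule ccontr)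
  define E where "E = c1 \<Lambda> L"
  define q where "q = E v (\<i> *s v)"
  assume "\<not> c1 \<Lambda> L v (\<i> *s v) > 0"
  hence q: "q \<le> 0" by (simp add: q_def E_def)
  obtain f k N \<theta> where f: "f \<in> L" and k: "k > (0::nat)"
    and \<theta>: "\<And>j. j \<le> (N::nat) \<Longrightarrow> \<theta> j \<in> sections UNIV \<Lambda> f k"
    and sep: "\<And>w w'. (\<exists>c. \<forall>j\<le>N. \<theta> j w' = c * \<theta> j w) \<Longrightarrow> w' - w \<in> \<Lambda>"
    using ample unfolding ample_def by (metis UNIV_I)
  have fE: "has_form UNIV \<Lambda> f E" unfolding E_def by (rule has_form_c1[OF La L f])
  note fc = mem_bundleD(1)[OF La L f]
  obtain h B c where h: "holo UNIV h" "\<And>w. h w \<noteq> 0" "exponent_form B E"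
    "\<And>l w. l \<in> \<Lambda> \<Longrightarrow> f l w = h (w + l) / h w * ce (B l w + c l)" using has_formE[OF fE] by (metis UNIV_I)
  note B = exponent_formD[OF h(3)]
  have ImB: "Im (B x y) = Im (B y x)" for x y using B(3)[of x y] by (metis Im_complex_of_real minus_complex.sel(2) right_minus_eq)
  \<comment> \<open>By the cocycle identity \<open>Im (c l)\<close> is additive up to the symmetric
    form \<open>Im (B l m)\<close>; subtracting half of the diagonal leaves an additive function,
    which extends to a real linear one.\<close>
  define a where "a l = Im (c l) - Im (B l l) / 2" for l
  have "a (l + m) = a l + a m" if lm: "l \<in> \<Lambda>" "m \<in> \<Lambda>" for l m
  proof -
    have "f (l + m) 0 = f l m * f m 0" using factorsD(3)[OF fc lm, of 0] by simp
    hence "h (l + m) / h 0 * ce (c (l + m)) = h (l + m) / h 0 * ce (B l m + c l + c m)"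
      using h(4)[OF lm(1), of m] h(4)[OF lm(2), of 0] h(4)[OF is_latticeD(8)[OF La lm], of 0] h(2)[of m]
      by (simp add: B ce_add add.commute mult_ac)
    hence "ce (c (l + m)) = ce (B l m + c l + c m)" using h(2) by simp
    hence "c (l + m) - (B l m + c l + c m) \<in> \<int>" by (simp only: ce_eq_iff)
    hence "Im (c (l + m) - (B l m + c l + c m)) = 0" by (elim Ints_cases) (simp only: complex_Im_of_int)
    thus ?thesis using ImB[of m l] by (simp add: a_def B field_simps)
  qed
  then obtain \<nu> where \<nu>: "linear \<nu>" "\<And>l. l \<in> \<Lambda> \<Longrightarrow> \<nu> l = a l"
    using lattice_additive_extends[OF La, of a] by metis
  \<comment> \<open>The weight of the natural metric: for a section of the k-th power, the modulus
    of \<open>T j w\<close> times exp (2 pi k Q) is periodic and therefore bounded.\<close>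
  define Q where "Q w = Im (B w w) / 2 + \<nu> w" for w
  have Qper: "Q (w + l) = Q w + Im (B l w + c l)" if "l \<in> \<Lambda>" for l w
    using ImB[of w l] by (simp add: Q_def B linear_add[OF \<nu>(1)] \<nu>(2)[OF that] a_def field_simps)
  define T where "T j w = \<theta> j w / h w ^ k" for j w
  have holT: "holo UNIV (T j)" if "j \<le> N" for j
    unfolding T_def using \<theta>[OF that] h(1,2) by (intro holo_divide holo_power) (auto simp: sections_def)
  have Tper: "T j (w + l) = ce (B l w + c l) ^ k * T j w" if "j \<le> N" "l \<in> \<Lambda>" for j w l
  proof -
    have "\<theta> j (w + l) = f l w ^ k * \<theta> j w" using \<theta>[OF that(1)] that(2) by (simp add: sections_def)
    thus ?thesis using h(2)[of w] h(2)[of "w + l"] h(4)[OF that(2), of w]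
      by (simp add: T_def power_mult_distrib power_divide)
  qed
  have contQ: "continuous_on UNIV Q"
  proof -
    have "continuous_on UNIV (\<lambda>w. B w w)"
    proof -
      have "bilinear B" unfolding bilinear_def using B(1,2) by (simp add: clin_def)
      hence "bounded_bilinear B" by (simp add: bilinear_conv_bounded_bilinear)
      from bounded_bilinear.continuous_on[OF this continuous_on_id continuous_on_id] show ?thesis .
    qed
    moreover have "continuous_on UNIV \<nu>"
      using \<nu>(1) by (simp add: linear_continuous_on linear_conv_bounded_linear)
    ultimately show ?thesis unfolding Q_def by (intro continuous_intros) auto
  qed
  have "\<exists>M. \<forall>w. norm (T j w) \<le> M * exp (- (2 * pi * k * Q w))" if j: "j \<le> N" for j
  proof -
    have "bounded ((\<lambda>w. norm (T j w) * exp (2 * pi * k * Q w)) ` UNIV)"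
    proof (rule lattice_periodic_bounded[OF La])
      show "continuous_on UNIV (\<lambda>w. norm (T j w) * exp (2 * pi * k * Q w))"
        by (intro continuous_intros holo_continuous_on holT j contQ)
      fix w l assume l: "l \<in> \<Lambda>"
      have key: "norm (ce (B l w + c l) ^ k) * exp (2 * pi * k * Im (B l w + c l)) = 1"
        by (simp only: norm_power norm_ce exp_of_nat_mult[symmetric] exp_add[symmetric]) (simp add: algebra_simps)
      have "norm (T j (w + l)) * exp (2 * pi * k * Q (w + l))
          = (norm (ce (B l w + c l) ^ k) * exp (2 * pi * k * Im (B l w + c l))) * (norm (T j w) * exp (2 * pi * k * Q w))"
        unfolding Tper[OF j l] Qper[OF l] norm_mult distrib_left exp_add by (simp only: mult_ac)
      thus "norm (T j (w + l)) * exp (2 * pi * k * Q (w + l)) = norm (T j w) * exp (2 * pi * k * Q w)"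
        unfolding key by simp
    qed
    then obtain M where "\<And>w. norm (T j w) * exp (2 * pi * k * Q w) \<le> M" by (auto simp: bounded_iff)
    thus ?thesis by (intro exI[of _ M]) (simp add: exp_minus field_simps)
  qed
  then obtain M where M: "\<And>j w. j \<le> N \<Longrightarrow> norm (T j w) \<le> M j * exp (- (2 * pi * k * Q w))" by metis
  define b where "b = B v v"
  \<comment> \<open>Along the line through \<open>v\<close> the weight is the real part of the
    polynomial \<open>\<kappa> * z\<^sup>2 + \<mu> * z\<close>, minus q |z|^2 / 4. The exponential
    of the polynomial is absorbed into the section; for q \<le> 0 the product is bounded and
    Liouville's theorem applies.\<close>
  define \<kappa> where "\<kappa> = - \<i> * b / 2 + of_real q / 4"
  define \<mu> where "\<mu> = of_real (\<nu> v) - \<i> * of_real (\<nu> (\<i> *s v))"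
  have zv: "z *s v = Re z *\<^sub>R v + Im z *\<^sub>R (\<i> *s v)" for z
    by (simp add: vec_eq_iff complex_eq_iff)
  have Qz: "Q (z *s v) = Re (\<kappa> * z\<^sup>2 + \<mu> * z) - q * (norm z)\<^sup>2 / 4" for z
  proof -
    have iv: "B (\<i> *s v) v = \<i> * b - of_real q" using B(3)[of v "\<i> *s v"] by (simp add: q_def b_def B)
    have Bz: "B (z *s v) v = z * b - of_real (Im z * q)"
      unfolding zv[of z] B(5) B(9) b_def[symmetric] iv by (simp add: complex_eq_iff algebra_simps)
    have \<nu>z: "\<nu> (z *s v) = Re (\<mu> * z)"
      unfolding zv[of z] linear_add[OF \<nu>(1)] linear_cmul[OF \<nu>(1)] by (simp add: \<mu>_def)
    have "Im (B (z *s v) (z *s v)) / 2 = Re (\<kappa> * z\<^sup>2) - q * (norm z)\<^sup>2 / 4"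
      unfolding B(6) Bz \<kappa>_def cmod_power2 by (simp add: power2_eq_square field_simps)
    thus ?thesis by (simp add: Q_def \<nu>z)
  qed
  have proportional: "T j (z *s v) * exp (2 * of_real pi * of_nat k * (\<kappa> * z\<^sup>2 + \<mu> * z)) = T j 0" if j: "j \<le> N" for j z
  proof -
    define R where "R z = T j (0 + z *s v) * exp (2 * of_real pi * of_nat k * (\<kappa> * z\<^sup>2 + \<mu> * z))" for z
    have "R holomorphic_on UNIV" unfolding R_def
      by (intro holomorphic_intros holo_line[OF holT[OF j]]) auto
    moreover have "bounded (range R)"
    proof -
      have "norm (R z) \<le> M j" for z
      proof -
        have "norm (R z) = norm (T j (z *s v)) * exp (2 * pi * k * Re (\<kappa> * z\<^sup>2 + \<mu> * z))"
          by (simp add: R_def norm_mult)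
        also have "\<dots> \<le> (M j * exp (- (2 * pi * k * Q (z *s v)))) * exp (2 * pi * k * Re (\<kappa> * z\<^sup>2 + \<mu> * z))"
          by (intro mult_right_mono M[OF j]) simp
        also have "\<dots> = M j * exp (2 * pi * k * (q * (norm z)\<^sup>2 / 4))"
          unfolding mult.assoc exp_add[symmetric] Qz by (simp add: algebra_simps)
        also have "\<dots> \<le> M j * 1"
        proof (rule mult_left_mono)
          show "exp (2 * pi * k * (q * (norm z)\<^sup>2 / 4)) \<le> 1"
            using q by (simp add: mult_nonneg_nonpos mult_nonpos_nonneg)
          have "0 \<le> norm (T j 0)" by simp
          also have "\<dots> \<le> M j * exp (- (2 * pi * k * Q 0))" by (rule M[OF j])
          finally show "0 \<le> M j" by (simp add: zero_le_mult_iff)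
        qed
        finally show ?thesis by simp
      qed
      thus ?thesis unfolding bounded_iff by auto
    qed
    ultimately have "R constant_on UNIV" by (rule Liouville_theorem)
    hence "R z = R 0" by (auto simp: constant_on_def)
    thus ?thesis by (simp add: R_def)
  qed
  \<comment> \<open>The factor of proportionality does not depend on \<open>j\<close>, so separation
    of points puts the whole complex line into the lattice, against discreteness.\<close>
  have "z *s v - 0 \<in> \<Lambda>" for z
  proof (rule sep)
    define e where "e = exp (2 * of_real pi * of_nat k * (\<kappa> * z\<^sup>2 + \<mu> * z))"
    have "\<theta> j (z *s v) = (h (z *s v) ^ k / (h 0 ^ k * e)) * \<theta> j 0" if "j \<le> N" for j
    proof -
      have "e \<noteq> 0" by (simp add: e_def)
      thus ?thesis using proportional[OF that, of z] h(2)[of 0] h(2)[of "z *s v"]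
        unfolding e_def[symmetric] T_def by (simp add: field_simps)
    qed
    thus "\<exists>c. \<forall>j\<le>N. \<theta> j (z *s v) = c * \<theta> j 0" by blast
  qed
  hence inL: "z *s v \<in> \<Lambda>" for z by simp
  have sub: "(\<lambda>t. complex_of_real t *s v) ` {0..1} \<subseteq> \<Lambda> \<inter> cball 0 (norm v)"
    using inL by (auto simp: norm_vec_scale mult_left_le_one_le)
  have "inj_on (\<lambda>t. complex_of_real t *s v) {0..1}" using v by (auto simp: inj_on_def vec_scale_of_real)
  hence "finite {0..1::real}"
    using finite_imageD finite_subset[OF sub lattice_finite[OF La bounded_cball]] by blast
  thus False using infinite_Icc[of 0 "1::real"] by simp
qed

section \<open>The form \<open>E\<close> on the lattice: symplectic bases, dual lattice and
  type\<close>

section \<open>Symplectic bases\<close>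

text \<open>
  A pair \<open>x, y\<close> of lattice vectors with minimal positive \<open>E x y = d\<close> splits off: \<open>d\<close> divides all values
  of \<open>E\<close>, because the remainder of a division by \<open>d\<close> would be a smaller value.
\<close>

lemma symplectic_basis:
  fixes E :: "'v::euclidean_space \<Rightarrow> 'v \<Rightarrow> real"
  assumes lin: "\<And>x. linear (E x)" and alt: "\<And>x y. E x y = - E y x"
    and "0 \<in> \<Lambda>" "\<And>x y. x \<in> \<Lambda> \<Longrightarrow> y \<in> \<Lambda> \<Longrightarrow> x - y \<in> \<Lambda>"
    and "\<And>x y. x \<in> \<Lambda> \<Longrightarrow> y \<in> \<Lambda> \<Longrightarrow> E x y \<in> \<int>"
    and "\<And>x. x \<in> span \<Lambda> \<Longrightarrow> (\<And>y. y \<in> \<Lambda> \<Longrightarrow> E x y = 0) \<Longrightarrow> x = 0"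
  shows "\<exists>(m::nat) a b d. (\<forall>i<m. a i \<in> \<Lambda> \<and> b i \<in> \<Lambda> \<and> (0::nat) < d i) \<and>
    (\<forall>i. Suc i < m \<longrightarrow> d i dvd d (Suc i)) \<and>
    (\<forall>i<m. \<forall>j<m. E (a i) (a j) = 0 \<and> E (b i) (b j) = 0 \<and> E (a i) (b j) = (if i = j then real (d i) else 0)) \<and>
    (\<forall>x\<in>\<Lambda>. \<exists>s t :: nat \<Rightarrow> int. x = (\<Sum>i<m. of_int (s i) *\<^sub>R a i + of_int (t i) *\<^sub>R b i))"
  using assms(3-6)
proof (induction "dim (span \<Lambda>)" arbitrary: \<Lambda> rule: less_induct)
  case less
  note zero = less.prems(1) and diff = less.prems(2) and int = less.prems(3) and nondeg = less.prems(4)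
  have Eadd: "E x (y + z) = E x y + E x z" "E (x + y) z = E x z + E y z"
    and Esc: "E x (r *\<^sub>R y) = r * E x y" "E (r *\<^sub>R x) y = r * E x y"
    and Ediff: "E x (y - z) = E x y - E x z" "E (x - y) z = E x z - E y z"
    and E0: "E x 0 = 0" for x y z r
  proof -
    show *: "E x (y + z) = E x y + E x z" "E x (r *\<^sub>R y) = r * E x y" "E x (y - z) = E x y - E x z" "E x 0 = 0" for x y z r
      using linear_add[OF lin] linear_cmul[OF lin] linear_diff[OF lin] linear_0[OF lin] by auto
    show "E (x + y) z = E x z + E y z" using alt[of "x + y" z] alt[of x z] alt[of y z] *(1)[of z x y] by simp
    show "E (r *\<^sub>R x) y = r * E x y" using alt[of "r *\<^sub>R x" y] alt[of x y] *(2)[of y r x] by simp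
    show "E (x - y) z = E x z - E y z" using alt[of "x - y" z] alt[of x z] alt[of y z] *(3)[of z x y] by simp
  qed
  have Exx: "E x x = 0" for x using alt[of x x] by simp
  have neg: "- x \<in> \<Lambda>" if "x \<in> \<Lambda>" for x using diff[OF zero that] by simp
  have add: "x + y \<in> \<Lambda>" if "x \<in> \<Lambda>" "y \<in> \<Lambda>" for x y using diff[OF that(1) neg[OF that(2)]] by simp
  have nat_scale: "real n *\<^sub>R x \<in> \<Lambda>" if "x \<in> \<Lambda>" for n x
    by (induction n) (auto simp: zero add that scaleR_left_distrib)
  have scale: "of_int n *\<^sub>R x \<in> \<Lambda>" if "x \<in> \<Lambda>" for n x
    using nat_scale[OF that, of "nat n"] neg[OF nat_scale[OF that, of "nat (- n)"]] by (cases "n \<ge> 0") auto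
  show ?case
  proof (cases "\<forall>x\<in>\<Lambda>. \<forall>y\<in>\<Lambda>. E x y = 0")
    case True
    have "x = 0" if "x \<in> \<Lambda>" for x by (rule nondeg[OF span_base[OF that]]) (use True that in blast)
    thus ?thesis by (intro exI[of _ "0::nat"]) auto
  next
    case False
    define P where "P n \<longleftrightarrow> 0 < n \<and> (\<exists>x\<in>\<Lambda>. \<exists>y\<in>\<Lambda>. E x y = real n)" for n :: nat
    have "\<exists>n. P n"
    proof -
      obtain x y where xy: "x \<in> \<Lambda>" "y \<in> \<Lambda>" "E x y \<noteq> 0" using False by blast
      obtain z where z: "E x y = of_int z" using int[OF xy(1,2)] by (elim Ints_cases)
      show ?thesis
      proof (cases "z > 0")
        case True
        hence "0 < nat z" "E x y = real (nat z)" using z by auto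
        hence "P (nat z)" unfolding P_def using xy by blast
        thus ?thesis ..
      next
        case False
        hence "z < 0" using xy(3) z by (cases "z = 0") auto
        hence "0 < nat (- z)" "E x (- y) = real (nat (- z))" using z Esc(1)[of x "-1" y] by auto
        hence "P (nat (- z))" unfolding P_def using xy neg by blast
        thus ?thesis ..
      qed
    qed
    define d where "d = (LEAST n. P n)"
    have "P d" unfolding d_def using \<open>\<exists>n. P n\<close> by (rule LeastI_ex)
    then obtain x y where xy: "x \<in> \<Lambda>" "y \<in> \<Lambda>" "E x y = real d" and d: "0 < d" unfolding P_def by blast
    have small: "r = 0" if "u \<in> \<Lambda>" "w \<in> \<Lambda>" "E u w = of_int r" "0 \<le> r" "r < int d" for u w r
    proof (rule ccontr)
      assume "r \<noteq> 0"
      hence "P (nat r)" unfolding P_def using that by auto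
      hence "d \<le> nat r" unfolding d_def by (rule Least_le)
      thus False using that by linarith
    qed
    have divx: "\<exists>q::int. E x z = of_int q * real d" if z: "z \<in> \<Lambda>" for z
    proof -
      obtain e where e: "E x z = of_int e" using int[OF xy(1) z] by (elim Ints_cases)
      have "E x (z - of_int (e div int d) *\<^sub>R y) = of_int (e mod int d)"
        using e xy(3) by (simp add: Ediff Esc minus_div_mult_eq_mod[symmetric])
      hence "e mod int d = 0"
        by (rule small[OF xy(1) diff[OF z scale[OF xy(2)]]]) (use d in auto)
      hence "e = e div int d * int d" by (metis div_mult_mod_eq add.right_neutral)
      thus ?thesis using e by (metis of_int_mult of_int_of_nat_eq)
    qed
    have divy: "\<exists>q::int. E z y = of_int q * real d" if z: "z \<in> \<Lambda>" for z
    proof -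
      obtain e where e: "E z y = of_int e" using int[OF z xy(2)] by (elim Ints_cases)
      have "E (z - of_int (e div int d) *\<^sub>R x) y = of_int (e mod int d)"
        using e xy(3) by (simp add: Ediff Esc minus_div_mult_eq_mod[symmetric])
      hence "e mod int d = 0"
        by (rule small[OF diff[OF z scale[OF xy(1)]] xy(2)]) (use d in auto)
      hence "e = e div int d * int d" by (metis div_mult_mod_eq add.right_neutral)
      thus ?thesis using e by (metis of_int_mult of_int_of_nat_eq)
    qed
    \<comment> \<open>The part of the lattice orthogonal to the pair. Divisibility by
      \<open>d\<close> makes the projection onto it integral, so the lattice splits and
      nondegeneracy passes to the complement.\<close>
    define \<Lambda>' where "\<Lambda>' = {z \<in> \<Lambda>. E x z = 0 \<and> E y z = 0}"
    have split: "\<exists>q p::int. z - of_int q *\<^sub>R x - of_int p *\<^sub>R y \<in> \<Lambda>'" if z: "z \<in> \<Lambda>" for z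
    proof -
      obtain p where p: "E x z = of_int p * real d" using divx[OF z] by blast
      obtain q where q: "E z y = of_int q * real d" using divy[OF z] by blast
      have "z - of_int q *\<^sub>R x - of_int p *\<^sub>R y \<in> \<Lambda>" by (intro diff scale xy z)
      moreover have "E x (z - of_int q *\<^sub>R x - of_int p *\<^sub>R y) = 0" by (simp add: Ediff Esc Exx p xy(3))
      moreover have "E y (z - of_int q *\<^sub>R x - of_int p *\<^sub>R y) = 0"
        using alt[of y z] alt[of y x] by (simp add: Ediff Esc Exx q xy(3))
      ultimately show ?thesis unfolding \<Lambda>'_def by blast
    qed
    have sub: "\<Lambda>' \<subseteq> \<Lambda>" by (auto simp: \<Lambda>'_def)
    have orth: "E y z = 0" "E x z = 0" if "z \<in> span \<Lambda>'" for z
      by (rule linear_eq_0_on_span[OF lin _ that], simp add: \<Lambda>'_def)+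
    have psub: "span \<Lambda>' \<subset> span \<Lambda>"
    proof -
      have "x \<notin> span \<Lambda>'" using orth(1)[of x] alt[of y x] xy(3) d by auto
      thus ?thesis using span_mono[OF sub] span_base[OF xy(1)] by blast
    qed
    have h1: "dim (span \<Lambda>') < dim (span \<Lambda>)" using psub by (intro dim_psubset) (simp add: span_span)
    have h2: "0 \<in> \<Lambda>'" by (simp add: \<Lambda>'_def zero E0)
    have h3: "u - w \<in> \<Lambda>'" if "u \<in> \<Lambda>'" "w \<in> \<Lambda>'" for u w using that diff by (auto simp: \<Lambda>'_def Ediff)
    have h4: "E u w \<in> \<int>" if "u \<in> \<Lambda>'" "w \<in> \<Lambda>'" for u w using that int by (auto simp: \<Lambda>'_def)
    have h5: "u = 0" if u: "u \<in> span \<Lambda>'" "\<And>w. w \<in> \<Lambda>' \<Longrightarrow> E u w = 0" for u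
    proof (rule nondeg)
      show "u \<in> span \<Lambda>" using u(1) psub by blast
      fix w assume "w \<in> \<Lambda>"
      then obtain q p :: int where w': "w - of_int q *\<^sub>R x - of_int p *\<^sub>R y \<in> \<Lambda>'" using split by blast
      have "E u x = 0" "E u y = 0" using orth[OF u(1)] alt[of u x] alt[of u y] by auto
      thus "E u w = 0" using u(2)[OF w'] by (simp add: Ediff Esc)
    qed
    have "\<exists>(m::nat) a b \<delta>. (\<forall>i<m. a i \<in> \<Lambda>' \<and> b i \<in> \<Lambda>' \<and> (0::nat) < \<delta> i) \<and>
        (\<forall>i. Suc i < m \<longrightarrow> \<delta> i dvd \<delta> (Suc i)) \<and>
        (\<forall>i<m. \<forall>j<m. E (a i) (a j) = 0 \<and> E (b i) (b j) = 0 \<and> E (a i) (b j) = (if i = j then real (\<delta> i) else 0)) \<and>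
        (\<forall>x\<in>\<Lambda>'. \<exists>s t :: nat \<Rightarrow> int. x = (\<Sum>i<m. of_int (s i) *\<^sub>R a i + of_int (t i) *\<^sub>R b i))"
    proof (rule less.hyps[OF h1 h2])
      show "u - w \<in> \<Lambda>'" if "u \<in> \<Lambda>'" "w \<in> \<Lambda>'" for u w by (rule h3[OF that])
      show "E u w \<in> \<int>" if "u \<in> \<Lambda>'" "w \<in> \<Lambda>'" for u w by (rule h4[OF that])
      show "u = 0" if "u \<in> span \<Lambda>'" "\<And>w. w \<in> \<Lambda>' \<Longrightarrow> E u w = 0" for u by (rule h5[OF that])
    qed
    then obtain m a b \<delta> where IH0: "(\<forall>i<m. a i \<in> \<Lambda>' \<and> b i \<in> \<Lambda>' \<and> (0::nat) < \<delta> i) \<and>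
        (\<forall>i. Suc i < m \<longrightarrow> \<delta> i dvd \<delta> (Suc i)) \<and>
        (\<forall>i<m. \<forall>j<m. E (a i) (a j) = 0 \<and> E (b i) (b j) = 0 \<and> E (a i) (b j) = (if i = j then real (\<delta> i) else 0)) \<and>
        (\<forall>x\<in>\<Lambda>'. \<exists>s t :: nat \<Rightarrow> int. x = (\<Sum>i<m. of_int (s i) *\<^sub>R a i + of_int (t i) *\<^sub>R b i))"
      by (elim exE)
    have IH: "\<And>i. i < m \<Longrightarrow> a i \<in> \<Lambda>' \<and> b i \<in> \<Lambda>' \<and> (0::nat) < \<delta> i"
        "\<And>i. Suc i < m \<Longrightarrow> \<delta> i dvd \<delta> (Suc i)"
        "\<And>i j. i < m \<Longrightarrow> j < m \<Longrightarrow> E (a i) (a j) = 0 \<and> E (b i) (b j) = 0 \<and> E (a i) (b j) = (if i = j then real (\<delta> i) else 0)"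
        "\<And>z. z \<in> \<Lambda>' \<Longrightarrow> \<exists>s t :: nat \<Rightarrow> int. z = (\<Sum>i<m. of_int (s i) *\<^sub>R a i + of_int (t i) *\<^sub>R b i)"
      using IH0 by blast+
    define a' where "a' i = (case i of 0 \<Rightarrow> x | Suc i \<Rightarrow> a i)" for i
    define b' where "b' i = (case i of 0 \<Rightarrow> y | Suc i \<Rightarrow> b i)" for i
    define d' where "d' i = (case i of 0 \<Rightarrow> d | Suc i \<Rightarrow> \<delta> i)" for i
    \<comment> \<open>The vectors \<open>x + a 0\<close> and \<open>b 0 - q y\<close>, with
      \<open>q\<close> the quotient of \<open>\<delta> 0\<close> by \<open>d\<close>, pair to the
      remainder of this division; being smaller than the least positive value it is 0.\<close>
    have dvd: "d dvd \<delta> 0" if "0 < m"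
    proof -
      have ab: "a 0 \<in> \<Lambda>'" "b 0 \<in> \<Lambda>'" "E (a 0) (b 0) = real (\<delta> 0)" using IH(1)[OF that] IH(3)[OF that that] by auto
      have "E (x + a 0) (b 0 - of_int (int (\<delta> 0) div int d) *\<^sub>R y) = of_int (int (\<delta> 0) mod int d)"
      proof -
        have "E (a 0) y = 0" "E x (b 0) = 0" using ab(1,2) alt[of "a 0" y] by (auto simp: \<Lambda>'_def)
        thus ?thesis using ab(3) xy(3) by (simp add: Ediff Esc Eadd minus_div_mult_eq_mod[symmetric])
      qed
      hence "int (\<delta> 0) mod int d = 0"
        by (rule small[rotated 2]) (use d ab sub xy in \<open>auto intro!: add diff scale\<close>)
      thus ?thesis by (metis dvd_eq_mod_eq_0 int_dvd_int_iff)
    qed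
    have E1: "E x z = 0" "E z x = 0" "E y z = 0" "E z y = 0" if "z \<in> \<Lambda>'" for z
      using that alt[of z x] alt[of z y] by (auto simp: \<Lambda>'_def)
    show ?thesis
    proof (rule exI[of _ "Suc m"], rule exI[of _ a'], rule exI[of _ b'], rule exI[of _ d'], intro conjI allI impI ballI)
      fix i assume i: "i < Suc m"
      show "a' i \<in> \<Lambda>" "b' i \<in> \<Lambda>" "0 < d' i"
        using i IH(1) sub xy d by (auto simp: a'_def b'_def d'_def split: nat.split)
      fix j assume j: "j < Suc m"
      show "E (a' i) (a' j) = 0" "E (b' i) (b' j) = 0" "E (a' i) (b' j) = (if i = j then real (d' i) else 0)"
        using i j IH(1,3) E1 Exx xy(3) by (auto simp: a'_def b'_def d'_def split: nat.split)
    next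
      fix i assume "Suc i < Suc m"
      thus "d' i dvd d' (Suc i)" using IH(2) dvd by (auto simp: d'_def split: nat.split)
    next
      fix z assume "z \<in> \<Lambda>"
      then obtain q p :: int where z': "z - of_int q *\<^sub>R x - of_int p *\<^sub>R y \<in> \<Lambda>'" using split by blast
      obtain s t :: "nat \<Rightarrow> int" where st: "z - of_int q *\<^sub>R x - of_int p *\<^sub>R y = (\<Sum>i<m. of_int (s i) *\<^sub>R a i + of_int (t i) *\<^sub>R b i)"
        using IH(4)[OF z'] by blast
      have "z = (\<Sum>i<Suc m. of_int (case i of 0 \<Rightarrow> q | Suc i \<Rightarrow> s i) *\<^sub>R a' i + of_int (case i of 0 \<Rightarrow> p | Suc i \<Rightarrow> t i) *\<^sub>R b' i)"
        using st unfolding sum.lessThan_Suc_shift by (simp add: a'_def b'_def algebra_simps)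
      thus "\<exists>s t :: nat \<Rightarrow> int. z = (\<Sum>i<Suc m. of_int (s i) *\<^sub>R a' i + of_int (t i) *\<^sub>R b' i)"
        by (intro exI[of _ "\<lambda>i. case i of 0 \<Rightarrow> q | Suc i \<Rightarrow> s i"] exI[of _ "\<lambda>i. case i of 0 \<Rightarrow> p | Suc i \<Rightarrow> t i"])
    qed
  qed
qed

text \<open>Each complex basis vector \<open>v\<close> contributes the two real directions
  \<open>v\<close> and \<open>\<i> *s v\<close>.\<close>

lemma dim_vec_dim:
  fixes V :: "(complex ^ 'g) set"
  assumes "vec.subspace V" shows "dim V = 2 * vec.dim V"
proof -
  have "finite B \<Longrightarrow> vec.independent B \<Longrightarrow> dim (vec.span B) = 2 * card B" for B :: "(complex ^ 'g) set"
  proof (induction B rule: finite_induct)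
    case (insert v B)
    let ?U = "vec.span B"
    have U: "vec.subspace ?U" "subspace ?U" using vec_subspace_imp_subspace by auto
    have v: "v \<notin> ?U" and B: "vec.independent B" using insert vec.independent_insert[of v B] by auto
    have spU: "span ?U = ?U" using U(2) by (simp add: span_eq_iff)
    have v': "v \<notin> span ?U" using v unfolding spU .
    have span1: "w \<in> span (insert v ?U) \<longleftrightarrow> (\<exists>r. w - r *\<^sub>R v \<in> ?U)" for w
      using span_insert[of v ?U] by (simp add: spU)
    have iv: "\<i> *s v \<notin> span (insert v ?U)"
    proof
      assume "\<i> *s v \<in> span (insert v ?U)"
      then obtain r where "\<i> *s v - r *\<^sub>R v \<in> ?U" using span1 by blast
      hence "(\<i> - of_real r) *s v \<in> ?U" by (simp add: vec.scale_left_diff_distrib vec_scale_of_real)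
      hence "inverse (\<i> - of_real r) *s ((\<i> - of_real r) *s v) \<in> ?U" by (rule vec.subspace_scale[OF U(1)])
      moreover have "\<i> - of_real r \<noteq> 0" by (simp add: complex_eq_iff)
      note left_inverse[OF this]
      hence "inverse (\<i> - of_real r) *s ((\<i> - of_real r) *s v) = v"
        by (simp only: vec.scale_scale vec.scale_one)
      ultimately show False using v by simp
    qed
    have "span (insert (\<i> *s v) (insert v ?U)) = vec.span (insert v B)"
    proof
      have "v \<in> vec.span (insert v B)" by (simp add: vec.span_base)
      thus "span (insert (\<i> *s v) (insert v ?U)) \<subseteq> vec.span (insert v B)"
        using vec.span_mono[of B "insert v B"]
        by (intro span_minimal vec_subspace_imp_subspace) (auto intro: vec.span_scale)
      show "vec.span (insert v B) \<subseteq> span (insert (\<i> *s v) (insert v ?U))"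
      proof
        fix w assume "w \<in> vec.span (insert v B)"
        then obtain c where c: "w - c *s v \<in> ?U" using vec.span_breakdown_eq by blast
        have w: "w = (w - c *s v) + (Re c *\<^sub>R v + Im c *\<^sub>R (\<i> *s v))"
          by (simp add: vec_eq_iff complex_eq_iff)
        show "w \<in> span (insert (\<i> *s v) (insert v ?U))"
          by (subst w, intro span_add span_scale span_base) (use c in auto)
      qed
    qed
    hence "dim (vec.span (insert v B)) = dim (insert (\<i> *s v) (insert v ?U))"
      by (metis dim_span)
    also have "\<dots> = dim ?U + 2"
      using iv v' by (simp add: dim_insert)
    finally show ?case using insert B by simp
  qed simp
  moreover obtain B where B: "B \<subseteq> V" "vec.independent B" "V \<subseteq> vec.span B" "card B = vec.dim V"
    using vec.basis_exists[of V] by blast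
  moreover have "vec.span B = V" using vec.span_minimal[OF B(1) assms] B(3) by auto
  ultimately show ?thesis using vec.finiteI_independent[OF B(2)] by metis
qed

lemma sum_pairs: "(\<Sum>k<2 * m. f k) = (\<Sum>i<m. f (2 * i) + f (2 * i + 1))"
  for f :: "nat \<Rightarrow> 'a::comm_monoid_add"
  by (induction m) (simp_all add: add.assoc)

lemma family_independentI:
  fixes u :: "nat \<Rightarrow> 'v::real_vector"
  assumes "\<And>c k. (\<Sum>k<N. c k *\<^sub>R u k) = 0 \<Longrightarrow> k < N \<Longrightarrow> c k = 0"
  shows "inj_on u {..<N}" "independent (u ` {..<N})"
proof -
  show inj: "inj_on u {..<N}"
  proof (rule inj_onI, rule ccontr)
    fix j k assume jk: "j \<in> {..<N}" "k \<in> {..<N}" "u j = u k" "j \<noteq> k"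
    define c where "c i = (if i = j then 1 else 0) - (if i = k then 1 else (0::real))" for i
    have "(\<Sum>i<N. c i *\<^sub>R u i) = (\<Sum>i<N. if i = j then u i else 0) - (\<Sum>i<N. if i = k then u i else 0)"
      unfolding c_def scaleR_left_diff_distrib sum_subtractf by (intro arg_cong2[of _ _ _ _ "(-)"] sum.cong) auto
    also have "\<dots> = 0" using jk by simp
    finally have "c j = 0" using assms jk(1) by blast
    thus False using jk(4) by (simp add: c_def)
  qed
  show "independent (u ` {..<N})"
  proof (rule independent_if_scalars_zero)
    fix f x assume s: "(\<Sum>x\<in>u ` {..<N}. f x *\<^sub>R x) = 0" and x: "x \<in> u ` {..<N}"
    hence "(\<Sum>k<N. f (u k) *\<^sub>R u k) = 0" by (simp add: sum.reindex[OF inj])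
    thus "f x = 0" using assms[of "\<lambda>k. f (u k)"] x by auto
  qed simp
qed

section \<open>The type of a polarization\<close>

text \<open>The order a 0, b 0, a 1, b 1, ... makes the matrix of \<open>E\<close> in a symplectic
  basis block diagonal with 2x2 blocks, in step with the index pairs 2i, 2i + 1 of
  \<open>wedge_eval\<close>.\<close>

definition interleave :: "(nat \<Rightarrow> 'v) \<Rightarrow> (nat \<Rightarrow> 'v) \<Rightarrow> nat \<Rightarrow> 'v" where
  "interleave a b k = (if even k then a (k div 2) else b (k div 2))"

lemma interleave_simps [simp]: "interleave a b (2 * i) = a i" "interleave a b (Suc (2 * i)) = b i"
  by (simp_all add: interleave_def)

text \<open>Used for the ambient torus and, with the same \<open>E\<close>, for each of its
  subtori.\<close>

locale positive_form =
  fixes V \<Lambda> :: "(complex ^ 'g) set" and E :: "complex ^ 'g \<Rightarrow> complex ^ 'g \<Rightarrow> real"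
  assumes L: "is_lattice V \<Lambda>" and E: "form11 E"
    and int: "l \<in> \<Lambda> \<Longrightarrow> m \<in> \<Lambda> \<Longrightarrow> E l m \<in> \<int>"
    and pos: "v \<in> V \<Longrightarrow> v \<noteq> 0 \<Longrightarrow> E v (\<i> *s v) > 0"
begin

lemmas Esimps = form11D(5-13)[OF E]

lemma Esum: "E (\<Sum>i\<in>I. f i) y = (\<Sum>i\<in>I. E (f i) y)" "E y (\<Sum>i\<in>I. f i) = (\<Sum>i\<in>I. E y (f i))"
  by (rule linear_sum[OF form11D(2)[OF E]]) (rule linear_sum[OF form11D(1)[OF E]])

lemma subV: "subspace V" using is_latticeD(1)[OF L] vec_subspace_imp_subspace by blast

lemma nondegenerate:
  assumes "x \<in> V" "\<And>y. y \<in> \<Lambda> \<Longrightarrow> E x y = 0" shows "x = 0"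
proof (rule ccontr)
  assume "x \<noteq> 0"
  have "\<i> *s x \<in> span \<Lambda>" using is_latticeD(1,6)[OF L] assms(1) vec.subspace_scale by blast
  from linear_eq_0_on_span[OF form11D(1)[OF E] assms(2) this] have "E x (\<i> *s x) = 0" .
  thus False using pos[OF assms(1) \<open>x \<noteq> 0\<close>] by simp
qed

definition is_symplectic :: "(nat \<Rightarrow> complex ^ 'g) \<Rightarrow> (nat \<Rightarrow> complex ^ 'g) \<Rightarrow> (nat \<Rightarrow> nat) \<Rightarrow> bool" where
  "is_symplectic a b d \<longleftrightarrow>
    (\<forall>i<vec.dim V. a i \<in> \<Lambda> \<and> b i \<in> \<Lambda> \<and> 0 < d i) \<and>
    (\<forall>i. Suc i < vec.dim V \<longrightarrow> d i dvd d (Suc i)) \<and>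
    (\<forall>i<vec.dim V. \<forall>j<vec.dim V. E (a i) (a j) = 0 \<and> E (b i) (b j) = 0 \<and> E (a i) (b j) = (if i = j then real (d i) else 0)) \<and>
    (\<forall>x\<in>\<Lambda>. \<exists>s t :: nat \<Rightarrow> int. x = (\<Sum>i<vec.dim V. of_int (s i) *\<^sub>R a i + of_int (t i) *\<^sub>R b i)) \<and>
    inj_on (interleave a b) {..<2 * vec.dim V} \<and> independent (interleave a b ` {..<2 * vec.dim V})"

text \<open>Pairing with the partner vectors shows that the vectors of
  \<open>symplectic_basis\<close> form a real basis of \<open>V\<close>, so the number of pairs is
  the complex dimension.\<close>

lemma ex_symplectic: "\<exists>a b d. is_symplectic a b d"
proof -
  have "\<exists>(m::nat) a b d. (\<forall>i<m. a i \<in> \<Lambda> \<and> b i \<in> \<Lambda> \<and> (0::nat) < d i) \<and>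
    (\<forall>i. Suc i < m \<longrightarrow> d i dvd d (Suc i)) \<and>
    (\<forall>i<m. \<forall>j<m. E (a i) (a j) = 0 \<and> E (b i) (b j) = 0 \<and> E (a i) (b j) = (if i = j then real (d i) else 0)) \<and>
    (\<forall>x\<in>\<Lambda>. \<exists>s t :: nat \<Rightarrow> int. x = (\<Sum>i<m. of_int (s i) *\<^sub>R a i + of_int (t i) *\<^sub>R b i))"
  proof (rule symplectic_basis[OF form11D(1)[OF E] form11D(3)[OF E]])
    show "x = 0" if "x \<in> span \<Lambda>" "\<And>y. y \<in> \<Lambda> \<Longrightarrow> E x y = 0" for x
      using nondegenerate that is_latticeD(6)[OF L] by blast
  qed (use is_latticeD[OF L] int in auto)
  then obtain m a b d where S: "\<forall>i<m. a i \<in> \<Lambda> \<and> b i \<in> \<Lambda> \<and> (0::nat) < d i"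
    "\<forall>i. Suc i < m \<longrightarrow> d i dvd d (Suc i)"
    "\<forall>i<m. \<forall>j<m. E (a i) (a j) = 0 \<and> E (b i) (b j) = 0 \<and> E (a i) (b j) = (if i = j then real (d i) else 0)"
    "\<forall>x\<in>\<Lambda>. \<exists>s t :: nat \<Rightarrow> int. x = (\<Sum>i<m. of_int (s i) *\<^sub>R a i + of_int (t i) *\<^sub>R b i)"
    by (elim exE conjE)
  let ?u = "interleave a b"
  have coeff0: "c k = 0" if z: "(\<Sum>k<2 * m. c k *\<^sub>R ?u k) = 0" and k: "k < 2 * m" for c k
  proof -
    have z': "(\<Sum>i<m. c (2 * i) *\<^sub>R a i + c (2 * i + 1) *\<^sub>R b i) = 0" using z by (simp add: sum_pairs)
    have i: "k div 2 < m" using k by simp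
    have dk: "d (k div 2) \<noteq> 0" using S(1) i by blast
    have "E (\<Sum>i<m. c (2 * i) *\<^sub>R a i + c (2 * i + 1) *\<^sub>R b i) (b (k div 2)) = (\<Sum>i<m. if i = k div 2 then c (2 * i) * real (d i) else 0)"
      unfolding Esum by (intro sum.cong) (use S(3) i in \<open>auto simp: Esimps\<close>)
    hence 1: "c (2 * (k div 2)) = 0" unfolding z' using i dk by (simp add: Esimps)
    have "E (a (k div 2)) (\<Sum>i<m. c (2 * i) *\<^sub>R a i + c (2 * i + 1) *\<^sub>R b i) = (\<Sum>i<m. if i = k div 2 then c (2 * i + 1) * real (d i) else 0)"
      unfolding Esum by (intro sum.cong) (use S(3) i in \<open>auto simp: Esimps\<close>)
    hence 2: "c (2 * (k div 2) + 1) = 0" unfolding z' using i dk by (simp add: Esimps)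
    show ?thesis
    proof (cases "even k")
      case True
      thus ?thesis using 1 by simp
    next
      case False
      hence "2 * (k div 2) + 1 = k" by (rule odd_two_times_div_two_succ)
      thus ?thesis using 2 by simp
    qed
  qed
  have ind1: "inj_on ?u {..<2 * m}"
    by (rule family_independentI(1), erule coeff0)
  have ind2: "independent (?u ` {..<2 * m})"
    by (rule family_independentI(2), erule coeff0)
  note ind = ind1 ind2
  have "\<Lambda> \<subseteq> span (?u ` {..<2 * m})"
  proof
    fix x assume "x \<in> \<Lambda>"
    then obtain s t :: "nat \<Rightarrow> int" where x: "x = (\<Sum>i<m. of_int (s i) *\<^sub>R a i + of_int (t i) *\<^sub>R b i)" using S(4) by blast
    have "a i \<in> ?u ` {..<2 * m}" "b i \<in> ?u ` {..<2 * m}" if "i < m" for i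
      using that by (auto intro: image_eqI[of _ _ "2 * i"] image_eqI[of _ _ "Suc (2 * i)"])
    thus "x \<in> span (?u ` {..<2 * m})" unfolding x
      by (intro span_sum span_add span_scale span_base) auto
  qed
  hence "V \<subseteq> span (?u ` {..<2 * m})" using is_latticeD(6)[OF L] span_minimal subspace_span by blast
  moreover have "?u ` {..<2 * m} \<subseteq> V"
    using S(1) is_latticeD(2)[OF L] by (auto simp: interleave_def)
  ultimately have "dim V = card (?u ` {..<2 * m})" using ind(2) by (intro dim_unique) auto
  also have "\<dots> = 2 * m" using card_image[OF ind(1)] by simp
  finally have "m = vec.dim V" using dim_vec_dim[OF is_latticeD(1)[OF L]] by simp
  thus ?thesis unfolding is_symplectic_def
    by (intro exI[of _ a] exI[of _ b] exI[of _ d]) (use S ind in \<open>auto\<close>)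
qed

lemma symplecticD:
  assumes "is_symplectic a b d"
  shows "i < vec.dim V \<Longrightarrow> a i \<in> \<Lambda>" "i < vec.dim V \<Longrightarrow> b i \<in> \<Lambda>" "i < vec.dim V \<Longrightarrow> 0 < d i"
    "i < vec.dim V \<Longrightarrow> j < vec.dim V \<Longrightarrow> E (a i) (a j) = 0"
    "i < vec.dim V \<Longrightarrow> j < vec.dim V \<Longrightarrow> E (b i) (b j) = 0"
    "i < vec.dim V \<Longrightarrow> j < vec.dim V \<Longrightarrow> E (a i) (b j) = (if i = j then real (d i) else 0)"
    "i < vec.dim V \<Longrightarrow> j < vec.dim V \<Longrightarrow> E (b i) (a j) = (if i = j then - real (d i) else 0)"
    "Suc i < vec.dim V \<Longrightarrow> d i dvd d (Suc i)"
    "x \<in> \<Lambda> \<Longrightarrow> \<exists>s t :: nat \<Rightarrow> int. x = (\<Sum>i<vec.dim V. of_int (s i) *\<^sub>R a i + of_int (t i) *\<^sub>R b i)"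
    "inj_on (interleave a b) {..<2 * vec.dim V}" "independent (interleave a b ` {..<2 * vec.dim V})"
proof -
  show *: "i < vec.dim V \<Longrightarrow> j < vec.dim V \<Longrightarrow> E (a i) (b j) = (if i = j then real (d i) else 0)" for i j
    using assms unfolding is_symplectic_def by blast
  show "E (b i) (a j) = (if i = j then - real (d i) else 0)" if "i < vec.dim V" "j < vec.dim V"
    using form11D(3)[OF E, of "b i" "a j"] *[OF that(2,1)] by auto
qed (use assms in \<open>unfold is_symplectic_def, blast\<close>)+

lemma symplectic_expand:
  assumes S: "is_symplectic a b d" and v: "v \<in> V"
  shows "v = (\<Sum>i<vec.dim V. (E v (b i) / d i) *\<^sub>R a i + (E (a i) v / d i) *\<^sub>R b i)" (is "v = ?w")
proof -
  let ?m = "vec.dim V"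
  note S1 = symplecticD[OF S]
  have w1: "E ?w (b j) = E v (b j)" if j: "j < ?m" for j
  proof -
    have "E ?w (b j) = (\<Sum>i<?m. if i = j then E v (b i) else 0)"
      unfolding Esum by (intro sum.cong) (use S1 j in \<open>auto simp: Esimps\<close>)
    thus ?thesis using j by simp
  qed
  have w2: "E (a j) ?w = E (a j) v" if j: "j < ?m" for j
  proof -
    have "E (a j) ?w = (\<Sum>i<?m. if i = j then E (a i) v else 0)"
      unfolding Esum by (intro sum.cong) (use S1 j in \<open>auto simp: Esimps\<close>)
    thus ?thesis using j by simp
  qed
  have aV: "a i \<in> V" "b i \<in> V" if "i < ?m" for i using S1(1,2)[OF that] is_latticeD(2)[OF L] by auto
  have wV: "?w \<in> V"
    by (rule subspace_sum[OF subV], rule subspace_add[OF subV]; rule subspace_scale[OF subV]) (use aV in auto)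
  have "v - ?w = 0"
  proof (rule nondegenerate)
    show "v - ?w \<in> V" by (rule subspace_diff[OF subV v wV])
    fix y assume "y \<in> \<Lambda>"
    then obtain s t :: "nat \<Rightarrow> int" where y: "y = (\<Sum>i<?m. of_int (s i) *\<^sub>R a i + of_int (t i) *\<^sub>R b i)"
      using S unfolding is_symplectic_def by blast
    have "E (v - ?w) (b i) = 0" if "i < ?m" for i
      unfolding Esimps(6) w1[OF that] by simp
    moreover have "E (v - ?w) (a i) = 0" if "i < ?m" for i
    proof -
      have "E (v - ?w) (a i) = - E (a i) (v - ?w)" by (rule form11D(3)[OF E])
      also have "\<dots> = 0" unfolding Esimps(5) w2[OF that] by simp
      finally show ?thesis .
    qed
    ultimately show "E (v - ?w) y = 0" unfolding y Esum(2) by (intro sum.neutral) (simp add: Esimps(1,3))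
  qed
  thus ?thesis by simp
qed

text \<open>The vectors whose classes form the kernel of the polarization map, by
  \<open>kernel_phi\<close>.\<close>

definition dual_lattice :: "(complex ^ 'g) set" where
  "dual_lattice = {v \<in> V. \<forall>l\<in>\<Lambda>. E l v \<in> \<int>}"

lemma group_dual_lattice: "group (vec_group dual_lattice)"
proof (rule groupI)
  show "\<exists>y\<in>carrier (vec_group dual_lattice). y \<otimes>\<^bsub>vec_group dual_lattice\<^esub> x = \<one>\<^bsub>vec_group dual_lattice\<^esub>"
    if "x \<in> carrier (vec_group dual_lattice)" for x
    using that subspace_neg[OF subV] linear_neg[OF form11D(1)[OF E]] by (intro bexI[of _ "- x"]) (auto simp: dual_lattice_def)
qed (use subV in \<open>auto simp: dual_lattice_def Esimps subspace_add subspace_0 add_ac\<close>)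

lemma kernel_phi:
  assumes M: "M \<in> carrier (Pic V \<Lambda>)" and f: "f \<in> M" "has_form V \<Lambda> f E"
  shows "(torus V \<Lambda>)\<lparr>carrier := kernel (torus V \<Lambda>) (dual V \<Lambda>) (phi V \<Lambda> M)\<rparr> = vec_group dual_lattice Mod \<Lambda>"
proof -
  have "kernel (torus V \<Lambda>) (dual V \<Lambda>) (phi V \<Lambda> M) = proj V \<Lambda> ` dual_lattice"
    unfolding kernel_def carrier_torus[OF L] dual_lattice_def
    using phi_eq_one_iff[OF L M f] by (auto simp: dual_def)
  also have "\<dots> = rcosets\<^bsub>vec_group dual_lattice\<^esub> \<Lambda>"
    by (auto simp: RCOSETS_def proj_def r_coset_def)
  finally have "kernel (torus V \<Lambda>) (dual V \<Lambda>) (phi V \<Lambda> M) = rcosets\<^bsub>vec_group dual_lattice\<^esub> \<Lambda>" .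
  moreover have "set_mult (vec_group V) = set_mult (vec_group dual_lattice)"
    by (simp add: set_mult_def fun_eq_iff)
  ultimately show ?thesis by (simp add: torus_def FactGroup_def)
qed

text \<open>The dual lattice is generated by the \<open>a i\<close> and \<open>b i\<close> divided
  by \<open>d i\<close>. The integers \<open>E v (b i)\<close> and \<open>E (a i) v\<close> are the
  coordinates in this system, and \<open>v\<close> lies in the lattice exactly if all of them are
  divisible by the respective \<open>d i\<close>.\<close>

lemma discriminant_group:
  assumes S: "is_symplectic a b d"
  defines "D \<equiv> product_group {..<vec.dim V} (\<lambda>i. integer_mod_group (d i))"
  shows "vec_group dual_lattice Mod \<Lambda> \<cong> D \<times>\<times> D"
proof -
  let ?m = "vec.dim V" and ?K = "vec_group dual_lattice"
  note S1 = symplecticD[OF S]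
  have LV: "\<And>l. l \<in> \<Lambda> \<Longrightarrow> l \<in> V" using is_latticeD(2)[OF L] by blast
  have aV: "a i \<in> V" "b i \<in> V" if "i < ?m" for i using S1(1,2)[OF that] LV by auto
  define x where "x v i = \<lfloor>E v (b i)\<rfloor>" for v i
  define y where "y v i = \<lfloor>E (a i) v\<rfloor>" for v i
  have xr: "of_int (x v i) = E v (b i)" "of_int (y v i) = E (a i) v" if "v \<in> dual_lattice" "i < ?m" for v i
  proof -
    have "E (b i) v \<in> \<int>" "E (a i) v \<in> \<int>" using that S1 by (auto simp: dual_lattice_def)
    moreover have "E v (b i) = - E (b i) v" by (rule form11D(3)[OF E])
    ultimately show "of_int (x v i) = E v (b i)" "of_int (y v i) = E (a i) v"
      by (auto simp: x_def y_def elim!: Ints_cases)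
  qed
  define h where "h v = (\<lambda>i\<in>{..<?m}. x v i mod int (d i), \<lambda>i\<in>{..<?m}. y v i mod int (d i))" for v
  have grD: "group D" unfolding D_def by simp
  have cD: "carrier D = (\<Pi>\<^sub>E i\<in>{..<?m}. {0..<int (d i)})"
    unfolding D_def carrier_product_group by (rule PiE_cong) (use S1(3) in \<open>auto simp: carrier_integer_mod_group\<close>)
  have multD: "p \<otimes>\<^bsub>D\<^esub> q = (\<lambda>i\<in>{..<?m}. (p i + q i) mod int (d i))" for p q
    unfolding D_def mult_product_group using S1(3) by (auto simp: integer_mod_group_def restrict_def fun_eq_iff)
  have hc: "h v \<in> carrier (D \<times>\<times> D)" for v
    using S1(3) by (auto simp: h_def cD)
  have hm: "h (v + w) = h v \<otimes>\<^bsub>D \<times>\<times> D\<^esub> h w" if v: "v \<in> dual_lattice" and w: "w \<in> dual_lattice" for v w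
  proof -
    have vw: "v + w \<in> dual_lattice" using v w subspace_add[OF subV] by (auto simp: dual_lattice_def Esimps)
    have "x (v + w) i = x v i + x w i" "y (v + w) i = y v i + y w i" if "i < ?m" for i
    proof -
      have "real_of_int (x (v + w) i) = real_of_int (x v i + x w i)" "real_of_int (y (v + w) i) = real_of_int (y v i + y w i)"
        using xr[OF vw that] xr[OF v that] xr[OF w that] by (simp_all add: Esimps)
      thus "x (v + w) i = x v i + x w i" "y (v + w) i = y v i + y w i" by (simp_all only: of_int_eq_iff)
    qed
    thus ?thesis by (auto simp: h_def multD mod_simps fun_eq_iff)
  qed
  interpret gh: group_hom ?K "D \<times>\<times> D" h
    by (intro group_hom.intro group_hom_axioms.intro homI group_dual_lattice DirProd_group grD)
       (use hc hm in auto)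
  have comb: "v \<in> dual_lattice \<and> (\<forall>j<?m. x v j = s j \<and> y v j = t j)"
    if v: "v = (\<Sum>i<?m. (of_int (s i) / d i) *\<^sub>R a i + (of_int (t i) / d i) *\<^sub>R b i)" for v and s t :: "nat \<Rightarrow> int"
  proof -
    have vb: "E v (b j) = of_int (s j)" if j: "j < ?m" for j
    proof -
      have "E v (b j) = (\<Sum>i<?m. if i = j then of_int (s j) else 0)"
        unfolding v Esum by (intro sum.cong) (use S1 j in \<open>auto simp: Esimps\<close>)
      thus ?thesis using j by simp
    qed
    have va: "E (a j) v = of_int (t j)" if j: "j < ?m" for j
    proof -
      have "E (a j) v = (\<Sum>i<?m. if i = j then of_int (t j) else 0)"
        unfolding v Esum by (intro sum.cong) (use S1 j in \<open>auto simp: Esimps\<close>)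
      thus ?thesis using j by simp
    qed
    have vb': "E (b j) v = - of_int (s j)" if "j < ?m" for j
      using vb[OF that] form11D(3)[OF E, of "b j" v] by simp
    have "v \<in> V" unfolding v
      by (rule subspace_sum[OF subV], rule subspace_add[OF subV]; rule subspace_scale[OF subV]) (use aV in auto)
    moreover have "E l v \<in> \<int>" if ll: "l \<in> \<Lambda>" for l
    proof -
      obtain s' t' :: "nat \<Rightarrow> int" where l: "l = (\<Sum>i<?m. of_int (s' i) *\<^sub>R a i + of_int (t' i) *\<^sub>R b i)"
        using S1(9)[OF ll] by blast
      show ?thesis unfolding l Esum by (intro Ints_sum) (auto simp: Esimps va vb' intro!: Ints_diff Ints_mult)
    qed
    ultimately show ?thesis using va vb by (simp add: dual_lattice_def x_def y_def)
  qed
  have surj: "h ` carrier ?K = carrier (D \<times>\<times> D)"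
  proof
    show "carrier (D \<times>\<times> D) \<subseteq> h ` carrier ?K"
    proof
      fix p assume "p \<in> carrier (D \<times>\<times> D)"
      then obtain s t where p: "p = (s, t)" "s \<in> carrier D" "t \<in> carrier D" by auto
      define v where "v = (\<Sum>i<?m. (of_int (s i) / d i) *\<^sub>R a i + (of_int (t i) / d i) *\<^sub>R b i)"
      note c = comb[OF v_def]
      have "(\<lambda>i\<in>{..<?m}. x v i mod int (d i)) = s" "(\<lambda>i\<in>{..<?m}. y v i mod int (d i)) = t"
        using p(2,3) c unfolding cD by (auto simp: fun_eq_iff PiE_def Pi_def extensional_def)
      hence "h v = p" by (simp add: h_def p(1))
      thus "p \<in> h ` carrier ?K" using c by auto
    qed
  qed (rule image_subsetI, rule hc)
  have ker: "kernel ?K (D \<times>\<times> D) h = \<Lambda>"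
  proof -
    have oneD: "\<one>\<^bsub>D\<^esub> = (\<lambda>i\<in>{..<?m}. 0)" by (simp add: D_def)
    have h1: "h v = \<one>\<^bsub>D \<times>\<times> D\<^esub> \<longleftrightarrow> (\<forall>i<?m. int (d i) dvd x v i \<and> int (d i) dvd y v i)" for v
      unfolding h_def one_DirProd oneD by (auto simp: fun_eq_iff restrict_def dvd_eq_mod_eq_0)
    have "v \<in> \<Lambda>" if v: "v \<in> dual_lattice" "\<And>i. i < ?m \<Longrightarrow> int (d i) dvd x v i \<and> int (d i) dvd y v i" for v
    proof -
      have "v = (\<Sum>i<?m. of_int (x v i div int (d i)) *\<^sub>R a i + of_int (y v i div int (d i)) *\<^sub>R b i)"
      proof (subst symplectic_expand[OF S, of v])
        show "v \<in> V" using v(1) by (simp add: dual_lattice_def)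
        show "(\<Sum>i<?m. (E v (b i) / d i) *\<^sub>R a i + (E (a i) v / d i) *\<^sub>R b i) =
            (\<Sum>i<?m. of_int (x v i div int (d i)) *\<^sub>R a i + of_int (y v i div int (d i)) *\<^sub>R b i)"
        proof (rule sum.cong)
          fix i assume "i \<in> {..<?m}"
          hence i: "i < ?m" by simp
          show "(E v (b i) / d i) *\<^sub>R a i + (E (a i) v / d i) *\<^sub>R b i =
              of_int (x v i div int (d i)) *\<^sub>R a i + of_int (y v i div int (d i)) *\<^sub>R b i"
            using v(2)[OF i] S1(3)[OF i] by (simp add: real_of_int_div xr[OF v(1) i])
        qed simp
      qed
      also have "\<dots> \<in> \<Lambda>"
        by (intro lattice_sum[OF L] is_latticeD(8)[OF L] lattice_int_scale[OF L]) (use S1 in auto)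
      finally show ?thesis .
    qed
    moreover have "v \<in> dual_lattice \<and> (\<forall>i<?m. int (d i) dvd x v i \<and> int (d i) dvd y v i)" if v: "v \<in> \<Lambda>" for v
    proof -
      obtain s t :: "nat \<Rightarrow> int" where st: "v = (\<Sum>i<?m. of_int (s i) *\<^sub>R a i + of_int (t i) *\<^sub>R b i)"
        using S1(9)[OF v] by blast
      have "v = (\<Sum>i<?m. (of_int (s i * int (d i)) / d i) *\<^sub>R a i + (of_int (t i * int (d i)) / d i) *\<^sub>R b i)"
        unfolding st using S1(3) by (intro sum.cong) auto
      from comb[OF this] show ?thesis by auto
    qed
    ultimately show ?thesis unfolding kernel_def by (auto simp: h1 simp del: one_DirProd)
  qed
  show ?thesis using gh.FactGroup_iso[OF surj] unfolding ker .
qed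

lemma product_group_cong:
  assumes "\<And>i. i \<in> I \<Longrightarrow> G i = H i" shows "product_group I G = product_group I H"
  unfolding product_group_def using assms by (auto intro!: PiE_cong simp: restrict_def fun_eq_iff)

lemma has_type_symplectic:
  assumes M: "M \<in> carrier (Pic V \<Lambda>)" and f: "f \<in> M" "has_form V \<Lambda> f E" and S: "is_symplectic a b d"
  shows "has_type V \<Lambda> M (map d [0..<vec.dim V])"
proof -
  have D: "product_group {..<vec.dim V} (\<lambda>i. integer_mod_group (map d [0..<vec.dim V] ! i))
      = product_group {..<vec.dim V} (\<lambda>i. integer_mod_group (d i))"
    by (rule product_group_cong) simp
  show ?thesis
    unfolding has_type_def kernel_phi[OF M f]
    using discriminant_group[OF S] symplecticD[OF S] by (auto simp: Let_def D)
qed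

lemma card_product_mod:
  assumes "\<forall>d\<in>set ds. 0 < d"
  shows "card (carrier (product_group {..<length ds} (\<lambda>i. integer_mod_group (ds ! i)))) = prod_list ds"
proof -
  have "card (carrier (product_group {..<length ds} (\<lambda>i. integer_mod_group (ds ! i)))) = (\<Prod>i<length ds. ds ! i)"
    unfolding carrier_product_group
    by (subst card_PiE) (use assms in \<open>auto simp: carrier_integer_mod_group intro!: prod.cong\<close>)
  thus ?thesis by (simp add: prod.list_conv_set_nth atLeast0LessThan)
qed

lemma pow_DirProd_mod:
  assumes "p \<in> carrier (product_group {..<n} (\<lambda>i. integer_mod_group (ds i)))"
    "q \<in> carrier (product_group {..<n} (\<lambda>i. integer_mod_group (ds i)))"
  shows "(p, q) [^]\<^bsub>product_group {..<n} (\<lambda>i. integer_mod_group (ds i)) \<times>\<times> product_group {..<n} (\<lambda>i. integer_mod_group (ds i))\<^esub> (k::nat)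
    = (\<lambda>i\<in>{..<n}. (int k * p i) mod int (ds i), \<lambda>i\<in>{..<n}. (int k * q i) mod int (ds i))"
proof (induction k)
  case (Suc k)
  thus ?case by (auto simp: fun_eq_iff mod_simps algebra_simps)
qed (simp add: restrict_def)

text \<open>\<open>pol_type\<close> is an arbitrary choice among the lists with
  \<open>has_type\<close>, so its properties are derived for every such list: the order of the
  kernel fixes the product of the entries, and the chain of divisibilities makes the last entry
  annihilate the kernel.\<close>

lemma has_type_prod_kill:
  assumes M: "M \<in> carrier (Pic V \<Lambda>)" and f: "f \<in> M" "has_form V \<Lambda> f E"
    and S: "is_symplectic a b d" and ds: "has_type V \<Lambda> M ds"
  shows "prod_list ds = (\<Prod>i<vec.dim V. d i)"
    and "vec.dim V \<noteq> 0 \<Longrightarrow> v \<in> dual_lattice \<Longrightarrow> real (last ds) *\<^sub>R v \<in> \<Lambda>"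
    and "vec.dim V \<noteq> 0 \<Longrightarrow> last ds > 0"
proof -
  let ?K = "vec_group dual_lattice Mod \<Lambda>"
  define D where "D ds = product_group {..<length ds} (\<lambda>i. integer_mod_group (ds ! i))" for ds
  have type: "length ds = vec.dim V" "\<forall>d\<in>set ds. 0 < d" "\<And>i. Suc i < length ds \<Longrightarrow> ds ! i dvd ds ! Suc i"
      "?K \<cong> D ds \<times>\<times> D ds" if "has_type V \<Lambda> M ds" for ds
    using that unfolding has_type_def kernel_phi[OF M f] D_def Let_def by auto
  have card: "card (carrier ?K) = (prod_list ds)\<^sup>2" if t: "has_type V \<Lambda> M ds" for ds
  proof -
    obtain \<phi> where "\<phi> \<in> iso ?K (D ds \<times>\<times> D ds)" using type(4)[OF t] unfolding is_iso_def by blast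
    hence "card (carrier ?K) = card (carrier (D ds \<times>\<times> D ds))"
      by (auto simp: iso_def intro: bij_betw_same_card)
    also have "\<dots> = (prod_list ds)\<^sup>2"
      using card_product_mod[OF type(2)[OF t]] by (simp add: D_def card_cartesian_product power2_eq_square del: carrier_product_group)
    finally show ?thesis .
  qed
  have "(prod_list ds)\<^sup>2 = (prod_list (map d [0..<vec.dim V]))\<^sup>2"
    using card[OF ds] card[OF has_type_symplectic[OF M f S]] by simp
  hence "prod_list ds = prod_list (map d [0..<vec.dim V])" by simp
  thus "prod_list ds = (\<Prod>i<vec.dim V. d i)"
    by (simp add: prod.distinct_set_conv_list[symmetric] atLeast0LessThan)
  assume n: "vec.dim V \<noteq> 0"
  have ne: "ds \<noteq> []" using n type(1)[OF ds] by auto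
  show "last ds > 0" using type(2)[OF ds] ne by simp
  assume v: "v \<in> dual_lattice"
  let ?e = "last ds"
  obtain \<phi> where \<phi>: "\<phi> \<in> iso ?K (D ds \<times>\<times> D ds)" using type(4)[OF ds] unfolding is_iso_def by blast
  have grD: "group (D ds \<times>\<times> D ds)" unfolding D_def by (intro DirProd_group) auto
  have Ksub: "subgroup \<Lambda> (vec_group dual_lattice)"
  proof -
    have "\<Lambda> \<subseteq> dual_lattice" using is_latticeD(2)[OF L] int by (auto simp: dual_lattice_def)
    moreover have "inv\<^bsub>vec_group dual_lattice\<^esub> x = - x" if "x \<in> dual_lattice" for x
      using that subspace_neg[OF subV] linear_neg[OF form11D(1)[OF E]]
      by (intro group.inv_equality[OF group_dual_lattice]) (auto simp: dual_lattice_def)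
    ultimately show ?thesis
      using is_latticeD[OF L] by unfold_locales (auto simp: subset_iff)
  qed
  have cgK: "comm_group (vec_group dual_lattice)"
    by (rule group.group_comm_groupI[OF group_dual_lattice]) (simp add: add.commute)
  interpret K: comm_group ?K by (rule comm_group.abelian_FactGroup[OF cgK Ksub])
  interpret gh: group_hom ?K "D ds \<times>\<times> D ds" \<phi>
    using \<phi> grD K.is_group by (simp add: group_hom_def group_hom_axioms_def iso_def)
  define x where "x = \<Lambda> #>\<^bsub>vec_group dual_lattice\<^esub> v"
  have x: "x \<in> carrier ?K" using v by (simp add: x_def carrier_FactGroup)
  have kill: "p [^]\<^bsub>D ds \<times>\<times> D ds\<^esub> ?e = \<one>\<^bsub>D ds \<times>\<times> D ds\<^esub>" if p: "p \<in> carrier (D ds \<times>\<times> D ds)" for p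
  proof -
    have dvd: "ds ! i dvd ?e" if "i < length ds" for i
    proof -
      have "ds ! i dvd ds ! (i + j)" if "i + j < length ds" for j
        using that
      proof (induction j)
        case (Suc j)
        thus ?case using type(3)[OF ds, of "i + j"] by (auto intro: dvd_trans)
      qed simp
      from this[of "length ds - 1 - i"] show ?thesis using that ne by (simp add: last_conv_nth)
    qed
    obtain s t where st: "p = (s, t)" "s \<in> carrier (D ds)" "t \<in> carrier (D ds)" using p by auto
    have "(int ?e * z) mod int (ds ! i) = 0" if "i < length ds" for i z
      using dvd[OF that] by (metis dvd_eq_mod_eq_0 dvd_mult2 int_dvd_int_iff)
    thus ?thesis using pow_DirProd_mod[of s "length ds" "\<lambda>i. ds ! i" t ?e] st(2,3)
      unfolding st(1) D_def by (auto simp: restrict_def fun_eq_iff simp del: carrier_product_group)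
  qed
  have "\<phi> (x [^]\<^bsub>?K\<^esub> ?e) = \<phi> \<one>\<^bsub>?K\<^esub>"
    unfolding gh.hom_one gh.hom_nat_pow[OF x] by (rule kill[OF gh.hom_closed[OF x]])
  hence "x [^]\<^bsub>?K\<^esub> ?e = \<one>\<^bsub>?K\<^esub>"
    using inj_onD[of \<phi> "carrier ?K"] \<phi> K.nat_pow_closed[OF x] K.one_closed unfolding iso_def bij_betw_def by blast
  moreover have "x [^]\<^bsub>?K\<^esub> ?e = \<Lambda> #>\<^bsub>vec_group dual_lattice\<^esub> (v [^]\<^bsub>vec_group dual_lattice\<^esub> ?e)"
    unfolding x_def by (rule comm_group.rcos_pow[OF cgK Ksub]) (use v in simp)
  moreover have "v [^]\<^bsub>vec_group dual_lattice\<^esub> (k::nat) = real k *\<^sub>R v" for k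
    by (induction k) (simp_all add: scaleR_left_distrib add.commute)
  moreover have "real ?e *\<^sub>R v \<in> \<Lambda> #>\<^bsub>vec_group dual_lattice\<^esub> (real ?e *\<^sub>R v)"
    using is_latticeD(3)[OF L] by (auto simp: r_coset_def)
  ultimately show "real ?e *\<^sub>R v \<in> \<Lambda>" by simp
qed

end

section \<open>Exterior algebra and simultaneous diagonalisation\<close>

section \<open>Evaluating wedge products of 2-forms\<close>

lemma prod_pairs: "(\<Prod>k<2 * m. f k) = (\<Prod>i<m. f (2 * i) * f (2 * i + 1))"
  for f :: "nat \<Rightarrow> 'a::comm_monoid_mult"
  by (induction m) (simp_all add: mult.assoc)

lemma sum_PiE_pairs:
  fixes f :: "(nat \<Rightarrow> 'x) \<Rightarrow> 'b::comm_monoid_add"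
  shows "(\<Sum>g\<in>PiE {..<n} (\<lambda>_. S \<times> S). f (\<lambda>r\<in>{..<2 * n}. if even r then fst (g (r div 2)) else snd (g (r div 2))))
    = (\<Sum>s\<in>PiE {..<2 * n} (\<lambda>_. S). f s)"
proof (rule sum.reindex_bij_witness[where j = "\<lambda>g. \<lambda>r\<in>{..<2 * n}. if even r then fst (g (r div 2)) else snd (g (r div 2))"
      and i = "\<lambda>s. \<lambda>i\<in>{..<n}. (s (2 * i), s (2 * i + 1))"])
  fix g assume g: "g \<in> PiE {..<n} (\<lambda>_. S \<times> S)"
  have gS: "fst (g i) \<in> S" "snd (g i) \<in> S" if "i < n" for i using g that by (auto simp: PiE_def Pi_def mem_Times_iff)
  show "(\<lambda>i\<in>{..<n}. ((\<lambda>r\<in>{..<2 * n}. if even r then fst (g (r div 2)) else snd (g (r div 2))) (2 * i),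
      (\<lambda>r\<in>{..<2 * n}. if even r then fst (g (r div 2)) else snd (g (r div 2))) (2 * i + 1))) = g"
    using g by (auto simp: fun_eq_iff PiE_def extensional_def)
  show "(\<lambda>r\<in>{..<2 * n}. if even r then fst (g (r div 2)) else snd (g (r div 2))) \<in> PiE {..<2 * n} (\<lambda>_. S)"
    using gS by auto
next
  fix s assume s: "s \<in> PiE {..<2 * n} (\<lambda>_. S)"
  have sS: "s k \<in> S" if "k < 2 * n" for k using s that by (auto simp: PiE_def Pi_def)
  show "(\<lambda>i\<in>{..<n}. (s (2 * i), s (2 * i + 1))) \<in> PiE {..<n} (\<lambda>_. S \<times> S)"
    using sS by auto
  show "(\<lambda>r\<in>{..<2 * n}. if even r then fst ((\<lambda>i\<in>{..<n}. (s (2 * i), s (2 * i + 1))) (r div 2))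
      else snd ((\<lambda>i\<in>{..<n}. (s (2 * i), s (2 * i + 1))) (r div 2))) = s"
  proof
    fix r
    show "(\<lambda>r\<in>{..<2 * n}. if even r then fst ((\<lambda>i\<in>{..<n}. (s (2 * i), s (2 * i + 1))) (r div 2))
      else snd ((\<lambda>i\<in>{..<n}. (s (2 * i), s (2 * i + 1))) (r div 2))) r = s r"
    proof (cases "r < 2 * n")
      case True
      hence "r div 2 < n" by simp
      moreover have "odd r \<Longrightarrow> Suc (2 * (r div 2)) = r" using odd_two_times_div_two_succ[of r] by simp
      ultimately show ?thesis using True by auto
    next
      case False
      thus ?thesis using s by (auto simp: PiE_def extensional_def)
    qed
  qed
qed auto

definition detn :: "nat \<Rightarrow> (nat \<Rightarrow> nat \<Rightarrow> real) \<Rightarrow> real" where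
  "detn N A = (\<Sum>p | p permutes {..<N}. of_int (sign p) * (\<Prod>k<N. A (p k) k))"

lemma detn_int: "(\<And>j k. j < N \<Longrightarrow> k < N \<Longrightarrow> A j k \<in> \<int>) \<Longrightarrow> detn N A \<in> \<int>"
  unfolding detn_def using permutes_in_image by (fastforce intro!: Ints_sum Ints_mult Ints_prod)

lemma permutation_lessThan: "p permutes {..<N::nat} \<Longrightarrow> permutation p"
  unfolding permutation_permutes by blast

text \<open>Composing \<open>p\<close> with the transposition of two indices at which
  \<open>s\<close> agrees changes nothing but the sign.\<close>

lemma sign_sum_noninj:
  assumes "\<not> inj_on s {..<N::nat}"
  shows "(\<Sum>p | p permutes {..<N}. of_int (sign p) * (\<Prod>k<N. A (p k) (s k))) = (0::real)"
proof -
  obtain x y where xy: "x < N" "y < N" "s x = s y" "x \<noteq> y" using assms by (auto simp: inj_on_def)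
  let ?\<tau> = "Transposition.transpose x y"
  have \<tau>: "?\<tau> permutes {..<N}" using xy by (intro permutes_swap_id) auto
  have st: "s (?\<tau> k) = s k" for k using xy(3) by (auto simp: Transposition.transpose_def)
  let ?S = "\<Sum>p | p permutes {..<N}. of_int (sign p) * (\<Prod>k<N. A (p k) (s k)) :: real"
  have "?S = (\<Sum>p | p permutes {..<N}. of_int (sign (p \<circ> ?\<tau>)) * (\<Prod>k<N. A ((p \<circ> ?\<tau>) k) (s k)))"
    by (rule sum.reindex_bij_witness[where i = "\<lambda>p. p \<circ> ?\<tau>" and j = "\<lambda>p. p \<circ> ?\<tau>"])
       (auto simp: o_assoc[symmetric] permutes_compose[OF \<tau>])
  also have "\<dots> = (\<Sum>p | p permutes {..<N}. - (of_int (sign p) * (\<Prod>k<N. A (p k) (s k))))"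
  proof (rule sum.cong, simp)
    fix p assume "p \<in> {p. p permutes {..<N}}"
    hence p: "p permutes {..<N}" by simp
    have "sign (p \<circ> ?\<tau>) = sign p * sign ?\<tau>"
      using p \<tau> by (intro sign_compose) (auto intro: permutation_lessThan)
    hence "sign (p \<circ> ?\<tau>) = - sign p" using xy(4) by (simp add: sign_swap_id)
    moreover have "(\<Prod>k<N. A ((p \<circ> ?\<tau>) k) (s k)) = (\<Prod>k<N. A (p k) (s k))"
      using prod.permute[OF \<tau>, of "\<lambda>k. A (p k) (s k)"] by (simp add: o_def st)
    ultimately show "of_int (sign (p \<circ> ?\<tau>)) * (\<Prod>k<N. A ((p \<circ> ?\<tau>) k) (s k)) = - (of_int (sign p) * (\<Prod>k<N. A (p k) (s k)))"
      by simp
  qed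
  also have "\<dots> = - ?S" by (simp add: sum_negf)
  finally show ?thesis by simp
qed

lemma sign_sum_perm:
  assumes s: "\<sigma> permutes {..<N}"
  shows "(\<Sum>p | p permutes {..<N}. of_int (sign p) * (\<Prod>k<N. A (p k) (\<sigma> k))) = of_int (sign \<sigma>) * detn N A"
proof -
  have "(\<Sum>p | p permutes {..<N}. of_int (sign p) * (\<Prod>k<N. A (p k) (\<sigma> k)))
      = (\<Sum>p | p permutes {..<N}. of_int (sign (p \<circ> \<sigma>)) * (\<Prod>k<N. A ((p \<circ> \<sigma>) k) (\<sigma> k)))"
    by (rule sum.reindex_bij_witness[where i = "\<lambda>p. p \<circ> \<sigma>" and j = "\<lambda>p. p \<circ> inv_into UNIV \<sigma>"])
       (auto simp: o_assoc[symmetric] permutes_compose[OF s] permutes_compose[OF permutes_inv[OF s]] permutes_inv_o[OF s])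
  also have "\<dots> = (\<Sum>p | p permutes {..<N}. of_int (sign \<sigma>) * (of_int (sign p) * (\<Prod>k<N. A (p k) k)))"
  proof (rule sum.cong, simp)
    fix p assume "p \<in> {p. p permutes {..<N}}"
    hence p: "p permutes {..<N}" by simp
    have "sign (p \<circ> \<sigma>) = sign p * sign \<sigma>"
      using p s by (intro sign_compose) (auto intro: permutation_lessThan)
    moreover have "(\<Prod>k<N. A ((p \<circ> \<sigma>) k) (\<sigma> k)) = (\<Prod>k<N. A (p k) k)"
      using prod.permute[OF s, of "\<lambda>k. A (p k) k"] by (simp add: o_def)
    ultimately show "of_int (sign (p \<circ> \<sigma>)) * (\<Prod>k<N. A ((p \<circ> \<sigma>) k) (\<sigma> k)) = of_int (sign \<sigma>) * (of_int (sign p) * (\<Prod>k<N. A (p k) k))"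
      by simp
  qed
  finally show ?thesis by (simp add: detn_def sum_distrib_left)
qed

lemma sum_inj_PiE_permutes:
  fixes f :: "(nat \<Rightarrow> nat) \<Rightarrow> 'b::comm_monoid_add"
  assumes "\<And>p s. (\<And>k. k < N \<Longrightarrow> p k = s k) \<Longrightarrow> f p = f s"
  shows "(\<Sum>s | s \<in> PiE {..<N} (\<lambda>_. {..<N}) \<and> inj_on s {..<N}. f s) = (\<Sum>p | p permutes {..<N}. f p)"
proof (rule sum.reindex_bij_witness[where i = "\<lambda>p. restrict p {..<N}" and j = "\<lambda>s k. if k < N then s k else k"])
  fix s assume s: "s \<in> {s. s \<in> PiE {..<N} (\<lambda>_. {..<N}) \<and> inj_on s {..<N}}"
  hence inj: "inj_on s {..<N}" and sub: "s ` {..<N} \<subseteq> {..<N}" by auto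
  have "bij_betw s {..<N} {..<N}"
    using endo_inj_surj[OF _ sub inj] inj by (simp add: bij_betw_def)
  hence "bij_betw (\<lambda>k. if k < N then s k else k) {..<N} {..<N}"
    by (subst bij_betw_cong[of _ _ s]) auto
  hence "(\<lambda>k. if k < N then s k else k) permutes {..<N}"
    by (rule bij_imp_permutes) auto
  thus "(\<lambda>k. if k < N then s k else k) \<in> {p. p permutes {..<N}}" by simp
  show "restrict (\<lambda>k. if k < N then s k else k) {..<N} = s"
    using s by (auto simp: fun_eq_iff PiE_def extensional_def)
  show "f (\<lambda>k. if k < N then s k else k) = f s" by (rule assms) simp
next
  fix p assume "p \<in> {p. p permutes {..<N}}"
  hence p: "p permutes {..<N}" by simp
  show "(\<lambda>k. if k < N then restrict p {..<N} k else k) = p"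
    using permutes_not_in[OF p] by (auto simp: fun_eq_iff)
  have "inj_on (restrict p {..<N}) {..<N}" using permutes_inj_on[OF p, of "{..<N}"] by (simp add: inj_on_def)
  thus "restrict p {..<N} \<in> {s. s \<in> PiE {..<N} (\<lambda>_. {..<N}) \<and> inj_on s {..<N}}"
    using permutes_in_image[OF p] by auto
qed

text \<open>Multilinear expansion gives a sum over all index maps \<open>s\<close>. The alternating
  sum over \<open>p\<close> vanishes unless \<open>s\<close> is injective, and for a permutation it
  is the sign times the determinant.\<close>

lemma wedge_change_basis:
  fixes \<omega> :: "nat \<Rightarrow> 'v::real_vector \<Rightarrow> 'v \<Rightarrow> real"
  assumes lin: "\<And>i x. i < n \<Longrightarrow> linear (\<omega> i x)" "\<And>i y. i < n \<Longrightarrow> linear (\<lambda>x. \<omega> i x y)"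
    and b: "\<And>k. k < 2 * n \<Longrightarrow> b k = (\<Sum>j<2 * n. A k j *\<^sub>R u j)"
  shows "wedge_eval n \<omega> b = detn (2 * n) A * wedge_eval n \<omega> u"
proof -
  let ?N = "2 * n" and ?P = "{p. p permutes {..<2 * n}}"
  define T where "T s = (\<Prod>i<n. \<omega> i (u (s (2 * i))) (u (s (2 * i + 1))))" for s
  have expand: "(\<Prod>i<n. \<omega> i (b (p (2 * i))) (b (p (2 * i + 1)))) = (\<Sum>s\<in>PiE {..<?N} (\<lambda>_. {..<?N}). (\<Prod>r<?N. A (p r) (s r)) * T s)"
    if p: "p permutes {..<?N}" for p
  proof -
    have pk: "p k < ?N" if "k < ?N" for k using permutes_in_image[OF p, of k] that by simp
    have "\<omega> i (b (p (2 * i))) (b (p (2 * i + 1))) = (\<Sum>q\<in>{..<?N} \<times> {..<?N}. A (p (2 * i)) (fst q) * A (p (2 * i + 1)) (snd q) * \<omega> i (u (fst q)) (u (snd q)))"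
      if i: "i < n" for i
    proof -
      have "\<omega> i (b (p (2 * i))) (b (p (2 * i + 1))) = \<omega> i (\<Sum>j<?N. A (p (2 * i)) j *\<^sub>R u j) (\<Sum>k<?N. A (p (2 * i + 1)) k *\<^sub>R u k)"
        using b[OF pk] i by simp
      also have "\<dots> = (\<Sum>j<?N. \<Sum>k<?N. A (p (2 * i)) j * (A (p (2 * i + 1)) k * \<omega> i (u j) (u k)))"
        by (simp add: linear_sum[OF lin(1)[OF i]] linear_sum[OF lin(2)[OF i]] linear_cmul[OF lin(1)[OF i]] linear_cmul[OF lin(2)[OF i]] sum_distrib_left mult_ac) (rule sum.swap)
      finally show ?thesis by (simp add: sum.cartesian_product case_prod_beta mult.assoc)
    qed
    hence "(\<Prod>i<n. \<omega> i (b (p (2 * i))) (b (p (2 * i + 1)))) = (\<Prod>i<n. \<Sum>q\<in>{..<?N} \<times> {..<?N}. A (p (2 * i)) (fst q) * A (p (2 * i + 1)) (snd q) * \<omega> i (u (fst q)) (u (snd q)))"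
      by simp
    also have "\<dots> = (\<Sum>g\<in>PiE {..<n} (\<lambda>_. {..<?N} \<times> {..<?N}). \<Prod>i<n. A (p (2 * i)) (fst (g i)) * A (p (2 * i + 1)) (snd (g i)) * \<omega> i (u (fst (g i))) (u (snd (g i))))"
      by (rule prod_sum_PiE) auto
    also have "\<dots> = (\<Sum>g\<in>PiE {..<n} (\<lambda>_. {..<?N} \<times> {..<?N}). (\<lambda>s. (\<Prod>r<?N. A (p r) (s r)) * T s) (\<lambda>r\<in>{..<?N}. if even r then fst (g (r div 2)) else snd (g (r div 2))))"
      by (rule sum.cong) (simp_all add: prod_pairs T_def prod.distrib)
    also have "\<dots> = (\<Sum>s\<in>PiE {..<?N} (\<lambda>_. {..<?N}). (\<Prod>r<?N. A (p r) (s r)) * T s)"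
      by (rule sum_PiE_pairs)
    finally show ?thesis .
  qed
  have "(\<Sum>p\<in>?P. of_int (sign p) * (\<Prod>i<n. \<omega> i (b (p (2 * i))) (b (p (2 * i + 1)))))
      = (\<Sum>p\<in>?P. \<Sum>s\<in>PiE {..<?N} (\<lambda>_. {..<?N}). T s * (of_int (sign p) * (\<Prod>r<?N. A (p r) (s r))))"
    by (rule sum.cong) (simp_all only: expand mem_Collect_eq sum_distrib_left, simp add: mult_ac)
  also have "\<dots> = (\<Sum>s\<in>PiE {..<?N} (\<lambda>_. {..<?N}). T s * (\<Sum>p\<in>?P. of_int (sign p) * (\<Prod>r<?N. A (p r) (s r))))"
    by (subst sum.swap) (simp add: sum_distrib_left)
  also have "\<dots> = (\<Sum>s | s \<in> PiE {..<?N} (\<lambda>_. {..<?N}) \<and> inj_on s {..<?N}. T s * (\<Sum>p\<in>?P. of_int (sign p) * (\<Prod>r<?N. A (p r) (s r))))"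
    by (rule sum.mono_neutral_right) (auto intro!: finite_PiE simp: sign_sum_noninj)
  also have "\<dots> = (\<Sum>\<sigma>\<in>?P. T \<sigma> * (\<Sum>p\<in>?P. of_int (sign p) * (\<Prod>r<?N. A (p r) (\<sigma> r))))"
    by (rule sum_inj_PiE_permutes) (auto simp: T_def intro!: arg_cong2[of _ _ _ _ "(*)"] prod.cong sum.cong)
  also have "\<dots> = (\<Sum>\<sigma>\<in>?P. detn ?N A * (of_int (sign \<sigma>) * T \<sigma>))"
    by (rule sum.cong) (simp_all add: sign_sum_perm)
  also have "\<dots> = detn ?N A * (\<Sum>\<sigma>\<in>?P. of_int (sign \<sigma>) * T \<sigma>)" by (simp add: sum_distrib_left)
  finally show ?thesis by (simp add: wedge_eval_def T_def)
qed

text \<open>The matrix of the coordinate 2-form in the variables 2j and 2j + 1.\<close>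

definition pair_form :: "nat \<Rightarrow> nat \<Rightarrow> nat \<Rightarrow> real" where
  "pair_form j x y = (if x = 2 * j \<and> y = 2 * j + 1 then 1 else if x = 2 * j + 1 \<and> y = 2 * j then -1 else 0)"

lemma pair_form_nz: "pair_form j x y \<noteq> 0 \<Longrightarrow> {x, y} = {2 * j, 2 * j + 1}"
  by (auto simp: pair_form_def split: if_splits)

text \<open>Only permutations that map each pair 2i, 2i + 1 to itself contribute. Each contributes
  1, since a swap changes both the sign and the form; their number is the divisor in
  \<open>wedge_eval\<close>.\<close>

lemma pair_form_sum:
  "(\<Sum>p | p permutes {..<2 * n}. of_int (sign p) * (\<Prod>i<n. pair_form i (p (2 * i)) (p (2 * i + 1)))) = 2 ^ n"
proof (induction n)
  case 0
  thus ?case by (simp add: permutes_empty)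
next
  case (Suc n)
  let ?N = "2 * n" and ?\<tau> = "Transposition.transpose (2 * n) (2 * n + 1)"
  let ?P = "{p. p permutes {..<2 * n}}" and ?P' = "{p. p permutes {..<2 * Suc n}}"
  define t where "t m p = real_of_int (sign p) * (\<Prod>i<m. pair_form i (p (2 * i)) (p (2 * i + 1)))" for m p
  have fin: "finite ?P" "finite ?P'" by (auto intro: finite_permutations)
  have PP': "p permutes {..<2 * Suc n}" if "p permutes {..<?N}" for p
    using that by (rule permutes_subset) auto
  have \<tau>: "?\<tau> permutes {..<2 * Suc n}" by (rule permutes_swap_id) auto
  have fixN: "p (2 * n) = 2 * n" "p (2 * n + 1) = 2 * n + 1" if "p permutes {..<?N}" for p
    using permutes_not_in[OF that] by auto
  have sgn: "sign (p \<circ> ?\<tau>) = - sign p" if p: "p permutes {..<?N}" for p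
  proof -
    have "sign (p \<circ> ?\<tau>) = sign p * sign ?\<tau>"
      using p \<tau> by (intro sign_compose) (auto intro: permutation_lessThan)
    thus ?thesis by (simp add: sign_swap_id)
  qed
  have t1: "t (Suc n) p = t n p" if "p permutes {..<?N}" for p
    using fixN[OF that] by (simp add: t_def pair_form_def)
  have t2: "t (Suc n) (p \<circ> ?\<tau>) = t n p" if p: "p permutes {..<?N}" for p
  proof -
    have "(\<Prod>i<n. pair_form i ((p \<circ> ?\<tau>) (2 * i)) ((p \<circ> ?\<tau>) (2 * i + 1))) = (\<Prod>i<n. pair_form i (p (2 * i)) (p (2 * i + 1)))"
      by (rule prod.cong) (auto simp: Transposition.transpose_def)
    moreover have "pair_form n ((p \<circ> ?\<tau>) (2 * n)) ((p \<circ> ?\<tau>) (2 * n + 1)) = -1" "pair_form n (p (2 * n)) (p (2 * n + 1)) = 1"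
      using fixN[OF p] by (simp_all add: pair_form_def)
    ultimately show ?thesis using sgn[OF p] unfolding t1[OF p] t_def prod.lessThan_Suc by simp
  qed
  have "sum (t (Suc n)) ?P' = sum (t (Suc n)) (?P \<union> (\<lambda>p. p \<circ> ?\<tau>) ` ?P)"
  proof (rule sum.mono_neutral_right[OF fin(2)])
    show "?P \<union> (\<lambda>p. p \<circ> ?\<tau>) ` ?P \<subseteq> ?P'" using PP' permutes_compose[OF \<tau>] by auto
    show "\<forall>p\<in>?P' - (?P \<union> (\<lambda>p. p \<circ> ?\<tau>) ` ?P). t (Suc n) p = 0"
    proof (rule ballI, rule ccontr)
      fix p assume p: "p \<in> ?P' - (?P \<union> (\<lambda>p. p \<circ> ?\<tau>) ` ?P)" and nz: "t (Suc n) p \<noteq> 0"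
      hence "pair_form n (p (2 * n)) (p (2 * n + 1)) \<noteq> 0" by (auto simp: t_def)
      hence cases: "(p (2 * n) = 2 * n \<and> p (2 * n + 1) = 2 * n + 1) \<or> (p (2 * n) = 2 * n + 1 \<and> p (2 * n + 1) = 2 * n)"
        by (auto simp: pair_form_def split: if_splits)
      have red: "q permutes {..<?N}" if q: "q permutes {..<2 * Suc n}" "q (2 * n) = 2 * n" "q (2 * n + 1) = 2 * n + 1" for q
        by (rule permutes_superset[OF q(1)]) (use q(2,3) in \<open>auto simp: less_Suc_eq\<close>)
      have pP: "p permutes {..<2 * Suc n}" using p by simp
      from cases show False
      proof
        assume "p (2 * n) = 2 * n \<and> p (2 * n + 1) = 2 * n + 1"
        thus False using red[OF pP] p by auto
      next
        assume "p (2 * n) = 2 * n + 1 \<and> p (2 * n + 1) = 2 * n"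
        hence "(p \<circ> ?\<tau>) permutes {..<?N}"
          by (intro red permutes_compose[OF \<tau> pP]) (auto simp: Transposition.transpose_def)
        moreover have "p = (p \<circ> ?\<tau>) \<circ> ?\<tau>" by (simp add: o_assoc[symmetric])
        ultimately show False using p by blast
      qed
    qed
  qed
  also have "\<dots> = sum (t (Suc n)) ?P + sum (t (Suc n)) ((\<lambda>p. p \<circ> ?\<tau>) ` ?P)"
  proof (rule sum.union_disjoint)
    show "?P \<inter> (\<lambda>p. p \<circ> ?\<tau>) ` ?P = {}"
    proof -
      have "(p \<circ> ?\<tau>) (2 * n) = 2 * n + 1" if "p permutes {..<?N}" for p using fixN[OF that] by simp
      thus ?thesis using fixN(1) by fastforce
    qed
  qed (use fin in auto)
  also have "sum (t (Suc n)) ((\<lambda>p. p \<circ> ?\<tau>) ` ?P) = (\<Sum>p\<in>?P. t (Suc n) (p \<circ> ?\<tau>))"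
  proof (rule sum.reindex[unfolded o_def])
    show "inj_on (\<lambda>p. p \<circ> ?\<tau>) ?P"
    proof (rule inj_onI)
      fix p q assume "p \<circ> ?\<tau> = q \<circ> ?\<tau>"
      hence "(p \<circ> ?\<tau>) \<circ> ?\<tau> = (q \<circ> ?\<tau>) \<circ> ?\<tau>" by simp
      thus "p = q" by (simp add: o_assoc[symmetric])
    qed
  qed
  also have "sum (t (Suc n)) ?P + (\<Sum>p\<in>?P. t (Suc n) (p \<circ> ?\<tau>)) = 2 * sum (t n) ?P"
    using t1 t2 by simp
  also have "sum (t n) ?P = 2 ^ n" using Suc by (simp add: t_def)
  finally show ?case by (simp add: t_def)
qed

text \<open>Moves the pairs 2i, 2i + 1 as blocks, in the way \<open>\<sigma>\<close> moves their
  numbers.\<close>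

definition blk :: "(nat \<Rightarrow> nat) \<Rightarrow> nat \<Rightarrow> nat" where
  "blk \<sigma> k = 2 * \<sigma> (k div 2) + k mod 2"

lemma blk_comp: "blk (\<sigma> \<circ> \<tau>) = blk \<sigma> \<circ> blk \<tau>"
  by (simp add: blk_def fun_eq_iff)

lemma blk_id: "blk (\<lambda>a. a) = (\<lambda>a. a)"
  by (simp add: blk_def fun_eq_iff)

lemma blk_transpose: "(a::nat) \<noteq> b \<Longrightarrow> blk (Transposition.transpose a b) = Transposition.transpose (2 * a) (2 * b) \<circ> Transposition.transpose (2 * a + 1) (2 * b + 1)"
proof
  fix k :: nat assume "a \<noteq> b"
  have "k = 2 * (k div 2) + k mod 2" "k mod 2 < 2" by simp_all
  then obtain q r where k: "k = 2 * q + r" "r < 2" by blast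
  hence "r = 0 \<or> r = 1" by auto
  thus "blk (Transposition.transpose a b) k = (Transposition.transpose (2 * a) (2 * b) \<circ> Transposition.transpose (2 * a + 1) (2 * b + 1)) k"
    using k(1) \<open>a \<noteq> b\<close> by (auto simp: blk_def Transposition.transpose_def)
qed

text \<open>Exchanging two blocks takes two transpositions.\<close>

lemma blk_permutes_sign:
  assumes "\<sigma> permutes {..<n}" shows "blk \<sigma> permutes {..<2 * n} \<and> sign (blk \<sigma>) = 1"
  using assms finite_lessThan
proof (induction rule: permutes_induct[consumes 2])
  case id
  thus ?case by (simp add: blk_id permutes_id[unfolded id_def] sign_id[unfolded id_def] id_def)
next
  case (swap a b p)
  show ?case
  proof (cases "a = b")
    case False
    have t: "Transposition.transpose (2 * a) (2 * b) permutes {..<2 * n}" "Transposition.transpose (2 * a + 1) (2 * b + 1) permutes {..<2 * n}"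
      using swap by (auto intro!: permutes_swap_id)
    have perm: "permutation (Transposition.transpose (2 * a) (2 * b))" "permutation (Transposition.transpose (2 * a + 1) (2 * b + 1))" "permutation (blk p)"
      using t swap.IH by (auto intro: permutation_lessThan)
    have s: "sign (Transposition.transpose (2 * a) (2 * b) \<circ> Transposition.transpose (2 * a + 1) (2 * b + 1)) = 1"
      using False perm by (simp add: sign_compose sign_swap_id)
    show ?thesis
      unfolding blk_comp blk_transpose[OF False]
      using permutes_compose[OF swap.IH[THEN conjunct1] permutes_compose[OF t(2,1)]]
        sign_compose[OF permutation_compose[OF perm(1,2)] perm(3)] s swap.IH
      by (simp add: o_def)
  qed (use swap in simp)
qed

text \<open>2-forms commute: block permutations are even, so all terms carry the same sign and the
  result is the permanent of \<open>c\<close> instead of a determinant.\<close>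

lemma wedge_block_diagonal:
  fixes \<omega> :: "nat \<Rightarrow> 'v \<Rightarrow> 'v \<Rightarrow> real"
  assumes "\<And>i x y. i < n \<Longrightarrow> x < 2 * n \<Longrightarrow> y < 2 * n \<Longrightarrow> \<omega> i (u x) (u y) = (\<Sum>j<n. c i j * pair_form j x y)"
  shows "wedge_eval n \<omega> u = (\<Sum>\<sigma> | \<sigma> permutes {..<n}. \<Prod>i<n. c i (\<sigma> i))"
proof -
  let ?P = "{p. p permutes {..<2 * n}}"
  define C where "C s = (\<Sum>p\<in>?P. of_int (sign p) * (\<Prod>i<n. pair_form (s i) (p (2 * i)) (p (2 * i + 1))))" for s
  have "(\<Sum>p\<in>?P. of_int (sign p) * (\<Prod>i<n. \<omega> i (u (p (2 * i))) (u (p (2 * i + 1)))))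
      = (\<Sum>p\<in>?P. \<Sum>s\<in>PiE {..<n} (\<lambda>_. {..<n}). (\<Prod>i<n. c i (s i)) * (of_int (sign p) * (\<Prod>i<n. pair_form (s i) (p (2 * i)) (p (2 * i + 1)))))"
  proof (rule sum.cong, simp)
    fix p assume "p \<in> ?P"
    hence p: "p permutes {..<2 * n}" by simp
    have pk: "p k < 2 * n" if "k < 2 * n" for k using permutes_in_image[OF p, of k] that by simp
    have "(\<Prod>i<n. \<omega> i (u (p (2 * i))) (u (p (2 * i + 1)))) = (\<Prod>i<n. \<Sum>j<n. c i j * pair_form j (p (2 * i)) (p (2 * i + 1)))"
      by (rule prod.cong) (auto intro!: assms pk)
    also have "\<dots> = (\<Sum>s\<in>PiE {..<n} (\<lambda>_. {..<n}). \<Prod>i<n. c i (s i) * pair_form (s i) (p (2 * i)) (p (2 * i + 1)))"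
      by (rule prod_sum_PiE) auto
    finally show "of_int (sign p) * (\<Prod>i<n. \<omega> i (u (p (2 * i))) (u (p (2 * i + 1))))
      = (\<Sum>s\<in>PiE {..<n} (\<lambda>_. {..<n}). (\<Prod>i<n. c i (s i)) * (of_int (sign p) * (\<Prod>i<n. pair_form (s i) (p (2 * i)) (p (2 * i + 1)))))"
      by (simp add: prod.distrib sum_distrib_left mult_ac)
  qed
  also have "\<dots> = (\<Sum>s\<in>PiE {..<n} (\<lambda>_. {..<n}). (\<Prod>i<n. c i (s i)) * C s)"
    by (subst sum.swap) (simp add: sum_distrib_left C_def)
  also have "\<dots> = (\<Sum>s | s \<in> PiE {..<n} (\<lambda>_. {..<n}) \<and> inj_on s {..<n}. (\<Prod>i<n. c i (s i)) * C s)"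
  proof (rule sum.mono_neutral_right)
    show "\<forall>s\<in>PiE {..<n} (\<lambda>_. {..<n}) - {s. s \<in> PiE {..<n} (\<lambda>_. {..<n}) \<and> inj_on s {..<n}}. (\<Prod>i<n. c i (s i)) * C s = 0"
    proof
      fix s assume "s \<in> PiE {..<n} (\<lambda>_. {..<n}) - {s. s \<in> PiE {..<n} (\<lambda>_. {..<n}) \<and> inj_on s {..<n}}"
      then obtain i j where ij: "i < n" "j < n" "i \<noteq> j" "s i = s j" by (auto simp: inj_on_def)
      have "(\<Prod>i<n. pair_form (s i) (p (2 * i)) (p (2 * i + 1))) = 0" if p: "p permutes {..<2 * n}" for p
      proof (rule ccontr)
        assume "(\<Prod>i<n. pair_form (s i) (p (2 * i)) (p (2 * i + 1))) \<noteq> 0"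
        hence "pair_form (s i) (p (2 * i)) (p (2 * i + 1)) \<noteq> 0" "pair_form (s j) (p (2 * j)) (p (2 * j + 1)) \<noteq> 0"
          using ij(1,2) by auto
        hence "{p (2 * i), p (2 * i + 1)} = {p (2 * j), p (2 * j + 1)}"
          using pair_form_nz ij(4) by metis
        hence "p (2 * i) = p (2 * j) \<or> p (2 * i) = p (2 * j + 1)" by auto
        hence "2 * i = 2 * j \<or> 2 * i = 2 * j + 1" unfolding inj_eq[OF permutes_inj[OF p]] .
        thus False using ij(3) by presburger
      qed
      hence "C s = 0" unfolding C_def by (intro sum.neutral) simp
      thus "(\<Prod>i<n. c i (s i)) * C s = 0" by simp
    qed
  qed (auto intro: finite_PiE)
  also have "\<dots> = (\<Sum>\<sigma> | \<sigma> permutes {..<n}. (\<Prod>i<n. c i (\<sigma> i)) * C \<sigma>)"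
  proof (rule sum_inj_PiE_permutes)
    fix p s :: "nat \<Rightarrow> nat" assume "\<And>k. k < n \<Longrightarrow> p k = s k"
    thus "(\<Prod>i<n. c i (p i)) * C p = (\<Prod>i<n. c i (s i)) * C s" unfolding C_def by simp
  qed
  also have "\<dots> = (\<Sum>\<sigma> | \<sigma> permutes {..<n}. (\<Prod>i<n. c i (\<sigma> i)) * 2 ^ n)"
  proof (rule sum.cong, simp)
    fix \<sigma> assume "\<sigma> \<in> {\<sigma>. \<sigma> permutes {..<n}}"
    hence \<sigma>: "\<sigma> permutes {..<n}" by simp
    note B = blk_permutes_sign[OF \<sigma>]
    have pf: "pair_form (\<sigma> i) (blk \<sigma> x) (blk \<sigma> y) = pair_form i x y" for i x y
    proof -
      have "blk \<sigma> x = 2 * \<sigma> i \<longleftrightarrow> x = 2 * i" "blk \<sigma> x = 2 * \<sigma> i + 1 \<longleftrightarrow> x = 2 * i + 1" for x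
      proof -
        have e: "2 * \<sigma> i = blk \<sigma> (2 * i)" "2 * \<sigma> i + 1 = blk \<sigma> (2 * i + 1)" by (auto simp: blk_def)
        have "inj (blk \<sigma>)" using B permutes_inj by blast
        thus "blk \<sigma> x = 2 * \<sigma> i \<longleftrightarrow> x = 2 * i" "blk \<sigma> x = 2 * \<sigma> i + 1 \<longleftrightarrow> x = 2 * i + 1"
          unfolding e(2) unfolding e(1) by (rule inj_eq)+
      qed
      thus ?thesis by (simp add: pair_form_def)
    qed
    \<comment> \<open>Reindexing by the even permutation \<open>blk \<sigma>\<close> reduces
      \<open>C \<sigma>\<close> to the identity assignment, which \<open>pair_form_sum\<close>
      evaluates.\<close>
    have "C \<sigma> = (\<Sum>p\<in>?P. of_int (sign (blk \<sigma> \<circ> p)) * (\<Prod>i<n. pair_form (\<sigma> i) ((blk \<sigma> \<circ> p) (2 * i)) ((blk \<sigma> \<circ> p) (2 * i + 1))))"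
      unfolding C_def
      by (rule sum.reindex_bij_witness[where i = "\<lambda>p. blk \<sigma> \<circ> p" and j = "\<lambda>p. inv_into UNIV (blk \<sigma>) \<circ> p"])
         (use B in \<open>auto simp: o_assoc permutes_inv_o permutes_inverses(1) permutes_compose permutes_inv\<close>)
    also have "\<dots> = (\<Sum>p\<in>?P. of_int (sign p) * (\<Prod>i<n. pair_form i (p (2 * i)) (p (2 * i + 1))))"
    proof (rule sum.cong, simp)
      fix p assume "p \<in> ?P"
      hence "sign (blk \<sigma> \<circ> p) = sign (blk \<sigma>) * sign p"
        using B by (intro sign_compose) (auto intro: permutation_lessThan)
      thus "of_int (sign (blk \<sigma> \<circ> p)) * (\<Prod>i<n. pair_form (\<sigma> i) ((blk \<sigma> \<circ> p) (2 * i)) ((blk \<sigma> \<circ> p) (2 * i + 1)))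
          = of_int (sign p) * (\<Prod>i<n. pair_form i (p (2 * i)) (p (2 * i + 1)))"
        using B by (simp add: pf)
    qed
    also have "\<dots> = 2 ^ n" by (rule pair_form_sum)
    finally show "(\<Prod>i<n. c i (\<sigma> i)) * C \<sigma> = (\<Prod>i<n. c i (\<sigma> i)) * 2 ^ n" by simp
  qed
  also have "\<dots> = (\<Sum>\<sigma> | \<sigma> permutes {..<n}. \<Prod>i<n. c i (\<sigma> i)) * 2 ^ n" by (simp add: sum_distrib_right)
  finally show ?thesis by (simp add: wedge_eval_def)
qed

section \<open>Simultaneous diagonalisation of (1,1)-forms\<close>

lemma i_i [simp]: "\<i> *s (\<i> *s v) = - (v :: complex ^ 'g)"
  by (simp add: vec_eq_iff mult.assoc[symmetric])

lemma i_scaleR: "\<i> *s (r *\<^sub>R v) = r *\<^sub>R (\<i> *s (v :: complex ^ 'g))"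
  by (simp add: vec_eq_iff)

lemma form11_minus: "form11 E \<Longrightarrow> E x (- y) = - E x y" "form11 E \<Longrightarrow> E (- x) y = - E x y"
  using linear_neg[OF form11D(1)] linear_neg[OF form11D(2)] by blast+

lemma form11_i_sym: "form11 E \<Longrightarrow> E x (\<i> *s y) = E y (\<i> *s x)"
  using form11D(4)[of E "\<i> *s x" y] form11D(3)[of E y "\<i> *s x"] form11D(4)[of E x "\<i> *s y"]
  by (metis form11_minus(1) i_i minus_minus form11D(3,4))

lemma form11_bounded_bilinear: "form11 E \<Longrightarrow> bounded_bilinear E"
  unfolding bilinear_conv_bounded_bilinear[symmetric] bilinear_def by (auto intro: form11D(1,2))

lemma continuous_on_form11: "form11 E \<Longrightarrow> continuous_on (A :: (complex ^ 'g) set) (\<lambda>v. E v (\<i> *s v))"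
proof -
  assume "form11 E"
  then interpret bounded_bilinear E by (rule form11_bounded_bilinear)
  have "linear (\<lambda>v :: complex ^ 'g. \<i> *s v)"
    by (rule linearI) (simp_all add: vec.scale_right_distrib i_scaleR)
  hence "continuous_on A (\<lambda>v :: complex ^ 'g. \<i> *s v)"
    by (simp add: linear_continuous_on linear_linear)
  thus ?thesis by (intro continuous_on continuous_on_id)
qed

lemma vec_subspace_scaleR: "vec.subspace U \<Longrightarrow> x \<in> U \<Longrightarrow> r *\<^sub>R x \<in> (U :: (complex ^ 'g) set)"
  unfolding vec_scale_of_real[symmetric] by (rule vec.subspace_scale)

text \<open>\<open>v\<close> maximises the quotient F(y, iy) / E(y, iy) on the unit sphere of
  \<open>U\<close>, with maximum \<open>c\<close>. Then G = c E - F is semidefinite and G(v, iv) =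
  0, and variation along \<open>y\<close> puts \<open>v\<close> into the kernel of
  \<open>G\<close>.\<close>

lemma form11_eigenvector:
  assumes E: "form11 E" and F: "form11 F" and U: "vec.subspace U" and U0: "U \<noteq> {0}"
    and pos: "\<And>v. v \<in> U \<Longrightarrow> v \<noteq> 0 \<Longrightarrow> E v (\<i> *s v) > 0"
  obtains v c where "v \<in> U" "v \<noteq> 0" "\<And>y. y \<in> U \<Longrightarrow> F v y = c * E v y"
proof -
  define q where "q y = F y (\<i> *s y) / E y (\<i> *s y)" for y
  have clU: "closed U" using closed_subspace[OF vec_subspace_imp_subspace[OF U]] .
  obtain u where u: "u \<in> U" "u \<noteq> 0" using U0 vec.subspace_0[OF U] by blast
  hence "(1 / norm u) *\<^sub>R u \<in> sphere 0 1 \<inter> U"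
    using vec_subspace_scaleR[OF U] by simp
  hence ne: "sphere 0 1 \<inter> U \<noteq> {}" by blast
  have "continuous_on (sphere 0 1 \<inter> U) q"
    unfolding q_def by (intro continuous_on_divide continuous_on_form11 E F) (use pos in force)
  then obtain v where v: "v \<in> sphere 0 1 \<inter> U" "\<And>y. y \<in> sphere 0 1 \<inter> U \<Longrightarrow> q y \<le> q v"
    using continuous_attains_sup[of "sphere 0 1 \<inter> U" q] compact_Int_closed[OF compact_sphere clU] ne by blast
  hence vU: "v \<in> U" "v \<noteq> 0" by auto
  define c where "c = q v"
  define G where "G x y = c * E x y - F x y" for x y
  have G: "G x (y + z) = G x y + G x z" "G (x + y) z = G x z + G y z" "G x (r *\<^sub>R y) = r * G x y" "G (r *\<^sub>R x) y = r * G x y"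
    "G x (\<i> *s y) = G y (\<i> *s x)" for x y z r
    using form11_i_sym[OF E, of x y] form11_i_sym[OF F, of x y]
    by (simp_all add: G_def form11D(5-8)[OF E] form11D(5-8)[OF F] algebra_simps)
  have Gv: "G v (\<i> *s v) = 0" using pos[OF vU] by (simp add: G_def c_def q_def)
  have Gpos: "G y (\<i> *s y) \<ge> 0" if "y \<in> U" for y
  proof (cases "y = 0")
    case True
    thus ?thesis by (simp add: G_def form11D(11,12)[OF E] form11D(11,12)[OF F])
  next
    case False
    let ?z = "(1 / norm y) *\<^sub>R y"
    have z: "?z \<in> sphere 0 1 \<inter> U" "?z \<noteq> 0" using False vec_subspace_scaleR[OF U that] by simp_all
    have "q ?z \<le> c" using v(2)[OF z(1)] by (simp add: c_def)
    moreover have "E ?z (\<i> *s ?z) > 0" using pos z by auto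
    ultimately have "G ?z (\<i> *s ?z) \<ge> 0" by (simp add: q_def G_def pos_divide_le_eq)
    hence "(1 / norm y) * ((1 / norm y) * G y (\<i> *s y)) \<ge> 0" by (simp only: i_scaleR G(1-4))
    thus ?thesis using False by (auto simp: zero_le_mult_iff zero_le_divide_iff mult_less_0_iff dest: order_antisym)
  qed
  have key: "G v (\<i> *s y) = 0" if y: "y \<in> U" for y
  proof (rule ccontr)
    assume nz: "G v (\<i> *s y) \<noteq> 0"
    define p where "p = G v (\<i> *s y)"
    define s where "s = G y (\<i> *s y)"
    have s: "s \<ge> 0" using Gpos[OF y] by (simp add: s_def)
    \<comment> \<open>With this \<open>t\<close> the quadratic expression equals
      \<open>- t\<^sup>2 * (s + 2)\<close>; the summand 1 in the denominator covers the case
      \<open>s = 0\<close>.\<close>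
    define t where "t = - p / (s + 1)"
    have "G (v + t *\<^sub>R y) (\<i> *s (v + t *\<^sub>R y)) = 2 * t * p + t\<^sup>2 * s"
      using Gv G(5)[of y v] by (simp add: vec.scale_right_distrib i_scaleR G(1-4) p_def s_def power2_eq_square algebra_simps)
    moreover have "v + t *\<^sub>R y \<in> U" using vec.subspace_add[OF U vU(1) vec_subspace_scaleR[OF U y]] .
    ultimately have "2 * t * p + t\<^sup>2 * s \<ge> 0" using Gpos by metis
    moreover have p: "p = - t * (s + 1)" using s by (simp add: t_def)
    moreover have "t\<^sup>2 * (s + 2) > 0" using s nz p by (auto simp: p_def[symmetric])
    ultimately show False by (simp add: power2_eq_square algebra_simps)
  qed
  have "F v y = c * E v y" if "y \<in> U" for y
  proof -
    have "- (\<i> *s y) \<in> U" using that U vec.subspace_neg vec.subspace_scale by blast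
    from key[OF this] have "G v y = 0" by (simp add: vec.scale_minus_right)
    thus ?thesis by (simp add: G_def)
  qed
  thus ?thesis using that vU by blast
qed

text \<open>A unitary basis for the hermitian form of \<open>E\<close> in which \<open>F\<close> is
  diagonal. The vectors \<open>v j\<close> and \<open>\<i> *s v j\<close> together are a real
  symplectic basis of \<open>U\<close>; the last clause gives the coordinates in it.\<close>

definition eigenbasis :: "(complex ^ 'g) set \<Rightarrow> (complex ^ 'g \<Rightarrow> complex ^ 'g \<Rightarrow> real) \<Rightarrow>
    (complex ^ 'g \<Rightarrow> complex ^ 'g \<Rightarrow> real) \<Rightarrow> (nat \<Rightarrow> complex ^ 'g) \<Rightarrow> (nat \<Rightarrow> real) \<Rightarrow> bool" where
  "eigenbasis U E F v c \<longleftrightarrow>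
     (\<forall>i<vec.dim U. v i \<in> U \<and> (\<forall>y\<in>U. F (v i) y = c i * E (v i) y)) \<and>
     (\<forall>i<vec.dim U. \<forall>j<vec.dim U. E (v i) (v j) = 0 \<and> E (v i) (\<i> *s v j) = (if i = j then 1 else 0)) \<and>
     (\<forall>y\<in>U. y = (\<Sum>j<vec.dim U. E y (\<i> *s v j) *\<^sub>R v j + E (v j) y *\<^sub>R (\<i> *s v j)))"

lemma ex_eigenbasis:
  assumes E: "form11 E" and F: "form11 F" and "vec.subspace U"
    and "\<And>v. v \<in> U \<Longrightarrow> v \<noteq> 0 \<Longrightarrow> E v (\<i> *s v) > 0"
  shows "\<exists>v c. eigenbasis U E F v c"
  using assms(3,4)
proof (induction "vec.dim U" arbitrary: U)
  case 0
  have "U \<subseteq> {0}" using 0(1) vec.dim_eq_0[of U] by simp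
  hence "eigenbasis U E F (\<lambda>_. 0) (\<lambda>_. 0)" unfolding eigenbasis_def 0(1)[symmetric] by auto
  thus ?case by blast
next
  case (Suc m)
  note U = Suc.prems(1) and pos = Suc.prems(2)
  have "U \<noteq> {0}" using Suc.hyps(2) vec.dim_eq_0[of U] by auto
  from form11_eigenvector[OF E F U this pos]
  obtain w c0 where w: "w \<in> U" "w \<noteq> 0" "\<And>y. y \<in> U \<Longrightarrow> F w y = c0 * E w y" by blast
  define s where "s = 1 / sqrt (E w (\<i> *s w))"
  define v0 where "v0 = s *\<^sub>R w"
  have spos: "s > 0" using pos[OF w(1,2)] by (simp add: s_def)
  have v0: "v0 \<in> U" "v0 \<noteq> 0" using w spos vec_subspace_scaleR[OF U w(1)] by (auto simp: v0_def)
  have v0n: "E v0 (\<i> *s v0) = 1"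
    using pos[OF w(1,2)] by (simp add: v0_def i_scaleR form11D(7,8)[OF E] s_def real_sqrt_mult_self field_simps)
  have v0F: "F v0 y = c0 * E v0 y" if "y \<in> U" for y
    using w(3)[OF that] by (simp add: v0_def form11D(8)[OF E] form11D(8)[OF F])
  \<comment> \<open>The hermitian orthogonal complement of \<open>v0\<close>. The two conditions
    together define a complex subspace, so the induction hypothesis applies to it.\<close>
  define U' where "U' = {y \<in> U. E v0 y = 0 \<and> E v0 (\<i> *s y) = 0}"
  have scale: "E x (a *s y) = Re a * E x y + Im a * E x (\<i> *s y)" for x y and a :: complex
  proof -
    have "a *s y = Re a *\<^sub>R y + Im a *\<^sub>R (\<i> *s y)"
      by (simp add: vec_eq_iff complex_eq_iff)
    thus ?thesis by (simp add: form11D(5-8)[OF E])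
  qed
  have U': "vec.subspace U'"
    unfolding U'_def
  proof (rule vec.subspaceI)
    fix a x assume "x \<in> {y \<in> U. E v0 y = 0 \<and> E v0 (\<i> *s y) = 0}"
    moreover have "\<i> *s (a *s x) = (\<i> * a) *s x" by (simp add: vec_eq_iff)
    ultimately show "a *s x \<in> {y \<in> U. E v0 y = 0 \<and> E v0 (\<i> *s y) = 0}"
      using vec.subspace_scale[OF U] scale[of v0 a x] scale[of v0 "\<i> * a" x] by simp
  qed (use U in \<open>auto simp: vec.subspace_0 vec.subspace_add form11D(5-12)[OF E] vec.scale_right_distrib\<close>)
  have comp: "y - E y (\<i> *s v0) *\<^sub>R v0 - E v0 y *\<^sub>R (\<i> *s v0) \<in> U'" if y: "y \<in> U" for y
  proof -
    have "y - E y (\<i> *s v0) *\<^sub>R v0 - E v0 y *\<^sub>R (\<i> *s v0) \<in> U"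
      using y v0(1) U by (intro vec.subspace_diff vec_subspace_scaleR vec.subspace_scale)
    thus ?thesis using v0n form11_i_sym[OF E, of v0 y]
      unfolding U'_def by (simp add: form11D(5-13)[OF E] vec.scale_right_diff_distrib i_scaleR form11_minus(1)[OF E])
  qed
  have dimU': "vec.dim U = Suc (vec.dim U')"
  proof -
    have "v0 \<notin> U'" using v0n by (simp add: U'_def)
    hence "v0 \<notin> vec.span U'" using U' by (metis vec.span_eq_iff)
    moreover have "U = vec.span (insert v0 U')"
    proof
      show "vec.span (insert v0 U') \<subseteq> U" by (rule vec.span_minimal) (use v0 U in \<open>auto simp: U'_def\<close>)
      show "U \<subseteq> vec.span (insert v0 U')"
      proof
        fix y assume y: "y \<in> U"
        let ?z = "y - E y (\<i> *s v0) *\<^sub>R v0 - E v0 y *\<^sub>R (\<i> *s v0)"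
        have "v0 \<in> vec.span (insert v0 U')" "?z \<in> vec.span (insert v0 U')" using comp[OF y] by (auto intro: vec.span_base)
        hence "?z + E v0 y *\<^sub>R (\<i> *s v0) + E y (\<i> *s v0) *\<^sub>R v0 \<in> vec.span (insert v0 U')"
          by (intro vec.subspace_add vec_subspace_scaleR vec.subspace_scale vec.subspace_span)
        thus "y \<in> vec.span (insert v0 U')" by simp
      qed
    qed
    hence "vec.dim U = vec.dim (insert v0 U')" using vec.dim_span by metis
    ultimately show ?thesis by (simp add: vec.dim_insert)
  qed
  have m: "m = vec.dim U'" using dimU' Suc.hyps(2) by simp
  have "\<exists>v c. eigenbasis U' E F v c"
    by (rule Suc.hyps(1)[OF m U']) (use pos in \<open>auto simp: U'_def\<close>)
  then obtain v c where vc: "eigenbasis U' E F v c" by blast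
  have vU': "v i \<in> U'" if "i < m" for i using vc that by (auto simp: eigenbasis_def m)
  have vU: "v i \<in> U" "E v0 (v i) = 0" "E v0 (\<i> *s v i) = 0" "E (v i) v0 = 0" "E (v i) (\<i> *s v0) = 0" if "i < m" for i
    using vU'[OF that] form11D(3)[OF E, of "v i" v0] form11_i_sym[OF E, of "v i" v0] by (auto simp: U'_def)
  have vF: "F (v i) y = c i * E (v i) y" if "i < m" "y \<in> U'" for i y
    using vc that by (auto simp: eigenbasis_def m)
  have vE: "E (v i) (v j) = 0" "E (v i) (\<i> *s v j) = (if i = j then 1 else 0)" if "i < m" "j < m" for i j
    using vc that by (auto simp: eigenbasis_def m)
  have vx: "y = (\<Sum>j<m. E y (\<i> *s v j) *\<^sub>R v j + E (v j) y *\<^sub>R (\<i> *s v j))" if "y \<in> U'" for y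
    using vc that unfolding eigenbasis_def m by blast
  have Fv0: "F (v i) v0 = 0" "F (v i) (\<i> *s v0) = 0" if "i < m" for i
  proof -
    have "\<i> *s v i \<in> U" using vU(1)[OF that] U vec.subspace_scale by blast
    thus "F (v i) v0 = 0" "F (v i) (\<i> *s v0) = 0"
      using v0F[OF vU(1)[OF that]] v0F[of "\<i> *s v i"] vU[OF that] form11D(3)[OF F, of "v i" v0] form11_i_sym[OF F, of "v i" v0]
      by simp_all
  qed
  define v' where "v' = case_nat v0 v"
  define c' where "c' = case_nat c0 c"
  have v': "v' 0 = v0" "v' (Suc k) = v k" "c' 0 = c0" "c' (Suc k) = c k" for k by (simp_all add: v'_def c'_def)
  have "eigenbasis U E F v' c'"
    unfolding eigenbasis_def Suc.hyps(2)[symmetric]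
  proof (intro conjI allI impI ballI)
    fix i assume "i < Suc m"
    thus "v' i \<in> U" using v0 vU by (cases i) (auto simp: v')
  next
    fix i y assume i: "i < Suc m" and y: "y \<in> U"
    show "F (v' i) y = c' i * E (v' i) y"
    proof (cases i)
      case (Suc k)
      hence k: "k < m" using i by simp
      have "F (v k) (y - E y (\<i> *s v0) *\<^sub>R v0 - E v0 y *\<^sub>R (\<i> *s v0)) = c k * E (v k) (y - E y (\<i> *s v0) *\<^sub>R v0 - E v0 y *\<^sub>R (\<i> *s v0))"
        by (rule vF[OF k comp[OF y]])
      thus ?thesis using Suc k by (simp add: v' form11D(5-12)[OF E] form11D(5-12)[OF F] Fv0 vU)
    qed (simp add: v' v0F y)
  next
    fix i j assume ij: "i < Suc m" "j < Suc m"
    show "E (v' i) (v' j) = 0"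
      using ij vE vU by (cases i; cases j) (auto simp: v' form11D(13)[OF E])
    show "E (v' i) (\<i> *s v' j) = (if i = j then 1 else 0)"
      using ij vE vU v0n by (cases i; cases j) (auto simp: v')
  next
    fix y assume y: "y \<in> U"
    let ?z = "y - E y (\<i> *s v0) *\<^sub>R v0 - E v0 y *\<^sub>R (\<i> *s v0)"
    have *: "E ?z (\<i> *s v j) = E y (\<i> *s v j)" "E (v j) ?z = E (v j) y" if "j < m" for j
      using vU[OF that] by (simp_all add: form11D(5-13)[OF E] form11D(4)[OF E])
    have "?z = (\<Sum>j<m. E ?z (\<i> *s v j) *\<^sub>R v j + E (v j) ?z *\<^sub>R (\<i> *s v j))" by (rule vx[OF comp[OF y]])
    also have "\<dots> = (\<Sum>j<m. E y (\<i> *s v j) *\<^sub>R v j + E (v j) y *\<^sub>R (\<i> *s v j))"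
      by (rule sum.cong) (simp_all add: *)
    finally have "y = (E y (\<i> *s v0) *\<^sub>R v0 + E v0 y *\<^sub>R (\<i> *s v0)) + (\<Sum>j<m. E y (\<i> *s v j) *\<^sub>R v j + E (v j) y *\<^sub>R (\<i> *s v j))"
      by (simp add: algebra_simps)
    thus "y = (\<Sum>j<Suc m. E y (\<i> *s v' j) *\<^sub>R v' j + E (v' j) y *\<^sub>R (\<i> *s v' j))"
      unfolding sum.lessThan_Suc_shift v' .
  qed
  thus ?case by blast
qed

section \<open>Mixed powers of two forms and their eigenvalues\<close>

lemma less_double_cases:
  assumes "x < 2 * (m::nat)" obtains p where "p < m" "x = 2 * p" | p where "p < m" "x = Suc (2 * p)"
proof (cases "even x")
  case True
  thus ?thesis using assms that(1)[of "x div 2"] by auto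
next
  case False
  thus ?thesis using assms that(2)[of "x div 2"] odd_two_times_div_two_succ[of x] by auto
qed

lemma pair_form_simps:
  "pair_form j (2 * p) (2 * q) = 0" "pair_form j (Suc (2 * p)) (Suc (2 * q)) = 0"
  "pair_form j (2 * p) (Suc (2 * q)) = (if j = p then if p = q then 1 else 0 else 0)"
  "pair_form j (Suc (2 * p)) (2 * q) = (if j = p then if p = q then - 1 else 0 else 0)"
  by (auto simp: pair_form_def) presburger+

lemma sum_pair_form:
  assumes "p < m"
  shows "(\<Sum>j<m. f j * pair_form j (2 * p) (2 * q)) = 0" "(\<Sum>j<m. f j * pair_form j (Suc (2 * p)) (Suc (2 * q))) = 0"
    "(\<Sum>j<m. f j * pair_form j (2 * p) (Suc (2 * q))) = (if p = q then f p else 0)"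
    "(\<Sum>j<m. f j * pair_form j (Suc (2 * p)) (2 * q)) = (if p = q then - f p else 0)"
proof -
  have *: "(\<Sum>j<m. f j * (if j = p then t else 0)) = f p * t" for t
    using assms by (subst sum.mono_neutral_right[of "{..<m}" "{p}"]) auto
  show "(\<Sum>j<m. f j * pair_form j (2 * p) (2 * q)) = 0" "(\<Sum>j<m. f j * pair_form j (Suc (2 * p)) (Suc (2 * q))) = 0"
    "(\<Sum>j<m. f j * pair_form j (2 * p) (Suc (2 * q))) = (if p = q then f p else 0)"
    "(\<Sum>j<m. f j * pair_form j (Suc (2 * p)) (2 * q)) = (if p = q then - f p else 0)"
    by (simp_all add: pair_form_simps *)
qed

lemma eigenbasisD:
  assumes "eigenbasis U E F v c" "i < vec.dim U"
  shows "v i \<in> U" "y \<in> U \<Longrightarrow> F (v i) y = c i * E (v i) y" "j < vec.dim U \<Longrightarrow> E (v i) (v j) = 0"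
    "j < vec.dim U \<Longrightarrow> E (v i) (\<i> *s v j) = (if i = j then 1 else 0)"
  using assms unfolding eigenbasis_def by blast+

lemma wedge_eigenbasis:
  assumes vc: "eigenbasis U E F v c" and U: "vec.subspace U"
    and \<omega>: "\<And>i. i < vec.dim U \<Longrightarrow> form11 (\<omega> i)"
    and ev: "\<And>i j y. i < vec.dim U \<Longrightarrow> j < vec.dim U \<Longrightarrow> y \<in> U \<Longrightarrow> \<omega> i (v j) y = e i j * E (v j) y"
  shows "wedge_eval (vec.dim U) \<omega> (interleave v (\<lambda>j. \<i> *s v j)) = (\<Sum>\<sigma> | \<sigma> permutes {..<vec.dim U}. \<Prod>i<vec.dim U. e i (\<sigma> i))"
proof (rule wedge_block_diagonal)
  let ?m = "vec.dim U" and ?u = "interleave v (\<lambda>j. \<i> *s v j)"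
  note D = eigenbasisD[OF vc]
  fix i x y assume i: "i < ?m" and x: "x < 2 * ?m" and y: "y < 2 * ?m"
  have iU: "\<i> *s v j \<in> U" if "j < ?m" for j using D(1)[OF that] U vec.subspace_scale by blast
  have e: "\<omega> i (v p) (v q) = 0" "\<omega> i (v p) (\<i> *s v q) = (if p = q then e i p else 0)"
    "\<omega> i (\<i> *s v p) (v q) = (if p = q then - e i p else 0)" "\<omega> i (\<i> *s v p) (\<i> *s v q) = 0"
    if pq: "p < ?m" "q < ?m" for p q
  proof -
    show 1: "\<omega> i (v p) (v q) = 0" using ev[OF i pq(1) D(1)[OF pq(2)]] D(3)[OF pq] by simp
    show "\<omega> i (v p) (\<i> *s v q) = (if p = q then e i p else 0)"
      using ev[OF i pq(1) iU[OF pq(2)]] D(4)[OF pq] by simp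
    show "\<omega> i (\<i> *s v p) (v q) = (if p = q then - e i p else 0)"
      using ev[OF i pq(2) iU[OF pq(1)]] D(4)[OF pq(2,1)] form11D(3)[OF \<omega>[OF i], of "\<i> *s v p" "v q"] by simp
    show "\<omega> i (\<i> *s v p) (\<i> *s v q) = 0" using 1 form11D(4)[OF \<omega>[OF i]] by simp
  qed
  from x show "\<omega> i (?u x) (?u y) = (\<Sum>j<?m. e i j * pair_form j x y)"
  proof (cases rule: less_double_cases)
    case (1 p)
    from y show ?thesis by (cases rule: less_double_cases) (use 1 e in \<open>simp_all add: sum_pair_form\<close>)
  next
    case (2 p)
    from y show ?thesis by (cases rule: less_double_cases) (use 2 e in \<open>simp_all add: sum_pair_form\<close>)
  qed
qed

text \<open>\<open>D\<close> is the determinant of the change from the eigenbasis to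
  \<open>b\<close>. It is quantified before the forms, so that one \<open>D\<close> serves for all
  wedge products to be compared.\<close>

lemma wedge_in_eigenbasis:
  assumes vc: "eigenbasis U E F v c" and U: "vec.subspace U" and b: "\<And>k. k < 2 * vec.dim U \<Longrightarrow> b k \<in> U"
  shows "\<exists>D. \<forall>\<omega> e. (\<forall>i<vec.dim U. form11 (\<omega> i)) \<longrightarrow>
      (\<forall>i<vec.dim U. \<forall>j<vec.dim U. \<forall>y\<in>U. \<omega> i (v j) y = e i j * E (v j) y) \<longrightarrow>
      wedge_eval (vec.dim U) \<omega> b = D * (\<Sum>\<sigma> | \<sigma> permutes {..<vec.dim U}. \<Prod>i<vec.dim U. e i (\<sigma> i))"
proof -
  let ?m = "vec.dim U" and ?u = "interleave v (\<lambda>j. \<i> *s v j)"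
  define A where "A k = interleave (\<lambda>j. E (b k) (\<i> *s v j)) (\<lambda>j. E (v j) (b k))" for k
  have "b k = (\<Sum>j<2 * ?m. A k j *\<^sub>R ?u j)" if "k < 2 * ?m" for k
  proof -
    have "b k = (\<Sum>j<?m. E (b k) (\<i> *s v j) *\<^sub>R v j + E (v j) (b k) *\<^sub>R (\<i> *s v j))"
      using vc b[OF that] unfolding eigenbasis_def by blast
    thus ?thesis by (simp add: sum_pairs A_def)
  qed
  note wcb = wedge_change_basis[OF _ _ this]
  show ?thesis
  proof (intro exI allI impI)
    fix \<omega> :: "nat \<Rightarrow> complex ^ 'a \<Rightarrow> complex ^ 'a \<Rightarrow> real" and e
    assume \<omega>: "\<forall>i<?m. form11 (\<omega> i)"
      and ev: "\<forall>i<?m. \<forall>j<?m. \<forall>y\<in>U. \<omega> i (v j) y = e i j * E (v j) y"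
    have "wedge_eval ?m \<omega> b = detn (2 * ?m) A * wedge_eval ?m \<omega> ?u"
      by (rule wcb) (use form11D(1,2) \<omega> in blast)+
    also have "wedge_eval ?m \<omega> ?u = (\<Sum>\<sigma> | \<sigma> permutes {..<?m}. \<Prod>i<?m. e i (\<sigma> i))"
      by (rule wedge_eigenbasis[OF vc U]) (use \<omega> ev in blast)+
    finally show "wedge_eval ?m \<omega> b = detn (2 * ?m) A * (\<Sum>\<sigma> | \<sigma> permutes {..<?m}. \<Prod>i<?m. e i (\<sigma> i))" .
  qed
qed

definition psum :: "nat \<Rightarrow> (nat \<Rightarrow> real) \<Rightarrow> nat \<Rightarrow> real" where
  "psum g c r = (\<Sum>\<sigma> | \<sigma> permutes {..<g}. \<Prod>i<r. c (\<sigma> i))"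

text \<open>In the eigenbasis \<open>E\<close> has eigenvalues 1 and \<open>F\<close> has
  eigenvalues \<open>c\<close>, so the permanents are the factorial and \<open>psum\<close>; the
  common determinant is eliminated by cross multiplication.\<close>

lemma wedge_mixed:
  assumes E: "form11 E" and F: "form11 F" and vc: "eigenbasis U E F v c" and U: "vec.subspace U"
    and b: "\<And>k. k < 2 * vec.dim U \<Longrightarrow> b k \<in> U" and r: "r \<le> vec.dim U"
  shows "fact (vec.dim U) * wedge_eval (vec.dim U) (\<lambda>i. if i < r then F else E) b
    = wedge_eval (vec.dim U) (\<lambda>_. E) b * psum (vec.dim U) c r"
proof -
  let ?m = "vec.dim U"
  obtain D where D: "\<forall>\<omega> e. (\<forall>i<?m. form11 (\<omega> i)) \<longrightarrow>
      (\<forall>i<?m. \<forall>j<?m. \<forall>y\<in>U. \<omega> i (v j) y = e i j * E (v j) y) \<longrightarrow>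
      wedge_eval ?m \<omega> b = D * (\<Sum>\<sigma> | \<sigma> permutes {..<?m}. \<Prod>i<?m. e i (\<sigma> i))"
    using wedge_in_eigenbasis[OF vc U, of b] b by blast
  note D = D[rule_format]
  have 1: "wedge_eval ?m (\<lambda>_. E) b = D * fact ?m"
    by (subst D[where e = "\<lambda>_ _. 1"]) (use E in \<open>simp_all add: card_permutations\<close>)
  have 2: "wedge_eval ?m (\<lambda>i. if i < r then F else E) b
      = D * (\<Sum>\<sigma> | \<sigma> permutes {..<?m}. \<Prod>i<?m. if i < r then c (\<sigma> i) else 1)"
    by (rule D[where e = "\<lambda>i j. if i < r then c j else 1"]) (use E F eigenbasisD(2)[OF vc] in simp_all)
  have 3: "(\<Prod>i<?m. if i < r then c (\<sigma> i) else 1) = (\<Prod>i<r. c (\<sigma> i))" for \<sigma>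
  proof -
    have "(\<Prod>i<?m. if i < r then c (\<sigma> i) else 1) = (\<Prod>i | i \<in> {..<?m} \<and> i < r. c (\<sigma> i))"
      using prod.inter_filter[of "{..<?m}" "\<lambda>i. c (\<sigma> i)" "\<lambda>i. i < r"] by simp
    moreover have "{i. i \<in> {..<?m} \<and> i < r} = {..<r}" using r by auto
    ultimately show ?thesis by simp
  qed
  show ?thesis unfolding 1 2 3 psum_def by simp
qed

lemma form11_kaehler: "form11 (kaehler :: complex ^ 'g \<Rightarrow> _)"
proof -
  have "kaehler x y = - kaehler y x" for x y :: "complex ^ 'g"
    by (simp add: kaehler_def sum_negf[symmetric] mult.commute)
  moreover have "kaehler (\<i> *s x) (\<i> *s y) = kaehler x y" for x y :: "complex ^ 'g"
    by (simp add: kaehler_def)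
  moreover have "linear (kaehler x)" for x :: "complex ^ 'g"
    by (rule linearI) (simp_all add: kaehler_def sum.distrib algebra_simps sum_distrib_left)
  moreover have "linear (\<lambda>x. kaehler x y)" for y :: "complex ^ 'g"
    by (rule linearI) (simp_all add: kaehler_def sum.distrib algebra_simps sum_distrib_left)
  ultimately show ?thesis unfolding form11_def by blast
qed

lemma kaehler_pos: "v \<noteq> 0 \<Longrightarrow> kaehler v (\<i> *s v) > 0"
proof -
  assume v: "v \<noteq> 0"
  have "kaehler v (\<i> *s v) = (\<Sum>k\<in>UNIV. (cmod (v $ k))\<^sup>2)"
    unfolding kaehler_def Im_sum by (rule sum.cong) (simp_all add: cmod_power2, simp add: power2_eq_square)
  moreover obtain k where "v $ k \<noteq> 0" using v by (auto simp: vec_eq_iff)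
  ultimately show ?thesis by (simp add: sum_pos2[of UNIV k])
qed

text \<open>Diagonalising the Kaehler form with respect to \<open>E\<close> yields positive
  eigenvalues, so the two top powers differ by a positive factor. Orientation can therefore be
  tested with \<open>E\<close>.\<close>

lemma kaehler_orientation:
  assumes E: "form11 E" and U: "vec.subspace U" and pos: "\<And>v. v \<in> U \<Longrightarrow> v \<noteq> 0 \<Longrightarrow> E v (\<i> *s v) > 0"
    and b: "\<And>k. k < 2 * vec.dim U \<Longrightarrow> b k \<in> U"
  shows "wedge_eval (vec.dim U) (\<lambda>_. kaehler) b > 0 \<longleftrightarrow> wedge_eval (vec.dim U) (\<lambda>_. E) b > 0"
proof -
  let ?m = "vec.dim U"
  obtain v c where vc: "eigenbasis U E kaehler v c" using ex_eigenbasis[OF E form11_kaehler U pos] by blast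
  have c: "c j > 0" if j: "j < ?m" for j
  proof -
    note D = eigenbasisD[OF vc j]
    have 1: "E (v j) (\<i> *s v j) = 1" using D(4)[OF j] by simp
    hence "v j \<noteq> 0" using form11D(12)[OF E] by force
    hence "0 < kaehler (v j) (\<i> *s v j)" by (rule kaehler_pos)
    also have "\<dots> = c j" using D(1) U vec.subspace_scale by (subst D(2)) (auto simp: 1)
    finally show ?thesis .
  qed
  have "psum ?m c ?m > 0" unfolding psum_def
  proof (rule sum_pos)
    show "{\<sigma>. \<sigma> permutes {..<?m}} \<noteq> {}" using permutes_id by blast
    show "0 < (\<Prod>i<?m. c (\<sigma> i))" if "\<sigma> \<in> {\<sigma>. \<sigma> permutes {..<?m}}" for \<sigma>
      using that c permutes_in_image[of \<sigma> "{..<?m}"] by (intro prod_pos) auto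
  qed (simp add: finite_permutations)
  moreover have "fact ?m * wedge_eval ?m (\<lambda>_. kaehler) b = wedge_eval ?m (\<lambda>_. E) b * psum ?m c ?m"
  proof -
    have "wedge_eval ?m (\<lambda>i. if i < ?m then kaehler else E) b = wedge_eval ?m (\<lambda>_. kaehler) b"
      unfolding wedge_eval_def by simp
    thus ?thesis using wedge_mixed[OF E form11_kaehler vc U, of b ?m] b by simp
  qed
  moreover have "fact ?m > (0::real)" by simp
  ultimately show ?thesis by (metis zero_less_mult_pos zero_less_mult_pos2 mult_pos_pos)
qed

lemma ex_permutes_image:
  fixes X :: "nat set"
  assumes "X \<subseteq> {..<g}" obtains \<pi> where "\<pi> permutes {..<g}" "\<pi> ` {..<card X} = X"
proof -
  let ?r = "card X"
  have fX: "finite X" using assms finite_subset by blast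
  have rg: "?r \<le> g" using card_mono[OF _ assms] by simp
  obtain f where f: "bij_betw f {..<?r} X" using finite_same_card_bij[of "{..<?r}" X] fX by auto
  have "card ({..<g} - {..<?r}) = card ({..<g} - X)"
    using rg assms fX by (subst (1 2) card_Diff_subset) auto
  then obtain h where h: "bij_betw h ({..<g} - {..<?r}) ({..<g} - X)"
    using finite_same_card_bij[of "{..<g} - {..<?r}" "{..<g} - X"] by auto
  define \<pi> where "\<pi> k = (if k < ?r then f k else if k < g then h k else k)" for k
  have 1: "bij_betw \<pi> {..<?r} X" using f by (subst bij_betw_cong[of _ _ f]) (auto simp: \<pi>_def)
  have 2: "bij_betw \<pi> ({..<g} - {..<?r}) ({..<g} - X)" using h by (subst bij_betw_cong[of _ _ h]) (auto simp: \<pi>_def)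
  have "bij_betw \<pi> ({..<?r} \<union> ({..<g} - {..<?r})) (X \<union> ({..<g} - X))"
    by (rule bij_betw_combine[OF 1 2]) auto
  hence "bij_betw \<pi> {..<g} {..<g}" using rg assms by (simp add: Un_absorb1 ivl_disj_un)
  hence "\<pi> permutes {..<g}" by (rule bij_imp_permutes) (use rg in \<open>auto simp: \<pi>_def\<close>)
  thus ?thesis using that 1 by (simp add: bij_betw_def)
qed

text \<open>The \<open>psum g c r\<close> are the elementary symmetric functions of \<open>c\<close>, up to the factor \<open>r! (g - r)!\<close>.\<close>

lemma psum_poly:
  "of_nat (fact g) * (\<Prod>j<g. [:c j, 1:]) = (\<Sum>r\<le>g. monom (of_nat (g choose r) * psum g c r) (g - r))"
proof -
  let ?P = "{\<sigma>. \<sigma> permutes {..<g}}"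
  define Q where "Q X = (\<Sum>\<sigma>\<in>?P. \<Prod>i\<in>X. c (\<sigma> i))" for X
  have fP: "finite ?P" by (simp add: finite_permutations)
  \<comment> \<open>Summing over all permutations makes the value depend on the size of
    \<open>X\<close> only.\<close>
  have Q: "Q X = psum g c (card X)" if X: "X \<subseteq> {..<g}" for X
  proof -
    obtain \<pi> where \<pi>: "\<pi> permutes {..<g}" "\<pi> ` {..<card X} = X" using ex_permutes_image[OF X] .
    have "psum g c (card X) = (\<Sum>\<sigma>\<in>?P. \<Prod>i<card X. c ((\<sigma> \<circ> \<pi>) i))"
      unfolding psum_def
      by (rule sum.reindex_bij_witness[where i = "\<lambda>p. p \<circ> \<pi>" and j = "\<lambda>p. p \<circ> inv_into UNIV \<pi>"])
         (auto simp: o_assoc[symmetric] permutes_compose[OF \<pi>(1)] permutes_compose[OF permutes_inv[OF \<pi>(1)]] permutes_inv_o[OF \<pi>(1)] permutes_inverses[OF \<pi>(1)])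
    also have "\<dots> = (\<Sum>\<sigma>\<in>?P. \<Prod>i\<in>\<pi> ` {..<card X}. c (\<sigma> i))"
      using permutes_inj_on[OF \<pi>(1)] by (subst prod.reindex) (auto simp: o_def)
    finally show ?thesis by (simp add: \<pi>(2) Q_def)
  qed
  \<comment> \<open>The product is the same for every order of the factors; adding the expansions
    over all \<open>\<sigma>\<close> symmetrises the coefficients.\<close>
  have "(\<Prod>j<g. [:c j, 1:]) = (\<Sum>X\<in>Pow {..<g}. monom (\<Prod>i\<in>X. c (\<sigma> i)) (g - card X))" if \<sigma>: "\<sigma> permutes {..<g}" for \<sigma>
  proof -
    have "(\<Prod>j<g. [:c j, 1:]) = (\<Prod>j<g. [:c (\<sigma> j):] + monom 1 1)"
      using prod.permute[OF \<sigma>, of "\<lambda>j. [:c j, 1:]"] by (simp add: o_def monom_Suc one_pCons)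
    also have "\<dots> = (\<Sum>X\<in>Pow {..<g}. (\<Prod>i\<in>X. [:c (\<sigma> i):]) * (\<Prod>i\<in>{..<g} - X. monom 1 1))"
      by (rule prod_add) simp
    also have "\<dots> = (\<Sum>X\<in>Pow {..<g}. monom (\<Prod>i\<in>X. c (\<sigma> i)) (g - card X))"
    proof (rule sum.cong, simp)
      fix X assume X: "X \<in> Pow {..<g}"
      hence fX: "finite X" using finite_subset by blast
      have "(\<Prod>i\<in>X. [:c (\<sigma> i):]) = [:\<Prod>i\<in>X. c (\<sigma> i):]"
        using fX by (induction X) (simp_all add: one_pCons)
      moreover have "card ({..<g} - X) = g - card X" using X fX by (subst card_Diff_subset) auto
      ultimately show "(\<Prod>i\<in>X. [:c (\<sigma> i):]) * (\<Prod>i\<in>{..<g} - X. monom 1 1) = monom (\<Prod>i\<in>X. c (\<sigma> i)) (g - card X)"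
        by (simp add: monom_power smult_monom)
    qed
    finally show ?thesis .
  qed
  hence "(\<Sum>\<sigma>\<in>?P. (\<Prod>j<g. [:c j, 1:])) = (\<Sum>\<sigma>\<in>?P. \<Sum>X\<in>Pow {..<g}. monom (\<Prod>i\<in>X. c (\<sigma> i)) (g - card X))"
    by (intro sum.cong) simp_all
  hence "of_nat (fact g) * (\<Prod>j<g. [:c j, 1:]) = (\<Sum>\<sigma>\<in>?P. \<Sum>X\<in>Pow {..<g}. monom (\<Prod>i\<in>X. c (\<sigma> i)) (g - card X))"
    by (simp add: card_permutations)
  also have "\<dots> = (\<Sum>X\<in>Pow {..<g}. monom (psum g c (card X)) (g - card X))"
    by (subst sum.swap) (simp add: Q[symmetric] Q_def monom_sum)
  also have "\<dots> = (\<Sum>r\<le>g. \<Sum>X | X \<in> Pow {..<g} \<and> card X = r. monom (psum g c (card X)) (g - card X))"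
    by (rule sum.group[symmetric]) (auto intro: card_mono[of "{..<g}", simplified])
  also have "\<dots> = (\<Sum>r\<le>g. monom (of_nat (g choose r) * psum g c r) (g - r))"
  proof (rule sum.cong[OF refl])
    fix r
    have "card {X. X \<in> Pow {..<g} \<and> card X = r} = g choose r"
      using n_subsets[of "{..<g}" r] by (simp add: conj_commute)
    thus "(\<Sum>X | X \<in> Pow {..<g} \<and> card X = r. monom (psum g c (card X)) (g - card X)) = monom (of_nat (g choose r) * psum g c r) (g - r)"
      by (simp add: of_nat_poly smult_monom)
  qed
  finally show ?thesis .
qed

lemma psum_coeff:
  assumes "r \<le> g"
  shows "fact g * coeff (\<Prod>j<g. [:c j, 1:]) (g - r) = of_nat (g choose r) * psum g c r"
proof -
  have "fact g * coeff (\<Prod>j<g. [:c j, 1:]) (g - r) = coeff (of_nat (fact g) * (\<Prod>j<g. [:c j, 1:])) (g - r)"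
    by (simp add: of_nat_poly)
  also have "\<dots> = (\<Sum>s\<le>g. if s = r then of_nat (g choose s) * psum g c s else 0)"
    unfolding psum_poly coeff_sum using assms by (intro sum.cong) auto
  finally show ?thesis using assms by simp
qed

text \<open>The product is (g - r)! / (n - r)!. So, up to the Euler characteristic, the prescribed
  intersection numbers are the values of \<open>psum\<close> that belong to the polynomial (t + 1)^n
  t^(g - n).\<close>

lemma falling_binomial:
  assumes "r \<le> n" "n \<le> g"
  shows "fact g * of_nat (n choose r) = of_nat (g choose r) * (fact n * (\<Prod>i=n+1..g. of_nat i - of_nat r) :: real)"
  using assms(2)
proof (induction g rule: dec_induct)
  case base
  thus ?case by simp
next
  case (step g)
  have rg: "r \<le> g" using step assms(1) by simp
  have "(real g + 1 - real r) * of_nat (Suc g choose r) = of_nat (Suc g) * of_nat (g choose r)"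
  proof -
    have "Suc g * (g choose r) = (Suc g - r) * (Suc g choose r)" using rg binomial_absorb_comp[of "Suc g" r] by simp
    hence "real (Suc g * (g choose r)) = real ((Suc g - r) * (Suc g choose r))" by simp
    thus ?thesis using rg unfolding of_nat_mult by (simp add: of_nat_diff)
  qed
  note * = this
  have "fact (Suc g) * real (n choose r) = of_nat (Suc g) * (of_nat (g choose r) * (fact n * (\<Prod>i=n+1..g. of_nat i - of_nat r)))"
    using step.IH by (simp only: fact_Suc of_nat_mult mult.assoc)
  also have "\<dots> = ((real g + 1 - real r) * of_nat (Suc g choose r)) * (fact n * (\<Prod>i=n+1..g. of_nat i - of_nat r))"
    unfolding * by (simp only: mult.assoc)
  also have "\<dots> = of_nat (Suc g choose r) * (fact n * (\<Prod>i=n+1..Suc g. of_nat i - of_nat r))"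
    using step.hyps by (simp add: prod.cl_ivl_Suc algebra_simps)
  finally show ?case .
qed

lemma prod_01_poly:
  assumes "\<And>j. j < g \<Longrightarrow> c j \<in> {0, 1::real}"
  shows "(\<Prod>j<g. [:c j, 1:]) = [:1, 1:] ^ card {j. j < g \<and> c j = 1} * monom 1 (g - card {j. j < g \<and> c j = 1})"
proof -
  let ?S = "{j. j < g \<and> c j = 1}"
  have S: "?S \<subseteq> {..<g}" "finite ?S" by auto
  have "(\<Prod>j<g. [:c j, 1:]) = (\<Prod>j\<in>?S. [:c j, 1:]) * (\<Prod>j\<in>{..<g} - ?S. [:c j, 1:])"
    using prod.subset_diff[OF S(1), of "\<lambda>j. [:c j, 1:]"] by (simp add: mult.commute)
  also have "(\<Prod>j\<in>?S. [:c j, 1:]) = [:1, 1:] ^ card ?S" by simp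
  also have "(\<Prod>j\<in>{..<g} - ?S. [:c j, 1:]) = (\<Prod>j\<in>{..<g} - ?S. monom 1 1)"
    by (rule prod.cong) (use assms in \<open>auto simp: monom_Suc\<close>)
  also have "\<dots> = monom 1 (g - card ?S)"
    using S by (simp add: monom_power card_Diff_subset)
  finally show ?thesis .
qed

lemma coeff_01_poly:
  "r \<le> g \<Longrightarrow> n \<le> g \<Longrightarrow> coeff ([:1, 1::real:] ^ n * monom 1 (g - n)) (g - r) = of_nat (n choose r)"
  unfolding mult.commute[of _ "monom 1 _"] coeff_monom_mult
  using binomial_symmetric[of r n] by (auto simp: coeff_linear_poly_power)

lemma psum_iff:
  assumes "n \<le> g"
  shows "(\<forall>r\<in>{1..g}. psum g c r = (if r \<le> n then fact n * (\<Prod>i=n+1..g. of_nat i - of_nat r) else 0))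
    \<longleftrightarrow> (\<forall>j<g. c j \<in> {0, 1}) \<and> card {j. j < g \<and> c j = 1} = n" (is "?L \<longleftrightarrow> ?R")
proof -
  define p where "p = (\<Prod>j<g. [:c j, 1:])"
  define q where "q n = [:1, 1::real:] ^ n * monom 1 (g - n)" for n
  have val: "(psum g c r = (if r \<le> n then fact n * (\<Prod>i=n+1..g. of_nat i - of_nat r) else 0)) \<longleftrightarrow> coeff p (g - r) = coeff (q n) (g - r)"
    if r: "r \<le> g" for r
  proof -
    have g: "fact g * coeff (q n) (g - r) = of_nat (g choose r) * (if r \<le> n then fact n * (\<Prod>i=n+1..g. of_nat i - of_nat r) else 0)"
      using falling_binomial[of r n g] assms coeff_01_poly[OF r assms] by (simp add: q_def binomial_eq_0)
    have "coeff p (g - r) = coeff (q n) (g - r) \<longleftrightarrow> fact g * coeff p (g - r) = fact g * coeff (q n) (g - r)"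
      by simp
    also have "\<dots> \<longleftrightarrow> of_nat (g choose r) * psum g c r = of_nat (g choose r) * (if r \<le> n then fact n * (\<Prod>i=n+1..g. of_nat i - of_nat r) else 0)"
      unfolding g unfolding p_def psum_coeff[OF r] ..
    finally show ?thesis using r by (simp add: binomial_eq_0_iff)
  qed
  \<comment> \<open>The index \<open>r = 0\<close> is not among the prescribed conditions; there the
    coefficients agree because both polynomials have leading term t^g.\<close>
  have top: "coeff p (g - 0) = coeff (q n) (g - 0)"
    using psum_coeff[of 0 g c] coeff_01_poly[of 0 g n] assms
    by (simp add: p_def q_def psum_def card_permutations)
  have "degree p \<le> (\<Sum>j<g. degree [:c j, 1:])" unfolding p_def using degree_prod_sum_le[of "{..<g}" "\<lambda>j. [:c j, 1:]"] by (simp add: o_def)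
  hence degp: "degree p \<le> g" by simp
  have "degree (q n) \<le> n * 1 + (g - n)"
    unfolding q_def by (intro degree_mult_le[THEN order_trans] add_mono degree_monom_le degree_power_le[THEN order_trans]) simp
  hence degq: "degree (q n) \<le> g" using assms by simp
  have "?L \<longleftrightarrow> (\<forall>r\<in>{1..g}. coeff p (g - r) = coeff (q n) (g - r))" using val by simp
  also have "\<dots> \<longleftrightarrow> p = q n"
  proof
    assume *: "\<forall>r\<in>{1..g}. coeff p (g - r) = coeff (q n) (g - r)"
    show "p = q n"
    proof (rule poly_eqI)
      fix k
      show "coeff p k = coeff (q n) k"
      proof (cases "k \<le> g")
        case True
        hence "g - k = 0 \<or> g - k \<in> {1..g}" "g - (g - k) = k" by auto
        thus ?thesis using * top by (metis diff_zero)
      next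
        case False
        thus ?thesis using degp degq by (simp add: coeff_eq_0)
      qed
    qed
  qed simp
  also have "\<dots> \<longleftrightarrow> ?R"
  proof
    assume pq: "p = q n"
    have c: "c j \<in> {0, 1}" if "j < g" for j
    proof -
      \<comment> \<open>The numbers \<open>- c j\<close> are roots of \<open>p\<close>, and a root
        of \<open>q n\<close> can only be 0 or -1.\<close>
      have "poly p (- c j) = 0" using that by (auto simp: p_def poly_prod)
      thus ?thesis unfolding pq by (auto simp: q_def poly_monom)
    qed
    hence "p = q (card {j. j < g \<and> c j = 1})" unfolding p_def q_def by (intro prod_01_poly) blast
    \<comment> \<open>At 1 the polynomial \<open>q n\<close> takes the value \<open>2 ^ n\<close>,
      which determines \<open>n\<close>.\<close>
    hence "poly (q n) 1 = poly (q (card {j. j < g \<and> c j = 1})) 1" using pq by simp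
    hence "card {j. j < g \<and> c j = 1} = n" by (simp add: q_def poly_monom)
    thus ?R using c by blast
  next
    assume ?R
    thus "p = q n" using prod_01_poly[of g c] by (auto simp: p_def q_def)
  qed
  finally show ?thesis .
qed

section \<open>Intersection numbers of rational classes\<close>

section \<open>Intersection numbers as values of wedge products\<close>

context positive_form
begin

lemma oriented_basis_in_V: "oriented_basis \<Lambda> (vec.dim V) B \<Longrightarrow> k < 2 * vec.dim V \<Longrightarrow> B k \<in> \<Lambda>"
proof -
  assume B: "oriented_basis \<Lambda> (vec.dim V) B" and k: "k < 2 * vec.dim V"
  have "(\<Sum>i<2 * vec.dim V. of_int (if i = k then 1 else 0) *\<^sub>R B i) = B k"
    using k by (subst sum.mono_neutral_right[of _ "{k}"]) auto
  hence "B k \<in> range (\<lambda>c :: nat \<Rightarrow> int. \<Sum>i<2 * vec.dim V. of_int (c i) *\<^sub>R B i)"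
    by (intro range_eqI[where x = "\<lambda>i. if i = k then 1 else 0"]) simp
  thus ?thesis using B unfolding oriented_basis_def by blast
qed

lemma wedge_symplectic:
  assumes S: "is_symplectic a b d"
  shows "wedge_eval (vec.dim V) (\<lambda>_. E) (interleave a b) = fact (vec.dim V) * (\<Prod>i<vec.dim V. real (d i))"
proof -
  let ?m = "vec.dim V"
  note S1 = symplecticD[OF S]
  have "wedge_eval ?m (\<lambda>_. E) (interleave a b) = (\<Sum>\<sigma> | \<sigma> permutes {..<?m}. \<Prod>i<?m. real (d (\<sigma> i)))"
  proof (rule wedge_block_diagonal)
    fix x y assume x: "x < 2 * ?m" and y: "y < 2 * ?m"
    from x show "E (interleave a b x) (interleave a b y) = (\<Sum>j<?m. real (d j) * pair_form j x y)"
    proof (cases rule: less_double_cases)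
      case (1 p)
      from y show ?thesis by (cases rule: less_double_cases) (use 1 S1(4,6) in \<open>simp_all add: sum_pair_form\<close>)
    next
      case (2 p)
      from y show ?thesis by (cases rule: less_double_cases) (use 2 S1(5,7) in \<open>simp_all add: sum_pair_form\<close>)
    qed
  qed
  also have "\<dots> = (\<Sum>\<sigma> | \<sigma> permutes {..<?m}. \<Prod>i<?m. real (d i))"
  proof (rule sum.cong, simp)
    fix \<sigma> assume "\<sigma> \<in> {\<sigma>. \<sigma> permutes {..<?m}}"
    thus "(\<Prod>i<?m. real (d (\<sigma> i))) = (\<Prod>i<?m. real (d i))"
      using prod.permute[of \<sigma> "{..<?m}" "\<lambda>i. real (d i)"] by (simp add: o_def)
  qed
  finally show ?thesis by (simp add: card_permutations)
qed

lemma wedge_symplectic_pos: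
  "is_symplectic a b d \<Longrightarrow> wedge_eval (vec.dim V) (\<lambda>_. E) (interleave a b) > 0"
  unfolding wedge_symplectic by (intro mult_pos_pos prod_pos) (auto simp: symplecticD(3))

lemma interleave_in_lattice:
  assumes "is_symplectic a b d" "k < 2 * vec.dim V" shows "interleave a b k \<in> \<Lambda>"
  using assms(2) by (cases rule: less_double_cases) (use symplecticD(1,2)[OF assms(1)] in simp_all)

lemma oriented_symplectic:
  assumes S: "is_symplectic a b d" shows "oriented_basis \<Lambda> (vec.dim V) (interleave a b)"
  unfolding oriented_basis_def
proof (intro conjI)
  let ?m = "vec.dim V"
  note S1 = symplecticD[OF S]
  show "inj_on (interleave a b) {..<2 * ?m}" "independent (interleave a b ` {..<2 * ?m})" using S1 by blast+
  show "\<Lambda> = range (\<lambda>c :: nat \<Rightarrow> int. \<Sum>i<2 * ?m. of_int (c i) *\<^sub>R interleave a b i)"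
  proof
    show "\<Lambda> \<subseteq> range (\<lambda>c :: nat \<Rightarrow> int. \<Sum>i<2 * ?m. of_int (c i) *\<^sub>R interleave a b i)"
    proof
      fix x assume "x \<in> \<Lambda>"
      then obtain s t :: "nat \<Rightarrow> int" where "x = (\<Sum>i<?m. of_int (s i) *\<^sub>R a i + of_int (t i) *\<^sub>R b i)" using S1(9) by blast
      hence "x = (\<Sum>i<2 * ?m. of_int (interleave s t i) *\<^sub>R interleave a b i)" by (simp add: sum_pairs)
      thus "x \<in> range (\<lambda>c :: nat \<Rightarrow> int. \<Sum>i<2 * ?m. of_int (c i) *\<^sub>R interleave a b i)" by blast
    qed
    show "range (\<lambda>c :: nat \<Rightarrow> int. \<Sum>i<2 * ?m. of_int (c i) *\<^sub>R interleave a b i) \<subseteq> \<Lambda>"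
      using interleave_in_lattice[OF S] by (auto intro!: lattice_sum[OF L] lattice_int_scale[OF L])
  qed
  show "wedge_eval ?m (\<lambda>_. kaehler) (interleave a b) > 0"
    using kaehler_orientation[OF E is_latticeD(1)[OF L] pos, of "interleave a b"] interleave_in_lattice[OF S]
      is_latticeD(2)[OF L] wedge_symplectic_pos[OF S] by blast
qed

text \<open>The change of basis between two oriented bases has an integral inverse and positive
  determinant, hence determinant 1.\<close>

lemma wedge_oriented:
  assumes S: "is_symplectic a b d" and B: "oriented_basis \<Lambda> (vec.dim V) B"
  shows "wedge_eval (vec.dim V) (\<lambda>_. E) B = fact (vec.dim V) * (\<Prod>i<vec.dim V. real (d i))"
proof -
  let ?m = "vec.dim V" and ?u = "interleave a b"
  have change: "\<exists>D\<in>\<int>. wedge_eval ?m (\<lambda>_. E) x = D * wedge_eval ?m (\<lambda>_. E) y"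
    if x: "\<And>k. k < 2 * ?m \<Longrightarrow> x k \<in> \<Lambda>" and y: "oriented_basis \<Lambda> ?m y" for x y
  proof -
    have "\<exists>c :: nat \<Rightarrow> int. x k = (\<Sum>i<2 * ?m. of_int (c i) *\<^sub>R y i)" if "k < 2 * ?m" for k
      using x[OF that] y unfolding oriented_basis_def by blast
    then obtain c :: "nat \<Rightarrow> nat \<Rightarrow> int" where c: "\<And>k. k < 2 * ?m \<Longrightarrow> x k = (\<Sum>i<2 * ?m. of_int (c k i) *\<^sub>R y i)" by metis
    have "wedge_eval ?m (\<lambda>_. E) x = detn (2 * ?m) (\<lambda>k i. of_int (c k i)) * wedge_eval ?m (\<lambda>_. E) y"
      by (rule wedge_change_basis) (use c form11D(1,2)[OF E] in blast)+
    moreover have "detn (2 * ?m) (\<lambda>k i. of_int (c k i)) \<in> \<int>" by (rule detn_int) simp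
    ultimately show ?thesis by blast
  qed
  note u = oriented_symplectic[OF S]
  obtain C where C: "C \<in> \<int>" "wedge_eval ?m (\<lambda>_. E) B = C * wedge_eval ?m (\<lambda>_. E) ?u"
    using change[of B ?u, OF oriented_basis_in_V[OF B] u] by (rule bexE)
  obtain D where D: "D \<in> \<int>" "wedge_eval ?m (\<lambda>_. E) ?u = D * wedge_eval ?m (\<lambda>_. E) B"
    using change[of ?u B, OF oriented_basis_in_V[OF u] B] by (rule bexE)
  have pos1: "wedge_eval ?m (\<lambda>_. E) ?u > 0" by (rule wedge_symplectic_pos[OF S])
  have pos2: "wedge_eval ?m (\<lambda>_. E) B > 0"
    using kaehler_orientation[OF E is_latticeD(1)[OF L] pos, of B] oriented_basis_in_V[OF B] is_latticeD(2)[OF L] B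
    unfolding oriented_basis_def by blast
  have "C * D * wedge_eval ?m (\<lambda>_. E) ?u = 1 * wedge_eval ?m (\<lambda>_. E) ?u"
    using D(2) unfolding C(2) by (simp add: mult_ac)
  hence CD: "C * D = 1" using pos1 by simp
  have "C > 0" using C(2) pos1 pos2 by (simp add: zero_less_mult_iff)
  moreover obtain m n :: int where mn: "C = of_int m" "D = of_int n" using C(1) D(1) by (auto elim!: Ints_cases)
  moreover have "m * n = 1" using CD unfolding mn by (metis of_int_eq_1_iff of_int_mult)
  ultimately have "m = 1" by (auto simp: zmult_eq_1_iff)
  thus ?thesis using C(2) mn wedge_symplectic[OF S] by simp
qed

end

lemma form11_scale:
  assumes F: "form11 F" shows "form11 (\<lambda>x y. r * F x y)"
proof -
  have "linear (\<lambda>y. r * F x y)" "linear (\<lambda>x. r * F x y)" for x y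
    by (rule linearI; simp add: form11D(5-8)[OF F] algebra_simps)+
  moreover have "r * F x y = - (r * F y x)" for x y by (subst form11D(3)[OF F, of x y]) simp
  ultimately show ?thesis unfolding form11_def form11D(4)[OF F] by blast
qed

locale polarized =
  fixes \<Lambda> :: "(complex ^ 'g) set" and Lb :: "'g line_bundle"
  assumes lattice: "is_lattice UNIV \<Lambda>" and Lb: "Lb \<in> carrier (Pic UNIV \<Lambda>)" and ample: "ample UNIV \<Lambda> Lb"
begin

abbreviation "E \<equiv> c1 \<Lambda> Lb"

sublocale positive_form UNIV \<Lambda> E
  by unfold_locales (use lattice form11_c1[OF lattice Lb] c1_int[OF lattice Lb] ample_pos[OF lattice Lb ample] in auto)

declare card_cart_basis [simp]

lemma dim_UNIV: "vec.dim (UNIV :: (complex ^ 'g) set) = CARD('g)"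
  by simp

lemma euler_char_eq:
  assumes S: "is_symplectic a b d" shows "euler_char UNIV \<Lambda> Lb = (\<Prod>i<CARD('g). d i)"
proof -
  obtain f where f: "f \<in> Lb" using mem_Pic_nonempty[OF lattice Lb] by blast
  note h = has_form_c1[OF lattice Lb f]
  have "has_type UNIV \<Lambda> Lb (pol_type UNIV \<Lambda> Lb)"
    unfolding pol_type_def by (rule someI) (rule has_type_symplectic[OF Lb f h S])
  from has_type_prod_kill(1)[OF Lb f h S this] show ?thesis by (simp add: euler_char_def dim_UNIV)
qed

text \<open>The basis that \<open>intersection\<close> selects; with a name for it, all intersection
  numbers are evaluated on the same vectors.\<close>

definition obasis :: "nat \<Rightarrow> complex ^ 'g" where
  "obasis = (SOME b. oriented_basis \<Lambda> CARD('g) b)"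

lemma obasis: "oriented_basis \<Lambda> CARD('g) obasis"
  unfolding obasis_def using ex_symplectic oriented_symplectic dim_UNIV by (metis someI)

lemma wedge_obasis: "wedge_eval CARD('g) (\<lambda>_. E) obasis = fact CARD('g) * real (euler_char UNIV \<Lambda> Lb)"
  using ex_symplectic wedge_oriented[of _ _ _ obasis] euler_char_eq obasis by (auto simp: dim_UNIV)

lemma euler_char_pos: "euler_char UNIV \<Lambda> Lb > 0"
proof -
  obtain a b d where S: "is_symplectic a b d" using ex_symplectic by blast
  thus ?thesis using euler_char_eq[OF S] symplecticD(3)[OF S] by (simp add: dim_UNIV prod_pos)
qed

lemma intersection_eq:
  assumes "\<And>i. i < CARD('g) \<Longrightarrow> M i \<in> carrier (Pic UNIV \<Lambda>)"
  shows "real_of_rat (intersection UNIV \<Lambda> M) = wedge_eval CARD('g) (\<lambda>i. c1 \<Lambda> (M i)) obasis"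
proof -
  have b: "obasis (p k) \<in> \<Lambda>" if "p permutes {..<2 * CARD('g)}" "k < 2 * CARD('g)" for p k
    using oriented_basis_in_V[of obasis "p k"] obasis permutes_in_image[OF that(1), of k] that(2) by (simp add: dim_UNIV)
  show ?thesis
    unfolding intersection_def dim_UNIV obasis_def[symmetric] wedge_eval_def
    by (simp add: of_rat_divide of_rat_power of_rat_sum of_rat_mult of_rat_prod)
       (intro sum.cong refl arg_cong2[of _ _ _ _ "(*)"] prod.cong; simp add: chern_eq_c1[OF lattice assms] b)
qed

lemma c1_hom:
  assumes "M \<in> carrier (Pic UNIV \<Lambda>)" "N \<in> carrier (Pic UNIV \<Lambda>)"
  shows "c1 \<Lambda> (M \<otimes>\<^bsub>Pic UNIV \<Lambda>\<^esub> inv\<^bsub>Pic UNIV \<Lambda>\<^esub> N) = (\<lambda>x y. c1 \<Lambda> M x y - c1 \<Lambda> N x y)"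
proof -
  interpret P: comm_group "Pic UNIV \<Lambda>" by (rule comm_group_Pic[OF lattice])
  have "c1 \<Lambda> (M \<otimes>\<^bsub>Pic UNIV \<Lambda>\<^esub> inv\<^bsub>Pic UNIV \<Lambda>\<^esub> N \<otimes>\<^bsub>Pic UNIV \<Lambda>\<^esub> N)
      = (\<lambda>x y. c1 \<Lambda> (M \<otimes>\<^bsub>Pic UNIV \<Lambda>\<^esub> inv\<^bsub>Pic UNIV \<Lambda>\<^esub> N) x y + c1 \<Lambda> N x y)"
    using assms by (intro c1_mult[OF lattice]) auto
  thus ?thesis using assms by (simp add: P.m_assoc fun_eq_iff)
qed

lemma Pic0_subgroup: "subgroup (Pic0_set UNIV \<Lambda>) (Pic UNIV \<Lambda>)"
proof -
  interpret P: comm_group "Pic UNIV \<Lambda>" by (rule comm_group_Pic[OF lattice])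
  have one: "c1 \<Lambda> \<one>\<^bsub>Pic UNIV \<Lambda>\<^esub> = (\<lambda>x y. 0)"
    using c1_hom[OF P.one_closed P.one_closed] by simp
  show ?thesis
  proof (rule P.subgroupI)
    show "Pic0_set UNIV \<Lambda> \<noteq> {}" using one Pic0_iff[OF lattice] P.one_closed by blast
    fix M assume M: "M \<in> Pic0_set UNIV \<Lambda>"
    hence "c1 \<Lambda> (\<one>\<^bsub>Pic UNIV \<Lambda>\<^esub> \<otimes>\<^bsub>Pic UNIV \<Lambda>\<^esub> inv\<^bsub>Pic UNIV \<Lambda>\<^esub> M) = (\<lambda>x y. 0)"
      using c1_hom[OF P.one_closed] one Pic0_iff[OF lattice] by simp
    thus "inv\<^bsub>Pic UNIV \<Lambda>\<^esub> M \<in> Pic0_set UNIV \<Lambda>" using M by (simp add: Pic0_iff[OF lattice])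
    fix N assume "N \<in> Pic0_set UNIV \<Lambda>"
    thus "M \<otimes>\<^bsub>Pic UNIV \<Lambda>\<^esub> N \<in> Pic0_set UNIV \<Lambda>" using M by (simp add: Pic0_iff[OF lattice] c1_mult[OF lattice])
  qed (auto simp: Pic0_iff[OF lattice])
qed

lemma carrier_NS: "carrier (NS UNIV \<Lambda>) = ns_of UNIV \<Lambda> ` carrier (Pic UNIV \<Lambda>)"
  by (auto simp: NS_def FactGroup_def RCOSETS_def ns_of_def)

lemma mem_ns_of:
  assumes "M \<in> carrier (Pic UNIV \<Lambda>)"
  shows "N \<in> ns_of UNIV \<Lambda> M \<longleftrightarrow> N \<in> carrier (Pic UNIV \<Lambda>) \<and> c1 \<Lambda> N = c1 \<Lambda> M"
proof -
  interpret P: comm_group "Pic UNIV \<Lambda>" by (rule comm_group_Pic[OF lattice])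
  show ?thesis unfolding ns_of_def
    using assms by (auto simp: P.mem_rcos_iff[OF Pic0_subgroup] Pic0_iff[OF lattice] c1_hom fun_eq_iff)
qed

lemma ns_of_some:
  assumes "M \<in> carrier (Pic UNIV \<Lambda>)"
  shows "(SOME N. N \<in> ns_of UNIV \<Lambda> M) \<in> carrier (Pic UNIV \<Lambda>)" "c1 \<Lambda> (SOME N. N \<in> ns_of UNIV \<Lambda> M) = c1 \<Lambda> M"
  using someI[of "\<lambda>N. N \<in> ns_of UNIV \<Lambda> M" M] mem_ns_of[OF assms] assms by auto

lemma ns_of_eq:
  "M \<in> carrier (Pic UNIV \<Lambda>) \<Longrightarrow> N \<in> carrier (Pic UNIV \<Lambda>) \<Longrightarrow> c1 \<Lambda> M = c1 \<Lambda> N \<Longrightarrow> ns_of UNIV \<Lambda> M = ns_of UNIV \<Lambda> N"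
  using mem_ns_of by auto

text \<open>Classes are recorded by the values of their Chern form on pairs of vectors; this is
  injective because \<open>Pic0_set\<close> is the kernel of \<open>c1\<close>.\<close>

sublocale NSv: vector_embedding "NS UNIV \<Lambda>" "\<lambda>c p. c1 \<Lambda> (SOME M. M \<in> c) (fst p) (snd p)"
proof -
  interpret P: comm_group "Pic UNIV \<Lambda>" by (rule comm_group_Pic[OF lattice])
  interpret N: normal "Pic0_set UNIV \<Lambda>" "Pic UNIV \<Lambda>" by (rule P.subgroup_imp_normal[OF Pic0_subgroup])
  have "group (NS UNIV \<Lambda>)" unfolding NS_def by (rule N.factorgroup_is_group)
  then interpret N: group "NS UNIV \<Lambda>" .
  show "vector_embedding (NS UNIV \<Lambda>) (\<lambda>c p. c1 \<Lambda> (SOME M. M \<in> c) (fst p) (snd p))"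
  proof unfold_locales
    fix x y and p :: "(complex ^ 'g) \<times> (complex ^ 'g)" assume "x \<in> carrier (NS UNIV \<Lambda>)" "y \<in> carrier (NS UNIV \<Lambda>)"
    then obtain M N where M: "x = ns_of UNIV \<Lambda> M" "M \<in> carrier (Pic UNIV \<Lambda>)" and N: "y = ns_of UNIV \<Lambda> N" "N \<in> carrier (Pic UNIV \<Lambda>)"
      unfolding carrier_NS by blast
    have "x \<otimes>\<^bsub>NS UNIV \<Lambda>\<^esub> y = ns_of UNIV \<Lambda> (M \<otimes>\<^bsub>Pic UNIV \<Lambda>\<^esub> N)"
      unfolding M N NS_def ns_of_def by (rule P.rcos_mult[OF Pic0_subgroup M(2) N(2)])
    thus "c1 \<Lambda> (SOME M. M \<in> x \<otimes>\<^bsub>NS UNIV \<Lambda>\<^esub> y) (fst p) (snd p)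
        = c1 \<Lambda> (SOME M. M \<in> x) (fst p) (snd p) + c1 \<Lambda> (SOME M. M \<in> y) (fst p) (snd p)"
      using M N by (simp add: ns_of_some c1_mult[OF lattice])
  next
    fix x y assume "x \<in> carrier (NS UNIV \<Lambda>)" "y \<in> carrier (NS UNIV \<Lambda>)"
      and eq: "(\<lambda>p. c1 \<Lambda> (SOME M. M \<in> x) (fst p) (snd p)) = (\<lambda>p. c1 \<Lambda> (SOME M. M \<in> y) (fst p) (snd p))"
    then obtain M N where M: "x = ns_of UNIV \<Lambda> M" "M \<in> carrier (Pic UNIV \<Lambda>)" and N: "y = ns_of UNIV \<Lambda> N" "N \<in> carrier (Pic UNIV \<Lambda>)"
      unfolding carrier_NS by blast
    have "c1 \<Lambda> M = c1 \<Lambda> N" using eq M N by (auto simp: ns_of_some fun_eq_iff)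
    thus "x = y" using M N ns_of_eq by blast
  qed
qed

definition form :: "('g ns_class \<times> nat) set \<Rightarrow> (complex ^ 'g \<Rightarrow> complex ^ 'g \<Rightarrow> real)" where
  "form \<alpha> x y = NSv.ext \<alpha> (x, y)"

lemma NS_ratE:
  assumes "\<alpha> \<in> NS_rat UNIV \<Lambda>"
  obtains M m where "M \<in> carrier (Pic UNIV \<Lambda>)" "0 < m" "\<alpha> = rat_frac (NS UNIV \<Lambda>) (ns_of UNIV \<Lambda> M) m"
proof -
  obtain c m where c: "c \<in> carrier (NS UNIV \<Lambda>)" "0 < m" "\<alpha> = rat_frac (NS UNIV \<Lambda>) c m"
    by (rule NSv.tensor_ratE[OF assms])
  moreover from c(1) obtain M where "M \<in> carrier (Pic UNIV \<Lambda>)" "c = ns_of UNIV \<Lambda> M" unfolding carrier_NS by blast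
  ultimately show ?thesis using that by blast
qed

lemma form_mem:
  assumes "\<alpha> \<in> NS_rat UNIV \<Lambda>" "(c, m) \<in> \<alpha>"
  shows "form \<alpha> x y = c1 \<Lambda> (SOME M. M \<in> c) x y / m"
  using NSv.ext_eq[OF assms] by (simp add: form_def field_simps)

lemma form_frac:
  assumes "M \<in> carrier (Pic UNIV \<Lambda>)" "0 < m"
  shows "form (rat_frac (NS UNIV \<Lambda>) (ns_of UNIV \<Lambda> M) m) x y = c1 \<Lambda> M x y / m"
proof -
  have "ns_of UNIV \<Lambda> M \<in> carrier (NS UNIV \<Lambda>)" using assms carrier_NS by blast
  thus ?thesis using NSv.ext_frac[of "ns_of UNIV \<Lambda> M" m] assms by (simp add: form_def ns_of_some field_simps)
qed

lemma form11_form: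
  assumes "\<alpha> \<in> NS_rat UNIV \<Lambda>" shows "form11 (form \<alpha>)"
proof -
  obtain M m where M: "M \<in> carrier (Pic UNIV \<Lambda>)" "0 < m" "\<alpha> = rat_frac (NS UNIV \<Lambda>) (ns_of UNIV \<Lambda> M) m" using NS_ratE[OF assms] .
  have "form \<alpha> = (\<lambda>x y. (1 / real m) * c1 \<Lambda> M x y)" unfolding M(3) using form_frac[OF M(1,2)] by (simp add: fun_eq_iff)
  thus ?thesis using form11_scale[OF form11_c1[OF lattice M(1)], of "1 / real m"] by simp
qed

lemma form_inj:
  assumes "\<alpha> \<in> NS_rat UNIV \<Lambda>" "\<beta> \<in> NS_rat UNIV \<Lambda>" "form \<alpha> = form \<beta>" shows "\<alpha> = \<beta>"
  by (rule NSv.ext_inj[OF assms(1,2)]) (use assms(3) in \<open>auto simp: fun_eq_iff form_def\<close>)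

text \<open>\<open>m\<close> clears the denominators, and a further factor 2 provides the evenness
  that \<open>ex_bundle_c1\<close> asks for.\<close>

lemma form_surj:
  assumes F: "form11 F" and m: "0 < m" "\<And>l k. l \<in> \<Lambda> \<Longrightarrow> k \<in> \<Lambda> \<Longrightarrow> real m * F l k \<in> \<int>"
  obtains \<alpha> where "\<alpha> \<in> NS_rat UNIV \<Lambda>" "form \<alpha> = F"
proof -
  define G where "G x y = real (2 * m) * F x y" for x y
  have G: "form11 G" unfolding G_def by (rule form11_scale[OF F])
  have "G l k / 2 \<in> \<int>" if "l \<in> \<Lambda>" "k \<in> \<Lambda>" for l k using m(2)[OF that] by (simp add: G_def)
  then obtain M where M: "M \<in> carrier (Pic UNIV \<Lambda>)" "c1 \<Lambda> M = G" using ex_bundle_c1[OF lattice G] by blast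
  let ?\<alpha> = "rat_frac (NS UNIV \<Lambda>) (ns_of UNIV \<Lambda> M) (2 * m)"
  have "?\<alpha> \<in> NS_rat UNIV \<Lambda>" using M m carrier_NS by (intro NSv.rat_frac_in) auto
  moreover have "form ?\<alpha> = F" using form_frac[OF M(1), of "2 * m"] m by (simp add: M(2) G_def fun_eq_iff)
  ultimately show ?thesis using that by blast
qed

lemma wedge_eval_divide:
  "wedge_eval n (\<lambda>i x y. \<omega> i x y / m i) b = wedge_eval n \<omega> b / (\<Prod>i<n. m i)" for m :: "nat \<Rightarrow> real"
  by (simp add: wedge_eval_def prod_dividef sum_divide_distrib[symmetric] mult.commute)

lemma intersection_rat_eq:
  assumes \<alpha>: "\<And>i. i < CARD('g) \<Longrightarrow> \<alpha> i \<in> NS_rat UNIV \<Lambda>"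
  shows "real_of_rat (intersection_rat UNIV \<Lambda> \<alpha>) = wedge_eval CARD('g) (\<lambda>i. form (\<alpha> i)) obasis"
proof -
  define q where "q i = (SOME p. p \<in> \<alpha> i)" for i
  have q: "(SOME M. M \<in> fst (q i)) \<in> carrier (Pic UNIV \<Lambda>)"
    "form (\<alpha> i) = (\<lambda>x y. c1 \<Lambda> (SOME M. M \<in> fst (q i)) x y / real (snd (q i)))" if i: "i < CARD('g)" for i
  proof -
    have "\<exists>p. p \<in> \<alpha> i" using NSv.tensor_ratE[OF \<alpha>[OF i]] by blast
    hence "q i \<in> \<alpha> i" unfolding q_def by (rule someI_ex)
    hence mem: "(fst (q i), snd (q i)) \<in> \<alpha> i" by simp
    have "fst (q i) \<in> carrier (NS UNIV \<Lambda>)" by (rule NSv.tensor_ratD(1)[OF \<alpha>[OF i] mem])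
    thus "(SOME M. M \<in> fst (q i)) \<in> carrier (Pic UNIV \<Lambda>)" unfolding carrier_NS using ns_of_some(1) by fastforce
    show "form (\<alpha> i) = (\<lambda>x y. c1 \<Lambda> (SOME M. M \<in> fst (q i)) x y / real (snd (q i)))"
      using form_mem[OF \<alpha>[OF i] mem] by blast
  qed
  have "real_of_rat (intersection_rat UNIV \<Lambda> \<alpha>)
      = real_of_rat (intersection UNIV \<Lambda> (\<lambda>i. SOME M. M \<in> fst (q i))) / (\<Prod>i<CARD('g). real (snd (q i)))"
    by (simp add: intersection_rat_def q_def Let_def dim_UNIV of_rat_divide of_rat_prod)
  also have "\<dots> = wedge_eval CARD('g) (\<lambda>i x y. c1 \<Lambda> (SOME M. M \<in> fst (q i)) x y / real (snd (q i))) obasis"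
    unfolding wedge_eval_divide using q(1) by (subst intersection_eq) simp_all
  also have "\<dots> = wedge_eval CARD('g) (\<lambda>i. form (\<alpha> i)) obasis"
    unfolding wedge_eval_def using q(2) by simp
  finally show ?thesis .
qed

text \<open>\<open>wedge_mixed\<close> and \<open>wedge_obasis\<close> turn each intersection number
  into the Euler characteristic times \<open>psum\<close>. The former is positive and cancels, and
  \<open>psum_iff\<close> does the rest.\<close>

lemma intersection_condition:
  assumes \<alpha>: "\<alpha> \<in> NS_rat UNIV \<Lambda>" and vc: "eigenbasis UNIV E (form \<alpha>) v c" and n: "n \<le> CARD('g)"
  shows "(\<forall>r\<in>{1..CARD('g)}. intersection_rat UNIV \<Lambda>
         (\<lambda>i. if i < r then \<alpha> else rat_frac (NS UNIV \<Lambda>) (ns_of UNIV \<Lambda> Lb) 1) =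
       (if r \<le> n then of_nat (euler_char UNIV \<Lambda> Lb) * fact n * (\<Prod>i=n+1..CARD('g). of_nat i - of_nat r) else 0))
    \<longleftrightarrow> (\<forall>j<CARD('g). c j \<in> {0, 1}) \<and> card {j. j < CARD('g) \<and> c j = 1} = n"
  unfolding psum_iff[OF n, symmetric]
proof (rule ball_cong[OF refl])
  fix r assume "r \<in> {1..CARD('g)}"
  hence r: "r \<le> CARD('g)" by simp
  let ?\<kappa> = "rat_frac (NS UNIV \<Lambda>) (ns_of UNIV \<Lambda> Lb) 1"
  have \<kappa>: "?\<kappa> \<in> NS_rat UNIV \<Lambda>" "form ?\<kappa> = E"
    using Lb carrier_NS form_frac[OF Lb, of 1] by (auto intro: NSv.rat_frac_in simp: fun_eq_iff)
  have "real_of_rat (intersection_rat UNIV \<Lambda> (\<lambda>i. if i < r then \<alpha> else ?\<kappa>))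
      = wedge_eval CARD('g) (\<lambda>i. form (if i < r then \<alpha> else ?\<kappa>)) obasis"
    by (rule intersection_rat_eq) (use \<alpha> \<kappa> in simp)
  also have "(\<lambda>i. form (if i < r then \<alpha> else ?\<kappa>)) = (\<lambda>i. if i < r then form \<alpha> else E)"
    using \<kappa>(2) by auto
  finally have 1: "real_of_rat (intersection_rat UNIV \<Lambda> (\<lambda>i. if i < r then \<alpha> else ?\<kappa>))
      = wedge_eval CARD('g) (\<lambda>i. if i < r then form \<alpha> else E) obasis" .
  have "fact CARD('g) * wedge_eval CARD('g) (\<lambda>i. if i < r then form \<alpha> else E) obasis
      = fact CARD('g) * real (euler_char UNIV \<Lambda> Lb) * psum CARD('g) c r"
    using wedge_mixed[OF E form11_form[OF \<alpha>] vc _ UNIV_I, of r] r wedge_obasis by (simp add: dim_UNIV)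
  hence 2: "real_of_rat (intersection_rat UNIV \<Lambda> (\<lambda>i. if i < r then \<alpha> else ?\<kappa>)) = real (euler_char UNIV \<Lambda> Lb) * psum CARD('g) c r"
    unfolding 1 by (simp add: mult.assoc)
  have "real_of_rat (fact n) = fact n" by (metis of_nat_fact of_rat_of_nat_eq)
  hence 3: "real_of_rat (if r \<le> n then of_nat (euler_char UNIV \<Lambda> Lb) * fact n * (\<Prod>i=n+1..CARD('g). of_nat i - of_nat r) else 0)
      = real (euler_char UNIV \<Lambda> Lb) * (if r \<le> n then fact n * (\<Prod>i=n+1..CARD('g). of_nat i - of_nat r) else 0)"
    by (simp add: of_rat_mult of_rat_prod of_rat_diff)
  show "(intersection_rat UNIV \<Lambda> (\<lambda>i. if i < r then \<alpha> else ?\<kappa>) =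
       (if r \<le> n then of_nat (euler_char UNIV \<Lambda> Lb) * fact n * (\<Prod>i=n+1..CARD('g). of_nat i - of_nat r) else 0))
     \<longleftrightarrow> psum CARD('g) c r = (if r \<le> n then fact n * (\<Prod>i=n+1..CARD('g). of_nat i - of_nat r) else 0)"
    unfolding of_rat_eq_iff[where 'a = real, symmetric] 2 3 mult_cancel_left using euler_char_pos by simp
qed

end

section \<open>Homomorphisms as real bilinear forms, endomorphisms as complex linear maps\<close>

section \<open>Groups of homomorphisms\<close>

lemma (in comm_group) comm_group_restrict:
  assumes "subgroup H G" shows "comm_group (G\<lparr>carrier := H\<rparr>)"
proof -
  have "group (G\<lparr>carrier := H\<rparr>)" by (rule subgroup.subgroup_is_group[OF assms is_group])
  thus ?thesis
    by (rule group.group_comm_groupI) (use subgroup.mem_carrier[OF assms] m_comm in simp)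
qed

lemma Hom_simps [simp]:
  "f \<otimes>\<^bsub>Hom G H\<^esub> h = (\<lambda>x\<in>carrier G. f x \<otimes>\<^bsub>H\<^esub> h x)" "\<one>\<^bsub>Hom G H\<^esub> = (\<lambda>x\<in>carrier G. \<one>\<^bsub>H\<^esub>)"
  "carrier (Hom G H) = hom G H \<inter> extensional (carrier G)"
  by (simp_all add: Hom_def)

lemma monoid_Hom:
  assumes "group G" "comm_group H" shows "monoid (Hom G H)"
proof -
  interpret G: group G by fact
  interpret H: comm_group H by fact
  show ?thesis
  proof
    fix f h assume fh: "f \<in> carrier (Hom G H)" "h \<in> carrier (Hom G H)"
    have c: "f x \<in> carrier H" "h x \<in> carrier H" if "x \<in> carrier G" for x
      using fh that by (auto simp: hom_def)
    have "(\<lambda>x\<in>carrier G. f x \<otimes>\<^bsub>H\<^esub> h x) \<in> hom G H"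
    proof (rule homI)
      fix x y assume xy: "x \<in> carrier G" "y \<in> carrier G"
      have "f (x \<otimes>\<^bsub>G\<^esub> y) = f x \<otimes>\<^bsub>H\<^esub> f y" "h (x \<otimes>\<^bsub>G\<^esub> y) = h x \<otimes>\<^bsub>H\<^esub> h y" using fh xy by (auto simp: hom_def)
      thus "(\<lambda>x\<in>carrier G. f x \<otimes>\<^bsub>H\<^esub> h x) (x \<otimes>\<^bsub>G\<^esub> y) = (\<lambda>x\<in>carrier G. f x \<otimes>\<^bsub>H\<^esub> h x) x \<otimes>\<^bsub>H\<^esub> (\<lambda>x\<in>carrier G. f x \<otimes>\<^bsub>H\<^esub> h x) y"
        using xy c by (simp add: H.m_ac)
    qed (use c in auto)
    thus "f \<otimes>\<^bsub>Hom G H\<^esub> h \<in> carrier (Hom G H)" by simp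
    fix k assume k: "k \<in> carrier (Hom G H)"
    hence "k x \<in> carrier H" if "x \<in> carrier G" for x using that by (auto simp: hom_def)
    thus "f \<otimes>\<^bsub>Hom G H\<^esub> h \<otimes>\<^bsub>Hom G H\<^esub> k = f \<otimes>\<^bsub>Hom G H\<^esub> (h \<otimes>\<^bsub>Hom G H\<^esub> k)"
      using c by (auto simp: fun_eq_iff H.m_assoc)
  next
    fix f assume f: "f \<in> carrier (Hom G H)"
    hence "f x \<in> carrier H" if "x \<in> carrier G" for x using that by (auto simp: hom_def)
    thus "\<one>\<^bsub>Hom G H\<^esub> \<otimes>\<^bsub>Hom G H\<^esub> f = f" "f \<otimes>\<^bsub>Hom G H\<^esub> \<one>\<^bsub>Hom G H\<^esub> = f"
      using f by (auto simp: fun_eq_iff extensional_def)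
  qed (auto intro!: homI)
qed

lemma Hom_pow:
  assumes "group G" "comm_group H" "f \<in> carrier (Hom G H)" "x \<in> carrier G"
  shows "(f [^]\<^bsub>Hom G H\<^esub> (n::nat)) x = f x [^]\<^bsub>H\<^esub> n"
  by (induction n) (use assms(4) in simp_all)

lemma linear_scaleR_into_lattice:
  assumes L: "is_lattice V \<Lambda>" and x: "\<And>t::real. t *\<^sub>R x \<in> \<Lambda>"
  shows "x = 0"
proof -
  obtain e where e: "e > 0" "\<And>x y. x \<in> \<Lambda> \<Longrightarrow> y \<in> \<Lambda> \<Longrightarrow> dist x y < e \<Longrightarrow> x = y"
    using is_latticeD(5)[OF L] unfolding uniform_discrete_def by blast
  define t where "t = e / (2 * (norm x + 1))"
  have t: "t > 0" "t * norm x < e" using e(1)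
    by (simp_all add: t_def divide_simps add_nonneg_pos mult_less_cancel_left_pos)
  have "t *\<^sub>R x = 0" by (rule e(2)) (use x[of t] is_latticeD(3)[OF L] t in auto)
  thus ?thesis using t by simp
qed

section \<open>Homomorphisms from the torus to its dual\<close>

context polarized
begin

abbreviation "T \<equiv> torus UNIV \<Lambda>"
abbreviation "D \<equiv> dual UNIV \<Lambda>"
abbreviation "\<pi> \<equiv> proj UNIV \<Lambda>"

lemma groupT: "comm_group T" by (rule comm_group_torus[OF lattice])

lemma group_dual: "comm_group D"
  unfolding dual_def by (rule comm_group.comm_group_restrict[OF comm_group_Pic[OF lattice] Pic0_subgroup])

lemma carrierT: "carrier T = range \<pi>" by (rule carrier_torus[OF lattice])

lemma flat_in_dual:
  assumes "linear \<phi>" shows "flat UNIV \<Lambda> \<phi> \<in> carrier D"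
proof -
  have c: "chr UNIV \<Lambda> \<phi> \<in> carrier (factors UNIV \<Lambda>)" by (rule chr_in_factors[OF lattice assms])
  have "has_form UNIV \<Lambda> (chr UNIV \<Lambda> \<phi>) (\<lambda>x y. 0)"
    unfolding has_form_def
    by (rule exI[of _ "\<lambda>_. 1"], rule exI[of _ "\<lambda>_ _. 0"], rule exI[of _ "\<lambda>l. of_real (\<phi> l)"])
       (auto simp: exponent_form_def clin_def chr_def linear_zero holo_const)
  hence "c1 \<Lambda> (flat UNIV \<Lambda> \<phi>) = (\<lambda>x y. 0)" unfolding flat_def by (rule c1_bundle_of[OF lattice c])
  thus ?thesis using flat_in_Pic[OF lattice assms] by (simp add: dual_def Pic0_iff[OF lattice])
qed

lemma pow_dual: "x [^]\<^bsub>D\<^esub> (n::nat) = x [^]\<^bsub>Pic UNIV \<Lambda>\<^esub> n"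
  by (simp add: dual_def nat_pow_def)

lemma phi_proj:
  assumes "M \<in> carrier (Pic UNIV \<Lambda>)" shows "phi UNIV \<Lambda> M (\<pi> v) = flat UNIV \<Lambda> (\<lambda>l. c1 \<Lambda> M l v)"
proof -
  obtain f where "f \<in> M" using mem_Pic_nonempty[OF lattice assms] by blast
  thus ?thesis using phi_eq[OF lattice assms _ has_form_c1[OF lattice assms]] by blast
qed

text \<open>Homomorphisms into the dual that come from a real bilinear form. Both \<open>phi\<close>
  of a bundle and the composition of \<open>phi\<close> with an endomorphism are of this kind, so
  that they can be compared rationally through their forms.\<close>

definition hom_form :: "('g point \<Rightarrow> 'g line_bundle) \<Rightarrow> (complex ^ 'g \<Rightarrow> complex ^ 'g \<Rightarrow> real) \<Rightarrow> bool" where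
  "hom_form h G \<longleftrightarrow> h \<in> extensional (carrier T) \<and> (\<forall>x. linear (G x)) \<and> (\<forall>y. linear (\<lambda>x. G x y)) \<and>
     (\<forall>v. h (\<pi> v) = flat UNIV \<Lambda> (\<lambda>l. G l v))"

lemma hom_form_phi: "M \<in> carrier (Pic UNIV \<Lambda>) \<Longrightarrow> hom_form (phi UNIV \<Lambda> M) (c1 \<Lambda> M)"
  unfolding hom_form_def using phi_proj form11D(1,2)[OF form11_c1[OF lattice]] by (auto simp: phi_def)

lemma hom_form_Hom:
  assumes "hom_form h G" shows "h \<in> carrier (Hom T D)"
proof -
  interpret T: comm_group T by (rule groupT)
  have "h \<in> hom T D"
  proof (rule homI)
    fix x assume "x \<in> carrier T"
    thus "h x \<in> carrier D" using assms flat_in_dual unfolding carrierT hom_form_def by auto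
  next
    fix x y assume "x \<in> carrier T" "y \<in> carrier T"
    then obtain v w where vw: "x = \<pi> v" "y = \<pi> w" unfolding carrierT by blast
    have lin: "linear (\<lambda>l. G l v)" "linear (\<lambda>l. G l w)" and add: "G l (v + w) = G l v + G l w" for l
      using assms unfolding hom_form_def by (auto simp: linear_add)
    have "h x \<otimes>\<^bsub>D\<^esub> h y = flat UNIV \<Lambda> (\<lambda>l. G l v) \<otimes>\<^bsub>Pic UNIV \<Lambda>\<^esub> flat UNIV \<Lambda> (\<lambda>l. G l w)"
      using assms unfolding vw hom_form_def dual_def by simp
    also have "\<dots> = h (\<pi> (v + w))" unfolding flat_mult[OF lattice lin] using assms add unfolding hom_form_def by simp
    finally show "h (x \<otimes>\<^bsub>T\<^esub> y) = h x \<otimes>\<^bsub>D\<^esub> h y" by (simp add: vw proj_add[OF lattice])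
  qed
  thus ?thesis using assms by (simp add: hom_form_def)
qed

text \<open>An integer-valued bilinear form on \<open>\<Lambda> \<times> V\<close> vanishes, by scaling the second argument.\<close>

lemma hom_form_rat_eq:
  assumes h: "hom_form h G" and h': "hom_form h' G'" and m: "0 < m" "0 < n"
  shows "rat_frac (Hom T D) h m = rat_frac (Hom T D) h' n \<longleftrightarrow> (\<forall>x y. G x y / real m = G' x y / real n)"
proof -
  interpret T: comm_group T by (rule groupT)
  interpret H: monoid "Hom T D" by (rule monoid_Hom[OF T.is_group group_dual])
  note hc = hom_form_Hom[OF h] and hc' = hom_form_Hom[OF h']
  have lin: "linear (G x)" "linear (\<lambda>x. G x y)" "linear (G' x)" "linear (\<lambda>x. G' x y)"
    and val: "h (\<pi> v) = flat UNIV \<Lambda> (\<lambda>l. G l v)" "h' (\<pi> v) = flat UNIV \<Lambda> (\<lambda>l. G' l v)" for x y v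
    using h h' unfolding hom_form_def by auto
  have pow: "(h [^]\<^bsub>Hom T D\<^esub> (p::nat)) (\<pi> v) = flat UNIV \<Lambda> (\<lambda>l. real p * G l v)"
    "(h' [^]\<^bsub>Hom T D\<^esub> (p::nat)) (\<pi> v) = flat UNIV \<Lambda> (\<lambda>l. real p * G' l v)" for p v
    using Hom_pow[OF T.is_group group_dual hc] Hom_pow[OF T.is_group group_dual hc'] flat_pow[OF lattice] lin
    by (simp_all add: val carrierT pow_dual)
  have scale: "linear (\<lambda>l. r * G l v)" "linear (\<lambda>l. r * G' l v)" for r v
    using linear_compose_scale_right[OF lin(2), of r v] linear_compose_scale_right[OF lin(4), of r v] by simp_all
  have pow_eq: "h [^]\<^bsub>Hom T D\<^esub> (p::nat) = h' [^]\<^bsub>Hom T D\<^esub> (q::nat) \<longleftrightarrow> (\<forall>x y. real p * G x y = real q * G' x y)" for p q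
  proof
    assume eq: "h [^]\<^bsub>Hom T D\<^esub> p = h' [^]\<^bsub>Hom T D\<^esub> q"
    have int: "real p * G l v - real q * G' l v \<in> \<int>" if "l \<in> \<Lambda>" for l v
      using pow[of p v] pow[of q v] that unfolding eq flat_eq_iff[OF lattice scale(1) scale(2), symmetric, of p v q v]
      using flat_eq_iff[OF lattice scale(1) scale(2), of p v q v] by simp
    have zero: "real p * G l v - real q * G' l v = 0" if l: "l \<in> \<Lambda>" for l v
    proof (rule ccontr)
      define r where "r = real p * G l v - real q * G' l v"
      assume "real p * G l v - real q * G' l v \<noteq> 0"
      hence r: "r \<noteq> 0" by (simp add: r_def)
      \<comment> \<open>Scaling the second argument by 1 / (2r) turns the value \<open>r\<close>
        into 1/2, which is not an integer.\<close>
      have "real p * G l ((1 / (2 * r)) *\<^sub>R v) - real q * G' l ((1 / (2 * r)) *\<^sub>R v) = (1 / (2 * r)) * r"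
        by (simp add: linear_cmul[OF lin(1)] linear_cmul[OF lin(3)] r_def diff_divide_distrib)
      also have "\<dots> = 1 / 2" using r by simp
      finally have "(1 / 2 :: real) \<in> \<int>" using int[OF l] by metis
      then obtain z :: int where "(1 / 2 :: real) = of_int z" by (rule Ints_cases)
      hence "real_of_int (2 * z) = of_int 1" by simp
      hence "2 * z = 1" by (simp only: of_int_eq_iff)
      thus False by presburger
    qed
    show "\<forall>x y. real p * G x y = real q * G' x y"
    proof (intro allI)
      fix x y
      have l: "linear (\<lambda>x. real p * G x y - real q * G' x y)" by (intro linear_compose_sub scale)
      have "x \<in> span \<Lambda>" using is_latticeD(6)[OF lattice] by simp
      from linear_eq_0_on_span[OF l zero this] show "real p * G x y = real q * G' x y" by simp
    qed
  next
    assume "\<forall>x y. real p * G x y = real q * G' x y"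
    hence "(h [^]\<^bsub>Hom T D\<^esub> p) a = (h' [^]\<^bsub>Hom T D\<^esub> q) a" if "a \<in> carrier T" for a
      using that unfolding carrierT by (auto simp: pow)
    thus "h [^]\<^bsub>Hom T D\<^esub> p = h' [^]\<^bsub>Hom T D\<^esub> q"
      using H.nat_pow_closed[OF hc, of p] H.nat_pow_closed[OF hc', of q] by (intro extensionalityI) auto
  qed
  have "rat_frac (Hom T D) h m = rat_frac (Hom T D) h' n \<longleftrightarrow> (\<exists>k>0. \<forall>x y. real (k * n) * G x y = real (k * m) * G' x y)"
    unfolding H.rat_frac_eq_iff[OF hc m(1) hc' m(2)] rat_rel_def using hc hc' m by (simp add: pow_eq)
  also have "\<dots> \<longleftrightarrow> (\<forall>x y. G x y / real m = G' x y / real n)"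
  proof
    assume "\<exists>k>0. \<forall>x y. real (k * n) * G x y = real (k * m) * G' x y"
    then obtain k :: nat where k: "k > 0" "\<And>x y. real (k * n) * G x y = real (k * m) * G' x y" by blast
    show "\<forall>x y. G x y / real m = G' x y / real n"
    proof (intro allI)
      fix x y
      have "real k * (real n * G x y) = real k * (real m * G' x y)" using k(2)[of x y] by (simp add: mult.assoc)
      hence "real n * G x y = real m * G' x y" using k(1) by simp
      thus "G x y / real m = G' x y / real n" using m by (simp add: field_simps)
    qed
  next
    assume "\<forall>x y. G x y / real m = G' x y / real n"
    hence "real (1 * n) * G x y = real (1 * m) * G' x y" for x y using m by (simp add: field_simps)
    thus "\<exists>k>0. \<forall>x y. real (k * n) * G x y = real (k * m) * G' x y" by blast
  qed
  finally show ?thesis .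
qed

lemma phi_rat_frac:
  assumes \<alpha>: "\<alpha> \<in> NS_rat UNIV \<Lambda>"
  obtains h G m where "hom_form h G" "0 < m" "phi_rat UNIV \<Lambda> \<alpha> = rat_frac (Hom T D) h m" "\<And>x y. form \<alpha> x y = G x y / real m"
proof -
  obtain c m where c: "c \<in> carrier (NS UNIV \<Lambda>)" "0 < m" "\<alpha> = rat_frac (NS UNIV \<Lambda>) c m" "(c, m) \<in> \<alpha>"
    by (rule NSv.tensor_ratE[OF \<alpha>])
  have some: "(SOME M. M \<in> c) \<in> carrier (Pic UNIV \<Lambda>)" if "c \<in> carrier (NS UNIV \<Lambda>)" for c
    using that ns_of_some(1) unfolding carrier_NS by auto
  interpret T: comm_group T by (rule groupT)
  interpret H: monoid "Hom T D" by (rule monoid_Hom[OF T.is_group group_dual])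
  have "phi_rat UNIV \<Lambda> \<alpha> = rat_frac (Hom T D) (phi UNIV \<Lambda> (SOME M. M \<in> c)) m"
    unfolding phi_rat_def
  proof (rule H.map_rat_eq[OF c(4)])
    fix c' m' assume c': "(c', m') \<in> \<alpha>"
    note cc = NSv.tensor_ratD[OF \<alpha> c']
    have "c1 \<Lambda> (SOME M. M \<in> c') x y / real m' = c1 \<Lambda> (SOME M. M \<in> c) x y / real m" for x y
      using form_mem[OF \<alpha> c'] form_mem[OF \<alpha> c(4)] by simp
    hence "rat_frac (Hom T D) (phi UNIV \<Lambda> (SOME M. M \<in> c')) m' = rat_frac (Hom T D) (phi UNIV \<Lambda> (SOME M. M \<in> c)) m"
      by (subst hom_form_rat_eq[OF hom_form_phi[OF some[OF cc(1)]] hom_form_phi[OF some[OF c(1)]] cc(2) c(2)]) simp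
    thus "((phi UNIV \<Lambda> (SOME M. M \<in> c'), m'), (phi UNIV \<Lambda> (SOME M. M \<in> c), m)) \<in> rat_rel (Hom T D)"
      using H.rat_frac_eq_iff hom_form_Hom[OF hom_form_phi[OF some[OF cc(1)]]] hom_form_Hom[OF hom_form_phi[OF some[OF c(1)]]] cc(2) c(2) by blast
  qed
  thus ?thesis using that[OF hom_form_phi[OF some[OF c(1)]] c(2)] form_mem[OF \<alpha> c(4)] by blast
qed

end

section \<open>Endomorphisms as complex linear maps\<close>

definition clmap :: "(complex ^ 'g \<Rightarrow> complex ^ 'g) \<Rightarrow> bool" where
  "clmap A \<longleftrightarrow> (\<forall>x y. A (x + y) = A x + A y) \<and> (\<forall>c x. A (c *s x) = c *s A x)"

lemma clmapD:
  assumes "clmap A"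
  shows "A (x + y) = A x + A y" "A (c *s x) = c *s A x" "A (r *\<^sub>R x) = r *\<^sub>R A x" "linear A" "A 0 = 0" "A (x - y) = A x - A y"
    "A (\<Sum>i\<in>I. f i) = (\<Sum>i\<in>I. A (f i))"
proof -
  show *: "A (x + y) = A x + A y" "A (c *s x) = c *s A x" for c x y using assms by (auto simp: clmap_def)
  show **: "A (r *\<^sub>R x) = r *\<^sub>R A x" for r x using *(2)[of "of_real r" x] by (simp add: vec_scale_of_real)
  show l: "linear A" by (rule linearI) (rule * **)+
  show "A 0 = 0" "A (x - y) = A x - A y" using linear_0[OF l] linear_diff[OF l] by auto
  show "A (\<Sum>i\<in>I. f i) = (\<Sum>i\<in>I. A (f i))" by (rule linear_sum[OF l])
qed

lemma clin_clmap: "clmap A \<Longrightarrow> clin (\<lambda>v. A v $ j)"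
  unfolding clin_def by (auto intro!: linearI simp: clmapD)

lemma clmap_scaleR: "clmap A \<Longrightarrow> clmap (\<lambda>v. r *\<^sub>R A v)"
  unfolding clmap_def by (simp add: scaleR_right_distrib vec_eq_iff)

lemma clmap_add: "clmap A \<Longrightarrow> clmap B \<Longrightarrow> clmap (\<lambda>v. A v + B v)"
  unfolding clmap_def by (simp add: vec.scale_right_distrib)

lemma clmap_zero: "clmap (\<lambda>v. 0)"
  unfolding clmap_def by simp

text \<open>By additivity the derivative is the same at every point, so each component equals its
  derivative at 0, which is complex linear by \<open>holo\<close>.\<close>

lemma holo_additive_clmap:
  fixes F :: "complex ^ 'g \<Rightarrow> complex ^ 'g"
  assumes hol: "\<And>j. holo UNIV (\<lambda>w. F w $ j)" and add: "\<And>x y. F (x + y) = F x + F y"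
  shows "clmap F"
proof -
  have "F (c *s x) $ j = c * F x $ j" for c x j
  proof -
    let ?f = "\<lambda>w. F w $ j"
    obtain D where D: "(?f has_derivative D) (at 0)" "\<And>c v. D (c *s v) = c * D v"
      using hol[of j, unfolded holo_def, rule_format, of 0] by auto
    have f0: "?f 0 = 0" using add[of 0 0] by simp
    have D0: "bounded_linear D" by (rule has_derivative_bounded_linear[OF D(1)])
    have "((\<lambda>w. ?f w - D w) has_derivative (\<lambda>h. 0)) (at w within UNIV)" for w
    proof -
      have 1: "((\<lambda>u. u - w) has_derivative (\<lambda>h. h)) (at w)" by (auto intro!: derivative_eq_intros)
      have "(?f has_derivative D) (at (w - w))" using D(1) by simp
      from has_derivative_compose[OF 1 this] have "((\<lambda>u. ?f (u - w)) has_derivative D) (at w)" .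
      hence "((\<lambda>u. ?f (u - w) + ?f w) has_derivative D) (at w)" by (rule has_derivative_add_const)
      moreover have "?f (u - w) + ?f w = ?f u" for u using add[of "u - w" w] by simp
      ultimately have "(?f has_derivative D) (at w)" by simp
      from has_derivative_diff[OF this bounded_linear_imp_has_derivative[OF D0]] show ?thesis by simp
    qed
    then obtain k where k: "\<And>w. ?f w - D w = k"
      using has_derivative_zero_constant[of UNIV "\<lambda>w. ?f w - D w"] by auto
    have "k = 0" using k[of 0] f0 linear_0[OF bounded_linear.linear[OF D0]] by simp
    hence "?f w = D w" for w using k[of w] by simp
    thus ?thesis using D(2) by simp
  qed
  thus ?thesis unfolding clmap_def using add by (simp add: vec_eq_iff)
qed

lemma continuous_into_lattice_constant:
  fixes G :: "complex ^ 'g \<Rightarrow> complex ^ 'g"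
  assumes L: "is_lattice V \<Lambda>" and cont: "continuous_on UNIV G" and G: "\<And>v. G v \<in> \<Lambda>"
  shows "G v = G 0"
proof -
  obtain e where e: "e > 0" "\<And>x y. x \<in> \<Lambda> \<Longrightarrow> y \<in> \<Lambda> \<Longrightarrow> dist x y < e \<Longrightarrow> x = y"
    using is_latticeD(5)[OF L] unfolding uniform_discrete_def by blast
  let ?S = "{v. G v = G 0}"
  have "?S = G -` ball (G 0) e" using e G by (auto simp: dist_commute)
  moreover have "open (G -` ball (G 0) e)" using cont by (intro open_vimage) auto
  moreover have "closed ?S" using cont by (intro closed_Collect_eq) auto
  ultimately have "?S = {} \<or> ?S = UNIV" using clopen[of ?S] by auto
  thus ?thesis by blast
qed

text \<open>For an eigenbasis \<open>v\<close>, the operator that multiplies the complex line of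
  \<open>v j\<close> by \<open>c j\<close>, written in real coordinates. With all \<open>c j\<close>
  equal to 1 it is the orthogonal projection onto \<open>U\<close>.\<close>

definition eop :: "(complex ^ 'g) set \<Rightarrow> (complex ^ 'g \<Rightarrow> complex ^ 'g \<Rightarrow> real) \<Rightarrow> (nat \<Rightarrow> complex ^ 'g) \<Rightarrow> (nat \<Rightarrow> real) \<Rightarrow>
    complex ^ 'g \<Rightarrow> complex ^ 'g" where
  "eop U E v c y = (\<Sum>j<vec.dim U. c j *\<^sub>R (E y (\<i> *s v j) *\<^sub>R v j + E (v j) y *\<^sub>R (\<i> *s v j)))"

lemma clmap_eop:
  assumes E: "form11 E" shows "clmap (eop U E v c)"
proof -
  have add: "eop U E v c (x + y) = eop U E v c x + eop U E v c y" for x y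
    by (simp add: eop_def form11D(5,6)[OF E] sum.distrib[symmetric] algebra_simps)
  have scaleR: "eop U E v c (r *\<^sub>R x) = r *\<^sub>R eop U E v c x" for r x
    by (simp add: eop_def form11D(7,8)[OF E] scaleR_sum_right algebra_simps)
  have i: "eop U E v c (\<i> *s x) = \<i> *s eop U E v c x" for x
  proof -
    have 1: "E (\<i> *s x) (\<i> *s v j) = - E (v j) x" "E (v j) (\<i> *s x) = E x (\<i> *s v j)" for j
      using form11D(4)[OF E, of x "v j"] form11D(3)[OF E, of x "v j"] form11_i_sym[OF E, of "v j" x] by simp_all
    show ?thesis unfolding eop_def 1 vec.scale_sum_right
      by (intro sum.cong refl) (simp add: vec.scale_right_distrib i_scaleR algebra_simps)
  qed
  have "eop U E v c (a *s x) = a *s eop U E v c x" for a x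
  proof -
    have a: "a *s y = Re a *\<^sub>R y + Im a *\<^sub>R (\<i> *s y)" for y :: "complex ^ 'a"
      by (simp add: vec_eq_iff complex_eq_iff)
    show ?thesis unfolding a[of x] a[of "eop U E v c x"] add scaleR i ..
  qed
  thus ?thesis unfolding clmap_def using add by blast
qed

lemma form_eop:
  assumes E: "form11 E"
  shows "E x (eop U E v c y) = (\<Sum>j<vec.dim U. c j * (E y (\<i> *s v j) * E x (v j) + E (v j) y * E x (\<i> *s v j)))"
  by (simp add: eop_def linear_sum[OF form11D(1)[OF E]] form11D(5,7)[OF E])

lemma form_eigen_eop:
  assumes E: "form11 E" and F: "form11 F" and U: "vec.subspace U" and vc: "eigenbasis U E F v c" and xy: "x \<in> U" "y \<in> U"
  shows "E x (eop U E v c y) = F x y"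
proof -
  note D = eigenbasisD[OF vc]
  have 1: "F x (v j) = c j * E x (v j)" "F x (\<i> *s v j) = c j * E x (\<i> *s v j)" if j: "j < vec.dim U" for j
  proof -
    have "\<i> *s x \<in> U" using xy(1) U vec.subspace_scale by blast
    thus "F x (v j) = c j * E x (v j)" "F x (\<i> *s v j) = c j * E x (\<i> *s v j)"
      using D(2)[OF j xy(1)] D(2)[OF j, of "\<i> *s x"] form11D(3)[OF F, of x "v j"] form11D(3)[OF E, of x "v j"]
        form11_i_sym[OF F, of x "v j"] form11_i_sym[OF E, of x "v j"] by simp_all
  qed
  have "y = (\<Sum>j<vec.dim U. E y (\<i> *s v j) *\<^sub>R v j + E (v j) y *\<^sub>R (\<i> *s v j))"
    using vc xy(2) unfolding eigenbasis_def by blast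
  hence "F x y = F x (\<Sum>j<vec.dim U. E y (\<i> *s v j) *\<^sub>R v j + E (v j) y *\<^sub>R (\<i> *s v j))" by simp
  also have "\<dots> = (\<Sum>j<vec.dim U. c j * (E y (\<i> *s v j) * E x (v j) + E (v j) y * E x (\<i> *s v j)))"
    unfolding linear_sum[OF form11D(1)[OF F]]
    by (intro sum.cong refl) (simp add: form11D(5,7)[OF F] 1 algebra_simps)
  finally show ?thesis by (simp add: form_eop[OF E])
qed

context polarized
begin

lemma clmap_eqI:
  assumes A: "clmap A" and B: "clmap B" and d: "\<And>v. A v - B v \<in> \<Lambda>" shows "A = B"
proof
  fix v
  have "t *\<^sub>R (A v - B v) \<in> \<Lambda>" for t
    using d[of "t *\<^sub>R v"] by (simp add: clmapD(3)[OF A] clmapD(3)[OF B] scaleR_diff_right)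
  from linear_scaleR_into_lattice[OF lattice this] show "A v = B v" by simp
qed

lemma pi_eq_iff: "\<pi> v = \<pi> w \<longleftrightarrow> v - w \<in> \<Lambda>" by (rule proj_eq_iff[OF lattice]) auto

lemma nondeg: "(\<And>x. E x y = E x z) \<Longrightarrow> y = z"
  using nondegenerate[of "y - z"] Esimps form11D(3)[OF E, of "y - z"] by (metis UNIV_I eq_iff_diff_eq_0 neg_equal_0_iff_equal)

definition lifts_to :: "('g point \<Rightarrow> 'g point) \<Rightarrow> (complex ^ 'g \<Rightarrow> complex ^ 'g) \<Rightarrow> bool" where
  "lifts_to f A \<longleftrightarrow> clmap A \<and> (\<forall>v. f (\<pi> v) = \<pi> (A v))"

lemma lifts_to_unique: "lifts_to f A \<Longrightarrow> lifts_to f B \<Longrightarrow> A = B"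
  by (rule clmap_eqI) (auto simp: lifts_to_def pi_eq_iff[symmetric])

lemma End_simps:
  "f \<otimes>\<^bsub>End UNIV \<Lambda>\<^esub> h = (\<lambda>x\<in>carrier T. f x \<otimes>\<^bsub>T\<^esub> h x)" "\<one>\<^bsub>End UNIV \<Lambda>\<^esub> = (\<lambda>x\<in>carrier T. \<one>\<^bsub>T\<^esub>)"
  by (simp_all add: End_def Hom_def)

text \<open>The additivity defect of a holomorphic lift is a continuous function into the lattice,
  hence constant.\<close>

lemma End_iff: "f \<in> carrier (End UNIV \<Lambda>) \<longleftrightarrow> f \<in> carrier (Hom T T) \<and> (\<exists>A. lifts_to f A)"
proof
  assume f: "f \<in> carrier (End UNIV \<Lambda>)"
  then obtain F :: "complex ^ 'g \<Rightarrow> complex ^ 'g" where F: "\<And>j. holo UNIV (\<lambda>w. F w $ j)" "\<And>w. f (\<pi> w) = \<pi> (F w)" and fh: "f \<in> carrier (Hom T T)"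
    unfolding End_def by auto
  have add: "F (v + w) - F v - F w \<in> \<Lambda>" for v w
  proof -
    have "\<pi> (F (v + w)) = f (\<pi> v \<otimes>\<^bsub>T\<^esub> \<pi> w)" by (simp add: F(2) proj_add[OF lattice])
    also have "\<dots> = f (\<pi> v) \<otimes>\<^bsub>T\<^esub> f (\<pi> w)" using fh by (auto simp: hom_def carrierT)
    also have "\<dots> = \<pi> (F v + F w)" by (simp add: F(2) proj_add[OF lattice])
    finally show ?thesis by (simp add: pi_eq_iff algebra_simps)
  qed
  have cont: "continuous_on UNIV F"
    using continuous_on_vec_lambda[of UNIV "\<lambda>j w. F w $ j"] holo_continuous_on[OF F(1)] by simp
  have "F (v + w) - F v - F w = - F 0" for v w
  proof -
    have "continuous_on UNIV (\<lambda>v. F (v + w) - F v - F w)"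
      by (intro continuous_intros cont continuous_on_compose2[OF cont]) auto
    from continuous_into_lattice_constant[OF lattice this add] show ?thesis by simp
  qed
  note * = this
  have F0: "F 0 \<in> \<Lambda>" using add[of 0 0] is_latticeD(7)[OF lattice, of "- F 0"] by simp
  have "clmap (\<lambda>v. F v - F 0)"
  proof (rule holo_additive_clmap)
    show "holo UNIV (\<lambda>w. (F w - F 0) $ j)" for j
      using holo_diff[OF F(1)[of j] holo_const[of UNIV "F 0 $ j"]] by simp
    show "F (x + y) - F 0 = F x - F 0 + (F y - F 0)" for x y using *[of x y] by (simp add: algebra_simps)
  qed
  moreover have "f (\<pi> v) = \<pi> (F v - F 0)" for v using F0 by (simp add: F(2) pi_eq_iff)
  ultimately show "f \<in> carrier (Hom T T) \<and> (\<exists>A. lifts_to f A)" using fh unfolding lifts_to_def by blast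
next
  assume f: "f \<in> carrier (Hom T T) \<and> (\<exists>A. lifts_to f A)"
  then obtain A where "clmap A" "\<And>v. f (\<pi> v) = \<pi> (A v)" unfolding lifts_to_def by blast
  hence "\<exists>F. F ` UNIV \<subseteq> UNIV \<and> (\<forall>j. holo UNIV (\<lambda>w. F w $ j)) \<and> (\<forall>w\<in>UNIV. f (\<pi> w) = \<pi> (F w))"
    using holo_clin[OF clin_clmap] by blast
  thus "f \<in> carrier (End UNIV \<Lambda>)" using f unfolding End_def by simp
qed

definition lift :: "('g point \<Rightarrow> 'g point) \<Rightarrow> complex ^ 'g \<Rightarrow> complex ^ 'g" where
  "lift f = (THE A. lifts_to f A)"

lemma lift_eq: "lifts_to f A \<Longrightarrow> lift f = A"
  unfolding lift_def using lifts_to_unique by blast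

lemma lifts_to_lift: "f \<in> carrier (End UNIV \<Lambda>) \<Longrightarrow> lifts_to f (lift f)"
  using lift_eq End_iff by metis

lemma monoid_Hom_TT: "monoid (Hom T T)"
  using monoid_Hom groupT comm_group.axioms(2) by blast

lemma lifts_to_mult: "lifts_to f A \<Longrightarrow> lifts_to h B \<Longrightarrow> lifts_to (f \<otimes>\<^bsub>End UNIV \<Lambda>\<^esub> h) (\<lambda>v. A v + B v)"
  unfolding lifts_to_def End_simps by (simp add: clmap_add carrierT proj_add[OF lattice])

lemma monoid_End: "monoid (End UNIV \<Lambda>)"
proof -
  interpret H: monoid "Hom T T" by (rule monoid_Hom_TT)
  have eq: "mult (End UNIV \<Lambda>) = mult (Hom T T)" "one (End UNIV \<Lambda>) = one (Hom T T)" by (simp_all add: End_def)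
  have sub: "f \<in> carrier (Hom T T)" if "f \<in> carrier (End UNIV \<Lambda>)" for f using that End_iff by blast
  show ?thesis
  proof
    fix f h assume fh: "f \<in> carrier (End UNIV \<Lambda>)" "h \<in> carrier (End UNIV \<Lambda>)"
    hence "f \<otimes>\<^bsub>End UNIV \<Lambda>\<^esub> h \<in> carrier (Hom T T)" unfolding eq by (intro H.m_closed sub)
    thus "f \<otimes>\<^bsub>End UNIV \<Lambda>\<^esub> h \<in> carrier (End UNIV \<Lambda>)"
      using lifts_to_mult fh unfolding End_iff by blast
    fix k assume "k \<in> carrier (End UNIV \<Lambda>)"
    thus "f \<otimes>\<^bsub>End UNIV \<Lambda>\<^esub> h \<otimes>\<^bsub>End UNIV \<Lambda>\<^esub> k = f \<otimes>\<^bsub>End UNIV \<Lambda>\<^esub> (h \<otimes>\<^bsub>End UNIV \<Lambda>\<^esub> k)"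
      unfolding eq using fh by (intro H.m_assoc sub)
  next
    have "lifts_to (\<one>\<^bsub>End UNIV \<Lambda>\<^esub>) (\<lambda>v. 0)"
      unfolding lifts_to_def End_simps using clmap_zero proj_eq_one_iff[OF lattice, of 0] is_latticeD(3)[OF lattice]
      by (simp add: carrierT one_torus[OF lattice])
    thus "\<one>\<^bsub>End UNIV \<Lambda>\<^esub> \<in> carrier (End UNIV \<Lambda>)" unfolding End_iff using H.one_closed eq by auto
  next
    fix f assume "f \<in> carrier (End UNIV \<Lambda>)"
    thus "\<one>\<^bsub>End UNIV \<Lambda>\<^esub> \<otimes>\<^bsub>End UNIV \<Lambda>\<^esub> f = f" "f \<otimes>\<^bsub>End UNIV \<Lambda>\<^esub> \<one>\<^bsub>End UNIV \<Lambda>\<^esub> = f"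
      unfolding eq by (intro H.l_one H.r_one sub; simp)+
  qed
qed

text \<open>Endomorphisms are recorded by their complex linear lifts, which exist by
  \<open>End_iff\<close> and are unique because a linear map with values in a lattice is 0.\<close>

sublocale EndV: vector_embedding "End UNIV \<Lambda>" lift
proof -
  interpret monoid "End UNIV \<Lambda>" by (rule monoid_End)
  show "vector_embedding (End UNIV \<Lambda>) lift"
  proof unfold_locales
    fix f h v assume "f \<in> carrier (End UNIV \<Lambda>)" "h \<in> carrier (End UNIV \<Lambda>)"
    thus "lift (f \<otimes>\<^bsub>End UNIV \<Lambda>\<^esub> h) v = lift f v + lift h v"
      using lift_eq[OF lifts_to_mult[OF lifts_to_lift lifts_to_lift]] by simp
  next
    fix f h assume fh: "f \<in> carrier (End UNIV \<Lambda>)" "h \<in> carrier (End UNIV \<Lambda>)" "lift f = lift h"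
    have "f a = h a" if "a \<in> carrier T" for a
      using that lifts_to_lift[OF fh(1)] lifts_to_lift[OF fh(2)] fh(3) unfolding carrierT lifts_to_def by auto
    thus "f = h" using fh(1,2) unfolding End_iff by (intro extensionalityI[of _ "carrier T"]) auto
  qed
qed

definition end_of :: "(complex ^ 'g \<Rightarrow> complex ^ 'g) \<Rightarrow> 'g point \<Rightarrow> 'g point" where
  "end_of A = (\<lambda>a\<in>carrier T. \<pi> (A (SOME v. v \<in> a)))"

lemma end_of:
  assumes A: "clmap A" and AL: "\<And>l. l \<in> \<Lambda> \<Longrightarrow> A l \<in> \<Lambda>"
  shows "end_of A \<in> carrier (End UNIV \<Lambda>)" "lifts_to (end_of A) A"
proof -
  have e: "end_of A (\<pi> v) = \<pi> (A v)" for v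
  proof -
    have "v \<in> \<pi> v" using mem_proj_iff[OF lattice, of v v] is_latticeD(3)[OF lattice] by simp
    hence "(SOME w. w \<in> \<pi> v) \<in> \<pi> v" by (rule someI)
    hence "A ((SOME w. w \<in> \<pi> v) - v) \<in> \<Lambda>" using mem_proj_iff[OF lattice, of v] AL by simp
    hence "\<pi> (A (SOME w. w \<in> \<pi> v)) = \<pi> (A v)" by (simp add: pi_eq_iff clmapD(6)[OF A])
    moreover have "\<pi> v \<in> carrier T" unfolding carrierT by blast
    ultimately show ?thesis by (simp add: end_of_def)
  qed
  thus l: "lifts_to (end_of A) A" using A unfolding lifts_to_def by blast
  have "end_of A \<in> hom T T"
  proof (rule homI)
    fix x y assume "x \<in> carrier T" "y \<in> carrier T"
    then obtain v w where "x = \<pi> v" "y = \<pi> w" unfolding carrierT by blast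
    thus "end_of A (x \<otimes>\<^bsub>T\<^esub> y) = end_of A x \<otimes>\<^bsub>T\<^esub> end_of A y"
      by (simp add: proj_add[OF lattice] e clmapD(1)[OF A])
  qed (use e in \<open>auto simp: carrierT\<close>)
  thus "end_of A \<in> carrier (End UNIV \<Lambda>)" unfolding End_iff using l by (auto simp: end_of_def)
qed

definition lin :: "(('g point \<Rightarrow> 'g point) \<times> nat) set \<Rightarrow> complex ^ 'g \<Rightarrow> complex ^ 'g" where
  "lin \<epsilon> = EndV.ext \<epsilon>"

lemma lin_frac:
  "lifts_to f A \<Longrightarrow> f \<in> carrier (End UNIV \<Lambda>) \<Longrightarrow> 0 < m \<Longrightarrow> lin (rat_frac (End UNIV \<Lambda>) f m) = (\<lambda>v. (1 / real m) *\<^sub>R A v)"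
  unfolding lin_def using EndV.ext_frac[of f m] lift_eq[of f A] by (simp add: fun_eq_iff divide_inverse)

lemma clmap_lin: "\<epsilon> \<in> tensor_rat (End UNIV \<Lambda>) \<Longrightarrow> clmap (lin \<epsilon>)"
  using EndV.tensor_ratE[of \<epsilon>] lin_frac[OF lifts_to_lift] lifts_to_lift clmap_scaleR unfolding lifts_to_def by metis

lemma ex_rat_end:
  assumes A: "clmap A" and N: "0 < N" "\<And>l. l \<in> \<Lambda> \<Longrightarrow> real N *\<^sub>R A l \<in> \<Lambda>"
  obtains \<epsilon> where "\<epsilon> \<in> tensor_rat (End UNIV \<Lambda>)" "lin \<epsilon> = A"
proof -
  note e = end_of[OF clmap_scaleR[OF A] N(2)]
  have "lin (rat_frac (End UNIV \<Lambda>) (end_of (\<lambda>v. real N *\<^sub>R A v)) N) = A"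
    using lin_frac[OF e(2,1) N(1)] N(1) by simp
  thus ?thesis using that EndV.rat_frac_in[OF e(1) N(1)] by blast
qed

lemma phi_comp_rat_frac:
  assumes \<epsilon>: "\<epsilon> \<in> tensor_rat (End UNIV \<Lambda>)"
  obtains h G m where "hom_form h G" "0 < m" "phi_comp_rat UNIV \<Lambda> Lb \<epsilon> = rat_frac (Hom T D) h m"
    "\<And>x y. E x (lin \<epsilon> y) = G x y / real m"
proof -
  obtain f m where f: "f \<in> carrier (End UNIV \<Lambda>)" "0 < m" "\<epsilon> = rat_frac (End UNIV \<Lambda>) f m" "(f, m) \<in> \<epsilon>"
    by (rule EndV.tensor_ratE[OF \<epsilon>])
  define h where "h f = compose (carrier T) (phi UNIV \<Lambda> Lb) f" for f
  have hf: "hom_form (h f) (\<lambda>x y. E x (lift f y))" if f: "f \<in> carrier (End UNIV \<Lambda>)" for f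
  proof -
    note l = lifts_to_lift[OF f, unfolded lifts_to_def]
    have "linear (\<lambda>y. E x (lift f y))" for x
      using linear_compose[OF clmapD(4)[OF conjunct1[OF l]] form11D(1)[OF E], of x] by (simp add: o_def)
    moreover have "h f (\<pi> v) = flat UNIV \<Lambda> (\<lambda>x. E x (lift f v))" for v
      using l phi_proj[OF Lb] by (simp add: h_def compose_def carrierT)
    ultimately show ?thesis unfolding hom_form_def using form11D(2)[OF E] by (auto simp: h_def)
  qed
  have ext: "E x (lin \<epsilon> y) = E x (lift f y) / real m" if "(f, m) \<in> \<epsilon>" for f m x y
    using EndV.ext_eq[OF \<epsilon> that] by (simp add: lin_def Esimps field_simps)
  interpret T: comm_group T by (rule groupT)
  interpret H: monoid "Hom T D" by (rule monoid_Hom[OF T.is_group group_dual])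
  have "phi_comp_rat UNIV \<Lambda> Lb \<epsilon> = rat_frac (Hom T D) (h f) m"
    unfolding phi_comp_rat_def h_def[symmetric]
  proof (rule H.map_rat_eq[OF f(4)])
    fix f' m' assume f': "(f', m') \<in> \<epsilon>"
    note ff = EndV.tensor_ratD[OF \<epsilon> f']
    have "rat_frac (Hom T D) (h f') m' = rat_frac (Hom T D) (h f) m"
      by (subst hom_form_rat_eq[OF hf[OF ff(1)] hf[OF f(1)] ff(2) f(2)]) (use ext[OF f'] ext[OF f(4)] in simp)
    thus "((h f', m'), (h f, m)) \<in> rat_rel (Hom T D)"
      using H.rat_frac_eq_iff hom_form_Hom[OF hf[OF ff(1)]] hom_form_Hom[OF hf[OF f(1)]] ff(2) f(2) by blast
  qed
  thus ?thesis using that[OF hf[OF f(1)] f(2)] ext[OF f(4)] by blast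
qed

text \<open>Translates the equation that defines \<open>ns_to_end\<close> into an identity of real
  forms; this identity determines \<open>lin \<epsilon>\<close> because \<open>E\<close> is
  nondegenerate.\<close>

lemma phi_comp_rat_eq_iff:
  assumes "\<alpha> \<in> NS_rat UNIV \<Lambda>" "\<epsilon> \<in> tensor_rat (End UNIV \<Lambda>)"
  shows "phi_comp_rat UNIV \<Lambda> Lb \<epsilon> = phi_rat UNIV \<Lambda> \<alpha> \<longleftrightarrow> (\<forall>x y. E x (lin \<epsilon> y) = form \<alpha> x y)"
proof -
  obtain h G m where h: "hom_form h G" "0 < m" "phi_rat UNIV \<Lambda> \<alpha> = rat_frac (Hom T D) h m" "\<And>x y. form \<alpha> x y = G x y / real m"
    using phi_rat_frac[OF assms(1)] by blast
  obtain h' G' m' where h': "hom_form h' G'" "0 < m'" "phi_comp_rat UNIV \<Lambda> Lb \<epsilon> = rat_frac (Hom T D) h' m'"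
    "\<And>x y. E x (lin \<epsilon> y) = G' x y / real m'"
    using phi_comp_rat_frac[OF assms(2)] by blast
  show ?thesis unfolding h(3,4) h'(3,4) by (rule hom_form_rat_eq[OF h'(1) h(1) h'(2) h(2)])
qed

lemma ex_type: "\<exists>ds. has_type UNIV \<Lambda> Lb ds"
proof -
  obtain a b d where S: "is_symplectic a b d" using ex_symplectic by blast
  obtain f where f: "f \<in> Lb" using mem_Pic_nonempty[OF lattice Lb] by blast
  show ?thesis using has_type_symplectic[OF Lb f has_form_c1[OF lattice Lb f] S] by blast
qed

lemma ex_kill: "\<exists>N>0. \<forall>v\<in>dual_lattice. real N *\<^sub>R v \<in> \<Lambda>"
proof -
  obtain a b d where S: "is_symplectic a b d" using ex_symplectic by blast
  obtain f where f: "f \<in> Lb" using mem_Pic_nonempty[OF lattice Lb] by blast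
  obtain ds where ds: "has_type UNIV \<Lambda> Lb ds" using ex_type by blast
  note k = has_type_prod_kill[OF Lb f has_form_c1[OF lattice Lb f] S ds]
  have "vec.dim (UNIV :: (complex ^ 'g) set) \<noteq> 0" unfolding dim_UNIV by simp
  thus ?thesis using k(2,3) by blast
qed

text \<open>The eigenbasis provides a real solution \<open>A\<close> of
  \<open>E x (A y) = form \<alpha> x y\<close>. It is rational: a factor \<open>m\<close> makes the
  form integral, so \<open>m A\<close> maps the lattice into the dual lattice, and a further factor
  \<open>N\<close> leads back into the lattice.\<close>

lemma rational_form_end:
  assumes \<alpha>: "\<alpha> \<in> NS_rat UNIV \<Lambda>"
  obtains \<epsilon> where "\<epsilon> \<in> tensor_rat (End UNIV \<Lambda>)" "\<And>x y. E x (lin \<epsilon> y) = form \<alpha> x y"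
proof -
  note F = form11_form[OF \<alpha>]
  obtain v c where vc: "eigenbasis UNIV E (form \<alpha>) v c"
    using ex_eigenbasis[OF E F, of UNIV] pos by auto
  define A where "A = eop UNIV E v c"
  have A: "clmap A" "\<And>x y. E x (A y) = form \<alpha> x y"
    using clmap_eop[OF E] form_eigen_eop[OF E F _ vc] by (simp_all add: A_def)
  obtain M m where M: "M \<in> carrier (Pic UNIV \<Lambda>)" "0 < m" "\<alpha> = rat_frac (NS UNIV \<Lambda>) (ns_of UNIV \<Lambda> M) m" using NS_ratE[OF \<alpha>] .
  obtain N where N: "N > 0" "\<And>v. v \<in> dual_lattice \<Longrightarrow> real N *\<^sub>R v \<in> \<Lambda>" using ex_kill by blast
  have "real (N * m) *\<^sub>R A l \<in> \<Lambda>" if l: "l \<in> \<Lambda>" for l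
  proof -
    have "E x (real m *\<^sub>R A l) \<in> \<int>" if "x \<in> \<Lambda>" for x
      using form_frac[OF M(1,2)] M(2,3) c1_int[OF lattice M(1) that l] by (simp add: Esimps A(2))
    hence "real m *\<^sub>R A l \<in> dual_lattice" by (simp add: dual_lattice_def)
    from N(2)[OF this] show ?thesis by simp
  qed
  then obtain \<epsilon> where "\<epsilon> \<in> tensor_rat (End UNIV \<Lambda>)" "lin \<epsilon> = A"
    using ex_rat_end[OF A(1), of "N * m"] N(1) M(2) by auto
  thus ?thesis using that A(2) by simp
qed

lemma lin_inj: "\<epsilon> \<in> tensor_rat (End UNIV \<Lambda>) \<Longrightarrow> \<delta> \<in> tensor_rat (End UNIV \<Lambda>) \<Longrightarrow> lin \<epsilon> = lin \<delta> \<Longrightarrow> \<epsilon> = \<delta>"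
  unfolding lin_def by (rule EndV.ext_inj)

lemma ns_to_end:
  assumes \<alpha>: "\<alpha> \<in> NS_rat UNIV \<Lambda>"
  shows "ns_to_end UNIV \<Lambda> Lb \<alpha> \<in> tensor_rat (End UNIV \<Lambda>)" "E x (lin (ns_to_end UNIV \<Lambda> Lb \<alpha>) y) = form \<alpha> x y"
proof -
  let ?P = "\<lambda>\<epsilon>. \<epsilon> \<in> tensor_rat (End UNIV \<Lambda>) \<and> phi_comp_rat UNIV \<Lambda> Lb \<epsilon> = phi_rat UNIV \<Lambda> \<alpha>"
  have "\<exists>!\<epsilon>. ?P \<epsilon>"
  proof (rule ex_ex1I)
    show "\<exists>\<epsilon>. ?P \<epsilon>" using rational_form_end[OF \<alpha>] phi_comp_rat_eq_iff[OF \<alpha>] by metis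
    fix \<epsilon> \<delta> assume ed: "?P \<epsilon>" "?P \<delta>"
    have "lin \<epsilon> y = lin \<delta> y" for y
      by (rule nondeg) (use ed phi_comp_rat_eq_iff[OF \<alpha>, of \<epsilon>] phi_comp_rat_eq_iff[OF \<alpha>, of \<delta>] in simp)
    thus "\<epsilon> = \<delta>" using lin_inj ed by blast
  qed
  from theI'[OF this] have "?P (ns_to_end UNIV \<Lambda> Lb \<alpha>)" unfolding ns_to_end_def .
  thus "ns_to_end UNIV \<Lambda> Lb \<alpha> \<in> tensor_rat (End UNIV \<Lambda>)" "E x (lin (ns_to_end UNIV \<Lambda> Lb \<alpha>) y) = form \<alpha> x y"
    using phi_comp_rat_eq_iff[OF \<alpha>] by blast+
qed

lemma ns_to_end_inj: "inj_on (ns_to_end UNIV \<Lambda> Lb) (NS_rat UNIV \<Lambda>)"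
  by (rule inj_onI, rule form_inj) (auto simp: fun_eq_iff simp flip: ns_to_end(2))

lemma inv_ns_to_end:
  assumes \<alpha>: "\<alpha> \<in> NS_rat UNIV \<Lambda>" and \<epsilon>: "\<epsilon> \<in> tensor_rat (End UNIV \<Lambda>)" "\<And>x y. E x (lin \<epsilon> y) = form \<alpha> x y"
  shows "inv_into (NS_rat UNIV \<Lambda>) (ns_to_end UNIV \<Lambda> Lb) \<epsilon> = \<alpha>"
proof -
  have "lin \<epsilon> y = lin (ns_to_end UNIV \<Lambda> Lb \<alpha>) y" for y by (rule nondeg) (simp add: \<epsilon>(2) ns_to_end(2)[OF \<alpha>])
  hence "\<epsilon> = ns_to_end UNIV \<Lambda> Lb \<alpha>" using lin_inj[OF \<epsilon>(1) ns_to_end(1)[OF \<alpha>]] by blast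
  thus ?thesis using inv_into_f_f[OF ns_to_end_inj \<alpha>] by simp
qed

end

section \<open>Subvarieties as ranges of rational orthogonal projections\<close>

section \<open>Abelian subvarieties and orthogonal projections\<close>

context polarized
begin

text \<open>Orthogonality is meant with respect to \<open>E\<close>; for a complex subspace
  \<open>W\<close> this agrees with hermitian orthogonality.\<close>

definition oproj :: "(complex ^ 'g) set \<Rightarrow> (complex ^ 'g \<Rightarrow> complex ^ 'g) \<Rightarrow> bool" where
  "oproj W p \<longleftrightarrow> clmap p \<and> (\<forall>y. p y \<in> W) \<and> (\<forall>x\<in>W. \<forall>y. E x (p y) = E x y)"

text \<open>\<open>eop\<close> with all eigenvalues 1, for a basis of \<open>W\<close> that is
  unitary with respect to \<open>E\<close>.\<close>

lemma ex_oproj: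
  assumes W: "vec.subspace W" shows "\<exists>p. oproj W p"
proof -
  obtain v c where vc: "eigenbasis W E E v c"
    using ex_eigenbasis[OF E E W] pos by blast
  note D = eigenbasisD[OF vc]
  let ?p = "eop W E v (\<lambda>_. 1)"
  have "?p y \<in> W" for y
    unfolding eop_def
    by (intro vec.subspace_sum[OF W] vec_subspace_scaleR[OF W] vec.subspace_add[OF W] vec.subspace_scale[OF W] D(1)) simp_all
  moreover have "E x (?p y) = E x y" if x: "x \<in> W" for x y
  proof -
    have i: "E (\<i> *s v j) y = - E y (\<i> *s v j)" "E x (v j) = - E (v j) x" for j
      by (rule form11D(3)[OF E])+
    have "x = (\<Sum>j<vec.dim W. E x (\<i> *s v j) *\<^sub>R v j + E (v j) x *\<^sub>R (\<i> *s v j))"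
      using vc x unfolding eigenbasis_def by blast
    hence "E x y = E (\<Sum>j<vec.dim W. E x (\<i> *s v j) *\<^sub>R v j + E (v j) x *\<^sub>R (\<i> *s v j)) y" by simp
    also have "\<dots> = (\<Sum>j<vec.dim W. E x (\<i> *s v j) * E (v j) y - E (v j) x * E y (\<i> *s v j))"
      by (simp add: Esum(1) Esimps i(1))
    finally show ?thesis unfolding form_eop[OF E] i(2) by (simp add: algebra_simps)
  qed
  ultimately show ?thesis unfolding oproj_def using clmap_eop[OF E] by blast
qed

lemma nondeg_on:
  assumes W: "vec.subspace W" and d: "d \<in> W" "\<And>z. z \<in> W \<Longrightarrow> E z d = 0" shows "d = 0"
proof (rule ccontr)
  assume "d \<noteq> 0"
  hence "E d (\<i> *s d) > 0" using pos by simp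
  moreover have "E (\<i> *s d) d = 0" using d W vec.subspace_scale by blast
  ultimately show False using form11D(3)[OF E, of d "\<i> *s d"] by simp
qed

context
  fixes W p
  assumes W: "vec.subspace W" and p: "oproj W p"
begin

lemma oprojD: "clmap p" "p y \<in> W" "x \<in> W \<Longrightarrow> E x (p y) = E x y"
  using p unfolding oproj_def by blast+

lemma oproj_id: "x \<in> W \<Longrightarrow> p x = x"
  using nondeg_on[OF W, of "p x - x"] vec.subspace_diff[OF W oprojD(2)[of x], of x] by (simp add: Esimps oprojD(3))

lemma oproj_range: "range p = W"
  using oprojD(2) oproj_id by (metis image_subset_iff subsetI rangeI subset_antisym)

lemma oproj_sym: "E x (p y) = E (p x) y"
proof -
  have "E x (p y) = - E (p y) x" by (rule form11D(3)[OF E])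
  also have "\<dots> = - E (p y) (p x)" using oprojD(2,3) by simp
  also have "\<dots> = E (p x) (p y)" using form11D(3)[OF E, of "p x" "p y"] by simp
  also have "\<dots> = E (p x) y" using oprojD(2,3) by simp
  finally show ?thesis .
qed

lemma oproj_unique:
  assumes "\<And>y. q y \<in> W" "\<And>x y. x \<in> W \<Longrightarrow> E x (q y) = E x y" shows "q = p"
proof
  fix y
  show "q y = p y"
    using nondeg_on[OF W, of "q y - p y"] vec.subspace_diff[OF W assms(1) oprojD(2), of y y] by (simp add: Esimps oprojD(3) assms(2))
qed

lemma form11_oproj: "form11 (\<lambda>x y. E x (p y))"
proof -
  have "linear (\<lambda>y. E x (p y))" for x
    using linear_compose[OF clmapD(4)[OF oprojD(1)] form11D(1)[OF E], of x] by (simp add: o_def)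
  moreover have "E x (p y) = - E y (p x)" for x y
    unfolding oproj_sym[of x y] by (rule form11D(3)[OF E])
  moreover have "E (\<i> *s x) (p (\<i> *s y)) = E x (p y)" for x y
    unfolding clmapD(2)[OF oprojD(1)] by (rule form11D(4)[OF E])
  ultimately show ?thesis unfolding form11_def using form11D(2)[OF E] by blast
qed

end

context
  fixes W p
  assumes LW: "is_lattice W (\<Lambda> \<inter> W)" and dimW: "vec.dim W \<noteq> 0" and p: "oproj W p"
begin

interpretation W: positive_form W "\<Lambda> \<inter> W" E
  by unfold_locales (use LW E int pos in auto)

lemma subW: "vec.subspace W" by (rule is_latticeD(1)[OF LW])

lemma subvar_exponent_kill:
  "0 < subvar_exponent W \<Lambda> Lb" "v \<in> W.dual_lattice \<Longrightarrow> real (subvar_exponent W \<Lambda> Lb) *\<^sub>R v \<in> \<Lambda> \<inter> W"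
proof -
  obtain a b d where S: "W.is_symplectic a b d" using W.ex_symplectic by blast
  obtain f where f: "has_form W (\<Lambda> \<inter> W) f E" "f \<in> restr_bundle W \<Lambda> Lb" "restr_bundle W \<Lambda> Lb \<in> carrier (Pic W (\<Lambda> \<inter> W))"
    using restr_bundle_form[OF lattice LW Lb] by blast
  have ty: "has_type W (\<Lambda> \<inter> W) (restr_bundle W \<Lambda> Lb) (pol_type W (\<Lambda> \<inter> W) (restr_bundle W \<Lambda> Lb))"
    unfolding pol_type_def by (rule someI) (rule W.has_type_symplectic[OF f(3,2,1) S])
  show "0 < subvar_exponent W \<Lambda> Lb" "v \<in> W.dual_lattice \<Longrightarrow> real (subvar_exponent W \<Lambda> Lb) *\<^sub>R v \<in> \<Lambda> \<inter> W"
    unfolding subvar_exponent_def by (rule W.has_type_prod_kill(3,2)[OF f(3,2,1) S ty dimW])+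
qed

text \<open>On the lattice of \<open>W\<close> the characters belonging to \<open>v\<close> and to
  \<open>p v\<close> agree, so restricting the image of \<open>v\<close> under \<open>phi\<close>
  gives the polarization map of the subtorus at \<open>p v\<close>. The preimage chosen in
  \<open>subvar_psi\<close> may differ from \<open>p v\<close> by a vector of the dual lattice,
  which the exponent sends into the lattice.\<close>

lemma norm_endo_proj: "norm_endo UNIV \<Lambda> Lb W (\<pi> v) = \<pi> (real (subvar_exponent W \<Lambda> Lb) *\<^sub>R p v)"
proof -
  let ?e = "subvar_exponent W \<Lambda> Lb" and ?R = "restr_bundle W \<Lambda> Lb" and ?LW = "\<Lambda> \<inter> W"
  note P = oprojD[OF subW p]
  obtain f where f: "has_form W ?LW f E" "f \<in> ?R" "?R \<in> carrier (Pic W ?LW)"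
    using restr_bundle_form[OF lattice LW Lb] by blast
  note ph = phi_eq[OF LW f(3,2,1)]
  define a where "a = inv_into (carrier (torus W ?LW)) (phi W ?LW ?R) (restr_bundle W \<Lambda> (phi UNIV \<Lambda> Lb (\<pi> v)))"
  have "restr_bundle W \<Lambda> (phi UNIV \<Lambda> Lb (\<pi> v)) = flat W ?LW (\<lambda>l. E l v)"
    unfolding phi_proj[OF Lb] by (rule restr_flat[OF lattice LW form11D(2)[OF E]])
  also have "\<dots> = flat W ?LW (\<lambda>l. E l (p v))"
    unfolding flat_eq_iff[OF LW form11D(2)[OF E] form11D(2)[OF E]] using P(3) by simp
  also have "\<dots> = phi W ?LW ?R (proj W ?LW (p v))" using ph[OF P(2)] by simp
  finally have eq: "restr_bundle W \<Lambda> (phi UNIV \<Lambda> Lb (\<pi> v)) = phi W ?LW ?R (proj W ?LW (p v))" .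
  have "proj W ?LW (p v) \<in> carrier (torus W ?LW)" using carrier_torus[OF LW] P(2) by blast
  hence im: "restr_bundle W \<Lambda> (phi UNIV \<Lambda> Lb (\<pi> v)) \<in> phi W ?LW ?R ` carrier (torus W ?LW)"
    unfolding eq by blast
  have "a \<in> carrier (torus W ?LW)" unfolding a_def by (rule inv_into_into[OF im])
  then obtain w where w: "w \<in> W" "a = proj W ?LW w" using carrier_torus[OF LW] by blast
  have "phi W ?LW ?R a = phi W ?LW ?R (proj W ?LW (p v))"
    unfolding a_def f_inv_into_f[OF im] by (rule eq)
  hence "flat W ?LW (\<lambda>l. E l w) = flat W ?LW (\<lambda>l. E l (p v))"
    unfolding w(2) ph[OF w(1)] ph[OF P(2)] .
  hence "\<forall>l\<in>?LW. E l (w - p v) \<in> \<int>"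
    unfolding flat_eq_iff[OF LW form11D(2)[OF E] form11D(2)[OF E]] by (simp add: Esimps)
  hence "w - p v \<in> W.dual_lattice" unfolding W.dual_lattice_def using vec.subspace_diff[OF subW w(1) P(2)] by blast
  from subvar_exponent_kill(2)[OF this] have k: "real ?e *\<^sub>R w - real ?e *\<^sub>R p v \<in> \<Lambda>" by (simp add: scaleR_diff_right)
  have eW: "real ?e *\<^sub>R w \<in> W" by (rule vec_subspace_scaleR[OF subW w(1)])
  have "norm_endo UNIV \<Lambda> Lb W (\<pi> v) = subvar_incl UNIV \<Lambda> (a [^]\<^bsub>torus W ?LW\<^esub> ?e)"
    by (simp add: norm_endo_def carrierT subvar_psi_def a_def)
  also have "\<dots> = subvar_incl UNIV \<Lambda> (proj W ?LW (real ?e *\<^sub>R w))"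
    unfolding w(2) proj_pow[OF LW w(1)] ..
  also have "\<dots> = \<pi> (real ?e *\<^sub>R w)"
  proof -
    have "\<pi> u = \<pi> (real ?e *\<^sub>R w)" if "u \<in> proj W ?LW (real ?e *\<^sub>R w)" for u
      using that unfolding mem_proj_iff[OF LW eW] pi_eq_iff by blast
    moreover have "real ?e *\<^sub>R w \<in> proj W ?LW (real ?e *\<^sub>R w)"
      unfolding mem_proj_iff[OF LW eW] using eW is_latticeD(3)[OF LW] by simp
    ultimately show ?thesis unfolding subvar_incl_def by blast
  qed
  also have "\<dots> = \<pi> (real ?e *\<^sub>R p v)" using k by (simp add: pi_eq_iff)
  finally show ?thesis .
qed

text \<open>The norm endomorphism is a function on the torus, where \<open>l\<close> and 0 are the
  same point.\<close>

lemma oproj_lattice: "l \<in> \<Lambda> \<Longrightarrow> real (subvar_exponent W \<Lambda> Lb) *\<^sub>R p l \<in> \<Lambda>"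
proof -
  assume "l \<in> \<Lambda>"
  hence "\<pi> l = \<pi> 0" by (simp add: pi_eq_iff)
  thus ?thesis using norm_endo_proj[of l] norm_endo_proj[of 0] clmapD(5)[OF oprojD(1)[OF subW p]]
    by (metis diff_zero pi_eq_iff scaleR_zero_right)
qed

lemma norm_endo_End:
  "norm_endo UNIV \<Lambda> Lb W \<in> carrier (End UNIV \<Lambda>)" "lifts_to (norm_endo UNIV \<Lambda> Lb W) (\<lambda>v. real (subvar_exponent W \<Lambda> Lb) *\<^sub>R p v)"
proof -
  note c = clmap_scaleR[OF oprojD(1)[OF subW p], of "real (subvar_exponent W \<Lambda> Lb)"]
  note e = end_of[OF c oproj_lattice]
  have "norm_endo UNIV \<Lambda> Lb W = end_of (\<lambda>v. real (subvar_exponent W \<Lambda> Lb) *\<^sub>R p v)"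
  proof (rule extensionalityI[of _ "carrier T"])
    fix a assume "a \<in> carrier T"
    then obtain v where "a = \<pi> v" unfolding carrierT by blast
    thus "norm_endo UNIV \<Lambda> Lb W a = end_of (\<lambda>v. real (subvar_exponent W \<Lambda> Lb) *\<^sub>R p v) a"
      using e(2) norm_endo_proj unfolding lifts_to_def by simp
  qed (auto simp: norm_endo_def end_of_def)
  thus "norm_endo UNIV \<Lambda> Lb W \<in> carrier (End UNIV \<Lambda>)" "lifts_to (norm_endo UNIV \<Lambda> Lb W) (\<lambda>v. real (subvar_exponent W \<Lambda> Lb) *\<^sub>R p v)"
    using e by auto
qed

text \<open>If all \<open>t v\<close> lie in \<open>W + \<Lambda>\<close>, then \<open>e (1 - p)\<close> maps the line through \<open>v\<close> into the lattice.\<close>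

lemma tangent_space_proj: "tangent_space UNIV \<Lambda> (\<pi> ` W) = W"
proof
  show "W \<subseteq> tangent_space UNIV \<Lambda> (\<pi> ` W)"
    using vec_subspace_scaleR[OF subW] unfolding tangent_space_def by blast
  show "tangent_space UNIV \<Lambda> (\<pi> ` W) \<subseteq> W"
  proof
    fix v assume "v \<in> tangent_space UNIV \<Lambda> (\<pi> ` W)"
    hence v: "\<pi> (t *\<^sub>R v) \<in> \<pi> ` W" for t unfolding tangent_space_def by blast
    note P = oprojD[OF subW p] and cl = clmapD[OF oprojD(1)[OF subW p]]
    let ?e = "real (subvar_exponent W \<Lambda> Lb)"
    have "t *\<^sub>R (?e *\<^sub>R (v - p v)) \<in> \<Lambda>" for t
    proof -
      obtain w where w: "w \<in> W" "\<pi> (t *\<^sub>R v) = \<pi> w" using v by blast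
      hence l: "t *\<^sub>R v - w \<in> \<Lambda>" by (simp add: pi_eq_iff)
      have "t *\<^sub>R (?e *\<^sub>R (v - p v)) = ?e *\<^sub>R (t *\<^sub>R v - w) - ?e *\<^sub>R p (t *\<^sub>R v - w)"
        by (simp add: cl(3,6) oproj_id[OF subW p w(1)] algebra_simps)
      moreover have "?e *\<^sub>R (t *\<^sub>R v - w) \<in> \<Lambda>" using lattice_int_scale[OF lattice l, of "int (subvar_exponent W \<Lambda> Lb)"] by simp
      ultimately show ?thesis using is_latticeD(4)[OF lattice _ oproj_lattice[OF l]] by simp
    qed
    from linear_scaleR_into_lattice[OF lattice this] have "v = p v" using subvar_exponent_kill(1) by simp
    thus "v \<in> W" using P(2) by metis
  qed
qed

text \<open>The norm endomorphism lifts to \<open>e p\<close> with \<open>e\<close> the exponent, so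
  the symmetric idempotent lifts to \<open>p\<close>. A class with this form exists because
  \<open>e p\<close> preserves the lattice.\<close>

lemma subvar_class_form:
  "subvar_class UNIV \<Lambda> Lb (\<pi> ` W) \<in> NS_rat UNIV \<Lambda>" "form (subvar_class UNIV \<Lambda> Lb (\<pi> ` W)) x y = E x (p y)"
proof -
  let ?e = "subvar_exponent W \<Lambda> Lb"
  have "real ?e * E l (p k) \<in> \<int>" if "l \<in> \<Lambda>" "k \<in> \<Lambda>" for l k
    using int[OF that(1) oproj_lattice[OF that(2)]] by (simp add: Esimps)
  then obtain \<alpha> where \<alpha>: "\<alpha> \<in> NS_rat UNIV \<Lambda>" "form \<alpha> = (\<lambda>x y. E x (p y))"
    using form_surj[OF form11_oproj[OF subW p] subvar_exponent_kill(1)] by blast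
  have id: "sym_idem UNIV \<Lambda> Lb (\<pi> ` W) = rat_frac (End UNIV \<Lambda>) (norm_endo UNIV \<Lambda> Lb W) ?e"
    by (simp add: sym_idem_def tangent_space_proj)
  have "lin (sym_idem UNIV \<Lambda> Lb (\<pi> ` W)) = p"
    unfolding id lin_frac[OF norm_endo_End(2,1) subvar_exponent_kill(1)] using subvar_exponent_kill(1) by simp
  moreover have "sym_idem UNIV \<Lambda> Lb (\<pi> ` W) \<in> tensor_rat (End UNIV \<Lambda>)"
    unfolding id by (rule EndV.rat_frac_in[OF norm_endo_End(1) subvar_exponent_kill(1)])
  ultimately have "subvar_class UNIV \<Lambda> Lb (\<pi> ` W) = \<alpha>"
    unfolding subvar_class_def by (intro inv_ns_to_end[OF \<alpha>(1)]) (simp_all add: \<alpha>(2))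
  thus "subvar_class UNIV \<Lambda> Lb (\<pi> ` W) \<in> NS_rat UNIV \<Lambda>" "form (subvar_class UNIV \<Lambda> Lb (\<pi> ` W)) x y = E x (p y)"
    using \<alpha> by simp_all
qed

end

lemma eigenbasis_spans:
  assumes vc: "eigenbasis UNIV E F v c"
  shows "vec.span (v ` {..<CARD('g)}) = UNIV" "inj_on v {..<CARD('g)}" "vec.independent (v ` {..<CARD('g)})"
proof -
  let ?B = "v ` {..<CARD('g)}"
  have "y \<in> vec.span ?B" for y
  proof -
    have y: "y = (\<Sum>j<CARD('g). E y (\<i> *s v j) *\<^sub>R v j + E (v j) y *\<^sub>R (\<i> *s v j))"
      using vc unfolding eigenbasis_def dim_UNIV by blast
    show ?thesis
      by (subst y) (intro vec.span_sum vec.span_add vec_subspace_scaleR[OF vec.subspace_span] vec.span_scale vec.span_base; simp)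
  qed
  thus sp: "vec.span ?B = UNIV" by blast
  have "card ?B \<ge> CARD('g)" using vec.dim_le_card[of UNIV ?B] sp by (simp add: dim_UNIV)
  moreover have "card ?B \<le> CARD('g)" using card_image_le[of "{..<CARD('g)}" v] by simp
  ultimately have card: "card ?B = CARD('g)" by simp
  thus "inj_on v {..<CARD('g)}" by (intro eq_card_imp_inj_on) simp_all
  show "vec.independent ?B" by (rule vec.card_le_dim_spanning[of _ UNIV]) (use sp card in auto)
qed

text \<open>The range is spanned by the \<open>v j\<close> with eigenvalue 1, and these are
  independent over the complex numbers because the whole eigenbasis is.\<close>

lemma eigenbasis_eop_range:
  assumes vc: "eigenbasis UNIV E F v c" and A: "clmap A" "\<And>j. j < CARD('g) \<Longrightarrow> A (v j) = c j *\<^sub>R v j"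
    and c: "\<And>j. j < CARD('g) \<Longrightarrow> c j \<in> {0, 1}"
  shows "vec.subspace (range A)" "vec.dim (range A) = card {j. j < CARD('g) \<and> c j = 1}" "A (A y) = A y"
proof -
  let ?J = "{j. j < CARD('g) \<and> c j = 1}"
  have y: "y = (\<Sum>j<CARD('g). E y (\<i> *s v j) *\<^sub>R v j + E (v j) y *\<^sub>R (\<i> *s v j))" for y
    using vc unfolding eigenbasis_def dim_UNIV by blast
  note cl = clmapD[OF A(1)]
  have Av: "A (\<Sum>j<CARD('g). a j *\<^sub>R v j + b j *\<^sub>R (\<i> *s v j)) = (\<Sum>j<CARD('g). (c j * a j) *\<^sub>R v j + (c j * b j) *\<^sub>R (\<i> *s v j))" for a b
    unfolding cl(7) by (intro sum.cong refl) (simp add: cl A(2) i_scaleR mult.commute)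
  have Ay: "A y = (\<Sum>j<CARD('g). (c j * E y (\<i> *s v j)) *\<^sub>R v j + (c j * E (v j) y) *\<^sub>R (\<i> *s v j))" for y
    by (subst y) (rule Av)
  have cc: "c j * (c j * r) = c j * r" if "j < CARD('g)" for j r using c[OF that] by auto
  show "A (A y) = A y"
    unfolding Ay[of y] Av by (intro sum.cong refl) (simp add: cc)
  have span: "range A = vec.span (v ` ?J)"
  proof
    show "range A \<subseteq> vec.span (v ` ?J)"
    proof
      fix z assume "z \<in> range A"
      then obtain y where z: "z = A y" by blast
      have "(c j * a) *\<^sub>R v j + (c j * b) *\<^sub>R (\<i> *s v j) \<in> vec.span (v ` ?J)" if j: "j < CARD('g)" for j a b
      proof (cases "c j = 1")
        case True
        hence "v j \<in> vec.span (v ` ?J)" using j by (intro vec.span_base) auto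
        thus ?thesis by (intro vec.span_add vec_subspace_scaleR[OF vec.subspace_span] vec.span_scale)
      next
        case False
        hence "c j = 0" using c[OF j] by auto
        thus ?thesis by (simp add: vec.span_zero)
      qed
      thus "z \<in> vec.span (v ` ?J)" unfolding z Ay[of y] by (intro vec.span_sum) simp
    qed
    show "vec.span (v ` ?J) \<subseteq> range A"
    proof (rule vec.span_minimal)
      show "v ` ?J \<subseteq> range A"
      proof (rule image_subsetI)
        fix j assume "j \<in> ?J"
        hence "A (v j) = v j" using A(2)[of j] by simp
        thus "v j \<in> range A" by (metis rangeI)
      qed
      show "vec.subspace (range A)"
      proof (rule vec.subspaceI)
        show "0 \<in> range A" by (rule range_eqI[where x = 0]) (simp add: cl(5))
        show "x + y \<in> range A" if "x \<in> range A" "y \<in> range A" for x y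
          using that by (auto simp: cl(1)[symmetric])
        show "a *s x \<in> range A" if "x \<in> range A" for a x
          using that by (auto simp: cl(2)[symmetric])
      qed
    qed
  qed
  show "vec.subspace (range A)" unfolding span by (rule vec.subspace_span)
  have "v ` ?J \<subseteq> v ` {..<CARD('g)}" by auto
  hence ind: "vec.independent (v ` ?J)" using eigenbasis_spans(3)[OF vc] vec.independent_mono by blast
  have "card (v ` ?J) = card ?J" by (intro card_image inj_on_subset[OF eigenbasis_spans(2)[OF vc]]) auto
  thus "vec.dim (range A) = card ?J" unfolding span using vec.dim_span_eq_card_independent[OF ind] by simp
qed

lemma subvarE:
  assumes "X \<in> abelian_subvarieties UNIV \<Lambda> n" "1 \<le> n"
  obtains W p where "X = \<pi> ` W" "vec.dim W = n" "is_lattice W (\<Lambda> \<inter> W)" "vec.dim W \<noteq> 0" "oproj W p" "vec.subspace W"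
proof -
  obtain W where W: "X = \<pi> ` W" "vec.dim W = n" "is_lattice W (\<Lambda> \<inter> W)"
    using assms(1) unfolding abelian_subvarieties_def by blast
  moreover obtain p where "oproj W p" using ex_oproj[OF is_latticeD(1)[OF W(3)]] by blast
  moreover have "vec.dim W \<noteq> 0" using W(2) assms(2) by simp
  ultimately show ?thesis using that is_latticeD(1)[OF W(3)] by blast
qed

text \<open>The class determines the form, the form determines the projection by nondegeneracy, and
  the range of the projection is the tangent space of the subvariety.\<close>

lemma inj_subvar_class:
  assumes "1 \<le> n" shows "inj_on (subvar_class UNIV \<Lambda> Lb) (abelian_subvarieties UNIV \<Lambda> n)"
proof (rule inj_onI)
  fix X Y assume X: "X \<in> abelian_subvarieties UNIV \<Lambda> n" and Y: "Y \<in> abelian_subvarieties UNIV \<Lambda> n"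
    and eq: "subvar_class UNIV \<Lambda> Lb X = subvar_class UNIV \<Lambda> Lb Y"
  obtain W p where W: "X = \<pi> ` W" "vec.dim W = n" "is_lattice W (\<Lambda> \<inter> W)" "vec.dim W \<noteq> 0" "oproj W p" "vec.subspace W"
    by (rule subvarE[OF X assms])
  obtain V q where V: "Y = \<pi> ` V" "vec.dim V = n" "is_lattice V (\<Lambda> \<inter> V)" "vec.dim V \<noteq> 0" "oproj V q" "vec.subspace V"
    by (rule subvarE[OF Y assms])
  have "p y = q y" for y
  proof (rule nondeg)
    fix x
    show "E x (p y) = E x (q y)"
      using subvar_class_form(2)[OF W(3,4,5), of x y] subvar_class_form(2)[OF V(3,4,5), of x y] eq W(1) V(1) by simp
  qed
  hence "p = q" by blast
  hence "W = V" using oproj_range[OF W(6,5)] oproj_range[OF V(6,5)] by simp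
  thus "X = Y" using W V by simp
qed

text \<open>The \<open>v j\<close> are eigenvectors of the orthogonal projection \<open>p\<close>.
  Idempotence leaves only the eigenvalues 0 and 1, and counting the latter gives the rank.\<close>

lemma subvar_class_condition:
  assumes X: "X \<in> abelian_subvarieties UNIV \<Lambda> n" and n: "1 \<le> n"
    and vc: "eigenbasis UNIV E (form (subvar_class UNIV \<Lambda> Lb X)) v c"
  shows "(\<forall>j<CARD('g). c j \<in> {0, 1}) \<and> card {j. j < CARD('g) \<and> c j = 1} = n"
proof -
  obtain W p where W: "X = \<pi> ` W" "vec.dim W = n" "is_lattice W (\<Lambda> \<inter> W)" "vec.dim W \<noteq> 0" "oproj W p" "vec.subspace W"
    by (rule subvarE[OF X n])
  note P = oprojD[OF W(6,5)] and fm = subvar_class_form(2)[OF W(3,4,5)]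
  have pv: "p (v j) = c j *\<^sub>R v j" if j: "j < CARD('g)" for j
  proof (rule nondeg)
    fix x
    have "E (p (v j)) x = E (c j *\<^sub>R v j) x"
      using eigenbasisD(2)[OF vc, of j x] j fm[of "v j" x] oproj_sym[OF W(6,5), of "v j" x] W(1) by (simp add: Esimps dim_UNIV)
    thus "E x (p (v j)) = E x (c j *\<^sub>R v j)"
      using form11D(3)[OF E, of x "p (v j)"] form11D(3)[OF E, of x "c j *\<^sub>R v j"] by simp
  qed
  have c: "c j \<in> {0, 1}" if j: "j < CARD('g)" for j
  proof -
    have "E (v j) (\<i> *s v j) = 1" using eigenbasisD(4)[OF vc, of j j] j by (simp add: dim_UNIV)
    hence v0: "v j \<noteq> 0" using Esimps by force
    have "p (p (v j)) = p (v j)" using oproj_id[OF W(6,5) P(2)] .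
    hence "(c j * c j) *\<^sub>R v j = c j *\<^sub>R v j" using clmapD(3)[OF P(1)] by (simp add: pv[OF j])
    hence "c j * c j = c j" using v0 by simp
    thus ?thesis by auto
  qed
  show ?thesis
    using eigenbasis_eop_range(2)[OF vc P(1)] pv c W(2) oproj_range[OF W(6,5)] by simp
qed

text \<open>The operator of \<open>\<alpha>\<close> is idempotent and self-adjoint for
  \<open>E\<close>, hence the orthogonal projection onto its range. A positive multiple preserves
  the lattice and maps it onto lattice vectors that span the range, which is therefore the tangent
  space of a subtorus.\<close>

lemma condition_imp_subvar:
  assumes \<alpha>: "\<alpha> \<in> NS_rat UNIV \<Lambda>" and n: "1 \<le> n" and vc: "eigenbasis UNIV E (form \<alpha>) v c"
    and c: "\<And>j. j < CARD('g) \<Longrightarrow> c j \<in> {0, 1}" "card {j. j < CARD('g) \<and> c j = 1} = n"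
  shows "\<exists>X\<in>abelian_subvarieties UNIV \<Lambda> n. subvar_class UNIV \<Lambda> Lb X = \<alpha>"
proof -
  define \<epsilon> where "\<epsilon> = ns_to_end UNIV \<Lambda> Lb \<alpha>"
  define A where "A = lin \<epsilon>"
  have \<epsilon>: "\<epsilon> \<in> tensor_rat (End UNIV \<Lambda>)" and EA: "E x (A y) = form \<alpha> x y" for x y
    using ns_to_end[OF \<alpha>] by (simp_all add: \<epsilon>_def A_def)
  have A: "clmap A" unfolding A_def by (rule clmap_lin[OF \<epsilon>])
  note cl = clmapD[OF A]
  have sym: "E (A x) y = E x (A y)" for x y
    using form11D(3)[OF E, of "A x" y] form11D(3)[OF form11_form[OF \<alpha>], of x y] by (simp add: EA)
  have Av: "A (v j) = c j *\<^sub>R v j" if j: "j < CARD('g)" for j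
  proof (rule nondeg)
    fix x
    have "E (A (v j)) x = c j * E (v j) x"
      unfolding sym EA using eigenbasisD(2)[OF vc, of j x] j by (simp add: dim_UNIV)
    thus "E x (A (v j)) = E x (c j *\<^sub>R v j)"
      using form11D(3)[OF E, of x "A (v j)"] form11D(3)[OF E, of x "v j"] by (simp add: Esimps)
  qed
  note R = eigenbasis_eop_range[OF vc A Av c(1)]
  define W where "W = range A"
  have AW: "A x = x" if "x \<in> W" for x using that R(3) unfolding W_def by auto
  obtain f m where f: "f \<in> carrier (End UNIV \<Lambda>)" "0 < m" "\<epsilon> = rat_frac (End UNIV \<Lambda>) f m" "(f, m) \<in> \<epsilon>"
    by (rule EndV.tensor_ratE[OF \<epsilon>])
  have mA: "real m *\<^sub>R A l \<in> \<Lambda>" if l: "l \<in> \<Lambda>" for l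
  proof -
    note lf = lifts_to_lift[OF f(1), unfolded lifts_to_def]
    have "\<pi> l = \<pi> 0" using l by (simp add: pi_eq_iff)
    hence "\<pi> (lift f l) = \<pi> (lift f 0)" using lf by metis
    hence "lift f l \<in> \<Lambda>" using clmapD(5)[OF conjunct1[OF lf]] by (simp add: pi_eq_iff)
    moreover have "real m *\<^sub>R A l = lift f l"
      unfolding A_def f(3) lin_frac[OF lifts_to_lift[OF f(1)] f(1,2)] using f(2) by simp
    ultimately show ?thesis by simp
  qed
  have subW: "vec.subspace W" unfolding W_def by (rule R(1))
  have spanW: "span (\<Lambda> \<inter> W) = W"
  proof
    show "span (\<Lambda> \<inter> W) \<subseteq> W" by (rule span_minimal) (use vec_subspace_imp_subspace[OF subW] in auto)
    have "A l \<in> span (\<Lambda> \<inter> W)" if l: "l \<in> \<Lambda>" for l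
    proof -
      have "real m *\<^sub>R A l \<in> \<Lambda> \<inter> W" using mA[OF l] vec_subspace_scaleR[OF subW] unfolding W_def by blast
      hence "(1 / real m) *\<^sub>R (real m *\<^sub>R A l) \<in> span (\<Lambda> \<inter> W)" by (intro span_scale span_base)
      thus ?thesis using f(2) by simp
    qed
    hence "A ` \<Lambda> \<subseteq> span (\<Lambda> \<inter> W)" by blast
    hence "span (A ` \<Lambda>) \<subseteq> span (\<Lambda> \<inter> W)" by (rule span_minimal[OF _ subspace_span])
    moreover have "span (A ` \<Lambda>) = W" unfolding linear_span_image[OF cl(4)] W_def is_latticeD(6)[OF lattice] ..
    ultimately show "W \<subseteq> span (\<Lambda> \<inter> W)" by simp
  qed
  have LW: "is_lattice W (\<Lambda> \<inter> W)"
  proof -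
    have "uniform_discrete (\<Lambda> \<inter> W)"
      using is_latticeD(5)[OF lattice] unfolding uniform_discrete_def by blast
    thus ?thesis unfolding is_lattice_def
      using subW spanW is_latticeD(3,4)[OF lattice] vec.subspace_0[OF subW] vec.subspace_diff[OF subW] by auto
  qed
  have dimW: "vec.dim W = n" using R(2) c(2) unfolding W_def by simp
  obtain p where p: "oproj W p" using ex_oproj[OF subW] by blast
  have "A = p"
  proof (rule oproj_unique[OF subW p])
    show "A y \<in> W" for y unfolding W_def by blast
    show "E x (A y) = E x y" if "x \<in> W" for x y using sym[of x y] AW[OF that] by simp
  qed
  have dim0: "vec.dim W \<noteq> 0" using dimW n by simp
  have "subvar_class UNIV \<Lambda> Lb (\<pi> ` W) = \<alpha>"
    by (rule form_inj[OF subvar_class_form(1)[OF LW dim0 p] \<alpha>])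
       (auto simp: fun_eq_iff subvar_class_form(2)[OF LW dim0 p] EA \<open>A = p\<close>[symmetric])
  moreover have "\<pi> ` W \<in> abelian_subvarieties UNIV \<Lambda> n"
    unfolding abelian_subvarieties_def using LW dimW by blast
  ultimately show ?thesis by blast
qed

end

theorem theorem3p3:
  fixes \<Lambda> :: "(complex ^ 'g) set" and L :: "'g line_bundle" and n :: nat
  assumes "is_lattice UNIV \<Lambda>"
    and "L \<in> carrier (Pic UNIV \<Lambda>)"
    and "ample UNIV \<Lambda> L"
    and "1 \<le> n" and "n \<le> CARD('g)"
  shows "bij_betw (subvar_class UNIV \<Lambda> L)
    (abelian_subvarieties UNIV \<Lambda> n)
    {\<alpha> \<in> NS_rat UNIV \<Lambda>. \<forall>r\<in>{1..CARD('g)}.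
       intersection_rat UNIV \<Lambda>
         (\<lambda>i. if i < r then \<alpha> else rat_frac (NS UNIV \<Lambda>) (ns_of UNIV \<Lambda> L) 1) =
       (if r \<le> n
        then of_nat (euler_char UNIV \<Lambda> L) * fact n * (\<Prod>i=n+1..CARD('g). of_nat i - of_nat r)
        else 0)}"
    (is "bij_betw _ _ {\<alpha> \<in> _. ?C \<alpha>}")
proof -
  interpret polarized \<Lambda> L by unfold_locales fact+
  have eb: "\<exists>v c. eigenbasis UNIV (c1 \<Lambda> L) (form \<alpha>) v c" if "\<alpha> \<in> NS_rat UNIV \<Lambda>" for \<alpha>
    using ex_eigenbasis[OF E form11_form[OF that], of UNIV] pos by auto
  have "subvar_class UNIV \<Lambda> L ` abelian_subvarieties UNIV \<Lambda> n = {\<alpha> \<in> NS_rat UNIV \<Lambda>. ?C \<alpha>}"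
  proof (intro equalityI subsetI)
    fix \<alpha> assume "\<alpha> \<in> subvar_class UNIV \<Lambda> L ` abelian_subvarieties UNIV \<Lambda> n"
    then obtain X where X: "X \<in> abelian_subvarieties UNIV \<Lambda> n" "\<alpha> = subvar_class UNIV \<Lambda> L X" by blast
    obtain W p where W: "X = \<pi> ` W" "vec.dim W = n" "is_lattice W (\<Lambda> \<inter> W)" "vec.dim W \<noteq> 0" "oproj W p" "vec.subspace W"
      by (rule subvarE[OF X(1) assms(4)])
    have \<alpha>: "\<alpha> \<in> NS_rat UNIV \<Lambda>" using subvar_class_form(1)[OF W(3,4,5)] X(2) W(1) by simp
    obtain v c where vc: "eigenbasis UNIV (c1 \<Lambda> L) (form \<alpha>) v c" using eb[OF \<alpha>] by blast
    have "?C \<alpha>"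
      unfolding intersection_condition[OF \<alpha> vc assms(5)]
      by (rule subvar_class_condition[OF X(1) assms(4)]) (use vc X(2) in simp)
    thus "\<alpha> \<in> {\<alpha> \<in> NS_rat UNIV \<Lambda>. ?C \<alpha>}" using \<alpha> by blast
  next
    fix \<alpha> assume a: "\<alpha> \<in> {\<alpha> \<in> NS_rat UNIV \<Lambda>. ?C \<alpha>}"
    hence \<alpha>: "\<alpha> \<in> NS_rat UNIV \<Lambda>" and C: "?C \<alpha>" by blast+
    obtain v c where vc: "eigenbasis UNIV (c1 \<Lambda> L) (form \<alpha>) v c" using eb[OF \<alpha>] by blast
    have c: "(\<forall>j<CARD('g). c j \<in> {0, 1}) \<and> card {j. j < CARD('g) \<and> c j = 1} = n"
      using C unfolding intersection_condition[OF \<alpha> vc assms(5)] .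
    have "\<exists>X\<in>abelian_subvarieties UNIV \<Lambda> n. subvar_class UNIV \<Lambda> L X = \<alpha>"
      by (rule condition_imp_subvar[OF \<alpha> assms(4) vc]) (use c in blast)+
    thus "\<alpha> \<in> subvar_class UNIV \<Lambda> L ` abelian_subvarieties UNIV \<Lambda> n" by blast
  qed
  thus ?thesis unfolding bij_betw_def using inj_subvar_class[OF assms(4)] by blast
qed

end
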